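(* Let $k$ be a field of characteristic different from $2$. Let $V$ be a superspace over $k$ of dimension $m|n$ with a nondegenerate, symmetric, homogeneous bilinear form $b=(-,-)$. Set $\varepsilon=(-1)^{\bar b}$ and $\delta=m-n$ (viewed in $k$), and let $\mathfrak{g}=\mathfrak{g}(V,b)$. Then there exists a unique covariant functor of $k$-linear tensor categories $$F:\mathcal{B}(\delta,\varepsilon)\to \mathbf{T}_{\mathfrak g}(V)$$ given on objects by $F([a])=V^{\otimes a}$ and on the generators $I,X,\cup,\cap$ by $$F(I)=\mathrm{Id}_V,\quad F(X)=s,\quad F(\cup)=b,\quad F(\cap)=c.$$ Furthermore, this functor preserves the $\mathbb{Z}_2$-grading of the Hom-spaces.
   Context: Superspaces and $\mathfrak g$. A superspace is a finite-dimensional $\mathbb{Z}_2$-graded $k$-vector space $V=V_{\bar0}\oplus V_{\bar1}$; it has dimension $m|n$ if $\dim V_{\bar0}=m$, $\dim V_{\bar1}=n$; $\bar v$ denotes the degree of a homogeneous $v$. A bilinear form on $V$ is homogeneous of degree $\bar b$ if the linear map $V\otimes V\to k$ is homogeneous of degree $\bar b$ ($k$ in degree $\bar0$); it is symmetric if $(x,y)=(-1)^{\bar x\bar y}(y,x)$ for homogeneous $x,y$; it is nondegenerate if for every $x\ne0$ there is $y$ with $(x,y)\ne0$. (If $b$ is odd then $m=n$, so $\delta=0$.) $\mathfrak g(V,b)$ is the Lie superalgebra of all $A\in\mathfrak{gl}(V)=\mathrm{End}_k(V)$ with $(Ax,y)+(-1)^{\bar A\bar x}(x,Ay)=0$ (for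 homogeneous $A,x,y$, extended linearly). Module homomorphisms are written on the right: $\mathrm{Hom}_{\mathfrak g}(W,U)=\{f\in\mathrm{Hom}_k(W,U): (x.w)f=x.(w)f \ \forall x\in\mathfrak g,w\in W\}$, $\mathbb{Z}_2$-graded by: $f$ has degree $r$ if $(W_s)f\subseteq U_{r+s}$ for all $s$. Composition is read left to right. $\mathbf{T}_{\mathfrak g}(V)$ is the full subcategory of $\mathfrak g$-modules with objects $V^{\otimes a}$, $a\ge0$ ($V^{\otimes0}=k$), with tensor product of homogeneous morphisms $(v\otimes w)(f\otimes g)=(-1)^{\bar f\,\bar w}(v)f\otimes(w)g$. Fix a homogeneous basis $v_1,\dots,v_{m+n}$ of $V$ and let $v_1^*,\dots,v_{m+n}^*$ be the homogeneous basis with $(v_i,v_j^* )=\delta_{i,j}$. The morphisms are: $c:k\to V\otimes V$, $(1)c=\sum_i(-1)^{\bar v_i}v_i\otimes v_i^*$; $b:V\otimes V\to k$, $(v_i\otimes v_j)b=(v_i,v_j)$; $s:V\otimes V\to V\otimes V$, $(v_i\otimes v_j)s=(-1)^{\bar v_i\bar v_j}v_j\otimes v_i$. These are $\mathfrak g$-homomorphisms and $c$ does not depend on the basis. The marked Brauer category. A Brauer diagram for $(r,s)$ is a partition of $\{1,\dots,r,1',\dots,s'\}$ into two-element subsets (edges), drawn with vertices $1,\dots,r$ in a top row and $1',\dots,s'$ in a bottom row. An edge joining two top vertices is a cup, two bottom vertices a cap, any other edge is a through string. A marked Brauer diagram is a Brauer diagram in which each cup carries one bead and each cap one arrow (pointing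 along the edge, toward its left or right endpoint), with no two markings (beads or arrows) at the same height; up to equivalence it is the data of the Brauer diagram, the total order of the markings from top to bottom, and a direction for each arrow. Two markings are adjacent if no other marking has height strictly between them. $B_{r,s}(\delta,\varepsilon)$ is the $k$-vector space spanned by marked Brauer diagrams for $(r,s)$ modulo: (i) interchanging the heights of two adjacent markings multiplies the diagram by $\varepsilon$; (ii) reversing the direction of one arrow multiplies it by $\varepsilon$. If $r+s$ is odd, $B_{r,s}(\delta,\varepsilon)=0$. Grading: if $\varepsilon=1$ all diagrams are even; if $\varepsilon=-1$ the degree is the number of markings mod $2$. Tensor product: $D_1\otimes D_2$ places $D_1$ to the left of $D_2$ with all markings of $D_1$ above those of $D_2$. Composition $B_{r,s}\times B_{s,t}\to B_{r,t}$: $D_1\circ D_2$ stacks $D_1$ above $D_2$, identifying the bottom vertices of $D_1$ with the top vertices of $D_2$ (markings of $D_1$ above those of $D_2$), then simplifies: (1) $m$ closed loops are deleted with factor $\delta^m$; (2) whenever a bead and an arrow are consecutive along the same edge and adjacent in height (which can be arranged using (i)), remove both and multiply by $1$ if the arrow is above the bead and points along the edge toward the bead, or the bead is above the arrow and the arrow points away from the bead, and by $\varepsilon$ otherwise; repeat until each cup carries one bead, each cap one arrow, through strings none. $\mathcal{B}(\delta,\varepsilon)$ has objects $[a]$, $a\ge0$, $\mathrm{Hom}([a],[b])=B_{a,b}(\delta,\varepsilon)$, composition of morphisms given by the bilinear extension of the vertical stacking operation $(D_1,D_2)\mapsto D_1\circ D_2$ (stack $D_1$ above $D_2$ and simplify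 by rules (1) and (2); $D_1$ first, then $D_2$), and $[a]\otimes[b]=[a+b]$. In both categories homogeneous morphisms satisfy $(f\otimes g)\circ(h\otimes j)=(-1)^{\bar g\,\bar h}(f\circ h)\otimes(g\circ j)$, where $\circ$ is read left to right (apply the left factor first). A functor of $k$-linear tensor categories is a functor that is $k$-linear on Hom-spaces and compatible with tensor products of objects and morphisms (identifying $V^{\otimes a}\otimes V^{\otimes b}=V^{\otimes(a+b)}$ and $k\otimes W=W=W\otimes k$). Generators: $I\in B_{1,1}$ is the through string $\{1,1'\}$; $X\in B_{2,2}$ has through strings $\{1,2'\},\{2,1'\}$; $\cup\in B_{2,0}$ is a single cup with a bead; $\cap\in B_{0,2}$ is a single cap with a right-pointing arrow. *)

theory Defs
  imports
    "HOL-Library.Function_Algebras"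
    "HOL-Library.FuncSet"
    "HOL-Library.Disjoint_Sets"
    "HOL-Library.Z2"
    "HOL-Computational_Algebra.Computational_Algebra"
begin

section \<open>k-linear tensor categories with graded Hom-spaces\<close>

text \<open>Composition is read from left to right: for \<open>f\<close> in \<open>Hom C a b\<close> and \<open>g\<close> in \<open>Hom C b c\<close>,
  \<open>Comp C a b c f g\<close> is \<open>f\<close> followed by \<open>g\<close>. For \<open>f\<close> in \<open>Hom C a b\<close> and \<open>g\<close> in \<open>Hom C a' b'\<close>,
  \<open>Tens C a b a' b' f g\<close> is the tensor product of \<open>f\<close> and \<open>g\<close>. All elements of \<open>'o\<close> are objects.\<close>

record ('o, 'h, 'k) tensor_category =
  Hom :: "'o \<Rightarrow> 'o \<Rightarrow> 'h set"
  Hom_deg :: "'o \<Rightarrow> 'o \<Rightarrow> bit \<Rightarrow> 'h set"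
  Ident :: "'o \<Rightarrow> 'h"
  Comp :: "'o \<Rightarrow> 'o \<Rightarrow> 'o \<Rightarrow> 'h \<Rightarrow> 'h \<Rightarrow> 'h"
  Plus :: "'o \<Rightarrow> 'o \<Rightarrow> 'h \<Rightarrow> 'h \<Rightarrow> 'h"
  Smult :: "'o \<Rightarrow> 'o \<Rightarrow> 'k \<Rightarrow> 'h \<Rightarrow> 'h"
  Tens_obj :: "'o \<Rightarrow> 'o \<Rightarrow> 'o"
  Tens :: "'o \<Rightarrow> 'o \<Rightarrow> 'o \<Rightarrow> 'o \<Rightarrow> 'h \<Rightarrow> 'h \<Rightarrow> 'h"

definition tensor_functor ::
  "('o, 'h, 'k) tensor_category \<Rightarrow> ('p, 'j, 'k) tensor_category
    \<Rightarrow> ('o \<Rightarrow> 'p) \<Rightarrow> ('o \<Rightarrow> 'o \<Rightarrow> 'h \<Rightarrow> 'j) \<Rightarrow> bool" where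
  "tensor_functor C D Fo Fm \<longleftrightarrow>
    (\<forall>a b. \<forall>f\<in>Hom C a b. Fm a b f \<in> Hom D (Fo a) (Fo b)) \<and>
    (\<forall>a. Fm a a (Ident C a) = Ident D (Fo a)) \<and>
    (\<forall>a b c. \<forall>f\<in>Hom C a b. \<forall>g\<in>Hom C b c.
      Fm a c (Comp C a b c f g) = Comp D (Fo a) (Fo b) (Fo c) (Fm a b f) (Fm b c g)) \<and>
    (\<forall>a b. \<forall>f\<in>Hom C a b. \<forall>g\<in>Hom C a b.
      Fm a b (Plus C a b f g) = Plus D (Fo a) (Fo b) (Fm a b f) (Fm a b g)) \<and>
    (\<forall>a b t. \<forall>f\<in>Hom C a b.
      Fm a b (Smult C a b t f) = Smult D (Fo a) (Fo b) t (Fm a b f)) \<and>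
    (\<forall>a b. Fo (Tens_obj C a b) = Tens_obj D (Fo a) (Fo b)) \<and>
    (\<forall>a b a' b'. \<forall>f\<in>Hom C a b. \<forall>g\<in>Hom C a' b'.
      Fm (Tens_obj C a a') (Tens_obj C b b') (Tens C a b a' b' f g)
        = Tens D (Fo a) (Fo b) (Fo a') (Fo b') (Fm a b f) (Fm a' b' g))"

definition preserves_grading ::
  "('o, 'h, 'k) tensor_category \<Rightarrow> ('p, 'j, 'k) tensor_category
    \<Rightarrow> ('o \<Rightarrow> 'p) \<Rightarrow> ('o \<Rightarrow> 'o \<Rightarrow> 'h \<Rightarrow> 'j) \<Rightarrow> bool" where
  "preserves_grading C D Fo Fm \<longleftrightarrow>
    (\<forall>a b p. \<forall>f\<in>Hom_deg C a b p. Fm a b f \<in> Hom_deg D (Fo a) (Fo b) p)"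

definition fun_scale :: "'k::field \<Rightarrow> ('x \<Rightarrow> 'k) \<Rightarrow> 'x \<Rightarrow> 'k" where
  "fun_scale c f = (\<lambda>x. c * f x)"

text \<open>\<open>koszul p\<close> is the sign \<open>(-1) ^ p\<close>.\<close>

definition koszul :: "bit \<Rightarrow> 'k::field" where
  "koszul p = (if p = 0 then 1 else - 1)"


section \<open>Superspaces and forms\<close>

text \<open>The whole type \<open>'v\<close> is the superspace; \<open>V p\<close> is its homogeneous part of degree \<open>p\<close>.\<close>

definition superspace ::
  "('k::field \<Rightarrow> 'v::ab_group_add \<Rightarrow> 'v) \<Rightarrow> (bit \<Rightarrow> 'v set) \<Rightarrow> nat \<Rightarrow> nat \<Rightarrow> bool" where
  "superspace scale V m n \<longleftrightarrow>
    vector_space scale \<and>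
    (\<exists>B. finite B \<and> module.span scale B = UNIV) \<and>
    (\<forall>p. module.subspace scale (V p)) \<and>
    V 0 \<inter> V 1 = {0} \<and>
    (\<forall>x. \<exists>y\<in>V 0. \<exists>z\<in>V 1. x = y + z) \<and>
    vector_space.dim scale (V 0) = m \<and>
    vector_space.dim scale (V 1) = n"

definition homogeneous :: "(bit \<Rightarrow> 'v set) \<Rightarrow> 'v \<Rightarrow> bool" where
  "homogeneous V x \<longleftrightarrow> x \<in> V 0 \<or> x \<in> V 1"

text \<open>The degree of a homogeneous vector. The zero vector lies in both parts; its degree is
  irrelevant in all formulas below.\<close>

definition par :: "(bit \<Rightarrow> 'v set) \<Rightarrow> 'v \<Rightarrow> bit" where
  "par V x = (if x \<in> V 0 then 0 else 1)"

definition bilinear_form ::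
  "('k::field \<Rightarrow> 'v::ab_group_add \<Rightarrow> 'v) \<Rightarrow> ('v \<Rightarrow> 'v \<Rightarrow> 'k) \<Rightarrow> bool" where
  "bilinear_form scale b \<longleftrightarrow>
    (\<forall>x. Vector_Spaces.linear scale (*) (\<lambda>y. b x y)) \<and>
    (\<forall>y. Vector_Spaces.linear scale (*) (\<lambda>x. b x y))"

text \<open>\<open>V p \<otimes> V q\<close> is mapped to degree \<open>p + q + d\<close> of \<open>k\<close>, which is zero unless
  \<open>p + q + d = 0\<close>.\<close>

definition homogeneous_form :: "(bit \<Rightarrow> 'v set) \<Rightarrow> bit \<Rightarrow> ('v \<Rightarrow> 'v \<Rightarrow> 'k::field) \<Rightarrow> bool" where
  "homogeneous_form V d b \<longleftrightarrow>
    (\<forall>p q. \<forall>x\<in>V p. \<forall>y\<in>V q. p + q + d \<noteq> 0 \<longrightarrow> b x y = 0)"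

definition supersymmetric_form :: "(bit \<Rightarrow> 'v set) \<Rightarrow> ('v \<Rightarrow> 'v \<Rightarrow> 'k::field) \<Rightarrow> bool" where
  "supersymmetric_form V b \<longleftrightarrow>
    (\<forall>p q. \<forall>x\<in>V p. \<forall>y\<in>V q. b x y = koszul (p * q) * b y x)"

definition nondegenerate_form :: "('v::zero \<Rightarrow> 'v \<Rightarrow> 'k::field) \<Rightarrow> bool" where
  "nondegenerate_form b \<longleftrightarrow> (\<forall>x. x \<noteq> 0 \<longrightarrow> (\<exists>y. b x y \<noteq> 0))"

text \<open>The family \<open>v 0, \<dots>, v (N - 1)\<close> is a basis of homogeneous vectors.\<close>

definition homogeneous_basis ::
  "('k::field \<Rightarrow> 'v::ab_group_add \<Rightarrow> 'v) \<Rightarrow> (bit \<Rightarrow> 'v set) \<Rightarrow> nat \<Rightarrow> (nat \<Rightarrow> 'v) \<Rightarrow> bool" where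
  "homogeneous_basis scale V N v \<longleftrightarrow>
    (\<forall>i<N. homogeneous V (v i)) \<and>
    inj_on v {..<N} \<and>
    \<not> module.dependent scale (v ` {..<N}) \<and>
    module.span scale (v ` {..<N}) = UNIV"

text \<open>\<open>osp scale V b p\<close> is the homogeneous part of degree \<open>p\<close> of the Lie superalgebra
  \<open>\<gg>(V, b)\<close>.\<close>

definition osp ::
  "('k::field \<Rightarrow> 'v::ab_group_add \<Rightarrow> 'v) \<Rightarrow> (bit \<Rightarrow> 'v set) \<Rightarrow> ('v \<Rightarrow> 'v \<Rightarrow> 'k) \<Rightarrow> bit
    \<Rightarrow> ('v \<Rightarrow> 'v) set" where
  "osp scale V b p = {A. Vector_Spaces.linear scale scale A \<and>
    (\<forall>q. A ` V q \<subseteq> V (p + q)) \<and>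
    (\<forall>q q'. \<forall>x\<in>V q. \<forall>y\<in>V q'. b (A x) y + koszul (p * q) * b x (A y) = 0)}"


section \<open>Tensor powers\<close>

text \<open>The tensor powers of a finite-dimensional \<open>V\<close> are realised as spaces of multilinear functions
  on the dual space: \<open>v\<^sub>1 \<otimes> \<dots> \<otimes> v\<^sub>a\<close> is the function sending \<open>(\<phi>\<^sub>1, \<dots>, \<phi>\<^sub>a)\<close> to
  \<open>\<phi>\<^sub>1 v\<^sub>1 \<cdots> \<phi>\<^sub>a v\<^sub>a\<close>. Lists of functionals of length different from \<open>a\<close> are sent to \<open>0\<close>, so that all
  tensor powers are subspaces of a single function space and the identification of
  \<open>V^a \<otimes> V^b\<close> with \<open>V^(a+b)\<close> is strict. The ground field is \<open>tpow scale 0\<close>,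
  its unit being \<open>ptens scale []\<close>.\<close>

type_synonym ('v, 'k) tensor = "('v \<Rightarrow> 'k) list \<Rightarrow> 'k"

definition ptens ::
  "('k::field \<Rightarrow> 'v::ab_group_add \<Rightarrow> 'v) \<Rightarrow> 'v list \<Rightarrow> ('v, 'k) tensor" where
  "ptens scale vs = (\<lambda>\<phi>s.
    if length \<phi>s = length vs \<and> (\<forall>\<phi>\<in>set \<phi>s. Vector_Spaces.linear scale (*) \<phi>)
    then \<Prod>i<length vs. (\<phi>s ! i) (vs ! i) else 0)"

definition tpow ::
  "('k::field \<Rightarrow> 'v::ab_group_add \<Rightarrow> 'v) \<Rightarrow> nat \<Rightarrow> ('v, 'k) tensor set" where
  "tpow scale a = module.span fun_scale {ptens scale vs |vs. length vs = a}"

definition tpow_deg ::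
  "('k::field \<Rightarrow> 'v::ab_group_add \<Rightarrow> 'v) \<Rightarrow> (bit \<Rightarrow> 'v set) \<Rightarrow> nat \<Rightarrow> bit
    \<Rightarrow> ('v, 'k) tensor set" where
  "tpow_deg scale V a p = module.span fun_scale
    {ptens scale vs |vs. length vs = a \<and> (\<forall>v\<in>set vs. homogeneous V v)
      \<and> sum_list (map (par V) vs) = p}"

text \<open>\<open>tprod a x y\<close> is \<open>x \<otimes> y\<close> for \<open>x\<close> in the \<open>a\<close>-th tensor power.\<close>

definition tprod :: "nat \<Rightarrow> ('v, 'k::field) tensor \<Rightarrow> ('v, 'k) tensor \<Rightarrow> ('v, 'k) tensor" where
  "tprod a x y = (\<lambda>\<phi>s. x (take a \<phi>s) * y (drop a \<phi>s))"

text \<open>Linear maps between tensor powers; as in FuncSet, they are \<open>undefined\<close> outside their domain.\<close>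

definition lin ::
  "('k::field \<Rightarrow> 'v::ab_group_add \<Rightarrow> 'v) \<Rightarrow> nat \<Rightarrow> nat
    \<Rightarrow> (('v, 'k) tensor \<Rightarrow> ('v, 'k) tensor) set" where
  "lin scale a c = {f \<in> tpow scale a \<rightarrow>\<^sub>E tpow scale c.
    (\<forall>x\<in>tpow scale a. \<forall>y\<in>tpow scale a. f (x + y) = f x + f y) \<and>
    (\<forall>t. \<forall>x\<in>tpow scale a. f (fun_scale t x) = fun_scale t (f x))}"

definition lin_deg ::
  "('k::field \<Rightarrow> 'v::ab_group_add \<Rightarrow> 'v) \<Rightarrow> (bit \<Rightarrow> 'v set) \<Rightarrow> nat \<Rightarrow> nat \<Rightarrow> bit
    \<Rightarrow> (('v, 'k) tensor \<Rightarrow> ('v, 'k) tensor) set" where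
  "lin_deg scale V a c p = {f \<in> lin scale a c.
    \<forall>q. f ` tpow_deg scale V a q \<subseteq> tpow_deg scale V c (p + q)}"

text \<open>The linear map with prescribed values on tensor products of homogeneous vectors.\<close>

definition lin_map ::
  "('k::field \<Rightarrow> 'v::ab_group_add \<Rightarrow> 'v) \<Rightarrow> (bit \<Rightarrow> 'v set) \<Rightarrow> nat \<Rightarrow> nat
    \<Rightarrow> ('v list \<Rightarrow> ('v, 'k) tensor) \<Rightarrow> ('v, 'k) tensor \<Rightarrow> ('v, 'k) tensor" where
  "lin_map scale V a c F = (THE f. f \<in> lin scale a c \<and>
    (\<forall>vs. length vs = a \<and> (\<forall>v\<in>set vs. homogeneous V v) \<longrightarrow> f (ptens scale vs) = F vs))"

text \<open>The action of a homogeneous operator \<open>A\<close> of degree \<open>p\<close> on the \<open>a\<close>-th tensor power.\<close>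

definition tensor_action ::
  "('k::field \<Rightarrow> 'v::ab_group_add \<Rightarrow> 'v) \<Rightarrow> (bit \<Rightarrow> 'v set) \<Rightarrow> nat \<Rightarrow> bit \<Rightarrow> ('v \<Rightarrow> 'v)
    \<Rightarrow> ('v, 'k) tensor \<Rightarrow> ('v, 'k) tensor" where
  "tensor_action scale V a p A = lin_map scale V a a (\<lambda>vs.
    \<Sum>i<a. fun_scale (koszul (p * sum_list (map (par V) (take i vs))))
      (ptens scale (vs[i := A (vs ! i)])))"


section \<open>The category of tensor powers of V\<close>

text \<open>The equivariance condition is linear in the element of \<open>\<gg>(V, b)\<close>, so it is required for
  homogeneous elements. There is no sign since homomorphisms are written on the right.\<close>

definition module_hom ::
  "('k::field \<Rightarrow> 'v::ab_group_add \<Rightarrow> 'v) \<Rightarrow> (bit \<Rightarrow> 'v set) \<Rightarrow> ('v \<Rightarrow> 'v \<Rightarrow> 'k) \<Rightarrow> nat \<Rightarrow> nat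
    \<Rightarrow> (('v, 'k) tensor \<Rightarrow> ('v, 'k) tensor) set" where
  "module_hom scale V b a c = {f \<in> lin scale a c.
    \<forall>p. \<forall>A\<in>osp scale V b p. \<forall>w\<in>tpow scale a.
      f (tensor_action scale V a p A w) = tensor_action scale V c p A (f w)}"

text \<open>\<open>(x \<otimes> y)(f \<otimes> g) = (-1)^(deg f * deg y) (x)f \<otimes> (y)g\<close> for homogeneous \<open>f\<close> and \<open>y\<close>, extended
  linearly by splitting \<open>f\<close> into its homogeneous parts.\<close>

definition hom_tensor ::
  "('k::field \<Rightarrow> 'v::ab_group_add \<Rightarrow> 'v) \<Rightarrow> (bit \<Rightarrow> 'v set) \<Rightarrow> nat \<Rightarrow> nat \<Rightarrow> nat \<Rightarrow> nat
    \<Rightarrow> (('v, 'k) tensor \<Rightarrow> ('v, 'k) tensor) \<Rightarrow> (('v, 'k) tensor \<Rightarrow> ('v, 'k) tensor)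
    \<Rightarrow> ('v, 'k) tensor \<Rightarrow> ('v, 'k) tensor" where
  "hom_tensor scale V a c a' c' f g = (THE h. h \<in> lin scale (a + a') (c + c') \<and>
    (\<exists>f0\<in>lin_deg scale V a c 0. \<exists>f1\<in>lin_deg scale V a c 1.
      (\<forall>x\<in>tpow scale a. f x = f0 x + f1 x) \<and>
      (\<forall>x\<in>tpow scale a. \<forall>q. \<forall>y\<in>tpow_deg scale V a' q.
        h (tprod a x y) = tprod c (f0 x) (g y) + fun_scale (koszul q) (tprod c (f1 x) (g y)))))"

text \<open>The object \<open>a\<close> stands for the \<open>a\<close>-th tensor power of \<open>V\<close>.\<close>

definition tensor_powers ::
  "('k::field \<Rightarrow> 'v::ab_group_add \<Rightarrow> 'v) \<Rightarrow> (bit \<Rightarrow> 'v set) \<Rightarrow> ('v \<Rightarrow> 'v \<Rightarrow> 'k)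
    \<Rightarrow> (nat, ('v, 'k) tensor \<Rightarrow> ('v, 'k) tensor, 'k) tensor_category" where
  "tensor_powers scale V b = \<lparr>
    Hom = module_hom scale V b,
    Hom_deg = (\<lambda>a c p. module_hom scale V b a c \<inter> lin_deg scale V a c p),
    Ident = (\<lambda>a. \<lambda>x\<in>tpow scale a. x),
    Comp = (\<lambda>a c e f g. \<lambda>x\<in>tpow scale a. g (f x)),
    Plus = (\<lambda>a c f g. \<lambda>x\<in>tpow scale a. f x + g x),
    Smult = (\<lambda>a c t f. \<lambda>x\<in>tpow scale a. fun_scale t (f x)),
    Tens_obj = (+),
    Tens = hom_tensor scale V\<rparr>"

definition form_map ::
  "('k::field \<Rightarrow> 'v::ab_group_add \<Rightarrow> 'v) \<Rightarrow> (bit \<Rightarrow> 'v set) \<Rightarrow> ('v \<Rightarrow> 'v \<Rightarrow> 'k)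
    \<Rightarrow> ('v, 'k) tensor \<Rightarrow> ('v, 'k) tensor" where
  "form_map scale V b = lin_map scale V 2 0 (\<lambda>vs. fun_scale (b (vs ! 0) (vs ! 1)) (ptens scale []))"

definition swap_map ::
  "('k::field \<Rightarrow> 'v::ab_group_add \<Rightarrow> 'v) \<Rightarrow> (bit \<Rightarrow> 'v set)
    \<Rightarrow> ('v, 'k) tensor \<Rightarrow> ('v, 'k) tensor" where
  "swap_map scale V = lin_map scale V 2 2 (\<lambda>vs.
    fun_scale (koszul (par V (vs ! 0) * par V (vs ! 1))) (ptens scale [vs ! 1, vs ! 0]))"

text \<open>Here \<open>v\<close> is a homogeneous basis with \<open>N\<close> elements and \<open>v'\<close> is its dual basis.\<close>

definition coform_map ::
  "('k::field \<Rightarrow> 'v::ab_group_add \<Rightarrow> 'v) \<Rightarrow> (bit \<Rightarrow> 'v set) \<Rightarrow> nat \<Rightarrow> (nat \<Rightarrow> 'v) \<Rightarrow> (nat \<Rightarrow> 'v)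
    \<Rightarrow> ('v, 'k) tensor \<Rightarrow> ('v, 'k) tensor" where
  "coform_map scale V N v v' = lin_map scale V 0 2 (\<lambda>_.
    \<Sum>i<N. fun_scale (koszul (par V (v i))) (ptens scale [v i, v' i]))"


section \<open>Marked Brauer diagrams\<close>

text \<open>Vertices are numbered from \<open>0\<close>, from left to right.\<close>

datatype vertex = Top nat | Bot nat

definition vertices :: "nat \<Rightarrow> nat \<Rightarrow> vertex set" where
  "vertices r s = Top ` {..<r} \<union> Bot ` {..<s}"

definition brauer_diagrams :: "nat \<Rightarrow> nat \<Rightarrow> vertex set set set" where
  "brauer_diagrams r s = {E. partition_on (vertices r s) E \<and> (\<forall>e\<in>E. card e = 2)}"

definition is_cup :: "vertex set \<Rightarrow> bool" where
  "is_cup e \<longleftrightarrow> e \<subseteq> range Top"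

definition is_cap :: "vertex set \<Rightarrow> bool" where
  "is_cap e \<longleftrightarrow> e \<subseteq> range Bot"

text \<open>\<open>Arrow e x\<close> is an arrow on the edge \<open>e\<close> that points towards its endpoint \<open>x\<close>.\<close>

datatype ('e, 'x) marking = Bead 'e | Arrow 'e 'x

fun carrier_edge :: "('e, 'x) marking \<Rightarrow> 'e" where
  "carrier_edge (Bead e) = e"
| "carrier_edge (Arrow e x) = e"

text \<open>A marked diagram consists of its set of edges and the list of its markings from top to
  bottom.\<close>

type_synonym diagram = "vertex set set \<times> (vertex set, vertex) marking list"

definition marked_diagrams :: "nat \<Rightarrow> nat \<Rightarrow> diagram set" where
  "marked_diagrams r s = {(E, L). E \<in> brauer_diagrams r s \<and>
    distinct (map carrier_edge L) \<and>
    carrier_edge ` set L = {e\<in>E. is_cup e \<or> is_cap e} \<and>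
    (\<forall>e. Bead e \<in> set L \<longrightarrow> is_cup e) \<and>
    (\<forall>e x. Arrow e x \<in> set L \<longrightarrow> is_cap e \<and> x \<in> e)}"

lemma finite_marked_diagrams: "finite (marked_diagrams r s)"
proof -
  define W where "W = vertices r s"
  define M where "M = Bead ` Pow W \<union> case_prod Arrow ` (Pow W \<times> W)"
  have fW: "finite W" by (simp add: W_def vertices_def)
  have fM: "finite M" unfolding M_def using fW by blast
  have "(E, L) \<in> Pow (Pow W) \<times> {L. set L \<subseteq> M \<and> length L \<le> card M}"
    if D: "(E, L) \<in> marked_diagrams r s" for E L
  proof -
    have E: "E \<subseteq> Pow W"
      using D unfolding marked_diagrams_def brauer_diagrams_def partition_on_def W_def by blast
    have c: "carrier_edge m \<subseteq> W" if "m \<in> set L" for m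
      using D E that unfolding marked_diagrams_def by blast
    have L: "m \<in> M" if m: "m \<in> set L" for m
    proof (cases m)
      case (Bead e)
      then have "e \<in> Pow W" using c[OF m] by simp
      then show ?thesis unfolding M_def Bead by blast
    next
      case (Arrow e x)
      have "x \<in> e" using D m Arrow unfolding marked_diagrams_def by blast
      moreover have "e \<subseteq> W" using c[OF m] Arrow by simp
      ultimately have "(e, x) \<in> Pow W \<times> W" by blast
      then have "case_prod Arrow (e, x) \<in> M" unfolding M_def by blast
      then show ?thesis using Arrow by simp
    qed
    have "distinct L" using D unfolding marked_diagrams_def by (simp add: distinct_map)
    then have "length L \<le> card M"
      using card_mono[OF fM, of "set L"] L by (simp add: distinct_card subset_iff)
    then show ?thesis using E L by blast
  qed
  then have "marked_diagrams r s \<subseteq> Pow (Pow W) \<times> {L. set L \<subseteq> M \<and> length L \<le> card M}"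
    by (intro subrelI)
  moreover have "finite (Pow (Pow W) \<times> {L. set L \<subseteq> M \<and> length L \<le> card M})"
    using fW finite_lists_length_le[OF fM] by (intro finite_cartesian_product) simp_all
  ultimately show ?thesis by (rule finite_subset)
qed


section \<open>The Hom-spaces of the marked Brauer category\<close>

type_synonym 'k combination = "diagram \<Rightarrow> 'k"

definition basis_vec :: "diagram \<Rightarrow> 'k::field combination" where
  "basis_vec D = (\<lambda>D'. if D' = D then 1 else 0)"

definition combinations :: "nat \<Rightarrow> nat \<Rightarrow> 'k::field combination set" where
  "combinations r s = {x. \<forall>D. x D \<noteq> 0 \<longrightarrow> D \<in> marked_diagrams r s}"

definition height_swaps :: "nat \<Rightarrow> nat \<Rightarrow> (diagram \<times> diagram) set" where
  "height_swaps r s = {(D, D'). D \<in> marked_diagrams r s \<and> D' \<in> marked_diagrams r s \<and>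
    (\<exists>E xs m m' ys. D = (E, xs @ [m, m'] @ ys) \<and> D' = (E, xs @ [m', m] @ ys))}"

definition arrow_reversals :: "nat \<Rightarrow> nat \<Rightarrow> (diagram \<times> diagram) set" where
  "arrow_reversals r s = {(D, D'). D \<in> marked_diagrams r s \<and> D' \<in> marked_diagrams r s \<and>
    (\<exists>E xs e x x' ys. x \<noteq> x' \<and>
      D = (E, xs @ [Arrow e x] @ ys) \<and> D' = (E, xs @ [Arrow e x'] @ ys))}"

definition relations :: "'k::field \<Rightarrow> nat \<Rightarrow> nat \<Rightarrow> 'k combination set" where
  "relations \<epsilon> r s = module.span fun_scale
    {basis_vec D - fun_scale \<epsilon> (basis_vec D') |D D'.
      (D, D') \<in> height_swaps r s \<union> arrow_reversals r s}"

definition diagram_equiv :: "'k::field \<Rightarrow> nat \<Rightarrow> nat \<Rightarrow> 'k combination rel" where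
  "diagram_equiv \<epsilon> r s = {(x, y). x \<in> combinations r s \<and> y \<in> combinations r s \<and>
    x - y \<in> relations \<epsilon> r s}"

definition brauer_hom :: "'k::field \<Rightarrow> nat \<Rightarrow> nat \<Rightarrow> 'k combination set set" where
  "brauer_hom \<epsilon> r s = combinations r s // diagram_equiv \<epsilon> r s"

definition brauer_class ::
  "'k::field \<Rightarrow> nat \<Rightarrow> nat \<Rightarrow> 'k combination \<Rightarrow> 'k combination set" where
  "brauer_class \<epsilon> r s x = diagram_equiv \<epsilon> r s `` {x}"

definition rep :: "'x set \<Rightarrow> 'x" where
  "rep X = (SOME x. x \<in> X)"

definition diagram_degree :: "'k::field \<Rightarrow> diagram \<Rightarrow> bit" where
  "diagram_degree \<epsilon> D = (if \<epsilon> = 1 then 0 else of_nat (length (snd D)))"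

definition brauer_hom_deg :: "'k::field \<Rightarrow> nat \<Rightarrow> nat \<Rightarrow> bit \<Rightarrow> 'k combination set set" where
  "brauer_hom_deg \<epsilon> r s p = brauer_class \<epsilon> r s `
    {x \<in> combinations r s. \<forall>D. x D \<noteq> 0 \<longrightarrow> diagram_degree \<epsilon> D = p}"


section \<open>Stacking diagrams\<close>

text \<open>When \<open>D1\<close> is stacked above \<open>D2\<close>, the vertices are arranged in three rows. The stacked figure
  is a graph whose segments are the edges \<open>Inl e\<close> of \<open>D1\<close> and \<open>Inr e\<close> of \<open>D2\<close>; a cap of \<open>D1\<close> and a
  cup of \<open>D2\<close> with the same two endpoints are different segments. The edges of the composite are the
  maximal paths of this graph.\<close>

datatype node = Upper nat | Middle nat | Lower nat

type_synonym segment = "vertex set + vertex set"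

fun node1 :: "vertex \<Rightarrow> node" where
  "node1 (Top i) = Upper i"
| "node1 (Bot i) = Middle i"

fun node2 :: "vertex \<Rightarrow> node" where
  "node2 (Top i) = Middle i"
| "node2 (Bot i) = Lower i"

fun outer_node :: "vertex \<Rightarrow> node" where
  "outer_node (Top i) = Upper i"
| "outer_node (Bot i) = Lower i"

fun seg_ends :: "segment \<Rightarrow> node set" where
  "seg_ends (Inl e) = node1 ` e"
| "seg_ends (Inr e) = node2 ` e"

definition stack_segments :: "diagram \<Rightarrow> diagram \<Rightarrow> segment set" where
  "stack_segments D1 D2 = Inl ` fst D1 \<union> Inr ` fst D2"

definition stack_markings :: "diagram \<Rightarrow> diagram \<Rightarrow> (segment, node) marking list" where
  "stack_markings D1 D2 =
    map (map_marking Inl node1) (snd D1) @ map (map_marking Inr node2) (snd D2)"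

text \<open>\<open>trail S x ss y\<close>: the pairwise distinct segments \<open>ss\<close> lead from \<open>x\<close> to \<open>y\<close>.\<close>

fun trail :: "segment set \<Rightarrow> node \<Rightarrow> segment list \<Rightarrow> node \<Rightarrow> bool" where
  "trail S x [] y \<longleftrightarrow> x = y"
| "trail S x (s # ss) y \<longleftrightarrow>
    s \<in> S \<and> s \<notin> set ss \<and> (\<exists>z. seg_ends s = {x, z} \<and> trail S z ss y)"

definition closed_loops :: "segment set \<Rightarrow> segment set set" where
  "closed_loops S = {set ss |ss x. ss \<noteq> [] \<and> trail S x ss x}"

definition composite_edges :: "segment set \<Rightarrow> vertex set set" where
  "composite_edges S = {{x, y} |x y. x \<noteq> y \<and> (\<exists>ss. trail S (outer_node x) ss (outer_node y))}"

text \<open>The arrow on the segment \<open>s\<close> with target \<open>x\<close> and the bead on the segment \<open>s'\<close> are consecutive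
  along the same edge, and the arrow points towards, respectively away from, the bead.\<close>

definition points_towards ::
  "segment set \<Rightarrow> (segment, node) marking list \<Rightarrow> segment \<Rightarrow> node \<Rightarrow> segment \<Rightarrow> bool" where
  "points_towards S L s x s' \<longleftrightarrow> (\<exists>y ss z. trail S y (s # ss @ [s']) z \<and>
    (\<forall>m\<in>set L. carrier_edge m \<notin> set ss) \<and> x \<noteq> y)"

definition points_away ::
  "segment set \<Rightarrow> (segment, node) marking list \<Rightarrow> segment \<Rightarrow> node \<Rightarrow> segment \<Rightarrow> bool" where
  "points_away S L s x s' \<longleftrightarrow> (\<exists>y ss z. trail S y (s # ss @ [s']) z \<and>
    (\<forall>m\<in>set L. carrier_edge m \<notin> set ss) \<and> x = y)"

inductive simplify_step ::
  "'k::field \<Rightarrow> segment set \<Rightarrow> 'k \<times> (segment, node) marking list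
    \<Rightarrow> 'k \<times> (segment, node) marking list \<Rightarrow> bool"
  for \<epsilon> :: 'k and S :: "segment set" where
  interchange:
    "simplify_step \<epsilon> S (c, xs @ [m, m'] @ ys) (\<epsilon> * c, xs @ [m', m] @ ys)"
| arrow_above_towards:
    "points_towards S (xs @ [Arrow s x, Bead s'] @ ys) s x s' \<Longrightarrow>
      simplify_step \<epsilon> S (c, xs @ [Arrow s x, Bead s'] @ ys) (c, xs @ ys)"
| bead_above_away:
    "points_away S (xs @ [Bead s', Arrow s x] @ ys) s x s' \<Longrightarrow>
      simplify_step \<epsilon> S (c, xs @ [Bead s', Arrow s x] @ ys) (c, xs @ ys)"
| arrow_above_away:
    "points_away S (xs @ [Arrow s x, Bead s'] @ ys) s x s' \<Longrightarrow>
      simplify_step \<epsilon> S (c, xs @ [Arrow s x, Bead s'] @ ys) (\<epsilon> * c, xs @ ys)"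
| bead_above_towards:
    "points_towards S (xs @ [Bead s', Arrow s x] @ ys) s x s' \<Longrightarrow>
      simplify_step \<epsilon> S (c, xs @ [Bead s', Arrow s x] @ ys) (\<epsilon> * c, xs @ ys)"

text \<open>A marking of a segment as a marking of the edge of the composite containing the segment. An
  arrow points towards the endpoint reached when the segment is traversed in its direction.\<close>

inductive composite_marking ::
  "segment set \<Rightarrow> (segment, node) marking \<Rightarrow> (vertex set, vertex) marking \<Rightarrow> bool"
  for S :: "segment set" where
  "x \<noteq> y \<Longrightarrow> trail S (outer_node x) ss (outer_node y) \<Longrightarrow> s \<in> set ss \<Longrightarrow>
    composite_marking S (Bead s) (Bead {x, y})"
| "x \<noteq> y \<Longrightarrow> trail S (outer_node x) (ss @ [s] @ ss') (outer_node y) \<Longrightarrow>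
    trail S (outer_node x) (ss @ [s]) z \<Longrightarrow>
    composite_marking S (Arrow s z) (Arrow {x, y} y)"

text \<open>\<open>composite \<delta> \<epsilon> r t D1 D2 c D\<close>: after deletion of the closed loops with their markings, the
  stacked figure simplifies to \<open>c\<close> times the marked diagram \<open>D\<close>.\<close>

definition composite ::
  "'k::field \<Rightarrow> 'k \<Rightarrow> nat \<Rightarrow> nat \<Rightarrow> diagram \<Rightarrow> diagram \<Rightarrow> 'k \<Rightarrow> diagram \<Rightarrow> bool" where
  "composite \<delta> \<epsilon> r t D1 D2 c D \<longleftrightarrow>
    (let S = stack_segments D1 D2;
         L0 = filter (\<lambda>m. carrier_edge m \<notin> \<Union> (closed_loops S)) (stack_markings D1 D2)
     in D \<in> marked_diagrams r t \<and> fst D = composite_edges S \<and>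
        (\<exists>L. (simplify_step \<epsilon> S)\<^sup>*\<^sup>* (\<delta> ^ card (closed_loops S), L0) (c, L) \<and>
             list_all2 (composite_marking S) L (snd D)))"

text \<open>The simplification can be carried out in several ways, with the same result modulo the relations
  between marked diagrams; one of them is chosen. Likewise, the operations on classes below are
  computed with representatives. If \<open>\<epsilon> = -1\<close>, this is meant for \<open>\<delta> = 0\<close> only.\<close>

definition compose_diagrams ::
  "'k::field \<Rightarrow> 'k \<Rightarrow> nat \<Rightarrow> nat \<Rightarrow> diagram \<Rightarrow> diagram \<Rightarrow> 'k combination" where
  "compose_diagrams \<delta> \<epsilon> r t D1 D2 =
    (let (c, D) = (SOME (c, D). composite \<delta> \<epsilon> r t D1 D2 c D) in fun_scale c (basis_vec D))"

definition compose_combinations ::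
  "'k::field \<Rightarrow> 'k \<Rightarrow> nat \<Rightarrow> nat \<Rightarrow> nat \<Rightarrow> 'k combination \<Rightarrow> 'k combination
    \<Rightarrow> 'k combination" where
  "compose_combinations \<delta> \<epsilon> r s t x y =
    (\<Sum>D1\<in>marked_diagrams r s. \<Sum>D2\<in>marked_diagrams s t.
      fun_scale (x D1 * y D2) (compose_diagrams \<delta> \<epsilon> r t D1 D2))"

fun shift_vertex :: "nat \<Rightarrow> nat \<Rightarrow> vertex \<Rightarrow> vertex" where
  "shift_vertex r s (Top i) = Top (r + i)"
| "shift_vertex r s (Bot i) = Bot (s + i)"

definition tensor_diagrams :: "nat \<Rightarrow> nat \<Rightarrow> diagram \<Rightarrow> diagram \<Rightarrow> diagram" where
  "tensor_diagrams r s D1 D2 =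
    (fst D1 \<union> (`) (shift_vertex r s) ` fst D2,
     snd D1 @ map (map_marking ((`) (shift_vertex r s)) (shift_vertex r s)) (snd D2))"

definition tensor_combinations ::
  "nat \<Rightarrow> nat \<Rightarrow> nat \<Rightarrow> nat \<Rightarrow> 'k::field combination \<Rightarrow> 'k combination \<Rightarrow> 'k combination" where
  "tensor_combinations r s r' s' x y =
    (\<Sum>D1\<in>marked_diagrams r s. \<Sum>D2\<in>marked_diagrams r' s'.
      fun_scale (x D1 * y D2) (basis_vec (tensor_diagrams r s D1 D2)))"

definition identity_diagram :: "nat \<Rightarrow> diagram" where
  "identity_diagram a = ((\<lambda>i. {Top i, Bot i}) ` {..<a}, [])"

definition marked_brauer ::
  "'k::field \<Rightarrow> 'k \<Rightarrow> (nat, 'k combination set, 'k) tensor_category" where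
  "marked_brauer \<delta> \<epsilon> = \<lparr>
    Hom = brauer_hom \<epsilon>,
    Hom_deg = brauer_hom_deg \<epsilon>,
    Ident = (\<lambda>a. brauer_class \<epsilon> a a (basis_vec (identity_diagram a))),
    Comp = (\<lambda>r s t X Y. brauer_class \<epsilon> r t (compose_combinations \<delta> \<epsilon> r s t (rep X) (rep Y))),
    Plus = (\<lambda>r s X Y. brauer_class \<epsilon> r s (rep X + rep Y)),
    Smult = (\<lambda>r s c X. brauer_class \<epsilon> r s (fun_scale c (rep X))),
    Tens_obj = (+),
    Tens = (\<lambda>r s r' s' X Y.
      brauer_class \<epsilon> (r + r') (s + s') (tensor_combinations r s r' s' (rep X) (rep Y)))\<rparr>"

definition gen_I :: "'k::field \<Rightarrow> 'k combination set" where
  "gen_I \<epsilon> = brauer_class \<epsilon> 1 1 (basis_vec ({{Top 0, Bot 0}}, []))"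

definition gen_X :: "'k::field \<Rightarrow> 'k combination set" where
  "gen_X \<epsilon> = brauer_class \<epsilon> 2 2 (basis_vec ({{Top 0, Bot 1}, {Top 1, Bot 0}}, []))"

definition gen_cup :: "'k::field \<Rightarrow> 'k combination set" where
  "gen_cup \<epsilon> = brauer_class \<epsilon> 2 0 (basis_vec ({{Top 0, Top 1}}, [Bead {Top 0, Top 1}]))"

definition gen_cap :: "'k::field \<Rightarrow> 'k combination set" where
  "gen_cap \<epsilon> = brauer_class \<epsilon> 0 2 (basis_vec ({{Bot 0, Bot 1}}, [Arrow {Bot 0, Bot 1} (Bot 1)]))"

text \<open>The functor sends \<open>[a]\<close> to the \<open>a\<close>-th tensor power and has the prescribed values on the
  generators.\<close>

definition realizes_generators ::
  "('k::field \<Rightarrow> 'v::ab_group_add \<Rightarrow> 'v) \<Rightarrow> (bit \<Rightarrow> 'v set) \<Rightarrow> ('v \<Rightarrow> 'v \<Rightarrow> 'k) \<Rightarrow> 'k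
    \<Rightarrow> nat \<Rightarrow> (nat \<Rightarrow> 'v) \<Rightarrow> (nat \<Rightarrow> 'v) \<Rightarrow> (nat \<Rightarrow> nat)
    \<Rightarrow> (nat \<Rightarrow> nat \<Rightarrow> 'k combination set \<Rightarrow> ('v, 'k) tensor \<Rightarrow> ('v, 'k) tensor) \<Rightarrow> bool" where
  "realizes_generators scale V b \<epsilon> N v v' Fo Fm \<longleftrightarrow>
    (\<forall>a. Fo a = a) \<and>
    Fm 1 1 (gen_I \<epsilon>) = (\<lambda>x\<in>tpow scale 1. x) \<and>
    Fm 2 2 (gen_X \<epsilon>) = swap_map scale V \<and>
    Fm 2 0 (gen_cup \<epsilon>) = form_map scale V b \<and>
    Fm 0 2 (gen_cap \<epsilon>) = coform_map scale V N v v'"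

end

theory Submission
  imports Defs
begin

text \<open>
Fix dual homogeneous bases. A marked diagram is sent to the matrix whose entries are state sums: the
values of the form along the edges (taken on \<open>v\<close> at top vertices and on \<open>v'\<close> at bottom vertices)
are multiplied, with a sign counting the odd inversions between the order in which vertices and
markings are met along the edges and their order in the diagram (top row, markings downwards, bottom
row from right to left); markings have the degree of the form. Contracting the middle row of a stacked
figure joins strands by \<open>\<Sum>i. b x (v' i) * b (v i) y = b x y\<close> and turns each closed loop into the
superdimension, and the sign obeys the simplification rules, so the matrices are multiplicative.

Marked diagrams with the same edges are proportional modulo the relations, and their matrices are
nonzero if \<open>V \<noteq> 0\<close>; hence products of classes may be computed with arbitrary representatives.
Composing with adjacent transpositions moves the endpoints of an edge to the left, where it splits off
as a tensor factor, so every diagram is a unit multiple of a product of generators. This gives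
equivariance and uniqueness. If \<open>V = 0\<close>, all linear maps between tensor powers vanish, except on
the ground field.
\<close>

text \<open>Composites are picked by \<open>SOME\<close> among the outcomes of a nondeterministic
  rewriting. Independence of the choice does not come from confluence: scalar times state is
  constant along every run, so all outcomes have the same matrix, and a nonzero matrix entry fixes
  the factor between two diagrams with the same edges.

  The bottom row is read backwards so that the middle row of a stacked figure reads s-1, ..., 0, 0,
  ..., s-1. The points to be glued then form nested pairs. If the positions 0, 1, ... are contracted
  in this order, each pair is separated only by points that are already gone, and its two letters
  leave the sign exponent without interacting with any other letter.

  For a closed strand the sum over the label is \<Sum> (-1)^(p i), up to a global sign. This sign is
  trivial for an even form; for an odd form \<delta> = 0, because passing to the dual basis
  exchanges the parities.

  Functoriality rests on the vanishing of matrices on relations, as both sides of each law use the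
  same representatives. Independence of representatives enters through generation, and from there
  equivariance and uniqueness.\<close>

abbreviation "marked \<equiv> marked_diagrams"
abbreviation "brauer \<equiv> brauer_diagrams"

section \<open>Koszul signs of rearrangements, with exponents modulo 2\<close>

section \<open>Signs of words\<close>

text \<open>Sums and products in \<open>bit\<close> are kept in ring notation, so that exponents of
  signs can be normalised by the ring laws.\<close>

declare add_bit_eq_xor [simp del] mult_bit_eq_and [simp del]

lemma bit_add_self [simp]: "p + p = (0::bit)"
 by (cases p) simp_all

lemma bit_add_self2 [simp]: "p + (p + q) = (q::bit)"
 by (metis add.assoc add_0 bit_add_self)

lemma bit_mult_self [simp]: "p * p = (p::bit)"
 by (cases p) simp_all

lemma bit_mult_self2 [simp]: "p * (p * q) = (p * q::bit)"
 by (metis mult.assoc bit_mult_self)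

lemma bit_eq_add_iff: "p = q + r \<longleftrightarrow> p + q = (r::bit)"
 by (auto simp: ac_simps)

lemma koszul_0 [simp]: "koszul 0 = 1"
 and koszul_1 [simp]: "koszul 1 = - 1"
 by (simp_all add: koszul_def)

lemma koszul_add: "koszul (p + q) = koszul p * (koszul q :: 'k::field)"
 by (cases p; cases q) simp_all

lemma koszul_nonzero [simp]: "koszul p \<noteq> (0 :: 'k::field)"
 by (cases p) simp_all

lemma koszul_self [simp]: "koszul p * koszul p = (1 :: 'k::field)"
 by (cases p) simp_all

lemma koszul_self2 [simp]: "koszul p * (koszul p * c) = (c :: 'k::field)"
 by (cases p) simp_all

text \<open>The first occurrence counts, and an absent letter gets position \<open>length W\<close>,
  behind all letters that occur. Words serve only as linear orders: signs compare positions and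
  nothing else.\<close>

definition pos :: "'a list \<Rightarrow> 'a \<Rightarrow> nat" where
 "pos W x = length (takeWhile (\<lambda>y. y \<noteq> x) W)"

lemma pos_Nil [simp]: "pos [] x = 0"
 by (simp add: pos_def)

lemma pos_Cons: "pos (y # W) x = (if y = x then 0 else Suc (pos W x))"
 by (simp add: pos_def)

lemma pos_append: "pos (U @ W) x = (if x \<in> set U then pos U x else length U + pos W x)"
 by (induction U) (auto simp: pos_Cons)

lemma pos_less: "x \<in> set W \<Longrightarrow> pos W x < length W"
 by (induction W) (auto simp: pos_Cons)

lemma nth_pos: "x \<in> set W \<Longrightarrow> W ! pos W x = x"
 by (induction W) (auto simp: pos_Cons)

lemma pos_notin: "x \<notin> set W \<Longrightarrow> pos W x = length W"
 by (induction W) (auto simp: pos_Cons)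

lemma pos_eq_iff: "x \<in> set W \<Longrightarrow> pos W x = pos W y \<longleftrightarrow> x = y"
 by (metis nth_pos pos_less pos_notin less_irrefl)

lemma pos_map: "inj_on f (insert x (set W)) \<Longrightarrow> pos (map f W) (f x) = pos W x"
 by (induction W) (auto simp: pos_Cons inj_on_def)

text \<open>Lets the reference word be shortened: discarding glued points, loop markings or
  cancelled pairs keeps the order of what remains.\<close>

lemma pos_filter_less:
 "x \<in> set W \<Longrightarrow> y \<in> set W \<Longrightarrow> P x \<Longrightarrow> P y \<Longrightarrow>
  pos (filter P W) x < pos (filter P W) y \<longleftrightarrow> pos W x < pos W y"
proof (induction W)
 case (Cons a W)
 then show ?case
  by (cases "a = x"; cases "a = y") (auto simp: pos_Cons)
qed simp

text \<open>Only letters of \<open>Z\<close> lie between \<open>a\<close> and \<open>b\<close>. In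
  the applications \<open>Z\<close> is empty or consists of points that were glued before.\<close>

lemma pos_adjacent:
 assumes "distinct (X @ [a] @ Z @ [b] @ Y)" "x \<notin> {a, b} \<union> set Z"
  "x \<in> set (X @ [a] @ Z @ [b] @ Y)"
 shows "pos (X @ [a] @ Z @ [b] @ Y) x < pos (X @ [a] @ Z @ [b] @ Y) a \<longleftrightarrow>
  pos (X @ [a] @ Z @ [b] @ Y) x < pos (X @ [a] @ Z @ [b] @ Y) b"
 using assms pos_less[of x X] by (auto simp: pos_append pos_Cons)

lemma pos_swap:
 assumes "distinct (X @ [a, b] @ Y)" "x \<noteq> y" "{x, y} \<noteq> {a, b}"
  "x \<in> set (X @ [a, b] @ Y)" "y \<in> set (X @ [a, b] @ Y)"
 shows "pos (X @ [b, a] @ Y) x < pos (X @ [b, a] @ Y) y \<longleftrightarrow>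
  pos (X @ [a, b] @ Y) x < pos (X @ [a, b] @ Y) y"
 using assms pos_less[of x X] pos_less[of y X] by (auto simp: pos_append pos_Cons)

definition total :: "('a \<Rightarrow> bit) \<Rightarrow> 'a list \<Rightarrow> bit" where
 "total dg Q = sum_list (map dg Q)"

lemma total_simps [simp]:
 "total dg [] = 0" "total dg (x # Q) = dg x + total dg Q"
 "total dg (Q @ R) = total dg Q + total dg R"
 "total dg (rev Q) = total dg Q"
 by (simp_all add: total_def rev_map sum_list_rev flip: rev_map)

definition before :: "'a list \<Rightarrow> ('a \<Rightarrow> bit) \<Rightarrow> 'a \<Rightarrow> 'a list \<Rightarrow> bit" where
 "before W dg x Q = sum_list (map (\<lambda>y. if pos W y < pos W x then dg y else 0) Q)"

lemma before_simps [simp]: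
 "before W dg x [] = 0"
 "before W dg x (y # Q) = (if pos W y < pos W x then dg y else 0) + before W dg x Q"
 "before W dg x (Q @ R) = before W dg x Q + before W dg x R"
 by (simp_all add: before_def)

text \<open>Counts modulo 2 the pairs of odd letters, one from each block, whose order in
  \<open>Q @ R\<close> is opposite to that in \<open>W\<close>.\<close>

definition crossing :: "'a list \<Rightarrow> ('a \<Rightarrow> bit) \<Rightarrow> 'a list \<Rightarrow> 'a list \<Rightarrow> bit" where
 "crossing W dg Q R = sum_list (map (\<lambda>x. dg x * before W dg x R) Q)"

lemma crossing_simps [simp]:
 "crossing W dg [] R = 0"
 "crossing W dg (x # Q) R = dg x * before W dg x R + crossing W dg Q R"
 "crossing W dg (Q @ Q') R = crossing W dg Q R + crossing W dg Q' R"
 by (simp_all add: crossing_def)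

lemma crossing_append2: "crossing W dg Q (R @ R') = crossing W dg Q R + crossing W dg Q R'"
 by (induction Q) (simp_all add: algebra_simps)

lemma crossing_Nil2 [simp]: "crossing W dg Q [] = 0"
 by (induction Q) simp_all

lemma crossing_rev [simp]: "crossing W dg (rev Q) R = crossing W dg Q R"
 by (induction Q) (simp_all add: add.commute)

text \<open>Exponent of the Koszul sign for sorting \<open>Q\<close> into the order of
  \<open>W\<close>: even letters move freely, and each inverted pair of odd letters counts
  once.\<close>

primrec invs :: "'a list \<Rightarrow> ('a \<Rightarrow> bit) \<Rightarrow> 'a list \<Rightarrow> bit" where
 "invs W dg [] = 0"
| "invs W dg (x # Q) = dg x * before W dg x Q + invs W dg Q"

lemma invs_append:
 "invs W dg (Q @ R) = invs W dg Q + invs W dg R + crossing W dg Q R"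
 by (induction Q) (simp_all add: algebra_simps)

lemma before_cong:
 assumes "\<And>y. y \<in> set Q \<Longrightarrow> pos W y < pos W x \<longleftrightarrow> pos W' y < pos W' x"
  and "\<And>y. y \<in> set Q \<Longrightarrow> dg y = dg' y"
 shows "before W dg x Q = before W' dg' x Q"
 using assms by (induction Q) auto

lemma invs_cong:
 assumes "\<And>x y. x \<in> set Q \<Longrightarrow> y \<in> set Q \<Longrightarrow> pos W y < pos W x \<longleftrightarrow> pos W' y < pos W' x"
  and "\<And>y. y \<in> set Q \<Longrightarrow> dg y = dg' y"
 shows "invs W dg Q = invs W' dg' Q"
 using assms
proof (induction Q)
 case (Cons x Q)
 have "before W dg x Q = before W' dg' x Q"
  by (rule before_cong) (use Cons.prems in auto)
 then show ?case using Cons by simp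
qed simp

lemma invs_map:
 assumes "inj_on f (set W \<union> set Q)" "\<And>x. x \<in> set Q \<Longrightarrow> dg' (f x) = dg x"
 shows "invs (map f W) dg' (map f Q) = invs W dg Q"
 using assms
proof (induction Q)
 case (Cons x Q)
 have p: "pos (map f W) (f y) = pos W y" if "y \<in> set (x # Q)" for y
  by (rule pos_map, rule inj_on_subset[OF Cons.prems(1)]) (use that in auto)
 have "before (map f W) dg' (f x) (map f Q) = before W dg x Q"
  unfolding before_def map_map comp_def
  by (rule arg_cong[where f = sum_list], rule map_cong[OF refl]) (use p Cons.prems(2) in auto)
 moreover have "invs (map f W) dg' (map f Q) = invs W dg Q"
  by (rule Cons.IH, rule inj_on_subset[OF Cons.prems(1)]) (use Cons.prems(2) in auto)
 ultimately show ?case using Cons.prems(2) by simp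
qed simp

text \<open>Every letter of \<open>R\<close> stands either before or after \<open>x\<close>, so the
  two terms add up to the full product of degrees.\<close>

lemma before_commute:
 assumes "\<And>y. y \<in> set R \<Longrightarrow> pos W x \<noteq> pos W y"
 shows "dg x * before W dg x R + crossing W dg R [x] = dg x * total dg R"
 using assms
proof (induction R)
 case (Cons y R)
 have "pos W x \<noteq> pos W y" using Cons.prems by simp
 then have "dg x * (if pos W y < pos W x then dg y else 0)
   + dg y * (if pos W x < pos W y then dg x else 0) = dg x * dg y"
  by (auto simp: mult.commute)
 moreover have "dg x * before W dg x R + crossing W dg R [x] = dg x * total dg R"
  using Cons by simp
 ultimately show ?case
  by (simp only: before_simps crossing_simps total_simps distrib_left add_0_right) (simp only: ac_simps)
qed simp

lemma crossing_commute:
 assumes "\<And>x y. x \<in> set Q \<Longrightarrow> y \<in> set R \<Longrightarrow> pos W x \<noteq> pos W y"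
 shows "crossing W dg Q R + crossing W dg R Q = total dg Q * total dg R"
 using assms
proof (induction Q)
 case (Cons x Q)
 have 1: "dg x * before W dg x R + crossing W dg R [x] = dg x * total dg R"
  by (rule before_commute) (use Cons.prems in auto)
 have 2: "crossing W dg Q R + crossing W dg R Q = total dg Q * total dg R"
  using Cons by simp
 have "crossing W dg (x # Q) R + crossing W dg R ([x] @ Q)
   = (dg x * before W dg x R + crossing W dg R [x])
    + (crossing W dg Q R + crossing W dg R Q)"
  unfolding crossing_append2 by (simp only: crossing_simps ac_simps)
 then show ?case unfolding 1 2 by (simp add: algebra_simps)
qed simp

text \<open>Second elementary symmetric function of the degrees: the exponent of the Koszul sign for
  reversing a word.\<close>

primrec pairs :: "('a \<Rightarrow> bit) \<Rightarrow> 'a list \<Rightarrow> bit" where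
 "pairs dg [] = 0"
| "pairs dg (x # Q) = dg x * total dg Q + pairs dg Q"

lemma pairs_append: "pairs dg (Q @ R) = pairs dg Q + pairs dg R + total dg Q * total dg R"
 by (induction Q) (simp_all add: algebra_simps)

text \<open>Reversal exchanges inverted and non-inverted pairs, so the two exponents add up to the
  sum over all pairs.\<close>

lemma invs_rev:
 assumes "distinct Q" "set Q \<subseteq> set W"
 shows "invs W dg (rev Q) = invs W dg Q + pairs dg Q"
 using assms
proof (induction Q)
 case (Cons x Q)
 have 1: "dg x * before W dg x Q + crossing W dg Q [x] = dg x * total dg Q"
  by (rule before_commute) (use Cons.prems in \<open>auto simp: pos_eq_iff\<close>)
 then have 2: "crossing W dg Q [x] = dg x * before W dg x Q + dg x * total dg Q"
  by (subst bit_eq_add_iff) (simp add: add.commute)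
 have "invs W dg (rev (x # Q)) = invs W dg Q + pairs dg Q + crossing W dg Q [x]"
  using Cons by (simp add: invs_append)
 then show ?case unfolding 2 by (simp add: ac_simps)
qed simp

lemma invs_move_even:
 assumes "set Q \<subseteq> set W" "distinct (Q @ R)" "total dg Q = 0"
 shows "invs W dg (Q @ R) = invs W dg (R @ Q)"
proof -
 have "crossing W dg Q R + crossing W dg R Q = total dg Q * total dg R"
  by (rule crossing_commute) (use assms pos_eq_iff[of _ W] in fastforce)
 then have "crossing W dg Q R = crossing W dg R Q"
  using assms(3) by (metis bit_eq_add_iff add_0_right mult_zero_left)
 then show ?thesis by (simp add: invs_append ac_simps)
qed

text \<open>Two letters of the same degree that no letter of \<open>Q\<close> separates contribute
  equally, hence cancel modulo 2.\<close>

lemma crossing_adjacent: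
 assumes "dg a = dg b" "\<And>x. x \<in> set Q \<Longrightarrow> pos W x < pos W a \<longleftrightarrow> pos W x < pos W b"
  "\<And>x. x \<in> set Q \<Longrightarrow> pos W x \<noteq> pos W a \<and> pos W x \<noteq> pos W b"
 shows "crossing W dg Q [a, b] = 0" "crossing W dg [a, b] Q = 0"
proof -
 show "crossing W dg Q [a, b] = 0"
  using assms(2,3)
 proof (induction Q)
  case (Cons x Q)
  have "pos W x < pos W a \<longleftrightarrow> pos W x < pos W b"
   "pos W x \<noteq> pos W a" "pos W x \<noteq> pos W b" using Cons.prems by auto
  then have "pos W a < pos W x \<longleftrightarrow> pos W b < pos W x" by linarith
  then show ?case using Cons assms(1) by simp
 qed simp
 have "before W dg a Q = before W dg b Q"
  using assms(2) by (induction Q) auto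
 then show "crossing W dg [a, b] Q = 0" using assms(1) by simp
qed

text \<open>Only the mutual inversion of \<open>a\<close> and \<open>b\<close> survives. This one
  fact serves both gluing, where the pair consists of two identified points, and the cancellation of
  a bead against an arrow.\<close>

lemma invs_remove_pair:
 assumes "dg a = dg b"
  "\<And>x. x \<in> set (U @ R) \<Longrightarrow> pos W x < pos W a \<longleftrightarrow> pos W x < pos W b"
  "\<And>x. x \<in> set (U @ R) \<Longrightarrow> pos W x \<noteq> pos W a \<and> pos W x \<noteq> pos W b"
 shows "invs W dg (U @ [a, b] @ R) =
  invs W dg (U @ R) + (if pos W b < pos W a then dg a else 0)"
proof -
 have "crossing W dg U [a, b] = 0" "crossing W dg [a, b] R = 0"
  using crossing_adjacent[of dg a b] assms by auto
 moreover have "invs W dg [a, b] = (if pos W b < pos W a then dg a else 0)"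
  using assms(1) by simp
 ultimately show ?thesis
  unfolding invs_append crossing_append2 by (simp add: add.assoc add.left_commute add.commute)
qed

text \<open>Interchanging neighbours of the reference word affects a single comparison, that of
  \<open>a\<close> with \<open>b\<close>, which counts only if both occur in \<open>Q\<close>. It is
  applied to the interchange of two heights.\<close>

lemma invs_swap:
 assumes W: "distinct (X @ [a, b] @ Y)" and "distinct Q" "set Q \<subseteq> set (X @ [a, b] @ Y)"
 shows "invs (X @ [b, a] @ Y) dg Q = invs (X @ [a, b] @ Y) dg Q
  + (if a \<in> set Q \<and> b \<in> set Q then dg a * dg b else 0)"
 using assms(2,3)
proof (induction Q)
 case (Cons x Q)
 let ?W = "X @ [a, b] @ Y" and ?W' = "X @ [b, a] @ Y"
 have same: "pos ?W' y < pos ?W' x \<longleftrightarrow> pos ?W y < pos ?W x" if "y \<in> set Q" "{y, x} \<noteq> {a, b}" for y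
  by (rule pos_swap[OF W]) (use that Cons.prems in auto)
 have ab: "pos ?W a < pos ?W b" "\<not> pos ?W b < pos ?W a" "\<not> pos ?W' a < pos ?W' b" "pos ?W' b < pos ?W' a"
  using W by (auto simp: pos_append pos_Cons)
 \<comment> \<open>For distinct letters \<open>R\<close> of \<open>Q\<close>: at most one of them
   can form the exceptional pair with \<open>x\<close>.\<close>
 have extra: "before ?W' dg x R = before ?W dg x R
   + (if x = a \<and> b \<in> set R then dg b else if x = b \<and> a \<in> set R then dg a else 0)"
  if "set R \<subseteq> set Q" "distinct R" for R
  using that
 proof (induction R)
  case (Cons y R)
  then have IH: "before ?W' dg x R = before ?W dg x R
   + (if x = a \<and> b \<in> set R then dg b else if x = b \<and> a \<in> set R then dg a else 0)" by simp
  have yx: "y \<noteq> x" using Cons.prems \<open>distinct (x # Q)\<close> by auto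
  show ?case
  proof (cases "{y, x} = {a, b}")
   case True
   then have "(y = a \<and> x = b) \<or> (y = b \<and> x = a)" using yx by (auto simp: doubleton_eq_iff)
   then show ?thesis
   proof
    assume *: "y = a \<and> x = b"
    then have "b \<notin> set R" "a \<notin> set R" using Cons.prems \<open>distinct (x # Q)\<close> by auto
    then show ?thesis using * ab yx unfolding before_simps IH by (simp add: ac_simps)
   next
    assume *: "y = b \<and> x = a"
    then have "b \<notin> set R" "a \<notin> set R" using Cons.prems \<open>distinct (x # Q)\<close> by auto
    then show ?thesis using * ab yx unfolding before_simps IH by (simp add: ac_simps)
   qed
  next
   case False
   moreover have "y \<in> set Q" using Cons.prems by simp
   ultimately have s: "pos ?W' y < pos ?W' x \<longleftrightarrow> pos ?W y < pos ?W x" using same by blast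
   have "(if x = a \<and> b \<in> set (y # R) then dg b else if x = b \<and> a \<in> set (y # R) then dg a else 0)
    = (if x = a \<and> b \<in> set R then dg b else if x = b \<and> a \<in> set R then dg a else 0)"
    using False yx by (auto simp: doubleton_eq_iff)
   then show ?thesis unfolding before_simps IH s by (simp only: ac_simps)
  qed
 qed simp
 have IH: "invs ?W' dg Q = invs ?W dg Q
  + (if a \<in> set Q \<and> b \<in> set Q then dg a * dg b else 0)" using Cons by simp
 have e: "before ?W' dg x Q = before ?W dg x Q
   + (if x = a \<and> b \<in> set Q then dg b else if x = b \<and> a \<in> set Q then dg a else 0)"
  using extra[of Q] Cons.prems by simp
 have "x \<notin> set Q" "a \<noteq> b" using Cons.prems W by auto
 then show ?case unfolding invs.simps IH e
  by (auto simp: algebra_simps simp del: append_Cons append.simps)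
qed simp

section \<open>Graphs without branching, and the paths and cycles of which they consist\<close>

section \<open>Trails in stacked diagrams\<close>

text \<open>Unlike in \<open>trail\<close>, source, segment and target of each step are recorded,
  and segments may repeat. Concatenation, rotation and reversal thus act on lists of steps;
  distinctness is imposed separately.\<close>

fun walk :: "segment set \<Rightarrow> node \<Rightarrow> (node \<times> segment \<times> node) list \<Rightarrow> node \<Rightarrow> bool" where
 "walk S x [] y \<longleftrightarrow> x = y"
| "walk S x ((a, s, z) # st) y \<longleftrightarrow> a = x \<and> s \<in> S \<and> seg_ends s = {x, z} \<and> walk S z st y"

abbreviation seg :: "'x \<times> 's \<times> 'x \<Rightarrow> 's" where
 "seg p \<equiv> fst (snd p)"

abbreviation dst :: "'a \<times> 'b \<times> 'c \<Rightarrow> 'c" where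
 "dst P \<equiv> snd (snd P)"

abbreviation segs :: "('x \<times> 's \<times> 'x) list \<Rightarrow> 's list" where
 "segs st \<equiv> map seg st"

definition turn :: "'x \<times> 's \<times> 'x \<Rightarrow> 'x \<times> 's \<times> 'x" where
 "turn p = (dst p, seg p, fst p)"

lemma turn_simps [simp]: "turn (a, s, z) = (z, s, a)" "seg (turn p) = seg p" "turn (turn p) = p"
 by (simp_all add: turn_def)

definition rev_steps :: "('x \<times> 's \<times> 'x) list \<Rightarrow> ('x \<times> 's \<times> 'x) list" where
 "rev_steps st = rev (map turn st)"

lemma rev_steps_simps [simp]:
 "rev_steps [] = []" "rev_steps (p # st) = rev_steps st @ [turn p]" "rev_steps (st @ st') = rev_steps st' @ rev_steps st"
 "rev_steps (rev_steps st) = st" "segs (rev_steps st) = rev (segs st)" "set (segs (rev_steps st)) = set (segs st)"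
 "rev_steps st = [] \<longleftrightarrow> st = []" "[] = rev_steps st \<longleftrightarrow> st = []" "length (rev_steps st) = length st"
 by (simp_all add: rev_steps_def rev_map comp_def)

lemma walk_append: "walk S x (st @ st') y \<longleftrightarrow> (\<exists>z. walk S x st z \<and> walk S z st' y)"
 by (induction S x st y rule: walk.induct) auto

lemma walk_back: "walk S x st y \<Longrightarrow> walk S y (rev_steps st) x"
 by (induction S x st y rule: walk.induct) (auto simp: walk_append insert_commute)

lemma walk_segs: "walk S x st y \<Longrightarrow> set (segs st) \<subseteq> S"
 by (induction S x st y rule: walk.induct) auto

lemma trail_iff_walk:
 "trail S x ss y \<longleftrightarrow> distinct ss \<and> (\<exists>st. walk S x st y \<and> segs st = ss)"
proof (induction ss arbitrary: x)
 case (Cons s ss)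
 show ?case
 proof
  assume "trail S x (s # ss) y"
  then obtain z where z: "s \<in> S" "s \<notin> set ss" "seg_ends s = {x, z}" "trail S z ss y" by auto
  then obtain st where "walk S z st y" "segs st = ss" "distinct ss" using Cons by blast
  then have "walk S x ((x, s, z) # st) y" "segs ((x, s, z) # st) = s # ss" using z by auto
  then show "distinct (s # ss) \<and> (\<exists>st. walk S x st y \<and> segs st = s # ss)"
   using z(2) \<open>distinct ss\<close> by (metis distinct.simps(2))
 next
  assume "distinct (s # ss) \<and> (\<exists>st. walk S x st y \<and> segs st = s # ss)"
  then obtain st where st: "walk S x st y" "segs st = s # ss" and "distinct (s # ss)"
   by (elim conjE exE)
  then obtain a z st' where "st = (a, s, z) # st'" "segs st' = ss" by (cases st) auto
  then show "trail S x (s # ss) y" using st Cons \<open>distinct (s # ss)\<close> by auto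
 qed
qed auto

lemma trail_walk: "trail S x ss y \<Longrightarrow> \<exists>st. walk S x st y \<and> distinct (segs st) \<and> segs st = ss"
 unfolding trail_iff_walk by (elim conjE exE) (metis (no_types))

lemma walk_trail: "walk S x st y \<Longrightarrow> distinct (segs st) \<Longrightarrow> trail S x (segs st) y"
 unfolding trail_iff_walk by (intro conjI exI[of _ st] refl)

lemma walk_last: "walk S x st y \<Longrightarrow> st \<noteq> [] \<Longrightarrow> y \<in> seg_ends (seg (last st)) \<and> snd (snd (last st)) = y"
proof (induction st arbitrary: x)
 case (Cons p st)
 then show ?case by (cases p; cases "st = []") auto
qed simp

lemma walk_hd: "walk S x st y \<Longrightarrow> st \<noteq> [] \<Longrightarrow> x \<in> seg_ends (seg (hd st)) \<and> fst (hd st) = x"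
 by (cases st) auto

lemma outer_node_inject [simp]: "outer_node u = outer_node w \<longleftrightarrow> u = w"
 by (cases u; cases w) auto

text \<open>The abstract shape of a stacked figure: segments have two different ends, at most two
  segments meet at a node and at most one at an outer node. Such a graph is a disjoint union of
  paths and cycles.\<close>

definition regular :: "segment set \<Rightarrow> bool" where
 "regular S \<longleftrightarrow> (\<forall>s\<in>S. card (seg_ends s) = 2) \<and>
  (\<forall>z. \<forall>s1\<in>S. \<forall>s2\<in>S. \<forall>s3\<in>S. z \<in> seg_ends s1 \<longrightarrow> z \<in> seg_ends s2 \<longrightarrow> z \<in> seg_ends s3 \<longrightarrow>
   s1 \<noteq> s2 \<longrightarrow> s1 \<noteq> s3 \<longrightarrow> s2 = s3) \<and>
  (\<forall>v. \<forall>s1\<in>S. \<forall>s2\<in>S. outer_node v \<in> seg_ends s1 \<longrightarrow> outer_node v \<in> seg_ends s2 \<longrightarrow> s1 = s2)"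

lemma regular_ends: "regular S \<Longrightarrow> s \<in> S \<Longrightarrow> seg_ends s = {x, z} \<Longrightarrow> x \<noteq> z"
 unfolding regular_def by (metis card_1_singleton_iff insert_absorb2 One_nat_def n_not_Suc_n numeral_2_eq_2)

lemma regular_2:
 "regular S \<Longrightarrow> s1 \<in> S \<Longrightarrow> s2 \<in> S \<Longrightarrow> s3 \<in> S \<Longrightarrow> z \<in> seg_ends s1 \<Longrightarrow> z \<in> seg_ends s2 \<Longrightarrow>
  z \<in> seg_ends s3 \<Longrightarrow> s1 \<noteq> s2 \<Longrightarrow> s1 \<noteq> s3 \<Longrightarrow> s2 = s3"
 unfolding regular_def by blast

lemma regular_1:
 "regular S \<Longrightarrow> s1 \<in> S \<Longrightarrow> s2 \<in> S \<Longrightarrow> outer_node v \<in> seg_ends s1 \<Longrightarrow> outer_node v \<in> seg_ends s2 \<Longrightarrow>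
  s1 = s2"
 unfolding regular_def by blast

text \<open>A node entered through one segment can be left through at most one other segment, so two
  walks with the same beginning differ in their length only.\<close>

lemma walk_deterministic:
 assumes "regular S" "walk S x (p # a) y" "walk S x (q # b) y'" "seg p = seg q"
  "distinct (segs (p # a))" "distinct (segs (q # b))"
 shows "p = q \<and> (\<exists>c. b = a @ c \<or> a = b @ c)"
 using assms(2-)
proof (induction a arbitrary: x p q b)
 case Nil
 then have "p = q" using assms(1)
  by (cases p; cases q) (auto simp: doubleton_eq_iff)
 then show ?case by auto
next
 case (Cons p' a)
 obtain s z where p: "p = (x, s, z)" "s \<in> S" "seg_ends s = {x, z}" "walk S z (p' # a) y"
  using Cons.prems(1) by (cases p) auto
 have q: "q = (x, s, z)" "walk S z b y'"
  using Cons.prems(2,3) p by (cases q; auto simp: doubleton_eq_iff)+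
 show ?case
 proof (cases b)
  case Nil
  then show ?thesis using p q by simp
 next
  case b: (Cons q' b')
  have "z \<in> seg_ends (seg p')" "seg p' \<in> S" using p(4) by (cases p'; auto)+
  moreover have "z \<in> seg_ends (seg q')" "seg q' \<in> S" using q(2) b by (cases q'; auto)+
  moreover have "seg p' \<noteq> s" "seg q' \<noteq> s" using Cons.prems(4,5) p(1) q(1) b by auto
  ultimately have "seg p' = seg q'" using regular_2[OF assms(1), of s "seg p'" "seg q'" z] p by auto
  then have "p' = q' \<and> (\<exists>c. b' = a @ c \<or> a = b' @ c)"
   using Cons.IH[of z p' q' b'] p(4) q(2) b Cons.prems(4,5) by auto
  then show ?thesis using p q b by auto
 qed
qed

text \<open>A walk cannot be prolonged beyond an outer node, since the only segment at this node has
  just been used.\<close>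

lemma walk_maximal:
 assumes "regular S" "walk S x (p # a) (outer_node v)" "walk S x (q # b) y" "seg p = seg q"
  "distinct (segs (p # a))" "distinct (segs (q # b))"
 shows "p = q \<and> (\<exists>c. a = b @ c)"
proof -
 from walk_deterministic[OF assms] obtain c where pq: "p = q" and c: "b = a @ c \<or> a = b @ c" by blast
 have "c = []" if b: "b = a @ c"
 proof (rule ccontr)
  assume "c \<noteq> []"
  have "walk S x ((p # a) @ c) y" using assms(3) b pq by simp
  then obtain z where z: "walk S x (p # a) z" "walk S z c y" unfolding walk_append by blast
  have "z = outer_node v"
   using walk_last[OF z(1)] walk_last[OF assms(2)] by auto
  then have 1: "outer_node v \<in> seg_ends (seg (hd c))" using walk_hd[OF z(2) \<open>c \<noteq> []\<close>] by simp
  have 2: "outer_node v \<in> seg_ends (seg (last (p # a)))" using walk_last[OF assms(2)] by simp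
  have "seg (hd c) \<in> S" using walk_segs[OF z(2)] \<open>c \<noteq> []\<close> by auto
  moreover have "seg (last (p # a)) \<in> S" using walk_segs[OF z(1)] last_in_set[of "p # a"] by auto
  ultimately have "seg (hd c) = seg (last (p # a))" using regular_1[OF assms(1)] 1 2 by blast
  moreover have "seg (hd c) \<in> set (segs c)" using \<open>c \<noteq> []\<close> by auto
  moreover have "seg (last (p # a)) \<in> set (segs (p # a))" using last_in_set[of "p # a"] by force
  moreover have "distinct (segs (p # a) @ segs c)" using assms(6) b pq by simp
  ultimately show False by (metis disjoint_iff distinct_append)
 qed
 then show ?thesis using pq c by auto
qed

text \<open>A directed path with its two endpoints. Endpoints, segments and nodes have separate
  types, because the notion is used for single edges, for partially glued figures and for the
  strands of a composite.\<close>

type_synonym ('p, 's, 'x) strand = "'p \<times> ('x \<times> 's \<times> 'x) list \<times> 'p"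

abbreviation steps :: "('p, 's, 'x) strand \<Rightarrow> ('x \<times> 's \<times> 'x) list" where
 "steps P \<equiv> fst (snd P)"

definition flip :: "('p, 's, 'x) strand \<Rightarrow> ('p, 's, 'x) strand" where
 "flip P = (dst P, rev_steps (steps P), fst P)"

lemma flip_simps [simp]: "flip (x, st, y) = (y, rev_steps st, x)" "flip (flip P) = P"
 by (simp_all add: flip_def)

lemma oriented_segs:
 "(x, st, y) = P \<or> (x, st, y) = flip P \<Longrightarrow> set (segs (steps P)) = set (segs st)"
 by (cases P; elim disjE; simp)

definition ends :: "('p, 's, 'x) strand list \<Rightarrow> 'p list" where
 "ends Ps = concat (map (\<lambda>P. [fst P, dst P]) Ps)"

lemma ends_simps [simp]:
 "ends [] = []" "ends ((x, st, y) # Ps) = x # y # ends Ps" "ends (Ps @ Qs) = ends Ps @ ends Qs"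
 by (simp_all add: ends_def)

lemma set_ends: "set (ends Ps) = (\<Union>P\<in>set Ps. {fst P, dst P})"
 by (auto simp: ends_def)

definition str_segs :: "('p, 's, 'x) strand list \<Rightarrow> 's list" where
 "str_segs Ps = concat (map (\<lambda>P. segs (steps P)) Ps)"

lemma str_segs_simps [simp]:
 "str_segs [] = []" "str_segs ((x, st, y) # Ps) = segs st @ str_segs Ps"
 "str_segs (Ps @ Qs) = str_segs Ps @ str_segs Qs"
 by (simp_all add: str_segs_def)

lemma set_strand_segs: "set (str_segs Ps) = (\<Union>P\<in>set Ps. set (segs (steps P)))"
 by (auto simp: str_segs_def)

definition loop_segs :: "('x \<times> 's \<times> 'x) list list \<Rightarrow> 's list" where
 "loop_segs Ls = concat (map segs Ls)"

lemma loop_segs_simps [simp]: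
 "loop_segs [] = []" "loop_segs (l # Ls) = segs l @ loop_segs Ls"
 by (simp_all add: loop_segs_def)

text \<open>A decomposition of the graph into paths between outer vertices and cycles, as gluing
  provides it. The edges and loops of a composite are defined through arbitrary trails; in the
  locale below they are read off from any such system.\<close>

definition complete_system ::
 "segment set \<Rightarrow> (vertex, segment, node) strand list \<Rightarrow> (node \<times> segment \<times> node) list list \<Rightarrow> bool" where
 "complete_system S Ps Ls \<longleftrightarrow>
  (\<forall>(x, st, y)\<in>set Ps. walk S (outer_node x) st (outer_node y)) \<and>
  (\<forall>l\<in>set Ls. l \<noteq> [] \<and> (\<exists>x. walk S x l x)) \<and>
  distinct (str_segs Ps @ loop_segs Ls) \<and> set (str_segs Ps @ loop_segs Ls) = S \<and>
  distinct (ends Ps) \<and>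
  (\<forall>v. \<forall>s\<in>S. outer_node v \<in> seg_ends s \<longrightarrow> v \<in> set (ends Ps))"

lemma distinct_strand:
 "distinct (str_segs Ps) \<Longrightarrow> P \<in> set Ps \<Longrightarrow> distinct (segs (steps P))"
 by (induction Ps) (auto simp: str_segs_def)

lemma distinct_ends: "distinct (ends Ps) \<Longrightarrow> (x, st, y) \<in> set Ps \<Longrightarrow> x \<noteq> y"
 by (induction Ps) (auto simp: ends_def)

lemma strand_unique_seg:
 "distinct (str_segs Ps) \<Longrightarrow> P \<in> set Ps \<Longrightarrow> Q \<in> set Ps \<Longrightarrow> s \<in> set (segs (steps P)) \<Longrightarrow>
  s \<in> set (segs (steps Q)) \<Longrightarrow> P = Q"
 by (induction Ps) (auto simp: str_segs_def)

locale complete_strands =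
 fixes S :: "segment set" and Ps Ls
 assumes regular: "regular S" and complete: "complete_system S Ps Ls"
begin

lemma distinct_ends_strands: "distinct (ends Ps)"
 and distinct_segs_strands: "distinct (str_segs Ps @ loop_segs Ls)"
 and segs_strands: "set (str_segs Ps @ loop_segs Ls) = S"
 and loop_closed: "l \<in> set Ls \<Longrightarrow> l \<noteq> [] \<and> (\<exists>x. walk S x l x)"
 and outer_in_ends: "s \<in> S \<Longrightarrow> outer_node v \<in> seg_ends s \<Longrightarrow> v \<in> set (ends Ps)"
 using complete unfolding complete_system_def by (simp_all, blast+)

lemma strand_walk: "(x, st, y) \<in> set Ps \<Longrightarrow> walk S (outer_node x) st (outer_node y)"
 using complete by (auto simp: complete_system_def)

lemma strand_walk': "P \<in> set Ps \<Longrightarrow> walk S (outer_node (fst P)) (steps P) (outer_node (dst P))"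
 using strand_walk[of "fst P" "steps P" "dst P"] by simp

lemma distinct_steps: "(x, st, y) \<in> set Ps \<Longrightarrow> distinct (segs st)"
 using distinct_segs_strands distinct_strand[of Ps "(x, st, y)"] by simp

lemma ends_distinct: "(x, st, y) \<in> set Ps \<Longrightarrow> x \<noteq> y"
 by (rule distinct_ends[OF distinct_ends_strands])

lemma strand_nonempty: "(x, st, y) \<in> set Ps \<Longrightarrow> st \<noteq> []"
 using strand_walk ends_distinct by fastforce

lemma oriented_walk:
 assumes "P \<in> set Ps" "(x, st, y) = P \<or> (x, st, y) = flip P"
 shows "walk S (outer_node x) st (outer_node y)" "distinct (segs st)" "st \<noteq> []"
proof -
 obtain x' st' y' where P: "P = (x', st', y')" by (cases P) auto
 have "walk S (outer_node x') st' (outer_node y')" "distinct (segs st')" "st' \<noteq> []"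
  using assms(1) strand_walk distinct_steps strand_nonempty P by auto
 then show "walk S (outer_node x) st (outer_node y)" "distinct (segs st)" "st \<noteq> []"
  using assms(2) P walk_back by auto
qed

text \<open>The walk and the strand through \<open>u\<close> start with the only segment at
  \<open>u\<close>, and both stop at an outer vertex. By maximality each is a prefix of the
  other.\<close>

lemma walk_eq_strand:
 assumes "walk S (outer_node u) st (outer_node w)" "distinct (segs st)" "u \<noteq> w"
 obtains P where "P \<in> set Ps" "(u, st, w) = P \<or> (u, st, w) = flip P"
proof -
 obtain p a where st: "st = p # a" using assms by (cases st) auto
 have p: "seg p \<in> S" "outer_node u \<in> seg_ends (seg p)" using assms(1) st by (cases p; auto)+
 then have "u \<in> set (ends Ps)" by (rule outer_in_ends)
 then obtain P where P: "P \<in> set Ps" "u = fst P \<or> u = dst P" by (auto simp: set_ends)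
 from P(2) obtain st' w' where P': "(u, st', w') = P \<or> (u, st', w') = flip P"
  by (metis flip_def prod.collapse)
 note o = oriented_walk[OF P(1) P']
 obtain q b where st': "st' = q # b" using o(3) by (cases st') auto
 have q: "seg q \<in> S" "outer_node u \<in> seg_ends (seg q)" using o(1) st' by (cases q; auto)+
 have pq: "seg p = seg q" by (rule regular_1[OF regular p(1) q(1) p(2) q(2)])
 have "p = q \<and> (\<exists>c. a = b @ c)"
  by (rule walk_maximal[OF regular, of "outer_node u" p a w q b "outer_node w'"])
   (use assms o st st' pq in auto)
 moreover have "q = p \<and> (\<exists>c. b = a @ c)"
  by (rule walk_maximal[OF regular, of "outer_node u" q b w' p a "outer_node w"])
   (use assms o st st' pq in auto)
 ultimately have "st = st'" using st st' by auto
 then have "w = w'" using walk_last[OF o(1)] walk_last[OF assms(1)] st by auto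
 then show ?thesis using that P(1) P' \<open>st = st'\<close> by blast
qed

lemma composite_edges_eq: "composite_edges S = (\<lambda>P. {fst P, dst P}) ` set Ps"
proof (intro set_eqI iffI)
 fix e assume "e \<in> composite_edges S"
 then obtain u w ss where e: "e = {u, w}" "u \<noteq> w" "trail S (outer_node u) ss (outer_node w)"
  unfolding composite_edges_def by blast
 from trail_walk[OF e(3)] obtain st where st: "walk S (outer_node u) st (outer_node w)"
  "distinct (segs st)" by (elim exE conjE)
 from walk_eq_strand[OF st e(2)] obtain P where P: "P \<in> set Ps" "(u, st, w) = P \<or> (u, st, w) = flip P" .
 from P(2) have "{fst P, dst P} = {u, w}"
  by (elim disjE) (auto simp: flip_def)
 then show "e \<in> (\<lambda>P. {fst P, dst P}) ` set Ps" using e(1) P(1)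
  by (metis (no_types, lifting) image_eqI)
next
 fix e assume "e \<in> (\<lambda>P. {fst P, dst P}) ` set Ps"
 then obtain u st w where P: "(u, st, w) \<in> set Ps" "e = {u, w}" by force
 show "e \<in> composite_edges S" unfolding composite_edges_def
  using walk_trail[OF strand_walk[OF P(1)] distinct_steps[OF P(1)]] ends_distinct[OF P(1)] P(2)
  by (intro CollectI exI[of _ u] exI[of _ w] conjI exI[of _ "segs st"]) simp_all
qed

lemma loop_walk: "l \<in> set Ls \<Longrightarrow> \<exists>x. walk S x l x"
 using loop_closed by blast

lemma loop_distinct: "l \<in> set Ls \<Longrightarrow> distinct (segs l)"
proof -
 have "distinct (loop_segs Ls)" using distinct_segs_strands by simp
 then show "l \<in> set Ls \<Longrightarrow> distinct (segs l)" by (induction Ls) auto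
qed

text \<open>As a segment has two different ends, a closed walk has at least two steps, and its last
  segment belongs to the tail \<open>a\<close>.\<close>

lemma closed_walk_last:
 assumes "walk S x (p # a) x"
 shows "seg (last (p # a)) \<in> set (segs a)" "x \<in> seg_ends (seg (last (p # a)))"
proof -
 show "x \<in> seg_ends (seg (last (p # a)))" using walk_last[OF assms] by simp
 have "a \<noteq> []"
 proof
  assume "a = []"
  then have "seg_ends (seg p) = {x, x}" "seg p \<in> S" using assms by (cases p; auto)+
  then show False using regular_ends[OF regular] by blast
 qed
 then show "seg (last (p # a)) \<in> set (segs a)" by auto
qed

text \<open>The closed walk would run along the strand and return to \<open>x\<close>. There it
  meets the segment of \<open>q\<close>, the segment by which it returns and the predecessor of
  \<open>q\<close> in the strand; if there is no predecessor, \<open>x\<close> is an outer node.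
  Either way there is one segment too many at \<open>x\<close>.\<close>

lemma not_closed_in_strand:
 assumes "walk S (outer_node u) (ps1 @ q # ps2) (outer_node w)" "distinct (segs (ps1 @ q # ps2))"
  "walk S x (q # a) x" "distinct (segs (q # a))"
 shows False
proof -
 obtain z where z: "walk S (outer_node u) ps1 z" "walk S z (q # ps2) (outer_node w)"
  using assms(1) unfolding walk_append by blast
 have "z = x" using z(2) assms(3) by (cases q) auto
 then have "\<exists>c. ps2 = a @ c"
  using walk_maximal[OF regular, of x q ps2 w q a x] z assms by auto
 then have last_in: "seg (last (q # a)) \<in> set (segs ps2)" using closed_walk_last(1)[OF assms(3)] by auto
 have l: "x \<in> seg_ends (seg (last (q # a)))" by (rule closed_walk_last(2)[OF assms(3)])
 have lS: "seg (last (q # a)) \<in> S" using walk_segs[OF z(2)] last_in by auto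
 have q: "seg q \<in> S" "x \<in> seg_ends (seg q)" using assms(3) by (cases q; auto)+
 have "seg q \<notin> set (segs ps2)" using assms(2) by simp
 then have ne: "seg q \<noteq> seg (last (q # a))" using last_in by metis
 show False
 proof (cases "ps1 = []")
  case True
  then have "x = outer_node u" using z \<open>z = x\<close> by simp
  then show False using regular_1[OF regular q(1) lS] q(2) l ne by blast
 next
  case False
  have m: "x \<in> seg_ends (seg (last ps1))" "seg (last ps1) \<in> S"
   using walk_last[OF z(1) False] walk_segs[OF z(1)] False \<open>z = x\<close> by auto
  have mp: "seg (last ps1) \<in> set (segs ps1)" using False by simp
  moreover have "seg q \<notin> set (segs ps1)" using assms(2) by simp
  ultimately have "seg q \<noteq> seg (last ps1)" by metis
  then have "seg (last (q # a)) = seg (last ps1)"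
   using regular_2[OF regular q(1) lS m(2) q(2) l m(1) ne] by simp
  then show False using mp last_in assms(2) by auto
 qed
qed

text \<open>A trail that returns to \<open>x\<close>, goes on and returns once more would use three
  segments at \<open>x\<close>.\<close>

lemma closed_prefix:
 assumes "walk S x (p # a) x" "walk S x (p # a @ c) x" "distinct (segs (p # a @ c))"
 shows "c = []"
proof (rule ccontr)
 assume "c \<noteq> []"
 have l: "seg (last (p # a)) \<in> set (segs a)" "x \<in> seg_ends (seg (last (p # a)))"
  by (rule closed_walk_last[OF assms(1)])+
 have m: "x \<in> seg_ends (seg (last c))" "seg (last c) \<in> set (segs c)"
  using closed_walk_last(2)[OF assms(2)] \<open>c \<noteq> []\<close> by auto
 have S: "seg (last (p # a)) \<in> S" "seg (last c) \<in> S"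
  using walk_segs[OF assms(2)] l(1) m(2) by auto
 have p: "seg p \<in> S" "x \<in> seg_ends (seg p)" using assms(1) by (cases p; auto)+
 have "seg p \<notin> set (segs a)" "seg p \<notin> set (segs c)" using assms(3) by simp_all
 then have "seg p \<noteq> seg (last (p # a))" "seg p \<noteq> seg (last c)"
  using l(1) m(2) by metis+
 then have "seg (last (p # a)) = seg (last c)"
  using regular_2[OF regular p(1) S p(2) l(2) m(1)] by simp
 then show False using l(1) m(2) assms(3) by auto
qed

lemma oriented_at:
 assumes "walk S x (p # a) y" "s \<in> S" "seg_ends s = {e, z}" "seg p = s"
 shows "p = (e, s, z) \<or> p = (z, s, e)"
 using assms by (cases p) (auto simp: doubleton_eq_iff)

lemma strand_step_split:
 assumes "P \<in> set Ps" "s \<in> set (segs (steps P))" "walk S x (p # a) y" "seg p = s"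
 shows "\<exists>u w ps1 ps2. (u, ps1 @ p # ps2, w) = P \<or> (u, ps1 @ p # ps2, w) = flip P"
proof -
 obtain u ps w where P: "P = (u, ps, w)" by (cases P) auto
 obtain q where q: "q \<in> set ps" "seg q = s" using assms(2) P by auto
 obtain ps1 ps2 where ps: "ps = ps1 @ q # ps2" using split_list[OF q(1)] by blast
 have "walk S (outer_node u) ps (outer_node w)" using strand_walk assms(1) P by blast
 then obtain e z where "q = (e, s, z)" "seg_ends s = {e, z}" "s \<in> S"
  using q(2) by (cases q) (auto simp: walk_append ps)
 with oriented_at[OF assms(3) _ _ assms(4), of e z] have "p = q \<or> p = turn q" by auto
 then show ?thesis
 proof
  assume "p = q"
  then show ?thesis using P ps by blast
 next
  assume "p = turn q"
  then have "(w, rev_steps ps2 @ p # rev_steps ps1, u) = flip P" using P ps by simp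
  then show ?thesis by blast
 qed
qed

text \<open>The first segment lies on a strand, which is impossible, or on a loop of the system.
  That loop is rotated, and reversed if necessary, so as to start with the same step; then neither
  of the two closed walks can be longer than the other.\<close>

lemma closed_walk_eq_loop:
 assumes "walk S x st x" "st \<noteq> []" "distinct (segs st)"
 shows "\<exists>l\<in>set Ls. set (segs st) = set (segs l)"
proof -
 obtain p a where st: "st = p # a" using assms(2) by (cases st) auto
 have "seg p \<in> S" using walk_segs[OF assms(1)] st by simp
 then consider P where "P \<in> set Ps" "seg p \<in> set (segs (steps P))" | l where "l \<in> set Ls" "seg p \<in> set (segs l)"
  using segs_strands by (force simp: set_strand_segs loop_segs_def)
 then show ?thesis
 proof cases
  case 1
  obtain u w ps1 ps2 where o: "(u, ps1 @ p # ps2, w) = P \<or> (u, ps1 @ p # ps2, w) = flip P"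
   using strand_step_split[OF 1 assms(1)[unfolded st] refl] by blast
  from oriented_walk[OF 1(1) o] show ?thesis
   using not_closed_in_strand[of u ps1 p ps2 w x a] assms st by blast
 next
  case 2
  obtain y where y: "walk S y l y" using loop_walk[OF 2(1)] by blast
  have dl: "distinct (segs l)" by (rule loop_distinct[OF 2(1)])
  obtain q where q: "q \<in> set l" "seg q = seg p" using 2(2) by auto
  obtain l1 l2 where l: "l = l1 @ q # l2" using split_list[OF q(1)] by blast
  obtain e s z where qe: "q = (e, s, z)" by (cases q) auto
  have w: "walk S y l1 e" "walk S z l2 y" "s \<in> S" "seg_ends s = {e, z}"
   using y unfolding l qe by (auto simp: walk_append)
  have "p = q \<or> p = turn q"
   using oriented_at[of x p a x s e z] assms(1) st w q qe by auto
  then obtain l' where l': "walk S x (p # l') x" "distinct (segs (p # l'))" "set (segs (p # l')) = set (segs l)"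
  proof
   assume "p = q"
   then have "x = e" using assms(1) st qe by auto
   have "walk S x (p # (l2 @ l1)) x" using w \<open>p = q\<close> \<open>x = e\<close> qe by (auto simp: walk_append)
   moreover have "distinct (segs (p # (l2 @ l1)))" "set (segs (p # (l2 @ l1))) = set (segs l)"
    using dl unfolding l \<open>p = q\<close> by auto
   ultimately show ?thesis using that by blast
  next
   assume "p = turn q"
   then have "x = z" using assms(1) st qe by auto
   have "walk S z (l2 @ l1 @ [q]) z" using w qe by (auto simp: walk_append)
   then have "walk S z (rev_steps (l2 @ l1 @ [q])) z" by (rule walk_back)
   then have "walk S x (p # rev_steps (l2 @ l1)) x" using \<open>x = z\<close> \<open>p = turn q\<close> by simp
   moreover have "distinct (segs (p # rev_steps (l2 @ l1)))" "set (segs (p # rev_steps (l2 @ l1))) = set (segs l)"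
    using dl unfolding l \<open>p = turn q\<close> by auto
   ultimately show ?thesis using that by blast
  qed
  have "\<exists>c. l' = a @ c \<or> a = l' @ c"
   using walk_deterministic[OF regular, of x p a x p l' x] assms st l' by auto
  then obtain c where "l' = a @ c \<or> a = l' @ c" by blast
  then have "l' = a"
  proof
   assume c: "l' = a @ c"
   have "c = []" by (rule closed_prefix[of x p a]) (use assms(1) st l' c in auto)
   then show ?thesis using c by simp
  next
   assume c: "a = l' @ c"
   have "c = []" by (rule closed_prefix[of x p l']) (use assms st l' c in auto)
   then show ?thesis using c by simp
  qed
  then show ?thesis using l'(3) st 2(1) by auto
 qed
qed

lemma closed_loops_eq: "closed_loops S = (\<lambda>l. set (segs l)) ` set Ls"
proof (intro set_eqI iffI)
 fix X assume "X \<in> closed_loops S"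
 then obtain ss x where "X = set ss" "ss \<noteq> []" "trail S x ss x" unfolding closed_loops_def by blast
 from trail_walk[OF this(3)] obtain st where "walk S x st x" "segs st = ss" "distinct (segs st)"
  by (elim exE conjE)
 then show "X \<in> (\<lambda>l. set (segs l)) ` set Ls"
  using closed_walk_eq_loop[of x st] \<open>X = set ss\<close> \<open>ss \<noteq> []\<close> by auto
next
 fix X assume "X \<in> (\<lambda>l. set (segs l)) ` set Ls"
 then obtain l where l: "l \<in> set Ls" "X = set (segs l)" by blast
 have "l \<noteq> []" using loop_closed l(1) by blast
 moreover obtain x where "walk S x l x" using loop_walk[OF l(1)] by blast
 ultimately have "segs l \<noteq> []" "trail S x (segs l) x"
  using walk_trail loop_distinct[OF l(1)] by auto
 then show "X \<in> closed_loops S" unfolding closed_loops_def using l(2) by blast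
qed

text \<open>The loops of the list have disjoint nonempty sets of segments, so none is lost in
  passing to the set of these sets.\<close>

lemma card_closed_loops: "card (closed_loops S) = length Ls"
proof -
 have "distinct (map (\<lambda>l. set (segs l)) Ls)" if "distinct (loop_segs Ls)" "\<forall>l\<in>set Ls. l \<noteq> []"
  using that
 proof (induction Ls)
  case (Cons l Ls)
  have "set (segs l) \<noteq> set (segs l')" if "l' \<in> set Ls" for l'
  proof -
   have "set (segs l') \<subseteq> set (loop_segs Ls)" using that by (auto simp: loop_segs_def)
   moreover have "set (segs l) \<inter> set (loop_segs Ls) = {}" using Cons.prems by auto
   moreover have "set (segs l) \<noteq> {}" using Cons.prems by simp
   ultimately show ?thesis by (metis Int_absorb2)
  qed
  then show ?case using Cons by auto
 qed simp
 then have "distinct (map (\<lambda>l. set (segs l)) Ls)" using distinct_segs_strands loop_closed by simp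
 then show ?thesis unfolding closed_loops_eq using distinct_card by fastforce
qed

lemma union_closed_loops: "\<Union> (closed_loops S) = set (loop_segs Ls)"
 unfolding closed_loops_eq by (auto simp: loop_segs_def)

lemma loop_strand_disjoint: "set (str_segs Ps) \<inter> set (loop_segs Ls) = {}"
 and segs_cover: "S = set (str_segs Ps) \<union> set (loop_segs Ls)"
 and str_segs_distinct: "distinct (str_segs Ps)"
 using distinct_segs_strands segs_strands by auto

lemma trail_in_strand:
 assumes "trail S y (s # ss) z" "s \<in> set (str_segs Ps)"
 obtains P u ps1 st ps2 w where "P \<in> set Ps"
  "(u, ps1 @ st @ ps2, w) = P \<or> (u, ps1 @ st @ ps2, w) = flip P"
  "walk S y st z" "segs st = s # ss"
proof -
 from trail_walk[OF assms(1)] obtain st where st: "walk S y st z" "segs st = s # ss" "distinct (segs st)"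
  by (elim exE conjE)
 obtain p a where pa: "st = p # a" "seg p = s" using st(2) by auto
 obtain P where P: "P \<in> set Ps" "s \<in> set (segs (steps P))" using assms(2) by (auto simp: set_strand_segs)
 obtain u w ps1 ps2 where o: "(u, ps1 @ p # ps2, w) = P \<or> (u, ps1 @ p # ps2, w) = flip P"
  using strand_step_split[OF P st(1)[unfolded pa(1)] pa(2)] by blast
 note w = oriented_walk[OF P(1) o]
 obtain x where x: "walk S x (p # ps2) (outer_node w)" using w(1) unfolding walk_append by blast
 have "x = y" using x st(1) pa by (cases p) auto
 then have "\<exists>c. ps2 = a @ c"
  using walk_maximal[OF regular, of y p ps2 w p a z] x st pa w(2) by auto
 then obtain c where "ps2 = a @ c" by blast
 then show ?thesis using that[of P u ps1 st c w] P(1) o st pa by auto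
qed

lemma composite_marking_Bead:
 assumes "(u, ps, w) \<in> set Ps" "s \<in> set (segs ps)"
 shows "composite_marking S (Bead s) M \<longleftrightarrow> M = Bead {u, w}"
proof
 assume "composite_marking S (Bead s) M"
 then obtain x y ss where M: "M = Bead {x, y}" "x \<noteq> y" "trail S (outer_node x) ss (outer_node y)" "s \<in> set ss"
  by (auto elim: composite_marking.cases)
 from trail_walk[OF M(3)] obtain st
  where st: "walk S (outer_node x) st (outer_node y)" "distinct (segs st)" "segs st = ss"
  by (elim exE conjE)
 from walk_eq_strand[OF st(1,2) M(2)] obtain P where P: "P \<in> set Ps" "(x, st, y) = P \<or> (x, st, y) = flip P" .
 have "s \<in> set (segs (steps P))" unfolding oriented_segs[OF P(2)] st(3) using M(4) .
 then have "P = (u, ps, w)" using strand_unique_seg[OF str_segs_distinct P(1) assms(1)] assms(2) by simp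
 then show "M = Bead {u, w}" using P(2) M(1) by auto
next
 assume "M = Bead {u, w}"
 then show "composite_marking S (Bead s) M"
  using composite_marking.intros(1)[OF ends_distinct[OF assms(1)]
    walk_trail[OF strand_walk[OF assms(1)] distinct_steps[OF assms(1)]] assms(2)] by simp
qed

text \<open>Along the strand the target of the arrow is the far or the near end of its segment,
  which decides towards which endpoint of the composite edge it points. The trails in
  \<open>composite_marking\<close> are first identified with the strand and an initial part of it,
  in one of the two directions.\<close>

lemma composite_marking_Arrow:
 assumes P: "(u, ps1 @ (e, s, z) # ps2, w) \<in> set Ps" and M: "composite_marking S (Arrow s t) M"
 shows "(t = z \<and> M = Arrow {u, w} w) \<or> (t = e \<and> M = Arrow {u, w} u)"
proof -
 from M obtain x y ss ss' where M: "M = Arrow {x, y} y" "x \<noteq> y"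
  "trail S (outer_node x) (ss @ [s] @ ss') (outer_node y)" "trail S (outer_node x) (ss @ [s]) t"
  by (auto elim: composite_marking.cases)
 from trail_walk[OF M(3)] obtain st
  where st: "walk S (outer_node x) st (outer_node y)" "distinct (segs st)" "segs st = ss @ [s] @ ss'"
  by (elim exE conjE)
 from trail_walk[OF M(4)] obtain st'
  where st': "walk S (outer_node x) st' t" "distinct (segs st')" "segs st' = ss @ [s]"
  by (elim exE conjE)
 obtain p a where pa: "st = p # a" using st(3) by (cases st) auto
 obtain q b where qb: "st' = q # b" using st'(3) by (cases st') auto
 have "seg p = seg q" using st(3) st'(3) pa qb by (cases ss) auto
 then have "p = q \<and> (\<exists>c. a = b @ c)"
  using walk_maximal[OF regular, of "outer_node x" p a y q b t] st st' pa qb by auto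
 then obtain c where c: "st = st' @ c" using pa qb by auto
 obtain st1 l where l: "st' = st1 @ [l]" "seg l = s" using st'(3)
  by (metis append_butlast_last_id last_map map_is_Nil_conv last_snoc snoc_eq_iff_butlast)
 have lt: "dst l = t" using walk_last[OF st'(1)] l by simp
 from walk_eq_strand[OF st(1,2) M(2)] obtain Q where Q: "Q \<in> set Ps" "(x, st, y) = Q \<or> (x, st, y) = flip Q" .
 have "s \<in> set (segs (steps Q))" unfolding oriented_segs[OF Q(2)] st(3) by simp
 then have Qe: "Q = (u, ps1 @ (e, s, z) # ps2, w)"
  using strand_unique_seg[OF str_segs_distinct Q(1) P] by simp
 have d: "distinct (segs (ps1 @ (e, s, z) # ps2))" by (rule distinct_steps[OF P])
 have uniq: "l = l'" if "l' \<in> set st" "seg l' = s" for l'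
 proof -
  have "l \<in> set st" using c l by simp
  moreover have "inj_on seg (set st)" using st(2) by (simp add: distinct_map)
  ultimately show ?thesis using that l(2) by (auto dest: inj_onD)
 qed
 show ?thesis
 proof (cases "(x, st, y) = Q")
  case True
  then have "l = (e, s, z)" using uniq[of "(e, s, z)"] Qe by auto
  then show ?thesis using lt True Qe M(1) by auto
 next
  case False
  then have "(x, st, y) = flip Q" using Q(2) by blast
  then have "l = (z, s, e)" using uniq[of "(z, s, e)"] Qe by auto
  then show ?thesis using lt \<open>(x, st, y) = flip Q\<close> Qe M(1) by (auto simp: insert_commute)
 qed
qed

lemma composite_marking_ArrowI:
 assumes P: "(u, ps1 @ (e, s, z) # ps2, w) \<in> set Ps"
 shows "composite_marking S (Arrow s z) (Arrow {u, w} w)" "composite_marking S (Arrow s e) (Arrow {u, w} u)"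
proof -
 have *: "composite_marking S (Arrow s z) (Arrow {u, w} w)"
  if "walk S (outer_node u) (ps1 @ (e, s, z) # ps2) (outer_node w)" "distinct (segs (ps1 @ (e, s, z) # ps2))"
   "u \<noteq> w" for u w ps1 ps2 e s z
 proof (rule composite_marking.intros(2)[of u w S "segs ps1" s "segs ps2"])
  show "u \<noteq> w" by fact
  show "trail S (outer_node u) (segs ps1 @ [s] @ segs ps2) (outer_node w)"
   using walk_trail[OF that(1,2)] by simp
  show "trail S (outer_node u) (segs ps1 @ [s]) z"
   using walk_trail[of S "outer_node u" "ps1 @ [(e, s, z)]" z] that(1,2) by (auto simp: walk_append)
 qed
 note w = strand_walk[OF P] distinct_steps[OF P] ends_distinct[OF P]
 show "composite_marking S (Arrow s z) (Arrow {u, w} w)" by (rule *[OF w])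
 have "composite_marking S (Arrow s e) (Arrow {w, u} u)"
  by (rule *[of w "rev_steps ps2" z s e "rev_steps ps1" u]) (use w walk_back[OF w(1)] in auto)
 then show "composite_marking S (Arrow s e) (Arrow {u, w} u)" by (simp add: insert_commute)
qed

end

section \<open>Directed strands with markings, and their signs and weights\<close>

section \<open>State sums\<close>

text \<open>A marking is represented by the segment that carries it, since no segment carries two
  markings. Kind and direction of a marking do not enter the order of letters.\<close>

datatype ('p, 's) letter = Pt 'p | Mk 's

abbreviation carriers :: "('s, 'x) marking list \<Rightarrow> 's set" where
 "carriers L \<equiv> carrier_edge ` set L"

definition letters :: "('s, 'x) marking list \<Rightarrow> ('p, 's, 'x) strand \<Rightarrow> ('p, 's) letter list" where
 "letters L P = Pt (fst P) #
  map (\<lambda>q. Mk (seg q)) (filter (\<lambda>q. seg q \<in> carriers L) (steps P)) @ [Pt (dst P)]"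

lemma letters_simps [simp]:
 "letters L (x, st, y) = Pt x # map (\<lambda>q. Mk (seg q)) (filter (\<lambda>q. seg q \<in> carriers L) st) @ [Pt y]"
 by (simp add: letters_def)

definition sequence :: "('s, 'x) marking list \<Rightarrow> ('p, 's, 'x) strand list \<Rightarrow> ('p, 's) letter list" where
 "sequence L Ps = concat (map (letters L) Ps)"

lemma sequence_simps [simp]:
 "sequence L [] = []" "sequence L (P # Ps) = letters L P @ sequence L Ps"
 "sequence L (Ps @ Qs) = sequence L Ps @ sequence L Qs"
 by (simp_all add: sequence_def)

lemma letters_flip [simp]: "letters L (flip P) = rev (letters L P)"
 by (cases P) (simp add: rev_steps_def rev_map filter_map comp_def flip: rev_filter)

lemma set_sequence:
 "set (sequence L Ps) = Pt ` set (ends Ps) \<union> Mk ` (set (str_segs Ps) \<inter> carriers L)"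
proof (induction Ps)
 case (Cons P Ps)
 have *: "(\<lambda>q. Mk (seg q)) ` {q \<in> X. seg q \<in> C} = Mk ` (seg ` X \<inter> C)"
  for X :: "('c \<times> 'b \<times> 'c) set" and C
  unfolding image_image[of Mk seg, symmetric] by (rule arg_cong[where f = "(`) Mk"]) blast
 obtain x st y where P: "P = (x, st, y)" by (cases P) auto
 show ?case unfolding sequence_simps set_append Cons.IH P letters_simps
  by (simp add: * Int_Un_distrib2 image_Un) blast
qed simp

lemma distinct_sequence:
 "distinct (ends Ps) \<Longrightarrow> distinct (str_segs Ps) \<Longrightarrow> distinct (sequence L Ps)"
proof (induction Ps)
 case (Cons P Ps)
 obtain x st y where P: "P = (x, st, y)" by (cases P) auto
 have "distinct (segs (filter (\<lambda>q. seg q \<in> carriers L) st))"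
  using Cons.prems(2) P by (simp add: distinct_map_filter)
 then have "distinct (map (\<lambda>q. Mk (seg q)) (filter (\<lambda>q. seg q \<in> carriers L) st))"
  by (simp add: distinct_map inj_on_def)
 then show ?case using Cons P by (auto simp: set_sequence)
qed simp

definition beads :: "('s, 'x) marking list \<Rightarrow> ('x \<times> 's \<times> 'x) list \<Rightarrow> nat" where
 "beads L st = length (filter (\<lambda>q. Bead (seg q) \<in> set L) st)"

definition arrows :: "('s, 'x) marking list \<Rightarrow> ('x \<times> 's \<times> 'x) list \<Rightarrow> nat" where
 "arrows L st = length (filter (\<lambda>q. \<exists>t. Arrow (seg q) t \<in> set L) st)"

lemma beads_simps [simp]:
 "beads L [] = 0" "beads L (q # st) = (if Bead (seg q) \<in> set L then 1 else 0) + beads L st"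
 "beads L (st @ st') = beads L st + beads L st'" "beads L (rev_steps st) = beads L st"
 by (auto simp: beads_def rev_steps_def filter_map comp_def simp flip: rev_filter)

lemma arrows_simps [simp]:
 "arrows L [] = 0" "arrows L (q # st) = (if \<exists>t. Arrow (seg q) t \<in> set L then 1 else 0) + arrows L st"
 "arrows L (st @ st') = arrows L st + arrows L st'" "arrows L (rev_steps st) = arrows L st"
 by (auto simp: arrows_def rev_steps_def filter_map comp_def simp flip: rev_filter)

lemma carriers_cases:
 assumes "distinct (map carrier_edge L)"
 shows "s \<in> carriers L \<longleftrightarrow> Bead s \<in> set L \<or> (\<exists>t. Arrow s t \<in> set L)"
  "\<not> (Bead s \<in> set L \<and> Arrow s t \<in> set L)"
  "Arrow s t \<in> set L \<Longrightarrow> Arrow s t' \<in> set L \<Longrightarrow> t = t'"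
proof -
 have inj: "inj_on carrier_edge (set L)" using assms by (simp add: distinct_map)
 show "s \<in> carriers L \<longleftrightarrow> Bead s \<in> set L \<or> (\<exists>t. Arrow s t \<in> set L)"
 proof
  assume "s \<in> carriers L"
  then obtain m where m: "m \<in> set L" "carrier_edge m = s" by blast
  show "Bead s \<in> set L \<or> (\<exists>t. Arrow s t \<in> set L)"
  proof (cases m)
   case (Bead s')
   then show ?thesis using m by simp
  next
   case (Arrow s' t)
   then show ?thesis using m by auto
  qed
 qed force
 show "\<not> (Bead s \<in> set L \<and> Arrow s t \<in> set L)"
  using inj_onD[OF inj, of "Bead s" "Arrow s t"] by auto
 show "Arrow s t \<in> set L \<Longrightarrow> Arrow s t' \<in> set L \<Longrightarrow> t = t'"
  using inj_onD[OF inj, of "Arrow s t" "Arrow s t'"] by auto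
qed

lemma length_marked:
 assumes "distinct (map carrier_edge L)"
 shows "length (filter (\<lambda>q. seg q \<in> carriers L) st) = beads L st + arrows L st"
 using carriers_cases[OF assms] by (induction st) auto

text \<open>The number of beads minus the number of arrows along a strand is determined by the kinds of its
 endpoints, since the segments with a bead are those turning upwards and the segments with an arrow are
 those turning downwards.\<close>

definition balanced :: "('p \<Rightarrow> bool) \<Rightarrow> ('s, 'x) marking list \<Rightarrow> ('p, 's, 'x) strand \<Rightarrow> bool" where
 "balanced tp L P \<longleftrightarrow> beads L (steps P) + 1 =
  arrows L (steps P) + (if tp (fst P) then 1 else 0) + (if tp (dst P) then 1 else 0)"

definition proper :: "('s, 'x) marking list \<Rightarrow> ('p, 's, 'x) strand \<Rightarrow> bool" where
 "proper L P \<longleftrightarrow> (\<forall>q\<in>set (steps P). fst q \<noteq> dst q \<and>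
  (\<forall>t. Arrow (seg q) t \<in> set L \<longrightarrow> t = fst q \<or> t = dst q))"

definition valid ::
 "('p \<Rightarrow> bool) \<Rightarrow> ('p, 's) letter list \<Rightarrow> ('s, 'x) marking list \<Rightarrow> ('p, 's, 'x) strand list \<Rightarrow> bool" where
 "valid tp W L Ps \<longleftrightarrow> distinct (map carrier_edge L) \<and> distinct (sequence L Ps) \<and>
  set (sequence L Ps) \<subseteq> set W \<and> (\<forall>P\<in>set Ps. balanced tp L P \<and> proper L P)"

text \<open>Changes of the order and the directions of strands. Reversal is stated for the first
  strand only, as every strand can be brought to the front.\<close>

inductive reordering :: "('p, 's, 'x) strand list \<Rightarrow> ('p, 's, 'x) strand list \<Rightarrow> bool" where
 refl: "reordering Ps Ps"
| front: "reordering (Ps @ P # Qs) (P # Ps @ Qs)"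
| flip: "reordering (P # Ps) (flip P # Ps)"
| trans: "reordering Ps Qs \<Longrightarrow> reordering Qs Rs \<Longrightarrow> reordering Ps Rs"

lemma reordering_Cons: "reordering Ps Qs \<Longrightarrow> reordering (R # Ps) (R # Qs)"
proof (induction rule: reordering.induct)
 case (front Ps P Qs)
 have "reordering ((R # Ps) @ P # Qs) (P # (R # Ps) @ Qs)" by (rule reordering.front)
 moreover have "reordering ([P] @ R # (Ps @ Qs)) (R # [P] @ (Ps @ Qs))" by (rule reordering.front)
 ultimately show ?case
  using reordering.trans[of "R # Ps @ P # Qs" "P # R # Ps @ Qs" "R # P # Ps @ Qs"] by simp
next
 case (flip P Ps)
 have "reordering ([R] @ P # Ps) (P # [R] @ Ps)" by (rule reordering.front)
 moreover have "reordering (P # [R] @ Ps) (flip P # [R] @ Ps)" by (rule reordering.flip)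
 moreover have "reordering ([flip P] @ R # Ps) (R # [flip P] @ Ps)" by (rule reordering.front)
 ultimately show ?case
  using reordering.trans[of "R # P # Ps" "P # R # Ps" "flip P # R # Ps"]
   reordering.trans[of "R # P # Ps" "flip P # R # Ps" "R # flip P # Ps"] by simp
qed (auto intro: reordering.intros)

definition triangular :: "nat \<Rightarrow> bit" where
 "triangular k = (\<Sum>i<k. of_nat i)"

text \<open>\<open>triangular k\<close> is the binomial coefficient k over 2 modulo 2; both a(2a -
  1) and a(2a + 1) have the parity of a.\<close>

lemma triangular_double: "triangular (2 * a) = of_nat a" "triangular (Suc (2 * a)) = of_nat a"
proof -
 have *: "triangular (2 * a) = of_nat a \<and> triangular (Suc (2 * a)) = of_nat a" for a
 proof (induction a)
  case 0
  then show ?case by (simp add: triangular_def)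
 next
  case (Suc a)
  have "triangular (Suc (Suc (2 * a))) = triangular (Suc (2 * a)) + of_nat (Suc (2 * a))"
   by (simp add: triangular_def)
  moreover have "triangular (Suc (Suc (Suc (2 * a)))) = triangular (Suc (Suc (2 * a))) + of_nat (Suc (Suc (2 * a)))"
   by (simp add: triangular_def)
  ultimately show ?case using Suc by (simp add: ac_simps)
 qed
 show "triangular (2 * a) = of_nat a" "triangular (Suc (2 * a)) = of_nat a" using * by auto
qed

text \<open>The Gram matrix of the form with respect to dual bases: \<open>True\<close> stands for
  \<open>v\<close>, used at top vertices, and \<open>False\<close> for \<open>v'\<close>, used at
  bottom vertices, whose degrees are shifted by \<open>d\<close>. Diagrams are treated from these
  identities alone. \<open>delta_odd\<close> is an axiom here and is later derived from the
  existence of dual bases.\<close>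

locale supermatrix =
 fixes N :: nat and p :: "nat \<Rightarrow> bit" and d :: bit
  and g :: "bool \<Rightarrow> nat \<Rightarrow> bool \<Rightarrow> nat \<Rightarrow> 'k::field" and \<epsilon> \<delta> :: 'k
 assumes g_symmetric: "g s i t j =
   koszul ((p i + (if s then 0 else d)) * (p j + (if t then 0 else d))) * g t j s i"
  and g_homogeneous: "g s i t j \<noteq> 0 \<Longrightarrow> p i + p j = d + (if s then 0 else d) + (if t then 0 else d)"
  and g_contract: "(\<Sum>l<N. g s i False l * g True l t j) = g s i t j"
  and g_dual: "i < N \<Longrightarrow> j < N \<Longrightarrow> g True i False j = (if i = j then 1 else 0)"
  and eps: "\<epsilon> = koszul d"
  and delta: "\<delta> = (\<Sum>i<N. koszul (p i))"
  and delta_odd: "d = 1 \<Longrightarrow> \<delta> = 0"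
begin

abbreviation "cls \<equiv> brauer_class \<epsilon>"
abbreviation "bhom \<equiv> brauer_hom \<epsilon>"
abbreviation "rels \<equiv> relations \<epsilon>"
abbreviation "compose_dgm \<equiv> compose_diagrams \<delta> \<epsilon>"
abbreviation "compose_comb \<equiv> compose_combinations \<delta> \<epsilon>"

section \<open>States of families of strands and their independence of order and directions\<close>

lemma eps_self [simp]: "\<epsilon> * \<epsilon> = 1" "\<epsilon> * (\<epsilon> * c) = c"
 by (simp_all add: eps)

definition arrow_sign :: "('s, 'x) marking list \<Rightarrow> 'x \<times> 's \<times> 'x \<Rightarrow> 'k" where
 "arrow_sign L q = (if \<exists>t. Arrow (seg q) t \<in> set L \<and> t \<noteq> dst q then \<epsilon> else 1)"

definition arrow_signs :: "('s, 'x) marking list \<Rightarrow> ('x \<times> 's \<times> 'x) list \<Rightarrow> 'k" where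
 "arrow_signs L st = prod_list (map (arrow_sign L) st)"

lemma arrow_signs_simps [simp]:
 "arrow_signs L [] = 1" "arrow_signs L (q # st) = arrow_sign L q * arrow_signs L st"
 "arrow_signs L (st @ st') = arrow_signs L st * arrow_signs L st'"
 by (simp_all add: arrow_signs_def)

text \<open>The middle factor compensates the sign of an odd marking that is met before a top
  endpoint. It is chosen such that the state does not depend on the direction of the strand; for a
  cup with its bead it leaves exactly the value of the form.\<close>

definition weight ::
 "('p \<Rightarrow> bool) \<Rightarrow> ('s, 'x) marking list \<Rightarrow> ('p \<Rightarrow> nat) \<Rightarrow> ('p, 's, 'x) strand \<Rightarrow> 'k" where
 "weight tp L lab P = g (tp (fst P)) (lab (fst P)) (tp (dst P)) (lab (dst P))
  * koszul (if tp (dst P) then d * p (lab (dst P)) else 0) * arrow_signs L (steps P)"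

text \<open>A bottom vertex with label i has the degree of \<open>v i\<close>, not that of
  \<open>v' i\<close>: the labels of the bottom row index basis vectors of the target.\<close>

fun degree :: "('p \<Rightarrow> nat) \<Rightarrow> ('p, 's) letter \<Rightarrow> bit" where
 "degree lab (Pt x) = p (lab x)"
| "degree lab (Mk s) = d"

text \<open>One summand of the state sum, with all labels fixed.\<close>

definition state ::
 "('p \<Rightarrow> bool) \<Rightarrow> ('p, 's) letter list \<Rightarrow> ('s, 'x) marking list \<Rightarrow> ('p \<Rightarrow> nat)
  \<Rightarrow> ('p, 's, 'x) strand list \<Rightarrow> 'k" where
 "state tp W L lab Ps = koszul (invs W (degree lab) (sequence L Ps))
  * prod_list (map (weight tp L lab) Ps)"

lemma total_marks:
 "total (degree lab) (map (\<lambda>q. Mk (seg q)) st) = of_nat (length st) * d"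
 by (induction st) (auto simp: algebra_simps)

lemma pairs_marks:
 "pairs (degree lab) (map (\<lambda>q. Mk (seg q)) st) = triangular (length st) * d"
 by (induction st) (auto simp: algebra_simps triangular_def total_marks)

text \<open>Homogeneity of the form relates the degrees at the two ends, and balance gives the
  parity of the number of markings; together they make the letters even.\<close>

lemma weight_nonzero:
 assumes "balanced tp L P" "distinct (map carrier_edge L)" "weight tp L lab P \<noteq> 0"
 shows "total (degree lab) (letters L P) = 0"
proof -
 obtain x st y where P: "P = (x, st, y)" by (cases P) auto
 have "g (tp x) (lab x) (tp y) (lab y) \<noteq> 0" using assms(3) P by (simp add: weight_def)
 then have 1: "p (lab x) + p (lab y) = d + (if tp x then 0 else d) + (if tp y then 0 else d)"
  by (rule g_homogeneous)
 have 2: "of_nat (beads L st) + 1 = of_nat (arrows L st) + (if tp x then 1 else 0) + (if tp y then 1 else (0::bit))"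
  using arg_cong[OF assms(1)[unfolded balanced_def P], of "of_nat :: nat \<Rightarrow> bit"] by (simp add: add.commute split: if_splits)
 have "total (degree lab) (letters L P) = p (lab x) + p (lab y) + (of_nat (beads L st) + of_nat (arrows L st)) * d"
  unfolding P by (simp add: total_marks length_marked[OF assms(2)] algebra_simps)
 then show ?thesis using 1 2
  by (cases d; cases "of_nat (beads L st) :: bit"; cases "of_nat (arrows L st) :: bit";
    cases "p (lab x)"; cases "p (lab y)") (auto split: if_splits)
qed

lemma arrow_sign_turn:
 assumes "distinct (map carrier_edge L)" "fst q \<noteq> dst q"
  "\<And>t. Arrow (seg q) t \<in> set L \<Longrightarrow> t = fst q \<or> t = dst q"
 shows "arrow_sign L (turn q) = (if \<exists>t. Arrow (seg q) t \<in> set L then \<epsilon> else 1) * arrow_sign L q"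
 using assms(2,3) carriers_cases(3)[OF assms(1), of "seg q"]
 by (cases q) (auto simp: arrow_sign_def)

lemma arrow_signs_rev:
 assumes "distinct (map carrier_edge L)" "proper L (x, st, y)"
 shows "arrow_signs L (rev_steps st) = \<epsilon> ^ arrows L st * arrow_signs L st"
 using assms(2)
proof (induction st)
 case (Cons q st)
 have "arrow_sign L (turn q) = (if \<exists>t. Arrow (seg q) t \<in> set L then \<epsilon> else 1) * arrow_sign L q"
  by (rule arrow_sign_turn[OF assms(1)]) (use Cons.prems in \<open>auto simp: proper_def\<close>)
 moreover have "arrow_signs L (rev_steps st) = \<epsilon> ^ arrows L st * arrow_signs L st"
  using Cons by (simp add: proper_def)
 ultimately show ?case by simp
qed simp

lemma eps_power: "\<epsilon> ^ n = koszul (d * of_nat n)"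
 by (induction n) (simp_all add: eps koszul_add[symmetric] algebra_simps)

text \<open>Reversal contributes the sign of reversing the letters, the symmetry of the form, a
  factor \<open>\<epsilon>\<close> for every arrow and the exchanged corrections at top ends.
  Balance expresses the number of markings by the number of arrows, and wherever the form does not
  vanish the exponents cancel.\<close>

lemma weight_flip:
 assumes "balanced tp L P" "distinct (map carrier_edge L)" "proper L P"
 shows "koszul (pairs (degree lab) (letters L P)) * weight tp L lab (flip P) = weight tp L lab P"
proof -
 obtain x st y where P: "P = (x, st, y)" by (cases P) auto
 let ?G = "g (tp x) (lab x) (tp y) (lab y)"
 let ?e = "koszul (pairs (degree lab) (letters L P)) *
  koszul ((p (lab x) + (if tp x then 0 else d)) * (p (lab y) + (if tp y then 0 else d))) *
  koszul (if tp x then d * p (lab x) else 0) * koszul (if tp y then d * p (lab y) else 0) *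
  koszul (d * of_nat (arrows L st)) :: 'k"
 define k where "k = beads L st + arrows L st"
 have pr: "pairs (degree lab) (letters L P) =
   p (lab x) * (of_nat k * d + p (lab y)) + of_nat k * d * p (lab y) + triangular k * d"
  unfolding P letters_simps pairs.simps pairs_append total_simps total_marks
  by (simp add: pairs_marks length_marked[OF assms(2)] k_def algebra_simps)
 have e1: "?e = 1" if "?G \<noteq> 0"
 proof -
  have 1: "p (lab x) + p (lab y) = d + (if tp x then 0 else d) + (if tp y then 0 else d)"
   by (rule g_homogeneous[OF that])
  have "beads L st + 1 = arrows L st + (if tp x then 1 else 0) + (if tp y then 1 else 0)"
   using assms(1) P by (simp add: balanced_def)
  \<comment> \<open>Strands turning like a cup, like a through string and like a cap: beads exceed
    arrows by 1, 0 and -1.\<close>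
  then consider "tp x" "tp y" "k = Suc (2 * arrows L st)" | "tp x \<noteq> tp y" "k = 2 * arrows L st"
   | n where "\<not> tp x" "\<not> tp y" "arrows L st = Suc n" "k = Suc (2 * n)"
   by (cases "tp x"; cases "tp y"; cases "arrows L st") (auto simp: k_def)
  then show ?thesis
  proof cases
   case 1
   then show ?thesis using \<open>p (lab x) + p (lab y) = _\<close> unfolding pr
    by (cases d; cases "of_nat (arrows L st) :: bit"; cases "p (lab x)"; cases "p (lab y)")
     (simp_all add: triangular_double)
  next
   case 2
   then show ?thesis using \<open>p (lab x) + p (lab y) = _\<close> unfolding pr
    by (cases d; cases "of_nat (arrows L st) :: bit"; cases "p (lab x)"; cases "p (lab y)"; cases "tp x")
     (simp_all add: triangular_double)
  next
   case (3 n)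
   then show ?thesis using \<open>p (lab x) + p (lab y) = _\<close> unfolding pr
    by (cases d; cases "of_nat n :: bit"; cases "p (lab x)"; cases "p (lab y)")
     (simp_all add: triangular_double)
  qed
 qed
 have "koszul (pairs (degree lab) (letters L P)) * weight tp L lab (flip P) = ?e * weight tp L lab P"
  unfolding weight_def P flip_simps fst_conv snd_conv
  using g_symmetric[of "tp y" "lab y" "tp x" "lab x"] arrow_signs_rev[OF assms(2) assms(3)[unfolded P]]
  by (simp add: eps_power mult.commute mult.left_commute)
 also have "\<dots> = weight tp L lab P"
 proof (cases "?G = 0")
  case True
  then show ?thesis unfolding weight_def P by simp
 next
  case False
  then show ?thesis using e1 by simp
 qed
 finally show ?thesis .
qed

text \<open>Either the weight of \<open>P\<close> vanishes, and with it both states, or its letters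
  are even and pass the others without a sign.\<close>

lemma state_front:
 assumes "valid tp W L (Ps @ P # Qs)"
 shows "state tp W L lab (Ps @ P # Qs) = state tp W L lab (P # Ps @ Qs)"
proof (cases "weight tp L lab P = 0")
 case True
 then show ?thesis by (simp add: state_def)
next
 case False
 have 0: "total (degree lab) (letters L P) = 0"
  by (rule weight_nonzero[OF _ _ False]) (use assms in \<open>auto simp: valid_def\<close>)
 have "invs W (degree lab) (letters L P @ sequence L Ps) = invs W (degree lab) (sequence L Ps @ letters L P)"
  by (rule invs_move_even[OF _ _ 0]) (use assms in \<open>auto simp: valid_def\<close>)
 then have "invs W (degree lab) ((sequence L Ps @ letters L P) @ sequence L Qs)
  = invs W (degree lab) ((letters L P @ sequence L Ps) @ sequence L Qs)"
  unfolding invs_append[of W "degree lab" "_ @ _"] by (simp add: add.commute)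
 then show ?thesis by (simp add: state_def)
qed

lemma state_flip:
 assumes "valid tp W L (P # Ps)"
 shows "state tp W L lab (flip P # Ps) = state tp W L lab (P # Ps)"
proof -
 let ?l = "letters L P"
 have "invs W (degree lab) (rev ?l) = invs W (degree lab) ?l + pairs (degree lab) ?l"
  by (rule invs_rev) (use assms in \<open>auto simp: valid_def\<close>)
 then have "invs W (degree lab) (sequence L (flip P # Ps))
  = invs W (degree lab) (sequence L (P # Ps)) + pairs (degree lab) ?l"
  by (simp add: invs_append ac_simps)
 then have "state tp W L lab (flip P # Ps) = koszul (invs W (degree lab) (sequence L (P # Ps)))
  * (koszul (pairs (degree lab) ?l) * weight tp L lab (flip P)) * prod_list (map (weight tp L lab) Ps)"
  unfolding state_def by (simp only: koszul_add list.map prod_list.Cons) (simp add: mult.assoc)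
 also have "\<dots> = state tp W L lab (P # Ps)"
  by (subst weight_flip) (use assms in \<open>auto simp: valid_def state_def\<close>)
 finally show ?thesis .
qed

end

lemma balanced_flip: "balanced tp L (flip P) \<longleftrightarrow> balanced tp L P"
 by (cases P) (auto simp: balanced_def)

lemma proper_flip: "proper L (flip P) \<longleftrightarrow> proper L P"
 by (cases P) (force simp: proper_def rev_steps_def)

lemma valid_rearrangement:
 assumes "reordering Ps Qs"
 shows "valid tp W L Ps \<longleftrightarrow> valid tp W L Qs"
 using assms
proof (induction rule: reordering.induct)
 case (front Ps P Qs)
 then show ?case by (auto simp: valid_def)
next
 case (flip P Ps)
 then show ?case by (simp add: valid_def balanced_flip proper_flip)
qed auto

text \<open>As no marking separates \<open>a\<close> from \<open>b\<close>, each marking stands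
  either after \<open>a\<close> or before \<open>b\<close> and is counted exactly once. This is used
  for closing a strand, whose markings lie between its two ends.\<close>

lemma crossing_marks:
 assumes "\<And>l. l \<in> set M \<Longrightarrow> dg l = d"
  "\<And>l. l \<in> set M \<Longrightarrow> pos W l < pos W a \<longleftrightarrow> pos W l < pos W b"
  "\<And>l. l \<in> set M \<Longrightarrow> pos W l \<noteq> pos W a"
 shows "crossing W dg M [a] + dg a * before W dg b M = of_nat (length M) * d * dg a"
 using assms
proof (induction M)
 case (Cons l M)
 have l: "(pos W a < pos W l) = (\<not> pos W l < pos W b)" "dg l = d"
  using Cons.prems(2,3)[of l] Cons.prems(1) by auto
 have "crossing W dg M [a] + dg a * before W dg b M = of_nat (length M) * d * dg a"
  by (rule Cons.IH) (use Cons.prems in auto)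
 then have "crossing W dg (l # M) [a] + dg a * before W dg b (l # M)
   = d * dg a + of_nat (length M) * d * dg a"
  using l by (auto simp: distrib_left ac_simps)
 then show ?case by (simp add: algebra_simps)
qed simp

lemma distinct_middle:
 "distinct (U @ [a, b] @ T) \<Longrightarrow> l \<in> set (U @ T) \<Longrightarrow> l \<noteq> a \<and> l \<noteq> b"
 "set (U @ [a, b] @ T) \<subseteq> X \<Longrightarrow> l \<in> set (U @ T) \<Longrightarrow> l \<in> X"
 by auto

lemma (in supermatrix) state_rearrangement:
 assumes "reordering Ps Qs" "valid tp W L Ps"
 shows "state tp W L lab Qs = state tp W L lab Ps"
 using assms
proof (induction rule: reordering.induct)
 case (trans Ps Qs Rs)
 then show ?case using valid_rearrangement by metis
qed (auto simp: state_front state_flip simp del: append_Cons)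

section \<open>Contraction of two points that are glued\<close>

context supermatrix
begin

lemma weight_cong:
 assumes "lab (fst P) = lab' (fst P)" "lab (dst P) = lab' (dst P)"
 shows "weight tp L lab P = weight tp L lab' P"
 using assms by (simp add: weight_def)

lemma weights_update:
 assumes "\<And>x. x \<in> set (ends R) \<Longrightarrow> lab x = lab' x"
 shows "map (weight tp L lab) R = map (weight tp L lab') R"
proof (rule map_cong[OF HOL.refl])
 fix P assume "P \<in> set R"
 then have "fst P \<in> set (ends R)" "dst P \<in> set (ends R)" by (auto simp: set_ends)
 then show "weight tp L lab P = weight tp L lab' P" using assms by (intro weight_cong) auto
qed

text \<open>\<open>a\<close> is a bottom vertex of the upper diagram and \<open>b\<close> the top vertex of the lower diagram to which
 it is glued.\<close>

lemma state_join:
 assumes v: "valid tp W L ((x, st, a) # (b, st', y) # R)"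
  and e: "distinct (ends ((x, st, a) # (b, st', y) # R))"
  and tp: "\<not> tp a" "tp b"
  and less: "pos W (Pt a) < pos W (Pt b)"
  and adj: "\<And>l. l \<in> set (sequence L ((x, st @ st', y) # R)) \<Longrightarrow>
   pos W l < pos W (Pt a) \<longleftrightarrow> pos W l < pos W (Pt b)"
 shows "(\<Sum>i<N. state tp W L (lab(a := i, b := i)) ((x, st, a) # (b, st', y) # R)) =
  state tp W L lab ((x, st @ st', y) # R)"
proof -
 let ?lab = "\<lambda>i. lab(a := i, b := i)"
 let ?M = "\<lambda>st. map (\<lambda>q. Mk (seg q)) (filter (\<lambda>q. seg q \<in> carriers L) st)"
 let ?U = "Pt x # ?M st" and ?T = "?M st' @ Pt y # sequence L R"
 have seq: "sequence L ((x, st, a) # (b, st', y) # R) = ?U @ [Pt a, Pt b] @ ?T"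
  "sequence L ((x, st @ st', y) # R) = ?U @ ?T" by simp_all
 have d: "distinct (?U @ [Pt a, Pt b] @ ?T)" "set (?U @ [Pt a, Pt b] @ ?T) \<subseteq> set W"
  using v unfolding valid_def seq by auto
 have ne: "pos W l \<noteq> pos W (Pt a) \<and> pos W l \<noteq> pos W (Pt b)" if l: "l \<in> set (?U @ ?T)" for l
 proof -
  have "l \<in> set W" "l \<noteq> Pt a" "l \<noteq> Pt b"
   using distinct_middle(1)[OF d(1) l] distinct_middle(2)[OF d(2) l] by blast+
  then show ?thesis by (simp add: pos_eq_iff)
 qed
 have deg: "degree (?lab i) l = degree lab l" if l: "l \<in> set (?U @ ?T)" for l i
  using distinct_middle(1)[OF d(1) l] by (cases l) auto
 \<comment> \<open>Equal labels give the glued points the same degree. They are neighbours in the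
   sequence, no letter in use separates them in the word, and \<open>a\<close> precedes
   \<open>b\<close> in both; so no sign remains.\<close>
 have inv: "invs W (degree (?lab i)) (sequence L ((x, st, a) # (b, st', y) # R))
   = invs W (degree lab) (sequence L ((x, st @ st', y) # R))" for i
 proof -
  have "invs W (degree (?lab i)) (?U @ [Pt a, Pt b] @ ?T) = invs W (degree (?lab i)) (?U @ ?T)"
   by (subst invs_remove_pair) (use adj ne less in \<open>auto simp: seq(2) simp del: sequence_simps\<close>)
  also have "\<dots> = invs W (degree lab) (?U @ ?T)"
   by (rule invs_cong) (use deg in auto)
  finally show ?thesis unfolding seq .
 qed
 have ab: "x \<noteq> a" "x \<noteq> b" "y \<noteq> a" "y \<noteq> b" "a \<noteq> b" "a \<notin> set (ends R)" "b \<notin> set (ends R)"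
  using e by auto
 have R: "map (weight tp L (?lab i)) R = map (weight tp L lab) R" for i
  by (rule weights_update) (use ab in auto)
 \<comment> \<open>Only the two values of the form at the glued points depend on
   \<open>i\<close>.\<close>
 have "(\<Sum>i<N. state tp W L (?lab i) ((x, st, a) # (b, st', y) # R)) =
  koszul (invs W (degree lab) (sequence L ((x, st @ st', y) # R))) *
   (koszul (if tp y then d * p (lab y) else 0) * arrow_signs L st * arrow_signs L st' *
   prod_list (map (weight tp L lab) R) * (\<Sum>i<N. g (tp x) (lab x) False i * g True i (tp y) (lab y)))"
  unfolding state_def inv sum_distrib_left list.map R
  by (rule sum.cong[OF HOL.refl]) (use ab tp in \<open>simp add: weight_def mult_ac\<close>)
 also have "\<dots> = state tp W L lab ((x, st @ st', y) # R)"
  unfolding g_contract state_def by (simp add: weight_def mult_ac)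
 finally show ?thesis .
qed

text \<open>The strand runs from \<open>b\<close> to \<open>a\<close>, against the order of the
  word. This inversion produces the sign \<open>koszul (p i)\<close>, whose sum is the
  superdimension. All other signs form a constant factor, which is 1 for an even form; for an odd
  form both sides vanish.\<close>

lemma state_loop:
 assumes v: "valid tp W L ((b, st, a) # R)"
  and e: "distinct (ends ((b, st, a) # R))"
  and tp: "\<not> tp a" "tp b"
  and less: "pos W (Pt a) < pos W (Pt b)"
  and adj: "\<And>l. l \<in> set (sequence L R) \<union> Mk ` set (filter (\<lambda>s. s \<in> carriers L) (segs st)) \<Longrightarrow>
   pos W l < pos W (Pt a) \<longleftrightarrow> pos W l < pos W (Pt b)"
 shows "(\<Sum>i<N. state tp W L (lab(a := i, b := i)) ((b, st, a) # R)) = \<delta> * state tp W L lab R"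
proof -
 let ?lab = "\<lambda>i. lab(a := i, b := i)"
 define M where "M = map (\<lambda>q. Mk (seg q) :: ('a, 'b) letter) (filter (\<lambda>q. seg q \<in> carriers L) st)"
 let ?Q = "sequence L R"
 have seq: "sequence L ((b, st, a) # R) = (Pt b # M @ [Pt a]) @ ?Q" by (simp add: M_def)
 have dst: "distinct ((Pt b # M @ [Pt a]) @ ?Q)" "set ((Pt b # M @ [Pt a]) @ ?Q) \<subseteq> set W"
  using v unfolding valid_def seq by auto
 have adj': "pos W l < pos W (Pt a) \<longleftrightarrow> pos W l < pos W (Pt b)" if "l \<in> set ?Q \<union> set M" for l
  by (rule adj) (use that in \<open>auto simp: M_def\<close>)
 have ne: "pos W l \<noteq> pos W (Pt a) \<and> pos W l \<noteq> pos W (Pt b)" if l: "l \<in> set ?Q \<union> set M" for l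
 proof -
  have "l \<in> set W" "l \<noteq> Pt a" "l \<noteq> Pt b" using dst l by auto
  then show ?thesis by (simp add: pos_eq_iff)
 qed
 have ab: "a \<noteq> b" "a \<notin> set (ends R)" "b \<notin> set (ends R)"
  using e by auto
 \<comment> \<open>For a strand with one top and one bottom end, balance says that there are as many
   beads as arrows.\<close>
 have lenM: "length M = 2 * arrows L st" "distinct (map carrier_edge L)"
  using v tp by (auto simp: valid_def M_def length_marked balanced_def)
 have degM: "degree lab' l = d" if "l \<in> set M" for l lab'
  using that by (auto simp: M_def)
 define K where "K = invs W (degree lab) M + crossing W (degree lab) M ?Q"
 have inv: "invs W (degree (?lab i)) (sequence L ((b, st, a) # R))
   = p i + K + invs W (degree lab) ?Q" for i
 proof -
  let ?dg = "degree (?lab i)"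
  have degQ: "?dg l = degree lab l" if "l \<in> set ?Q \<union> set M" for l
   using that dst by (cases l) auto
  have c1: "before W ?dg (Pt b) ?Q = before W ?dg (Pt a) ?Q"
   unfolding before_def by (rule arg_cong[where f = sum_list], rule map_cong[OF HOL.refl])
    (use adj' in auto)
  have "?dg (Pt a :: ('a, 'b) letter) = p i" by simp
  then have c2: "crossing W ?dg M [Pt a] + p i * before W ?dg (Pt b) M = of_nat (length M) * d * p i"
   using crossing_marks[of M ?dg d W "Pt a" "Pt b"] adj' ne degM by simp
  have c2': "crossing W ?dg M [Pt a] = p i * before W ?dg (Pt b) M"
   using c2 lenM(1) by (simp add: bit_eq_add_iff[of "crossing W ?dg M [Pt a]" "p i * before W ?dg (Pt b) M" 0, simplified])
  have c3: "invs W ?dg M = invs W (degree lab) M"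
   by (rule invs_cong) (use degQ in auto)
  have c4: "invs W ?dg ?Q = invs W (degree lab) ?Q"
   by (rule invs_cong) (use degQ in auto)
  have c5: "crossing W ?dg M ?Q = crossing W (degree lab) M ?Q"
  proof -
   have "before W ?dg l ?Q = before W (degree lab) l ?Q" for l
    by (rule before_cong) (use degQ in auto)
   then show ?thesis unfolding crossing_def using degQ
    by (intro arg_cong[where f = sum_list] map_cong) auto
  qed
  have "before W ?dg (Pt b) [Pt a] = p i" using less by simp
  then show ?thesis unfolding seq invs_append K_def c3[symmetric] c4[symmetric] c5[symmetric]
   using ab c1 c2'
   by (simp add: invs_append algebra_simps)
 qed
 have R: "map (weight tp L (?lab i)) R = map (weight tp L lab) R" for i
  by (rule weights_update) (use ab in auto)
 have "(\<Sum>i<N. state tp W L (?lab i) ((b, st, a) # R)) =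
  (\<Sum>i<N. koszul (p i) * (koszul K * arrow_signs L st * state tp W L lab R))"
  unfolding state_def inv list.map R
  by (rule sum.cong[OF HOL.refl]) (use ab tp in \<open>simp add: weight_def koszul_add g_dual mult_ac\<close>)
 also have "\<dots> = \<delta> * (koszul K * arrow_signs L st * state tp W L lab R)"
  unfolding delta sum_distrib_right ..
 also have "\<dots> = \<delta> * state tp W L lab R"
 proof (cases "d = 0")
  case True
  have "\<epsilon> = 1" using True eps by simp
  then have "arrow_sign L q = 1" for q unfolding arrow_sign_def by simp
  then have "arrow_signs L st = 1" by (induction st) simp_all
  moreover have "invs W (degree lab) M' = 0" "crossing W (degree lab) M' ?Q = 0" if "set M' \<subseteq> set M" for M'
   using that degM[of _ lab] True by (induction M') auto
  ultimately show ?thesis by (simp add: K_def)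
 next
  case False
  then show ?thesis using delta_odd by simp
 qed
 finally show ?thesis .
qed

end

section \<open>Gluing two diagrams\<close>

fun is_top :: "vertex \<Rightarrow> bool" where
 "is_top (Top i) = True"
| "is_top (Bot i) = False"

definition word :: "nat \<Rightarrow> nat \<Rightarrow> ('s, 'x) marking list \<Rightarrow> (vertex, 's) letter list" where
 "word r s L = map (\<lambda>i. Pt (Top i)) [0..<r] @ map (\<lambda>m. Mk (carrier_edge m)) L
  @ map (\<lambda>i. Pt (Bot i)) (rev [0..<s])"

lemma set_word: "set (word r s L) = Pt ` vertices r s \<union> Mk ` carriers L"
 by (auto simp: word_def vertices_def)

lemma distinct_word: "distinct (map carrier_edge L) \<Longrightarrow> distinct (word r s L)"
 by (auto simp: word_def distinct_map inj_on_def)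

definition edge :: "vertex \<times> vertex \<Rightarrow> vertex set" where
 "edge q = {fst q, snd q}"

lemma edge_simps [simp]: "edge (x, y) = {x, y}"
 by (simp add: edge_def)

definition enumerates :: "(vertex \<times> vertex) list \<Rightarrow> vertex set set \<Rightarrow> bool" where
 "enumerates es E \<longleftrightarrow> distinct (map edge es) \<and> edge ` set es = E \<and>
  (\<forall>(x, y)\<in>set es. x \<noteq> y)"

text \<open>An edge as a strand with a single step: its vertices serve as nodes and the edge itself
  as the only segment.\<close>

definition estrand :: "vertex \<times> vertex \<Rightarrow> (vertex, vertex set, vertex) strand" where
 "estrand q = (fst q, [(fst q, {fst q, snd q}, snd q)], snd q)"

lemma estrand_simps [simp]: "estrand (x, y) = (x, [(x, {x, y}, y)], y)"
 by (simp add: estrand_def)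

lemma brauer_edge:
 assumes "E \<in> brauer r s" "e \<in> E"
 shows "e \<subseteq> vertices r s" "card e = 2"
 using assms by (auto simp: brauer_diagrams_def partition_on_def)

lemma brauer_disjoint:
 assumes "E \<in> brauer r s" "e \<in> E" "e' \<in> E" "x \<in> e" "x \<in> e'"
 shows "e = e'"
 using assms by (auto simp: brauer_diagrams_def partition_on_def disjoint_def)

lemma finite_vertices [simp]: "finite (vertices r s)"
 by (simp add: vertices_def)

lemma finite_brauer: "E \<in> brauer r s \<Longrightarrow> finite E"
 using finite_elements[of "vertices r s" E] by (auto simp: brauer_diagrams_def)

lemma enumerates_exists:
 assumes "E \<in> brauer r s"
 shows "\<exists>es. enumerates es E"
proof -
 have "\<exists>es. enumerates es F" if "finite F" "\<And>e. e \<in> F \<Longrightarrow> card e = 2" for F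
  using that
 proof (induction F rule: finite_induct)
  case empty
  show ?case by (rule exI[of _ "[]"]) (simp add: enumerates_def)
 next
  case (insert e F)
  then obtain es where "enumerates es F" by auto
  moreover obtain x y where "e = {x, y}" "x \<noteq> y" using insert.prems[of e] by (auto simp: card_2_iff)
  ultimately have "enumerates ((x, y) # es) (insert e F)"
   using insert.hyps by (auto simp: enumerates_def)
  then show ?case by blast
 qed
 then show ?thesis using finite_brauer[OF assms] brauer_edge(2)[OF assms] by blast
qed

lemma enumerates_ends:
 assumes "enumerates es E" "E \<in> brauer r s"
 shows "distinct (ends (map estrand es))" "set (ends (map estrand es)) = vertices r s"
proof -
 have "distinct (ends (map estrand fs)) \<and> set (ends (map estrand fs)) = \<Union> (edge ` set fs)"
  if "distinct (map edge fs)" "edge ` set fs \<subseteq> E" "\<forall>(x, y)\<in>set fs. x \<noteq> y" for fs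
  using that
 proof (induction fs)
  case (Cons q fs)
  obtain x y where q: "q = (x, y)" by (cases q) auto
  have IH: "distinct (ends (map estrand fs))" "set (ends (map estrand fs)) = \<Union> (edge ` set fs)"
   using Cons by auto
  have "z \<notin> {x, y}" if zf: "z \<in> \<Union> (edge ` set fs)" for z
  proof
   assume z: "z \<in> {x, y}"
   obtain e where e: "e \<in> edge ` set fs" "z \<in> e" using zf by blast
   have "e \<in> E" "{x, y} \<in> E" using e(1) Cons.prems(2) q by auto
   then have "e = {x, y}" using brauer_disjoint[OF assms(2)] e(2) z by blast
   then show False using e(1) Cons.prems(1) q by auto
  qed
  then show ?case using IH Cons.prems q by auto
 qed simp
 then have "distinct (ends (map estrand es)) \<and> set (ends (map estrand es)) = \<Union> E"
  using assms(1) unfolding enumerates_def by simp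
 then show "distinct (ends (map estrand es))" "set (ends (map estrand es)) = vertices r s"
  using assms(2) by (auto simp: brauer_diagrams_def partition_on_def)
qed

lemma enumerates_segs:
 assumes "enumerates es E"
 shows "distinct (str_segs (map estrand es))" "set (str_segs (map estrand es)) = E"
proof -
 have "str_segs (map estrand es) = map edge es"
  by (induction es) auto
 then show "distinct (str_segs (map estrand es))" "set (str_segs (map estrand es)) = E"
  using assms by (simp_all add: enumerates_def)
qed

lemma markedD:
 assumes "D \<in> marked r s"
 shows "fst D \<in> brauer r s" "distinct (map carrier_edge (snd D))"
  "carriers (snd D) = {e \<in> fst D. is_cup e \<or> is_cap e}"
  "Bead e \<in> set (snd D) \<Longrightarrow> is_cup e" "Arrow e x \<in> set (snd D) \<Longrightarrow> is_cap e \<and> x \<in> e"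
 using assms unfolding marked_diagrams_def by auto

lemma cup_cap_iff:
 "is_cup {x, y} \<longleftrightarrow> is_top x \<and> is_top y" "is_cap {x, y} \<longleftrightarrow> \<not> is_top x \<and> \<not> is_top y"
 by (cases x; cases y; auto simp: is_cup_def is_cap_def)+

lemma marked_edge:
 assumes D: "D \<in> marked r s" and e: "{x, y} \<in> fst D"
 shows "Bead {x, y} \<in> set (snd D) \<longleftrightarrow> is_top x \<and> is_top y"
  "(\<exists>t. Arrow {x, y} t \<in> set (snd D)) \<longleftrightarrow> \<not> is_top x \<and> \<not> is_top y"
proof -
 note * = markedD[OF D]
 have 1: "{x, y} \<in> carriers (snd D) \<longleftrightarrow> is_cup {x, y} \<or> is_cap {x, y}" using *(3) e by blast
 have 2: "{x, y} \<in> carriers (snd D) \<longleftrightarrow> Bead {x, y} \<in> set (snd D) \<or> (\<exists>t. Arrow {x, y} t \<in> set (snd D))"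
  by (rule carriers_cases[OF *(2)])
 show "Bead {x, y} \<in> set (snd D) \<longleftrightarrow> is_top x \<and> is_top y"
  "(\<exists>t. Arrow {x, y} t \<in> set (snd D)) \<longleftrightarrow> \<not> is_top x \<and> \<not> is_top y"
  using 1 2 *(4)[of "{x, y}"] *(5)[of "{x, y}"] unfolding cup_cap_iff by blast+
qed

text \<open>Beads sit exactly on the edges with two top ends and arrows exactly on those with two
  bottom ends, which is what balance requires of a single edge.\<close>

lemma estrand_balanced:
 assumes D: "D \<in> marked r s" and es: "enumerates es (fst D)" and P: "P \<in> set (map estrand es)"
 shows "balanced is_top (snd D) P" "proper (snd D) P"
proof -
 obtain x y where xy: "(x, y) \<in> set es" "P = estrand (x, y)" using P by auto
 have e: "{x, y} \<in> fst D" "x \<noteq> y"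
  using es imageI[OF xy(1), of edge] xy(1) by (auto simp: enumerates_def)
 show "balanced is_top (snd D) P"
  using marked_edge[OF D e(1)] by (auto simp: xy(2) balanced_def)
 show "proper (snd D) P"
  using markedD(5)[OF D, of "{x, y}"] e(2) by (auto simp: xy(2) proper_def)
qed

lemma edge_strands_valid:
 assumes "D \<in> marked r s" "enumerates es (fst D)"
 shows "valid is_top (word r s (snd D)) (snd D) (map estrand es)"
 unfolding valid_def
 using markedD(1,2)[OF assms(1)] distinct_sequence[OF enumerates_ends(1) enumerates_segs(1)]
  estrand_balanced[OF assms] assms(2) enumerates_ends(2)[OF assms(2)]
 by (auto simp: set_sequence set_word)

lemma enumerates_remove:
 assumes "enumerates (As @ q # Bs) E"
 shows "enumerates (As @ Bs) (E - {edge q})"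
proof -
 have d: "distinct (map edge (As @ q # Bs))" "edge ` set (As @ q # Bs) = E"
  "\<forall>(x, y)\<in>set (As @ q # Bs). x \<noteq> y"
  using assms unfolding enumerates_def by blast+
 have "edge q \<notin> edge ` set (As @ Bs)" using d(1) by auto
 moreover have "insert (edge q) (edge ` set (As @ Bs)) = E" using d(2) by auto
 ultimately have "edge ` set (As @ Bs) = E - {edge q}" by blast
 then show ?thesis unfolding enumerates_def using d(1,3) by simp
qed

text \<open>Two listings of the same edges differ by order and directions. The first edge of the
  target list is brought to the front, directed as required, and removed from both.\<close>

lemma reordering_enumerates:
 assumes "enumerates es E" "enumerates es' E"
 shows "reordering (map estrand es) (map estrand es')"
 using assms
proof (induction es' arbitrary: es E)
 case Nil
 then show ?case by (auto simp: enumerates_def intro: reordering.refl)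
next
 case (Cons q es')
 obtain x y where q: "q = (x, y)" by (cases q) auto
 have "{x, y} \<in> edge ` set es" using Cons.prems q by (auto simp: enumerates_def)
 then obtain q' where q': "q' \<in> set es" "{x, y} = edge q'" by blast
 from q'(2) have q'': "q' = (x, y) \<or> q' = (y, x)" by (cases q') (auto simp: doubleton_eq_iff)
 obtain As Bs where es: "es = As @ q' # Bs" using split_list[OF q'(1)] by blast
 have "enumerates (As @ Bs) (E - {{x, y}})" "enumerates es' (E - {{x, y}})"
  using enumerates_remove[OF Cons.prems(1)[unfolded es]]
   enumerates_remove[of "[]" q es', simplified, OF Cons.prems(2)] q'(2) q by simp_all
 then have "reordering (map estrand (As @ Bs)) (map estrand es')" by (rule Cons.IH)
 then have 1: "reordering (estrand q # map estrand (As @ Bs)) (map estrand (q # es'))"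
  by (simp add: reordering_Cons)
 have 2: "reordering (map estrand es) (estrand q' # map estrand (As @ Bs))"
  unfolding es using reordering.front by simp
 have "estrand q' = estrand q \<or> flip (estrand q') = estrand q"
  using q'' unfolding q by (auto simp: insert_commute)
 then have "reordering (estrand q' # map estrand (As @ Bs)) (estrand q # map estrand (As @ Bs))"
  by (metis reordering.flip reordering.refl)
 from reordering.trans[OF 2 reordering.trans[OF this 1]] show ?case .
qed

definition enumeration :: "vertex set set \<Rightarrow> (vertex \<times> vertex) list" where
 "enumeration E = (SOME es. enumerates es E)"

lemma enumeration: "E \<in> brauer r s \<Longrightarrow> enumerates (enumeration E) E"
 unfolding enumeration_def by (rule someI_ex) (rule enumerates_exists)

fun vertex_label :: "nat list \<Rightarrow> nat list \<Rightarrow> vertex \<Rightarrow> nat" where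
 "vertex_label is js (Top i) = is ! i"
| "vertex_label is js (Bot j) = js ! j"

text \<open>Order and directions of the enumerated edges are arbitrary; by the invariance of states
  any other enumeration gives the same entry.\<close>

definition (in supermatrix) dgm_matrix ::
 "nat \<Rightarrow> nat \<Rightarrow> diagram \<Rightarrow> nat list \<Rightarrow> nat list \<Rightarrow> 'k" where
 "dgm_matrix r s D is js = state is_top (word r s (snd D)) (snd D) (vertex_label is js)
  (map estrand (enumeration (fst D)))"

lemma (in supermatrix) dgm_matrix_eq:
 assumes "D \<in> marked r s" "enumerates es (fst D)"
 shows "dgm_matrix r s D is js = state is_top (word r s (snd D)) (snd D) (vertex_label is js)
  (map estrand es)"
 unfolding dgm_matrix_def
 by (rule state_rearrangement[OF reordering_enumerates[OF assms(2) enumeration]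
    edge_strands_valid[OF assms], OF markedD(1)[OF assms(1)]])

definition indices :: "nat \<Rightarrow> nat \<Rightarrow> nat list set" where
 "indices N k = {l. length l = k \<and> set l \<subseteq> {..<N}}"

lemma finite_indices [simp]: "finite (indices N k)"
 unfolding indices_def using finite_lists_length_eq[of "{..<N}" k] by (simp add: conj_commute)

lemma indices_0 [simp]: "indices N 0 = {[]}"
 by (auto simp: indices_def)

text \<open>Middle positions are glued in increasing order, so the newest label is the last entry of
  the list.\<close>

lemma sum_indices_snoc:
 "(\<Sum>l\<in>indices N (Suc k). f l) = (\<Sum>i<N. \<Sum>l\<in>indices N k. f (l @ [i]))"
proof -
 have "indices N (Suc k) = (\<lambda>(i, l). l @ [i]) ` ({..<N} \<times> indices N k)"
 proof (intro set_eqI iffI)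
  fix l assume l: "l \<in> indices N (Suc k)"
  then have "l = butlast l @ [last l]" "l \<noteq> []" by (auto simp: indices_def intro: append_butlast_last_id[symmetric])
  moreover have "last l \<in> {..<N}" "butlast l \<in> indices N k"
   using l last_in_set[OF \<open>l \<noteq> []\<close>] by (auto simp: indices_def dest: in_set_butlastD subsetD)
  ultimately show "l \<in> (\<lambda>(i, l). l @ [i]) ` ({..<N} \<times> indices N k)"
   by (intro image_eqI[of _ _ "(last l, butlast l)"]) simp_all
 qed (auto simp: indices_def)
 moreover have "inj_on (\<lambda>(i, l). l @ [i]) ({..<N} \<times> indices N k)" by (auto simp: inj_on_def)
 ultimately show ?thesis
  by (simp add: sum.reindex sum.cartesian_product comp_def split_def)
qed

lemma reordering_end:
 assumes "a \<in> set (ends Ps)"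
 shows "\<exists>x st R. reordering Ps ((x, st, a) # R)" "\<exists>st y R. reordering Ps ((a, st, y) # R)"
proof -
 obtain P where P: "P \<in> set Ps" "a = fst P \<or> a = dst P" using assms by (auto simp: set_ends)
 obtain As Bs where "Ps = As @ P # Bs" using split_list[OF P(1)] by blast
 then have 1: "reordering Ps (P # As @ Bs)" using reordering.front by simp
 have 2: "reordering Ps (flip P # As @ Bs)" by (rule reordering.trans[OF 1 reordering.flip])
 obtain x st y where P': "P = (x, st, y)" by (cases P) auto
 show "\<exists>x st R. reordering Ps ((x, st, a) # R)" "\<exists>st y R. reordering Ps ((a, st, y) # R)"
  using P(2) 1 2 unfolding P' by auto
qed

section \<open>Gluing the middle row position by position\<close>

fun point_node :: "vertex + vertex \<Rightarrow> node" where
 "point_node (Inl v) = node1 v"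
| "point_node (Inr v) = node2 v"

definition point_top :: "vertex + vertex \<Rightarrow> bool" where
 "point_top = case_sum is_top is_top"

lemma point_top_simps [simp]: "point_top (Inl v) = is_top v" "point_top (Inr v) = is_top v"
 by (simp_all add: point_top_def)

text \<open>Each middle position has two points, a bottom vertex of the upper and a top vertex of
  the lower diagram. At positions below \<open>k\<close> they have been glued and are no longer ends
  of strands.\<close>

definition open_points :: "nat \<Rightarrow> nat \<Rightarrow> nat \<Rightarrow> nat \<Rightarrow> (vertex + vertex) set" where
 "open_points r s t k = {Inl (Top i) |i. i < r} \<union> {Inl (Bot j) |j. k \<le> j \<and> j < s}
  \<union> {Inr (Top j) |j. k \<le> j \<and> j < s} \<union> {Inr (Bot i) |i. i < t}"

lemma node_inject [simp]:
 "node1 u = node1 w \<longleftrightarrow> u = w" "node2 u = node2 w \<longleftrightarrow> u = w"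
 by (cases u; cases w; auto)+

lemma seg_ends_card: "card (seg_ends (Inl e)) = card e" "card (seg_ends (Inr e)) = card e"
 by (auto intro!: card_image simp: inj_on_def)

lemma regular_stack:
 assumes "fst D1 \<in> brauer r s" "fst D2 \<in> brauer s t"
 shows "regular (stack_segments D1 D2)"
proof -
 let ?S = "stack_segments D1 D2"
 have l: "x = y" if "Inl x \<in> ?S" "Inl y \<in> ?S" and z: "z \<in> seg_ends (Inl x)" "z \<in> seg_ends (Inl y)" for x y z
 proof -
  obtain u w where "u \<in> x" "z = node1 u" "w \<in> y" "z = node1 w" using z by auto
  then show ?thesis using brauer_disjoint[OF assms(1), of x y u] that(1,2) by (auto simp: stack_segments_def)
 qed
 have r: "x = y" if "Inr x \<in> ?S" "Inr y \<in> ?S" and z: "z \<in> seg_ends (Inr x)" "z \<in> seg_ends (Inr y)" for x y z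
 proof -
  obtain u w where "u \<in> x" "z = node2 u" "w \<in> y" "z = node2 w" using z by auto
  then show ?thesis using brauer_disjoint[OF assms(2), of x y u] that(1,2) by (auto simp: stack_segments_def)
 qed
 have n: False if v: "outer_node v \<in> seg_ends (Inl x)" "outer_node v \<in> seg_ends (Inr y)" for v x y
 proof -
  obtain u w where "outer_node v = node1 u" "outer_node v = node2 w" using v by auto
  then show False by (cases v; cases u; cases w) auto
 qed
 show ?thesis unfolding regular_def
 proof (intro conjI ballI allI impI)
  fix s assume "s \<in> ?S"
  then show "card (seg_ends s) = 2"
   using brauer_edge(2)[OF assms(1)] brauer_edge(2)[OF assms(2)] seg_ends_card
   by (auto simp: stack_segments_def simp del: seg_ends.simps)
 next
  fix z s1 s2 s3
  assume "s1 \<in> ?S" "s2 \<in> ?S" "s3 \<in> ?S" "z \<in> seg_ends s1" "z \<in> seg_ends s2" "z \<in> seg_ends s3"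
   "s1 \<noteq> s2" "s1 \<noteq> s3"
  then show "s2 = s3"
   by (cases s1; cases s2; cases s3; simp only: sum.inject) (use l r in metis)+
 next
  fix v s1 s2
  assume "s1 \<in> ?S" "s2 \<in> ?S" "outer_node v \<in> seg_ends s1" "outer_node v \<in> seg_ends s2"
  then show "s1 = s2"
   by (cases s1; cases s2; simp only: sum.inject) (use l r n in metis)+
 qed
qed

lemma in_stack_markings:
 "Bead (Inl e) \<in> set (stack_markings D1 D2) \<longleftrightarrow> Bead e \<in> set (snd D1)"
 "Bead (Inr e) \<in> set (stack_markings D1 D2) \<longleftrightarrow> Bead e \<in> set (snd D2)"
 "Arrow (Inl e) z \<in> set (stack_markings D1 D2) \<longleftrightarrow> (\<exists>x. z = node1 x \<and> Arrow e x \<in> set (snd D1))"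
 "Arrow (Inr e) z \<in> set (stack_markings D1 D2) \<longleftrightarrow> (\<exists>x. z = node2 x \<and> Arrow e x \<in> set (snd D2))"
proof -
 have *: "Bead (f e) \<in> map_marking f h ` X \<longleftrightarrow> Bead e \<in> X"
  "Arrow (f e) z \<in> map_marking f h ` X \<longleftrightarrow> (\<exists>x. z = h x \<and> Arrow e x \<in> X)"
  if "inj f" for f :: "vertex set \<Rightarrow> segment" and h :: "vertex \<Rightarrow> node" and X e z
 proof -
  have "Bead (f e) = map_marking f h m \<longleftrightarrow> m = Bead e" for m
   using that by (cases m) (auto dest: injD)
  then show "Bead (f e) \<in> map_marking f h ` X \<longleftrightarrow> Bead e \<in> X" by (auto simp: image_iff)
  have "Arrow (f e) z = map_marking f h m \<longleftrightarrow> (\<exists>x. z = h x \<and> m = Arrow e x)" for m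
   using that by (cases m) (auto dest: injD)
  then show "Arrow (f e) z \<in> map_marking f h ` X \<longleftrightarrow> (\<exists>x. z = h x \<and> Arrow e x \<in> X)"
   by (auto simp: image_iff)
 qed
 have ne: "Bead (Inl e) \<notin> map_marking Inr h ` X" "Bead (Inr e) \<notin> map_marking Inl h ` X"
  "Arrow (Inl e) z \<notin> map_marking Inr h ` X" "Arrow (Inr e) z \<notin> map_marking Inl h ` X"
  for e :: "vertex set" and h :: "vertex \<Rightarrow> node" and X :: "(vertex set, vertex) marking set" and z
 proof -
  have "map_marking Inr h m \<noteq> Bead (Inl e)" "map_marking Inl h m \<noteq> Bead (Inr e)"
   "map_marking Inr h m \<noteq> Arrow (Inl e) z" "map_marking Inl h m \<noteq> Arrow (Inr e) z" for m
   by (cases m; simp)+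
  then show "Bead (Inl e) \<notin> map_marking Inr h ` X" "Bead (Inr e) \<notin> map_marking Inl h ` X"
   "Arrow (Inl e) z \<notin> map_marking Inr h ` X" "Arrow (Inr e) z \<notin> map_marking Inl h ` X"
   by (metis (no_types, lifting) imageE)+
 qed
 show "Bead (Inl e) \<in> set (stack_markings D1 D2) \<longleftrightarrow> Bead e \<in> set (snd D1)"
  "Bead (Inr e) \<in> set (stack_markings D1 D2) \<longleftrightarrow> Bead e \<in> set (snd D2)"
  "Arrow (Inl e) z \<in> set (stack_markings D1 D2) \<longleftrightarrow> (\<exists>x. z = node1 x \<and> Arrow e x \<in> set (snd D1))"
  "Arrow (Inr e) z \<in> set (stack_markings D1 D2) \<longleftrightarrow> (\<exists>x. z = node2 x \<and> Arrow e x \<in> set (snd D2))"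
  unfolding stack_markings_def set_append set_map Un_iff by (simp_all only: ne *[OF inj_Inl] *[OF inj_Inr] simp_thms)
qed

lemma carrier_map_marking: "carrier_edge (map_marking f h m) = f (carrier_edge m)"
 by (cases m) auto

lemma carriers_stack:
 "map carrier_edge (stack_markings D1 D2) = map Inl (map carrier_edge (snd D1)) @ map Inr (map carrier_edge (snd D2))"
 by (simp add: stack_markings_def carrier_map_marking)

definition stack_word ::
 "nat \<Rightarrow> nat \<Rightarrow> nat \<Rightarrow> diagram \<Rightarrow> diagram \<Rightarrow> (vertex + vertex, segment) letter list" where
 "stack_word r s t D1 D2 = map (map_letter Inl Inl) (word r s (snd D1))
  @ map (map_letter Inr Inr) (word s t (snd D2))"

definition map_strand ::
 "('p \<Rightarrow> 'q) \<Rightarrow> ('s \<Rightarrow> 'u) \<Rightarrow> ('x \<Rightarrow> 'z) \<Rightarrow> ('p, 's, 'x) strand \<Rightarrow> ('q, 'u, 'z) strand" where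
 "map_strand f h n P = (f (fst P), map (\<lambda>q. (n (fst q), h (seg q), n (dst q))) (steps P), f (dst P))"

lemma map_strand_simps [simp]:
 "map_strand f h n (x, st, y) = (f x, map (\<lambda>q. (n (fst q), h (seg q), n (dst q))) st, f y)"
 by (simp add: map_strand_def)

lemma ends_map_strand: "ends (map (map_strand f h n) Ps) = map f (ends Ps)"
 by (induction Ps) (auto simp: ends_def map_strand_def)

lemma str_segs_map_strand: "str_segs (map (map_strand f h n) Ps) = map h (str_segs Ps)"
 by (induction Ps) (auto simp: str_segs_def map_strand_def)

lemma letters_map_strand:
 assumes "\<And>s. h s \<in> carriers L' \<longleftrightarrow> s \<in> carriers L"
 shows "letters L' (map_strand f h n P) = map (map_letter f h) (letters L P)"
 by (cases P) (simp add: filter_map comp_def assms)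

lemma sequence_map_strand:
 assumes "\<And>s. h s \<in> carriers L' \<longleftrightarrow> s \<in> carriers L"
 shows "sequence L' (map (map_strand f h n) Ps) = map (map_letter f h) (sequence L Ps)"
 by (induction Ps) (simp_all add: letters_map_strand[OF assms])

lemma (in supermatrix) weight_map_strand:
 assumes "\<And>x. tp' (f x) = tp x" "\<And>x. lab' (f x) = lab x"
  and "\<And>s z. (\<exists>t. Arrow (h s) t \<in> set L' \<and> t \<noteq> n z) \<longleftrightarrow> (\<exists>t. Arrow s t \<in> set L \<and> t \<noteq> z)"
 shows "weight tp' L' lab' (map_strand f h n P) = weight tp L lab P"
proof -
 have "arrow_sign L' (n a, h s, n z) = arrow_sign L (a, s, z)" for a s z
  unfolding arrow_sign_def fst_conv snd_conv assms(3) ..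
 then have "arrow_signs L' (map (\<lambda>q. (n (fst q), h (seg q), n (dst q))) st) = arrow_signs L st" for st
  by (induction st) auto
 then show ?thesis using assms(1,2) by (cases P) (simp add: weight_def)
qed

lemma (in supermatrix) degree_map_letter: "degree lab (map_letter f h l) = degree (\<lambda>x. lab (f x)) l"
 by (cases l) auto

lemma walk_step: "walk S x st y \<Longrightarrow> (a, e, z) \<in> set st \<Longrightarrow> e \<in> S \<and> seg_ends e = {a, z}"
 by (induction S x st y rule: walk.induct) auto

lemma insert2_ident:
 assumes "a \<notin> X" "b \<notin> X" "a \<notin> Y" "b \<notin> Y" "insert a (insert b X) = insert a (insert b Y)"
 shows "X = Y"
proof -
 have "X = insert a (insert b X) - {a, b}" "Y = insert a (insert b Y) - {a, b}"
  using assms(1-4) by auto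
 then show ?thesis using assms(5) by simp
qed

lemma upt_split: "k < s \<Longrightarrow> [0..<s] = [0..<k] @ [k] @ [Suc k..<s]"
 by (metis append_Cons append_Nil le0 less_imp_le_nat upt_add_eq_append upt_conv_Cons le_add_diff_inverse)

lemma open_points_0: "open_points r s t 0 = Inl ` vertices r s \<union> Inr ` vertices s t"
 by (auto simp: open_points_def vertices_def)

lemma open_points_Suc:
 assumes "k < s"
 shows "open_points r s t k = insert (Inl (Bot k)) (insert (Inr (Top k)) (open_points r s t (Suc k)))"
  "Inl (Bot j) \<in> open_points r s t k \<longleftrightarrow> k \<le> j \<and> j < s"
  "Inr (Top j) \<in> open_points r s t k \<longleftrightarrow> k \<le> j \<and> j < s"
 using assms by (auto simp: open_points_def)

fun outer_point :: "vertex \<Rightarrow> vertex + vertex" where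
 "outer_point (Top i) = Inl (Top i)"
| "outer_point (Bot i) = Inr (Bot i)"

lemma outer_point_simps [simp]:
 "point_node (outer_point v) = outer_node v" "point_top (outer_point v) = is_top v"
 "outer_point u = outer_point v \<longleftrightarrow> u = v"
 by (cases u; cases v; simp)+

lemma open_points_final: "open_points r s t s = outer_point ` vertices r t"
proof -
 have "outer_point ` vertices r t = (\<lambda>i. Inl (Top i)) ` {..<r} \<union> (\<lambda>i. Inr (Bot i)) ` {..<t}"
  unfolding vertices_def image_Un image_image by simp
 then show ?thesis by (auto simp: open_points_def)
qed

fun middle_label :: "(vertex + vertex \<Rightarrow> nat) \<Rightarrow> nat list \<Rightarrow> vertex + vertex \<Rightarrow> nat" where
 "middle_label lab l (Inl (Bot j)) = (if j < length l then l ! j else lab (Inl (Bot j)))"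
| "middle_label lab l (Inr (Top j)) = (if j < length l then l ! j else lab (Inr (Top j)))"
| "middle_label lab l x = lab x"

lemma middle_label_Nil [simp]: "middle_label lab [] = lab"
proof
 fix x show "middle_label lab [] x = lab x"
  by (cases "(lab, [] :: nat list, x)" rule: middle_label.cases) auto
qed

lemma middle_label_snoc:
 "middle_label lab (l @ [i]) =
  middle_label (lab(Inl (Bot (length l)) := i, Inr (Top (length l)) := i)) l"
proof
 fix x
 show "middle_label lab (l @ [i]) x = middle_label (lab(Inl (Bot (length l)) := i, Inr (Top (length l)) := i)) l x"
  by (cases "(lab, l, x)" rule: middle_label.cases) (auto simp: nth_append)
qed

lemma crossing_ordered:
 assumes "\<And>x y. x \<in> set Q \<Longrightarrow> y \<in> set R \<Longrightarrow> pos W x < pos W y"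
 shows "crossing W dg Q R = 0"
proof -
 have "before W dg x R = 0" if "x \<in> set Q" for x
  using assms[OF that]
 proof (induction R)
  case (Cons a R)
  have "pos W x < pos W a" using Cons.prems by simp
  then have "\<not> pos W a < pos W x" by simp
  then show ?case using Cons by simp
 qed simp
 then show ?thesis by (induction Q) auto
qed

lemma complete_systemI:
 assumes "\<And>x st y. (x, st, y) \<in> set Ps \<Longrightarrow> walk S (outer_node x) st (outer_node y)"
  "\<And>l. l \<in> set Ls \<Longrightarrow> l \<noteq> [] \<and> (\<exists>x. walk S x l x)"
  "distinct (str_segs Ps @ loop_segs Ls)" "set (str_segs Ps @ loop_segs Ls) = S"
  "distinct (ends Ps)"
  "\<And>v s. s \<in> S \<Longrightarrow> outer_node v \<in> seg_ends s \<Longrightarrow> v \<in> set (ends Ps)"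
 shows "complete_system S Ps Ls"
 unfolding complete_system_def using assms by (intro conjI ballI allI impI) auto

lemma outer_stack:
 assumes "fst D1 \<in> brauer r s" "fst D2 \<in> brauer s t"
  "e \<in> stack_segments D1 D2" "outer_node v \<in> seg_ends e"
 shows "v \<in> vertices r t"
proof -
 consider e' where "e = Inl e'" "e' \<in> fst D1" | e' where "e = Inr e'" "e' \<in> fst D2"
  using assms(3) by (auto simp: stack_segments_def)
 then show ?thesis
 proof cases
  case 1
  then obtain u where u: "u \<in> e'" "outer_node v = node1 u" using assms(4) by auto
  then have "u \<in> vertices r s" using brauer_edge(1)[OF assms(1) 1(2)] by blast
  then show ?thesis using u(2) by (cases u; cases v) (auto simp: vertices_def)
 next
  case 2
  then obtain u where u: "u \<in> e'" "outer_node v = node2 u" using assms(4) by auto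
  then have "u \<in> vertices s t" using brauer_edge(1)[OF assms(2) 2(2)] by blast
  then show ?thesis using u(2) by (cases u; cases v) (auto simp: vertices_def)
 qed
qed

locale stacking = supermatrix N p d g \<epsilon> \<delta>
 for N :: nat and p :: "nat \<Rightarrow> bit" and d :: bit
  and g :: "bool \<Rightarrow> nat \<Rightarrow> bool \<Rightarrow> nat \<Rightarrow> 'k::field" and \<epsilon> \<delta> :: 'k +
 fixes r s t :: nat and D1 D2 :: diagram
 assumes D1: "D1 \<in> marked r s" and D2: "D2 \<in> marked s t"
begin

abbreviation "SS \<equiv> stack_segments D1 D2"
abbreviation "LL \<equiv> stack_markings D1 D2"
abbreviation "WW \<equiv> stack_word r s t D1 D2"

abbreviation "strands1 \<equiv> map estrand (enumeration (fst D1))"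
abbreviation "strands2 \<equiv> map estrand (enumeration (fst D2))"

definition initial :: "(vertex + vertex, segment, node) strand list" where
 "initial = map (map_strand Inl Inl node1) strands1 @ map (map_strand Inr Inr node2) strands2"

text \<open>Invariant of the gluing after the positions below \<open>k\<close>. The nodes are those
  of the finished figure from the beginning, so partial strands are already walks in it; only the
  set of ends changes.\<close>

definition stage ::
 "nat \<Rightarrow> (vertex + vertex, segment, node) strand list \<Rightarrow> (node \<times> segment \<times> node) list list \<Rightarrow> bool" where
 "stage k Ps Ls \<longleftrightarrow>
  (\<forall>P\<in>set Ps. steps P \<noteq> [] \<and> walk SS (point_node (fst P)) (steps P) (point_node (dst P))
   \<and> balanced point_top LL P) \<and>
  (\<forall>l\<in>set Ls. l \<noteq> [] \<and> (\<exists>x. walk SS x l x)) \<and>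
  distinct (str_segs Ps @ loop_segs Ls) \<and> set (str_segs Ps @ loop_segs Ls) = SS \<and>
  distinct (ends Ps) \<and> set (ends Ps) = open_points r s t k"

lemma E1: "fst D1 \<in> brauer r s" and E2: "fst D2 \<in> brauer s t"
 using markedD(1)[OF D1] markedD(1)[OF D2] by auto

lemma reg: "regular SS"
 by (rule regular_stack[OF E1 E2])

lemma distinct_carriers: "distinct (map carrier_edge LL)"
 unfolding carriers_stack using markedD(2)[OF D1] markedD(2)[OF D2]
 by (auto simp: distinct_map inj_on_def)

lemma carriers_LL: "carriers LL = Inl ` carriers (snd D1) \<union> Inr ` carriers (snd D2)"
 using arg_cong[OF carriers_stack[of D1 D2], of set] by (simp add: image_image)

lemma set_WW: "set WW = Pt ` open_points r s t 0 \<union> Mk ` carriers LL"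
 unfolding stack_word_def carriers_LL open_points_0 set_append set_map set_word
 by (simp add: image_Un image_image Un_ac)

lemma distinct_WW: "distinct WW"
proof -
 have "inj (map_letter Inl Inl :: (vertex, vertex set) letter \<Rightarrow> (vertex + vertex, segment) letter)"
  "inj (map_letter Inr Inr :: (vertex, vertex set) letter \<Rightarrow> (vertex + vertex, segment) letter)"
  by (rule letter.inj_map; simp)+
 moreover have "map_letter Inl Inl x \<noteq> map_letter Inr Inr y" for x y :: "(vertex, vertex set) letter"
  by (cases x; cases y) auto
 moreover have "distinct (word r s (snd D1))" "distinct (word s t (snd D2))"
  using distinct_word[OF markedD(2)[OF D1]] distinct_word[OF markedD(2)[OF D2]] by auto
 ultimately show ?thesis unfolding stack_word_def
  by (auto simp: distinct_map intro: inj_on_subset)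
qed

lemma arrow_target:
 assumes "e \<in> SS" "Arrow e z \<in> set LL"
 shows "z \<in> seg_ends e"
 using assms(2) markedD(5)[OF D1] markedD(5)[OF D2]
 by (cases e) (auto simp: in_stack_markings)

lemma walk_proper: "walk SS x st y \<Longrightarrow> proper LL (a, st, b)"
 unfolding proper_def using walk_step[of SS x st y] arrow_target regular_ends[OF reg] by fastforce

lemma open_points_antimono: "open_points r s t k \<subseteq> open_points r s t 0"
 by (auto simp: open_points_def)

lemma stage_valid:
 assumes "stage k Ps Ls"
 shows "valid point_top WW LL Ps"
proof -
 have "proper LL P" if "P \<in> set Ps" for P
  using assms that walk_proper unfolding stage_def by (metis prod.collapse)
 moreover have "set (sequence LL Ps) \<subseteq> set WW"
  unfolding set_sequence set_WW using assms open_points_antimono[of k] unfolding stage_def by blast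
 moreover have "distinct (sequence LL Ps)"
  by (rule distinct_sequence) (use assms in \<open>auto simp: stage_def\<close>)
 ultimately show ?thesis
  using assms distinct_carriers unfolding valid_def stage_def by blast
qed

lemma stage_rearrangement:
 assumes "reordering Ps Qs" "stage k Ps Ls"
 shows "stage k Qs Ls"
 using assms
proof (induction rule: reordering.induct)
 case (front Ps P Qs)
 then show ?case by (cases P) (auto simp: stage_def)
next
 case (flip P Ps)
 obtain x st y where "P = (x, st, y)" by (cases P) auto
 then show ?case using flip walk_back[of SS "point_node x" st "point_node y"]
  by (auto simp: stage_def balanced_flip[of point_top LL "(x, st, y)", simplified])
qed auto

lemma stage_initial: "stage 0 initial []"
proof -
 note en = enumeration[OF E1] enumeration[OF E2]
 have e: "ends initial = map Inl (ends strands1) @ map Inr (ends strands2)"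
  by (simp only: initial_def ends_simps ends_map_strand)
 have sg: "str_segs initial = map Inl (str_segs strands1) @ map Inr (str_segs strands2)"
  by (simp only: initial_def str_segs_simps str_segs_map_strand)
 have 1: "distinct (ends initial)" "set (ends initial) = open_points r s t 0"
  unfolding e open_points_0 using enumerates_ends[OF en(1) E1] enumerates_ends[OF en(2) E2]
  by (auto simp: distinct_map)
 have 2: "distinct (str_segs initial)" "set (str_segs initial) = SS"
  unfolding sg stack_segments_def using enumerates_segs[OF en(1)] enumerates_segs[OF en(2)]
  by (auto simp: distinct_map)
 have 3: "steps P \<noteq> [] \<and> walk SS (point_node (fst P)) (steps P) (point_node (dst P))
   \<and> balanced point_top LL P" if P: "P \<in> set initial" for P
 proof -
  have "P \<in> (\<lambda>q. map_strand Inl Inl node1 (estrand q)) ` set (enumeration (fst D1)) \<union>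
   (\<lambda>q. map_strand Inr Inr node2 (estrand q)) ` set (enumeration (fst D2))"
   using P unfolding initial_def set_append set_map image_image .
  then
  consider q where "q \<in> set (enumeration (fst D1))" "P = map_strand Inl Inl node1 (estrand q)"
   | q where "q \<in> set (enumeration (fst D2))" "P = map_strand Inr Inr node2 (estrand q)"
   by blast
  then show ?thesis
  proof cases
   case 1
   obtain x y where q: "q = (x, y)" by (cases q) auto
   have "edge q \<in> fst D1" using en(1) 1(1) unfolding enumerates_def by blast
   then have xy: "{x, y} \<in> fst D1" by (simp add: q)
   then show ?thesis using marked_edge[OF D1 xy] unfolding 1(2) q
    by (auto simp: balanced_def in_stack_markings stack_segments_def)
  next
   case 2
   obtain x y where q: "q = (x, y)" by (cases q) auto
   have "edge q \<in> fst D2" using en(2) 2(1) unfolding enumerates_def by blast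
   then have xy: "{x, y} \<in> fst D2" by (simp add: q)
   then show ?thesis using marked_edge[OF D2 xy] unfolding 2(2) q
    by (auto simp: balanced_def in_stack_markings stack_segments_def)
  qed
 qed
 show ?thesis unfolding stage_def using 1 2 3 by simp
qed

text \<open>The bottom row of the upper diagram is read backwards and the top row of the lower one
  forwards, hence the letters between the two points of position \<open>k\<close> belong to
  positions below \<open>k\<close>.\<close>

lemma word_split:
 assumes "k < s"
 obtains X Y Z where "WW = X @ [Pt (Inl (Bot k))] @ Z @ [Pt (Inr (Top k))] @ Y"
  "set Z = {Pt (Inl (Bot j)) |j. j < k} \<union> {Pt (Inr (Top j)) |j. j < k}"
proof
 let ?A = "map (\<lambda>i. Pt (Inl (Bot i)))" and ?B = "map (\<lambda>i. Pt (Inr (Top i)))"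
 let ?X = "map (map_letter Inl Inl) (map (\<lambda>i. Pt (Top i)) [0..<r] @ map (\<lambda>m. Mk (carrier_edge m)) (snd D1))
  @ ?A (rev [Suc k..<s])"
 let ?Y = "?B [Suc k..<s] @ map (map_letter Inr Inr)
  (map (\<lambda>m. Mk (carrier_edge m)) (snd D2) @ map (\<lambda>i. Pt (Bot i)) (rev [0..<t]))"
 let ?Z = "?A (rev [0..<k]) @ ?B [0..<k]"
 have "WW = map (map_letter Inl Inl) (map (\<lambda>i. Pt (Top i)) [0..<r] @ map (\<lambda>m. Mk (carrier_edge m)) (snd D1))
  @ ?A (rev [0..<s]) @ ?B [0..<s] @ map (map_letter Inr Inr)
  (map (\<lambda>m. Mk (carrier_edge m)) (snd D2) @ map (\<lambda>i. Pt (Bot i)) (rev [0..<t]))"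
  by (simp add: stack_word_def word_def)
 then show "WW = ?X @ [Pt (Inl (Bot k))] @ ?Z @ [Pt (Inr (Top k))] @ ?Y"
  unfolding upt_split[OF assms] by simp
 show "set ?Z = {Pt (Inl (Bot j)) |j. j < k} \<union> {Pt (Inr (Top j)) |j. j < k}" by auto
qed

text \<open>The strand at \<open>?b\<close> is directed away from it. If it ends at
  \<open>?a\<close>, it closes up to a loop and yields a factor \<delta>; otherwise another strand
  ends at \<open>?a\<close> and the two are joined.\<close>

lemma glue_step:
 assumes st: "stage k Ps Ls" and k: "k < s"
 shows "\<exists>Ps' Ls'. stage (Suc k) Ps' Ls' \<and> (\<forall>lab.
  \<delta> ^ length Ls * (\<Sum>i<N. state point_top WW LL (lab(Inl (Bot k) := i, Inr (Top k) := i)) Ps) =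
  \<delta> ^ length Ls' * state point_top WW LL lab Ps')"
proof -
 let ?a = "Inl (Bot k) :: vertex + vertex" and ?b = "Inr (Top k) :: vertex + vertex"
 obtain X Y Z where W: "WW = X @ [Pt ?a] @ Z @ [Pt ?b] @ Y"
  and Z: "set Z = {Pt (Inl (Bot j)) |j. j < k} \<union> {Pt (Inr (Top j)) |j. j < k}"
  by (rule word_split[OF k])
 have less: "pos WW (Pt ?a) < pos WW (Pt ?b)"
  using distinct_WW unfolding W by (auto simp: pos_append pos_Cons)
 have adj: "pos WW l < pos WW (Pt ?a) \<longleftrightarrow> pos WW l < pos WW (Pt ?b)"
  if "l \<in> set WW" "l \<notin> Pt ` {?a, ?b}" "\<And>j. j < k \<Longrightarrow> l \<noteq> Pt (Inl (Bot j)) \<and> l \<noteq> Pt (Inr (Top j))" for l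
  using pos_adjacent[of X "Pt ?a" Z "Pt ?b" Y l] distinct_WW that unfolding W[symmetric] Z by auto
 have in_ends: "?a \<in> set (ends Ps)" "?b \<in> set (ends Ps)"
  using st k unfolding stage_def by (simp_all add: open_points_Suc)
 obtain st' y R where R: "reordering Ps ((?b, st', y) # R)" using reordering_end(2)[OF in_ends(2)] by blast
 have stR: "stage k ((?b, st', y) # R) Ls" by (rule stage_rearrangement[OF R st])
 have ne: "?a \<noteq> ?b" by simp
 have tp: "\<not> point_top ?a" "point_top ?b" by simp_all
 note os = open_points_Suc[OF k, of r t]
 have notSuc: "?a \<notin> open_points r s t (Suc k)" "?b \<notin> open_points r s t (Suc k)"
  by (auto simp: open_points_def)
 \<comment> \<open>The letters between the two points belong to positions glued earlier and occur on
   no strand any more.\<close>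
 have adj': "pos WW l < pos WW (Pt ?a) \<longleftrightarrow> pos WW l < pos WW (Pt ?b)"
  if "stage (Suc k) Qs Ls'" "l \<in> set (sequence LL Qs) \<union> Mk ` carriers LL" for l Qs Ls'
 proof (rule adj)
  have q: "set (ends Qs) = open_points r s t (Suc k)" using that(1) by (simp add: stage_def)
  have l: "l \<in> Pt ` open_points r s t (Suc k) \<union> Mk ` carriers LL"
   using that(2) unfolding set_sequence q by blast
  then show "l \<in> set WW" unfolding set_WW using open_points_antimono[of "Suc k"] by blast
  show "l \<notin> Pt ` {?a, ?b}" using l notSuc by auto
  show "l \<noteq> Pt (Inl (Bot j)) \<and> l \<noteq> Pt (Inr (Top j))" if "j < k" for j
   using l that by (auto simp: open_points_def)
 qed
 show ?thesis
 proof (cases "y = ?a")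
  case True
  have sR: "stage (Suc k) R (st' # Ls)"
  proof -
   have d: "?a \<notin> set (ends R)" "?b \<notin> set (ends R)" "insert ?a (insert ?b (set (ends R))) = open_points r s t k"
    using stR True by (simp_all add: stage_def insert_commute)
   have w: "walk SS (Middle k) st' (Middle k)" "st' \<noteq> []" using stR True by (auto simp: stage_def)
   have "set (ends R) = open_points r s t (Suc k)"
    by (rule insert2_ident[OF d(1,2) notSuc d(3)[unfolded os(1)]])
   then show ?thesis using stR w unfolding stage_def by auto
  qed
  have "(\<Sum>i<N. state point_top WW LL (lab(?a := i, ?b := i)) Ps) = \<delta> * state point_top WW LL lab R" for lab
  proof -
   have "(\<Sum>i<N. state point_top WW LL (lab(?a := i, ?b := i)) Ps) =
    (\<Sum>i<N. state point_top WW LL (lab(?a := i, ?b := i)) ((?b, st', ?a) # R))"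
    by (rule sum.cong[OF HOL.refl], rule state_rearrangement[symmetric])
     (use R stage_valid[OF st] True in auto)
   also have "\<dots> = \<delta> * state point_top WW LL lab R"
   proof (rule state_loop[OF _ _ tp less])
    show "valid point_top WW LL ((?b, st', ?a) # R)" using stage_valid[OF stR] True by simp
    show "distinct (ends ((?b, st', ?a) # R))" using stR True unfolding stage_def by simp
    fix l assume "l \<in> set (sequence LL R) \<union> Mk ` set (filter (\<lambda>s. s \<in> carriers LL) (segs st'))"
    then have "l \<in> set (sequence LL R) \<union> Mk ` carriers LL" by auto
    then show "pos WW l < pos WW (Pt ?a) \<longleftrightarrow> pos WW l < pos WW (Pt ?b)" by (rule adj'[OF sR])
   qed
   finally show ?thesis .
  qed
  then show ?thesis using sR by (intro exI[of _ R] exI[of _ "st' # Ls"]) (simp add: mult_ac)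
 next
  case False
  then have aR: "?a \<in> set (ends R)"
   using stR k unfolding stage_def by (auto simp: open_points_Suc)
  from reordering_end(1)[OF aR] obtain x st2 R' where R': "reordering R ((x, st2, ?a) # R')"
   by (elim exE)
  have R2: "reordering Ps ((x, st2, ?a) # (?b, st', y) # R')"
   using reordering.trans[OF R reordering.trans[OF reordering_Cons[OF R']]]
    reordering.front[of "[(?b, st', y)]" "(x, st2, ?a)" R'] by simp
  have st3: "stage k ((x, st2, ?a) # (?b, st', y) # R') Ls" by (rule stage_rearrangement[OF R2 st])
  have sR: "stage (Suc k) ((x, st2 @ st', y) # R') Ls"
  proof -
   have d: "?a \<notin> set (x # y # ends R')" "?b \<notin> set (x # y # ends R')"
    "insert ?a (insert ?b (set (x # y # ends R'))) = open_points r s t k"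
    using st3 by (auto simp: stage_def)
   have "set (x # y # ends R') = open_points r s t (Suc k)"
    by (rule insert2_ident[OF d(1,2) notSuc d(3)[unfolded os(1)]])
   moreover have "walk SS (point_node x) (st2 @ st') (point_node y)"
    using st3 unfolding walk_append by (auto simp: stage_def)
   moreover have "balanced point_top LL (x, st2 @ st', y)"
    using st3 by (auto simp: stage_def balanced_def)
   ultimately show ?thesis using st3 unfolding stage_def by auto
  qed
  have "(\<Sum>i<N. state point_top WW LL (lab(?a := i, ?b := i)) Ps) =
   state point_top WW LL lab ((x, st2 @ st', y) # R')" for lab
  proof -
   have "(\<Sum>i<N. state point_top WW LL (lab(?a := i, ?b := i)) Ps) =
    (\<Sum>i<N. state point_top WW LL (lab(?a := i, ?b := i)) ((x, st2, ?a) # (?b, st', y) # R'))"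
    by (rule sum.cong[OF HOL.refl], rule state_rearrangement[symmetric, OF R2 stage_valid[OF st]])
   also have "\<dots> = state point_top WW LL lab ((x, st2 @ st', y) # R')"
   proof (rule state_join[OF stage_valid[OF st3] _ tp less])
    show "distinct (ends ((x, st2, ?a) # (?b, st', y) # R'))" using st3 unfolding stage_def by blast
    fix l assume "l \<in> set (sequence LL ((x, st2 @ st', y) # R'))"
    then show "pos WW l < pos WW (Pt ?a) \<longleftrightarrow> pos WW l < pos WW (Pt ?b)"
     by (intro adj'[OF sR]) blast
   qed
   finally show ?thesis .
  qed
  then show ?thesis using sR by (intro exI[of _ "(x, st2 @ st', y) # R'"] exI[of _ Ls]) simp
 qed
qed

lemma glue_all:
 assumes "k \<le> s"
 shows "\<exists>Ps Ls. stage k Ps Ls \<and> (\<forall>lab.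
  (\<Sum>l\<in>indices N k. state point_top WW LL (middle_label lab l) initial) =
  \<delta> ^ length Ls * state point_top WW LL lab Ps)"
 using assms
proof (induction k)
 case 0
 show ?case by (rule exI[of _ initial], rule exI[of _ "[]"]) (simp add: stage_initial)
next
 case (Suc k)
 then obtain Ps Ls where P: "stage k Ps Ls" "\<And>lab.
  (\<Sum>l\<in>indices N k. state point_top WW LL (middle_label lab l) initial) =
  \<delta> ^ length Ls * state point_top WW LL lab Ps" by auto
 from glue_step[OF P(1)] Suc.prems obtain Ps' Ls' where P': "stage (Suc k) Ps' Ls'" "\<And>lab.
  \<delta> ^ length Ls * (\<Sum>i<N. state point_top WW LL (lab(Inl (Bot k) := i, Inr (Top k) := i)) Ps) =
  \<delta> ^ length Ls' * state point_top WW LL lab Ps'" by auto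
 have "(\<Sum>l\<in>indices N (Suc k). state point_top WW LL (middle_label lab l) initial) =
  \<delta> ^ length Ls' * state point_top WW LL lab Ps'" for lab
 proof -
  have "(\<Sum>l\<in>indices N (Suc k). state point_top WW LL (middle_label lab l) initial) =
   (\<Sum>i<N. \<Sum>l\<in>indices N k. state point_top WW LL
    (middle_label (lab(Inl (Bot k) := i, Inr (Top k) := i)) l) initial)"
   unfolding sum_indices_snoc
   by (intro sum.cong HOL.refl) (simp add: middle_label_snoc indices_def)
  also have "\<dots> = \<delta> ^ length Ls' * state point_top WW LL lab Ps'"
   unfolding P(2) P'(2)[symmetric] sum_distrib_left ..
  finally show ?thesis .
 qed
 then show ?case using P'(1) by blast
qed

text \<open>Before gluing, all letters of the upper diagram precede those of the lower one, so there
  are no inversions between the two and the state is a product.\<close>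

lemma state_initial:
 "state point_top WW LL lab initial =
  state is_top (word r s (snd D1)) (snd D1) (\<lambda>x. lab (Inl x)) strands1 *
  state is_top (word s t (snd D2)) (snd D2) (\<lambda>x. lab (Inr x)) strands2"
proof -
 let ?W1 = "word r s (snd D1)" and ?W2 = "word s t (snd D2)"
 let ?f1 = "map_letter Inl Inl :: (vertex, vertex set) letter \<Rightarrow> (vertex + vertex, segment) letter"
 let ?f2 = "map_letter Inr Inr :: (vertex, vertex set) letter \<Rightarrow> (vertex + vertex, segment) letter"
 let ?Q1 = "sequence (snd D1) strands1" and ?Q2 = "sequence (snd D2) strands2"
 have c: "Inl e \<in> carriers LL \<longleftrightarrow> e \<in> carriers (snd D1)" "Inr e \<in> carriers LL \<longleftrightarrow> e \<in> carriers (snd D2)" for e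
  unfolding carriers_LL by auto
 have seq: "sequence LL initial = map ?f1 ?Q1 @ map ?f2 ?Q2"
  unfolding initial_def sequence_simps
  by (simp only: sequence_map_strand[of Inl LL "snd D1", OF c(1)] sequence_map_strand[of Inr LL "snd D2", OF c(2)])
 have inj: "inj ?f1" "inj ?f2" by (rule letter.inj_map; simp)+
 have W: "WW = map ?f1 ?W1 @ map ?f2 ?W2" by (simp add: stack_word_def)
 have sub: "set ?Q1 \<subseteq> set ?W1" "set ?Q2 \<subseteq> set ?W2"
  using edge_strands_valid[OF D1 enumeration[OF E1]] edge_strands_valid[OF D2 enumeration[OF E2]]
  by (auto simp: valid_def)
 have disj: "?f2 x \<notin> set (map ?f1 ?W1)" for x
 proof
  assume "?f2 x \<in> set (map ?f1 ?W1)"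
  then obtain y where "?f2 x = ?f1 y" by auto
  then show False by (cases x; cases y) auto
 qed
 have 1: "invs WW (degree lab) (map ?f1 ?Q1) = invs ?W1 (degree (\<lambda>x. lab (Inl x))) ?Q1"
 proof -
  have "invs WW (degree lab) (map ?f1 ?Q1) = invs (map ?f1 ?W1) (degree lab) (map ?f1 ?Q1)"
   by (rule invs_cong) (use sub(1) in \<open>auto simp: W pos_append subset_iff\<close>)
  also have "\<dots> = invs ?W1 (degree (\<lambda>x. lab (Inl x))) ?Q1"
   by (rule invs_map) (auto intro: inj_on_subset[OF inj(1)] simp: degree_map_letter)
  finally show ?thesis .
 qed
 have 2: "invs WW (degree lab) (map ?f2 ?Q2) = invs ?W2 (degree (\<lambda>x. lab (Inr x))) ?Q2"
 proof -
  have "invs WW (degree lab) (map ?f2 ?Q2) = invs (map ?f2 ?W2) (degree lab) (map ?f2 ?Q2)"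
   by (rule invs_cong) (use disj in \<open>auto simp: W pos_append\<close>)
  also have "\<dots> = invs ?W2 (degree (\<lambda>x. lab (Inr x))) ?Q2"
   by (rule invs_map) (auto intro: inj_on_subset[OF inj(2)] simp: degree_map_letter)
  finally show ?thesis .
 qed
 have 3: "crossing WW (degree lab) (map ?f1 ?Q1) (map ?f2 ?Q2) = 0"
 proof (rule crossing_ordered)
  fix x y assume x: "x \<in> set (map ?f1 ?Q1)" and y: "y \<in> set (map ?f2 ?Q2)"
  have x': "x \<in> set (map ?f1 ?W1)" using x sub(1) by auto
  have "y \<notin> set (map ?f1 ?W1)" using y disj by auto
  then show "pos WW x < pos WW y" unfolding W pos_append using x' pos_less[OF x'] by simp
 qed
 have inv: "invs WW (degree lab) (sequence LL initial) =
  invs ?W1 (degree (\<lambda>x. lab (Inl x))) ?Q1 + invs ?W2 (degree (\<lambda>x. lab (Inr x))) ?Q2"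
  unfolding seq invs_append 1 2 3 by simp
 have w1: "weight point_top LL lab (map_strand Inl Inl node1 P) = weight is_top (snd D1) (\<lambda>x. lab (Inl x)) P" for P
  by (rule weight_map_strand) (auto simp: in_stack_markings)
 have w2: "weight point_top LL lab (map_strand Inr Inr node2 P) = weight is_top (snd D2) (\<lambda>x. lab (Inr x)) P" for P
  by (rule weight_map_strand) (auto simp: in_stack_markings)
 have "map (weight point_top LL lab) initial = map (weight is_top (snd D1) (\<lambda>x. lab (Inl x))) strands1
  @ map (weight is_top (snd D2) (\<lambda>x. lab (Inr x))) strands2"
  unfolding initial_def map_append map_map comp_def w1 w2 ..
 then show ?thesis unfolding state_def inv by (simp add: koszul_add mult_ac)
qed

definition to_vertex :: "(vertex + vertex, segment, node) strand \<Rightarrow> (vertex, segment, node) strand" where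
 "to_vertex P = (case_sum id id (fst P), steps P, case_sum id id (dst P))"

text \<open>When all positions are glued, the ends are outer points, and the strands become strands
  between vertices of the composite. The word is still that of the stacked figure; the comparison
  with a word of the composite follows later.\<close>

lemma glued:
 obtains Ps Ls where "complete_system SS Ps Ls" "set (ends Ps) = vertices r t"
  "\<And>P. P \<in> set Ps \<Longrightarrow> balanced is_top LL P \<and> proper LL P"
  "\<And>is js. (\<Sum>l\<in>indices N s. dgm_matrix r s D1 is l * dgm_matrix s t D2 l js) =
   \<delta> ^ length Ls * (koszul (invs WW (degree (\<lambda>x. vertex_label is js (case_sum id id x)))
    (sequence LL (map (map_strand outer_point id id) Ps)))
   * prod_list (map (weight is_top LL (vertex_label is js)) Ps))"
proof -
 obtain Qs Ls where Q: "stage s Qs Ls" and sum: "\<And>lab.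
  (\<Sum>l\<in>indices N s. state point_top WW LL (middle_label lab l) initial) =
  \<delta> ^ length Ls * state point_top WW LL lab Qs" using glue_all[of s] by auto
 define Ps where "Ps = map to_vertex Qs"
 have eQ: "set (ends Qs) = outer_point ` vertices r t" "distinct (ends Qs)"
  using Q by (simp_all add: stage_def open_points_final)
 have outer: "outer_point (case_sum id id x) = x" if "x \<in> set (ends Qs)" for x
 proof -
  have "x \<in> outer_point ` vertices r t" using that eQ by simp
  then obtain v where "x = outer_point v" by blast
  then show ?thesis by (cases v) auto
 qed
 have QP: "Qs = map (map_strand outer_point id id) Ps"
 proof -
  have "map_strand outer_point id id (to_vertex P) = P" if "P \<in> set Qs" for P
  proof -
   have "fst P \<in> set (ends Qs)" "dst P \<in> set (ends Qs)" using that by (auto simp: set_ends)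
   then show ?thesis by (cases P) (simp add: to_vertex_def outer)
  qed
  then show ?thesis unfolding Ps_def map_map comp_def by (simp add: map_idI)
 qed
 have e: "ends Qs = map outer_point (ends Ps)" unfolding QP ends_map_strand ..
 have sg: "str_segs Qs = str_segs Ps" unfolding QP str_segs_map_strand by simp
 have inP: "(outer_point (fst P), steps P, outer_point (dst P)) \<in> set Qs" if "P \<in> set Ps" for P
  using imageI[OF that, of "map_strand outer_point id id"] unfolding QP by (cases P) simp
 have walkP: "walk SS (outer_node (fst P)) (steps P) (outer_node (dst P))"
  "balanced is_top LL P" if "P \<in> set Ps" for P
  using bspec[OF conjunct1[OF Q[unfolded stage_def]] inP[OF that]] by (auto simp: balanced_def)
 have ends: "set (ends Ps) = vertices r t"
 proof -
  have "outer_point ` set (ends Ps) = outer_point ` vertices r t" using eQ(1) e by simp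
  then show ?thesis by (simp add: inj_image_eq_iff inj_def)
 qed
 have comp: "complete_system SS Ps Ls"
 proof (rule complete_systemI)
  show "walk SS (outer_node x) st (outer_node y)" if "(x, st, y) \<in> set Ps" for x st y
   using walkP(1)[OF that] by simp
  show "l \<noteq> [] \<and> (\<exists>x. walk SS x l x)" if "l \<in> set Ls" for l using Q that unfolding stage_def by blast
  show "distinct (str_segs Ps @ loop_segs Ls)" "set (str_segs Ps @ loop_segs Ls) = SS"
   using Q unfolding stage_def sg by blast+
  show "distinct (ends Ps)" using eQ(2) unfolding e by (simp add: distinct_map)
  show "v \<in> set (ends Ps)" if "e \<in> SS" "outer_node v \<in> seg_ends e" for v e
   using outer_stack[OF E1 E2 that] ends by simp
 qed
 have main: "(\<Sum>l\<in>indices N s. dgm_matrix r s D1 is l * dgm_matrix s t D2 l js) =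
   \<delta> ^ length Ls * (koszul (invs WW (degree (\<lambda>x. vertex_label is js (case_sum id id x)))
    (sequence LL (map (map_strand outer_point id id) Ps)))
   * prod_list (map (weight is_top LL (vertex_label is js)) Ps))" for "is" js
 proof -
  let ?lab = "\<lambda>x. vertex_label is js (case_sum id id x)"
  have ml: "middle_label ?lab l (Inl v) = vertex_label is l v" "middle_label ?lab l (Inr w) = vertex_label l js w"
   if "l \<in> indices N s" "v \<in> vertices r s" "w \<in> vertices s t" for l v w
   using that by (cases v; cases w; auto simp: indices_def vertices_def)+
  have st1: "state is_top (word r s (snd D1)) (snd D1) (\<lambda>x. middle_label ?lab l (Inl x)) strands1
    = dgm_matrix r s D1 is l" (is ?A)
   and st2: "state is_top (word s t (snd D2)) (snd D2) (\<lambda>x. middle_label ?lab l (Inr x)) strands2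
    = dgm_matrix s t D2 l js" (is ?B) if l: "l \<in> indices N s" for l
  proof -
   \<comment> \<open>States depend only on the labels at the ends of strands.\<close>
   have cong: "state tp W L lab Rs = state tp W L lab' Rs"
    if "\<And>x. x \<in> set (ends Rs) \<Longrightarrow> lab x = lab' x"
    for tp :: "vertex \<Rightarrow> bool" and W L lab lab' and Rs :: "(vertex, vertex set, vertex) strand list"
   proof -
    have inv: "invs W (degree lab) (sequence L Rs) = invs W (degree lab') (sequence L Rs)"
     by (rule invs_cong) (use that in \<open>auto simp: set_sequence\<close>)
    have ws: "map (weight tp L lab) Rs = map (weight tp L lab') Rs"
     by (rule weights_update) (rule that)
    show ?thesis unfolding state_def inv ws ..
   qed
   have l1: "middle_label ?lab l (Inl v) = vertex_label is l v" if "v \<in> vertices r s" for v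
    using l that by (cases v) (auto simp: indices_def vertices_def)
   have l2: "middle_label ?lab l (Inr v) = vertex_label l js v" if "v \<in> vertices s t" for v
    using l that by (cases v) (auto simp: indices_def vertices_def)
   show ?A unfolding dgm_matrix_def
    by (rule cong) (use l1 enumerates_ends(2)[OF enumeration[OF E1] E1] in auto)
   show ?B unfolding dgm_matrix_def
    by (rule cong) (use l2 enumerates_ends(2)[OF enumeration[OF E2] E2] in auto)
  qed
  have "(\<Sum>l\<in>indices N s. dgm_matrix r s D1 is l * dgm_matrix s t D2 l js) =
   (\<Sum>l\<in>indices N s. state point_top WW LL (middle_label ?lab l) initial)"
   unfolding state_initial by (rule sum.cong[OF HOL.refl]) (simp add: st1 st2)
  also have "\<dots> = \<delta> ^ length Ls * state point_top WW LL ?lab Qs" by (rule sum)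
  also have "state point_top WW LL ?lab Qs = koszul (invs WW (degree ?lab) (sequence LL Qs))
    * prod_list (map (weight is_top LL (vertex_label is js)) Ps)"
  proof -
   have "weight point_top LL ?lab (map_strand outer_point id id P) = weight is_top LL (vertex_label is js) P" for P
   proof (rule weight_map_strand)
    show "vertex_label is js (case_sum id id (outer_point x)) = vertex_label is js x" for x
     by (cases x) auto
   qed auto
   then show ?thesis unfolding state_def QP map_map comp_def by simp
  qed
  finally show ?thesis unfolding QP .
 qed
 show ?thesis
 proof (rule that[OF comp ends _ main])
  show "balanced is_top LL P \<and> proper LL P" if "P \<in> set Ps" for P
   using walkP[OF that] walk_proper[of _ "steps P" _ "fst P" "dst P"] by simp
 qed
qed

end

section \<open>Invariance of the state under the simplification rules\<close>

section \<open>Simplification\<close>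

lemma letters_cong:
 assumes "\<And>q. q \<in> set (steps P) \<Longrightarrow> seg q \<in> carriers L \<longleftrightarrow> seg q \<in> carriers L'"
 shows "letters L P = letters L' P"
proof -
 have "filter (\<lambda>q. seg q \<in> carriers L) (steps P) = filter (\<lambda>q. seg q \<in> carriers L') (steps P)"
  by (rule filter_cong[OF HOL.refl assms])
 then show ?thesis unfolding letters_def by simp
qed

lemma sequence_cong:
 assumes "\<And>s. s \<in> set (str_segs Ps) \<Longrightarrow> s \<in> carriers L \<longleftrightarrow> s \<in> carriers L'"
 shows "sequence L Ps = sequence L' Ps"
proof -
 have "letters L P = letters L' P" if "P \<in> set Ps" for P
 proof (rule letters_cong)
  fix q assume "q \<in> set (steps P)"
  then have "seg q \<in> set (str_segs Ps)" using that unfolding set_strand_segs by auto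
  then show "seg q \<in> carriers L \<longleftrightarrow> seg q \<in> carriers L'" by (rule assms)
 qed
 then show ?thesis unfolding sequence_def by (intro arg_cong[where f = concat] map_cong) auto
qed

lemma reordering_to_front:
 assumes "P \<in> set Ps" "Q = P \<or> Q = flip P"
 obtains R where "reordering Ps (Q # R)" "\<And>X. X \<in> set R \<Longrightarrow> X \<in> set Ps"
proof -
 obtain As Bs where Ps: "Ps = As @ P # Bs" using split_list[OF assms(1)] by blast
 have 1: "reordering Ps (P # As @ Bs)" unfolding Ps by (rule reordering.front)
 have 2: "reordering Ps (flip P # As @ Bs)" by (rule reordering.trans[OF 1 reordering.flip])
 have "reordering Ps (Q # As @ Bs)" using assms(2) 1 2 by blast
 moreover have "X \<in> set Ps" if "X \<in> set (As @ Bs)" for X using that Ps by auto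
 ultimately show ?thesis using that by blast
qed

lemma reordering_segs:
 assumes "reordering Ps Qs" "distinct (str_segs Ps)"
 shows "distinct (str_segs Qs)"
 using assms
proof (induction rule: reordering.induct)
 case (front Ps P Qs)
 then show ?case by (cases P) auto
next
 case (flip P Ps)
 then show ?case by (cases P) auto
qed auto

lemma beads_cong: "(\<And>q. q \<in> set st \<Longrightarrow> Bead (seg q) \<in> set L \<longleftrightarrow> Bead (seg q) \<in> set L') \<Longrightarrow> beads L st = beads L' st"
 by (induction st) auto

lemma arrows_cong:
 "(\<And>q t. q \<in> set st \<Longrightarrow> Arrow (seg q) t \<in> set L \<longleftrightarrow> Arrow (seg q) t \<in> set L') \<Longrightarrow> arrows L st = arrows L' st"
 by (induction st) auto

context supermatrix
begin

lemma arrow_signs_cong: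
 "(\<And>q t. q \<in> set st \<Longrightarrow> Arrow (seg q) t \<in> set L \<longleftrightarrow> Arrow (seg q) t \<in> set L') \<Longrightarrow>
  arrow_signs L st = arrow_signs L' st"
 by (induction st) (auto simp: arrow_sign_def)

lemma weight_marking_cong:
 "(\<And>q t. q \<in> set (steps P) \<Longrightarrow> Arrow (seg q) t \<in> set L \<longleftrightarrow> Arrow (seg q) t \<in> set L') \<Longrightarrow>
  weight tp L lab P = weight tp L' lab P"
 unfolding weight_def using arrow_signs_cong[of "steps P" L L'] by simp

end

lemma word_append:
 "word r t (xs @ M @ ys) = (map (\<lambda>i. Pt (Top i)) [0..<r] @ map (\<lambda>m. Mk (carrier_edge m)) xs)
  @ map (\<lambda>m. Mk (carrier_edge m)) M @ (map (\<lambda>m. Mk (carrier_edge m)) ys @ map (\<lambda>i. Pt (Bot i)) (rev [0..<t]))"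
 by (simp add: word_def)

text \<open>Two neighbours of the word, both of degree \<open>d\<close>, are exchanged. The exponent
  changes by d * d = d, that is, the state by the factor \<open>\<epsilon>\<close>.\<close>

lemma (in supermatrix) state_interchange:
 assumes v: "valid tp (word r t (xs @ [m, m'] @ ys)) (xs @ [m, m'] @ ys) Ps"
  and c: "carriers (xs @ [m, m'] @ ys) \<subseteq> set (str_segs Ps)"
 shows "state tp (word r t (xs @ [m, m'] @ ys)) (xs @ [m, m'] @ ys) lab Ps =
   \<epsilon> * state tp (word r t (xs @ [m', m] @ ys)) (xs @ [m', m] @ ys) lab Ps"
proof -
 let ?L = "xs @ [m, m'] @ ys" and ?L' = "xs @ [m', m] @ ys"
 have set_eq: "set ?L' = set ?L" by auto
 have seq: "sequence ?L' Ps = sequence ?L Ps"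
  by (rule sequence_cong) (simp only: set_eq)
 have w: "weight tp ?L' lab = weight tp ?L lab"
  by (rule ext, rule weight_marking_cong) (simp only: set_eq)
 have "invs (word r t ?L') (degree lab) (sequence ?L Ps) =
  invs (word r t ?L) (degree lab) (sequence ?L Ps) + d"
 proof -
  have "Mk (carrier_edge m) \<in> set (sequence ?L Ps)" "Mk (carrier_edge m') \<in> set (sequence ?L Ps)"
   using c unfolding set_sequence by auto
  moreover have "distinct (word r t ?L)" by (rule distinct_word) (use v in \<open>simp add: valid_def\<close>)
  ultimately show ?thesis
   using invs_swap[of "map (\<lambda>i. Pt (Top i)) [0..<r] @ map (\<lambda>m. Mk (carrier_edge m)) xs"
     "Mk (carrier_edge m)" "Mk (carrier_edge m')"
     "map (\<lambda>m. Mk (carrier_edge m)) ys @ map (\<lambda>i. Pt (Bot i)) (rev [0..<t])" "sequence ?L Ps" "degree lab"] v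
   unfolding word_append valid_def by simp
 qed
 then show "state tp (word r t ?L) ?L lab Ps = \<epsilon> * state tp (word r t ?L') ?L' lab Ps"
  unfolding state_def seq w by (simp add: koszul_add eps mult_ac)
qed

text \<open>A decomposition of the stacked figure as obtained by gluing. The rewriting of markings
  is followed along its strands.\<close>

locale decomposed = stacking N p d g \<epsilon> \<delta> r s t D1 D2
 for N :: nat and p :: "nat \<Rightarrow> bit" and d :: bit
  and g :: "bool \<Rightarrow> nat \<Rightarrow> bool \<Rightarrow> nat \<Rightarrow> 'k::field" and \<epsilon> \<delta> :: 'k
  and r s t :: nat and D1 D2 :: diagram +
 fixes Ps Ls
 assumes complete: "complete_system SS Ps Ls" and ends_Ps: "set (ends Ps) = vertices r t"
  and balanced_LL: "P \<in> set Ps \<Longrightarrow> balanced is_top LL P"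
begin

sublocale complete_strands SS Ps Ls
 by unfold_locales (rule reg, rule complete)

abbreviation "initial_markings \<equiv> filter (\<lambda>m. carrier_edge m \<notin> \<Union> (closed_loops SS)) LL"

text \<open>Invariant of the simplification. Balance survives because a cancellation removes one
  bead and one arrow from the same strand.\<close>

definition admissible :: "(segment, node) marking list \<Rightarrow> bool" where
 "admissible L \<longleftrightarrow> distinct (map carrier_edge L) \<and> carriers L \<subseteq> set (str_segs Ps) \<and> set L \<subseteq> set LL \<and>
  (\<forall>P\<in>set Ps. balanced is_top L P)"

lemma carriers_LL_SS: "carriers LL \<subseteq> SS"
 unfolding carriers_LL stack_segments_def
 using markedD(3)[OF D1] markedD(3)[OF D2] by blast

lemma in_initial_markings:
 "carrier_edge m \<in> set (str_segs Ps) \<Longrightarrow> m \<in> set initial_markings \<longleftrightarrow> m \<in> set LL"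
 using loop_strand_disjoint unfolding union_closed_loops by auto

lemma carriers_initial: "carriers initial_markings = carriers LL \<inter> set (str_segs Ps)"
 using carriers_LL_SS segs_cover loop_strand_disjoint unfolding union_closed_loops by auto

lemma strand_step_seg: "P \<in> set Ps \<Longrightarrow> q \<in> set (steps P) \<Longrightarrow> seg q \<in> set (str_segs Ps)"
 unfolding set_strand_segs by auto

lemma admissible_initial: "admissible initial_markings"
proof -
 have "balanced is_top initial_markings P" if P: "P \<in> set Ps" for P
 proof -
  have 1: "beads initial_markings (steps P) = beads LL (steps P)"
   by (rule beads_cong) (rule in_initial_markings, use strand_step_seg[OF P] in auto)
  have 2: "arrows initial_markings (steps P) = arrows LL (steps P)"
   by (rule arrows_cong) (rule in_initial_markings, use strand_step_seg[OF P] in auto)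
  show ?thesis using balanced_LL[OF P] unfolding balanced_def 1 2 .
 qed
 moreover have "distinct (map carrier_edge initial_markings)"
  using distinct_carriers by (simp add: distinct_map_filter)
 moreover have "carriers initial_markings \<subseteq> set (str_segs Ps)" unfolding carriers_initial by blast
 ultimately show ?thesis unfolding admissible_def by auto
qed

lemma strand_proper:
 assumes "P \<in> set Ps" "set L \<subseteq> set LL"
 shows "proper L P"
 using walk_proper[OF strand_walk'[OF assms(1)], of "fst P" "dst P"] assms(2)
 unfolding proper_def by auto

lemma admissible_valid:
 assumes "admissible L"
 shows "valid is_top (word r t L) L Ps"
 unfolding valid_def
 using assms strand_proper distinct_sequence[OF distinct_ends_strands str_segs_distinct] ends_Ps
 by (auto simp: admissible_def set_sequence set_word)

text \<open>Passes from the word of the stacked figure to that of the composite: the second arises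
  from the first by deleting the middle points and the markings of loops, none of which lie on a
  strand.\<close>

lemma state_initial_markings:
 "koszul (invs WW (degree (\<lambda>x. lab (case_sum id id x)))
   (sequence LL (map (map_strand outer_point id id) Ps)))
  * prod_list (map (weight is_top LL lab) Ps) = state is_top (word r t initial_markings) initial_markings lab Ps"
proof -
 let ?L = initial_markings and ?dg = "degree (\<lambda>x. lab (case_sum id id x))"
 let ?f = "map_letter outer_point id :: (vertex, segment) letter \<Rightarrow> (vertex + vertex, segment) letter"
 let ?Q = "sequence ?L Ps"
 \<comment> \<open>\<open>K\<close> keeps the outer points and the markings off the loops.\<close>
 define K where "K l \<longleftrightarrow> (case l of Pt x \<Rightarrow> x \<in> range outer_point | Mk s \<Rightarrow> s \<notin> \<Union> (closed_loops SS))"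
  for l :: "(vertex + vertex, segment) letter"
 have w: "weight is_top LL lab P = weight is_top ?L lab P" if P: "P \<in> set Ps" for P
  by (rule weight_marking_cong) (rule in_initial_markings[symmetric], use strand_step_seg[OF P] in auto)
 have "sequence LL Ps = ?Q"
  by (rule sequence_cong) (use carriers_initial in auto)
 then have seq: "sequence LL (map (map_strand outer_point id id) Ps) = map ?f ?Q"
  by (subst sequence_map_strand[of id LL LL]) auto
 have rng: "Inl (Top i) \<in> range outer_point" "Inr (Bot i) \<in> range outer_point"
  "Inl (Bot i) \<notin> range outer_point" "Inr (Top i) \<notin> range outer_point" for i
 proof -
  show "Inl (Top i) \<in> range outer_point" by (rule range_eqI[of _ _ "Top i"]) simp
  show "Inr (Bot i) \<in> range outer_point" by (rule range_eqI[of _ _ "Bot i"]) simp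
  have "outer_point v \<noteq> Inl (Bot i)" "outer_point v \<noteq> Inr (Top i)" for v by (cases v; simp)+
  then show "Inl (Bot i) \<notin> range outer_point" "Inr (Top i) \<notin> range outer_point" by (metis rangeE)+
 qed
 have Kmk: "K (Mk s) \<longleftrightarrow> s \<notin> \<Union> (closed_loops SS)" and Kpt: "K (Pt x) \<longleftrightarrow> x \<in> range outer_point" for s x
  by (simp_all only: K_def letter.case)
 have fl: "filter K (map (\<lambda>x. Mk (h (carrier_edge x))) M)
  = map (\<lambda>m. Mk (carrier_edge m)) (filter (\<lambda>m. carrier_edge m \<notin> \<Union> (closed_loops SS)) (map (map_marking h n) M))"
  for h :: "vertex set \<Rightarrow> segment" and n :: "vertex \<Rightarrow> node" and M
  by (induction M) (simp_all add: Kmk carrier_map_marking del: Union_iff)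
 have all: "filter K (map (\<lambda>i. Pt (Inl (Top i))) xs) = map (\<lambda>i. Pt (Inl (Top i))) xs"
  "filter K (map (\<lambda>i. Pt (Inr (Bot i))) xs) = map (\<lambda>i. Pt (Inr (Bot i))) xs"
  "filter K (map (\<lambda>i. Pt (Inl (Bot i))) xs) = []" "filter K (map (\<lambda>i. Pt (Inr (Top i))) xs) = []" for xs
  by (induction xs) (simp_all only: list.map filter.simps Kpt rng if_True if_False simp_thms)
 have W: "map ?f (word r t ?L) = filter K WW"
  unfolding stack_word_def word_def stack_markings_def
  by (simp add: comp_def all fl[of Inl _ node1] fl[of Inr _ node2] filter_append del: filter_map Union_iff)
 have inQ: "x \<in> set WW \<and> K x" if "x \<in> set (map ?f ?Q)" for x
 proof -
  have "set ?Q \<subseteq> set (word r t ?L)" using admissible_valid[OF admissible_initial] by (simp add: valid_def)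
  then have "x \<in> set (map ?f (word r t ?L))" using that by auto
  then show ?thesis unfolding W by auto
 qed
 have "invs WW ?dg (map ?f ?Q) = invs (filter K WW) ?dg (map ?f ?Q)"
  by (rule invs_cong) (use inQ pos_filter_less[of _ WW _ K] in blast)+
 also have "\<dots> = invs (word r t ?L) (degree lab) ?Q"
  unfolding W[symmetric]
 proof (rule invs_map)
  have "inj ?f" by (rule letter.inj_map) (auto simp: inj_def)
  then show "inj_on ?f (set (word r t ?L) \<union> set ?Q)" by (rule inj_on_subset) simp
  show "?dg (?f x) = degree lab x" for x
  proof (cases x)
   case (Pt v)
   then show ?thesis by (cases v) auto
  qed auto
 qed
 finally show ?thesis unfolding state_def seq using w by (simp cong: map_cong)
qed

lemma interchange_step:
 assumes "admissible (xs @ [m, m'] @ ys)"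
 shows "admissible (xs @ [m', m] @ ys)"
  "state is_top (word r t (xs @ [m, m'] @ ys)) (xs @ [m, m'] @ ys) lab Ps =
   \<epsilon> * state is_top (word r t (xs @ [m', m] @ ys)) (xs @ [m', m] @ ys) lab Ps"
proof -
 have set_eq: "set (xs @ [m', m] @ ys) = set (xs @ [m, m'] @ ys)" by auto
 have b: "beads (xs @ [m', m] @ ys) st = beads (xs @ [m, m'] @ ys) st"
  "arrows (xs @ [m', m] @ ys) st = arrows (xs @ [m, m'] @ ys) st" for st :: "(node \<times> segment \<times> node) list"
  by (simp_all only: beads_def arrows_def set_eq)
 show "admissible (xs @ [m', m] @ ys)"
  using assms unfolding admissible_def balanced_def set_eq b by auto
 show "state is_top (word r t (xs @ [m, m'] @ ys)) (xs @ [m, m'] @ ys) lab Ps =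
   \<epsilon> * state is_top (word r t (xs @ [m', m] @ ys)) (xs @ [m', m] @ ys) lab Ps"
  by (rule state_interchange[OF admissible_valid[OF assms]]) (use assms in \<open>unfold admissible_def, blast\<close>)
qed

text \<open>On the strand, directed from the arrow to the bead, the two letters are neighbours, and
  so they are in the word. Removing them costs their mutual inversion, present if the bead is above,
  and the arrow sign, present if the arrow points away from the bead. The product is the factor of
  the corresponding rule.\<close>

lemma cancel_step:
 assumes adm: "admissible (xs @ [m, m'] @ ys)"
  and m: "(m = Arrow e x \<and> m' = Bead e') \<or> (m = Bead e' \<and> m' = Arrow e x)"
  and trail: "trail SS y (e # ss @ [e']) z"
  and free: "\<forall>m\<in>set (xs @ [m, m'] @ ys). carrier_edge m \<notin> set ss"
 shows "admissible (xs @ ys)"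
  "state is_top (word r t (xs @ [m, m'] @ ys)) (xs @ [m, m'] @ ys) lab Ps =
   (if x = y then \<epsilon> else 1) * (if m = Bead e' then \<epsilon> else 1) * state is_top (word r t (xs @ ys)) (xs @ ys) lab Ps"
proof -
 let ?L = "xs @ [m, m'] @ ys" and ?L' = "xs @ ys"
 have dc: "distinct (map carrier_edge ?L)" using adm by (simp add: admissible_def)
 have ee: "e \<noteq> e'" using dc m by auto
 have inL: "Arrow e x \<in> set ?L" "Bead e' \<in> set ?L" using m by auto
 have eL: "e \<in> carriers ?L" "e' \<in> carriers ?L"
  using imageI[OF inL(1), of carrier_edge] imageI[OF inL(2), of carrier_edge] by (simp_all only: carrier_edge.simps)
 have "carriers ?L \<subseteq> set (str_segs Ps)" using adm unfolding admissible_def by blast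
 then have e_in: "e \<in> set (str_segs Ps)" "e' \<in> set (str_segs Ps)" using eL by blast+
 obtain P u ps1 st ps2 w where P: "P \<in> set Ps"
  "(u, ps1 @ st @ ps2, w) = P \<or> (u, ps1 @ st @ ps2, w) = flip P" "walk SS y st z" "segs st = e # ss @ [e']"
  using trail_in_strand[OF trail e_in(1)] by metis
 \<comment> \<open>The strand of the two markings, directed such that it meets the arrow
   first.\<close>
 define P' where "P' = (u, ps1 @ st @ ps2, w)"
 obtain q st1 where q: "st = q # st1" "seg q = e" "segs st1 = ss @ [e']" using P(4) by auto
 obtain mid q' where q': "st1 = mid @ [q']" "seg q' = e'" "segs mid = ss"
  using q(3) by (auto simp: map_eq_append_conv)
 have qy: "fst q = y" "e \<in> SS" "seg_ends e = {y, dst q}" using P(3) q by (cases q; auto)+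
 have yq: "y \<noteq> dst q" using regular_ends[OF reg qy(2,3)] .
 have xq: "x = y \<or> x = dst q"
  using arrow_target[OF qy(2), of x] inL(1) adm qy(3) unfolding admissible_def by auto
 obtain R where R: "reordering Ps (P' # R)" "\<And>X. X \<in> set R \<Longrightarrow> X \<in> set Ps"
  using reordering_to_front[OF P(1), of P'] P(2) unfolding P'_def by metis
 have dsegs: "distinct (str_segs (P' # R))" by (rule reordering_segs[OF R(1) str_segs_distinct])
 have st_eq: "steps P' = ps1 @ q # mid @ q' # ps2" by (simp add: P'_def q q')
 have P'v: "P' = (u, ps1 @ q # mid @ q' # ps2, w)" by (simp add: P'_def q q')
 have notin: "e \<notin> set (segs ps1)" "e \<notin> set (segs mid)" "e \<notin> set (segs ps2)" "e \<notin> set (str_segs R)"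
  "e' \<notin> set (segs ps1)" "e' \<notin> set (segs mid)" "e' \<notin> set (segs ps2)" "e' \<notin> set (str_segs R)"
  using dsegs unfolding P'v by (auto simp: q(2) q'(2))
 have setL': "n \<in> set ?L' \<longleftrightarrow> n \<in> set ?L" if "carrier_edge n \<noteq> e" "carrier_edge n \<noteq> e'" for n
  using that m by auto
 have notL': "e \<notin> carriers ?L'" "e' \<notin> carriers ?L'" using dc m by auto
 have car: "f \<in> carriers ?L' \<longleftrightarrow> f \<in> carriers ?L" if "f \<noteq> e" "f \<noteq> e'" for f
  using that m by auto
 have bL: "Bead f \<in> set ?L' \<longleftrightarrow> Bead f \<in> set ?L" "Arrow f a \<in> set ?L' \<longleftrightarrow> Arrow f a \<in> set ?L"
  if "f \<noteq> e" "f \<noteq> e'" for f a using setL'[of "Bead f"] setL'[of "Arrow f a"] that by auto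
 have kinds: "Bead e \<notin> set ?L" "Arrow e' a \<notin> set ?L" "Bead e \<notin> set ?L'" "Arrow e' a \<notin> set ?L'"
  "Bead e' \<notin> set ?L'" "Arrow e a \<notin> set ?L'" for a
 proof -
  show "Bead e \<notin> set ?L" using carriers_cases(2)[OF dc, of e x] inL(1) by blast
  show "Arrow e' a \<notin> set ?L" using carriers_cases(2)[OF dc, of e' a] inL(2) by blast
  show "Bead e \<notin> set ?L'" "Arrow e' a \<notin> set ?L'" "Bead e' \<notin> set ?L'" "Arrow e a \<notin> set ?L'"
   using notL' by force+
 qed
 have off: "seg k \<noteq> e \<and> seg k \<noteq> e'" if "k \<in> set ps1 \<or> k \<in> set mid \<or> k \<in> set ps2" for k
  using that notin by auto
 have offb: "beads ?L' l = beads ?L l" "arrows ?L' l = arrows ?L l" "arrow_signs ?L' l = arrow_signs ?L l"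
  "filter (\<lambda>k. seg k \<in> carriers ?L') l = filter (\<lambda>k. seg k \<in> carriers ?L) l"
  if "\<And>k. k \<in> set l \<Longrightarrow> seg k \<noteq> e \<and> seg k \<noteq> e'" for l
 proof -
  show "beads ?L' l = beads ?L l" by (rule beads_cong) (use that bL in blast)
  show "arrows ?L' l = arrows ?L l" by (rule arrows_cong) (use that bL in blast)
  show "arrow_signs ?L' l = arrow_signs ?L l" by (rule arrow_signs_cong) (use that bL in blast)
  show "filter (\<lambda>k. seg k \<in> carriers ?L') l = filter (\<lambda>k. seg k \<in> carriers ?L) l"
   by (rule filter_cong[OF HOL.refl]) (use that car in blast)
 qed
 have offR: "seg k \<noteq> e \<and> seg k \<noteq> e'" if "X \<in> set R" "k \<in> set (steps X)" for X k
 proof -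
  have "seg k \<in> set (str_segs R)" using that unfolding set_strand_segs by auto
  then show ?thesis using notin by metis
 qed
 note offs = offb[of ps1] offb[of mid] offb[of ps2]
 have balP: "balanced is_top ?L' P' \<longleftrightarrow> balanced is_top ?L P'"
  unfolding balanced_def st_eq using offs off kinds inL by (auto simp: q(2) q'(2) simp del: set_append)
 have balR: "balanced is_top ?L' X \<longleftrightarrow> balanced is_top ?L X" if "X \<in> set R" for X
  unfolding balanced_def using offb[of "steps X"] offR[OF that] by simp
 have "valid is_top (word r t ?L) ?L (P' # R)"
  using valid_rearrangement[OF R(1)] admissible_valid[OF adm] by blast
 note vL = this
 have bal': "\<forall>X\<in>set (P' # R). balanced is_top ?L' X" using vL balP balR by (simp add: valid_def)
 have "balanced is_top ?L' X" if "X \<in> set Ps" for X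
 proof -
  have sub: "reordering As Bs \<Longrightarrow> (\<forall>X\<in>set Bs. balanced is_top ?L' X) \<Longrightarrow> (\<forall>X\<in>set As. balanced is_top ?L' X)"
   for As Bs :: "(vertex, segment, node) strand list"
   by (induction rule: reordering.induct) (auto simp: balanced_flip)
  show ?thesis using sub[OF R(1) bal'] that by blast
 qed
 then show adm': "admissible ?L'"
  using adm unfolding admissible_def by auto
 have v': "valid is_top (word r t ?L') ?L' (P' # R)"
  using valid_rearrangement[OF R(1)] admissible_valid[OF adm'] by blast
 let ?M = "\<lambda>l. map (\<lambda>q. Mk (seg q)) (filter (\<lambda>q. seg q \<in> carriers ?L) l)"
 let ?U = "Pt u # ?M ps1" and ?T = "?M ps2 @ Pt w # sequence ?L R"
 \<comment> \<open>The segments between the two markings are unmarked and contribute no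
   letters.\<close>
 have midf: "filter (\<lambda>k. seg k \<in> carriers ?L) mid = []"
 proof -
  have "seg k \<notin> carriers ?L" if "k \<in> set mid" for k
  proof -
   have "seg k \<in> set ss" using that unfolding q'(3)[symmetric] by simp
   then show ?thesis using free by (metis imageE)
  qed
  then show ?thesis by (simp add: filter_empty_conv del: set_append)
 qed
 have seqR: "sequence ?L' R = sequence ?L R"
  by (rule sequence_cong) (use car notin in metis)
 have seqL: "sequence ?L (P' # R) = ?U @ [Mk e, Mk e'] @ ?T"
  unfolding P'v sequence_simps letters_simps filter_append filter.simps midf
  using eL by (simp add: q(2) q'(2))
 have seqL': "sequence ?L' (P' # R) = ?U @ ?T"
  unfolding P'v sequence_simps letters_simps filter_append filter.simps seqR
  using offs off midf notL' by (simp add: q(2) q'(2) del: set_append)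
 define W1 where "W1 = map (\<lambda>i. Pt (Top i) :: (vertex, segment) letter) [0..<r] @ map (\<lambda>m. Mk (carrier_edge m)) xs"
 define W2 where "W2 = map (\<lambda>m. Mk (carrier_edge m) :: (vertex, segment) letter) ys @ map (\<lambda>i. Pt (Bot i)) (rev [0..<t])"
 have W: "word r t ?L = W1 @ [Mk (carrier_edge m), Mk (carrier_edge m')] @ W2" "word r t ?L' = W1 @ W2"
  unfolding W1_def W2_def word_def by simp_all
 have dW: "distinct (word r t ?L)" by (rule distinct_word[OF dc])
 have dQ: "distinct (?U @ [Mk e, Mk e'] @ ?T)" "set (?U @ [Mk e, Mk e'] @ ?T) \<subseteq> set (word r t ?L)"
  using vL unfolding valid_def seqL by blast+
 have ae: "{Mk (carrier_edge m), Mk (carrier_edge m')} = {Mk e, Mk e' :: (vertex, segment) letter}" using m by auto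
 have ne: "l \<noteq> Mk e \<and> l \<noteq> Mk e' \<and> l \<in> set (word r t ?L)" if "l \<in> set (?U @ ?T)" for l
  using distinct_middle(1)[OF dQ(1) that] distinct_middle(2)[OF dQ(2) that] by blast
 have inv: "invs (word r t ?L) (degree lab) (sequence ?L (P' # R)) =
  invs (word r t ?L') (degree lab) (sequence ?L' (P' # R)) + (if m = Bead e' then d else 0)"
 proof -
  have adj: "pos (word r t ?L) l < pos (word r t ?L) (Mk e) \<longleftrightarrow> pos (word r t ?L) l < pos (word r t ?L) (Mk e')"
   if "l \<in> set (?U @ ?T)" for l
   using pos_adjacent[of W1 "Mk (carrier_edge m)" "[]" "Mk (carrier_edge m')" W2 l] dW ne[OF that] m
   unfolding W(1) by auto
  have "invs (word r t ?L) (degree lab) (?U @ [Mk e, Mk e'] @ ?T) =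
   invs (word r t ?L) (degree lab) (?U @ ?T)
    + (if pos (word r t ?L) (Mk e') < pos (word r t ?L) (Mk e) then degree lab (Mk e) else 0)"
   by (rule invs_remove_pair) (use adj ne in \<open>auto simp: pos_eq_iff simp del: set_append append.simps append_Cons\<close>)
  moreover have "pos (word r t ?L) (Mk e') < pos (word r t ?L) (Mk e) \<longleftrightarrow> m = Bead e'"
   using m dW ee unfolding W(1) by (auto simp: pos_append pos_Cons)
  moreover have "invs (word r t ?L) (degree lab) (?U @ ?T) = invs (word r t ?L') (degree lab) (?U @ ?T)"
  proof (rule invs_cong)
   have W': "word r t ?L' = filter (\<lambda>l. l \<noteq> Mk e \<and> l \<noteq> Mk e') (word r t ?L)"
   proof -
    have "filter (\<lambda>l. l \<noteq> Mk e \<and> l \<noteq> Mk e') (W1 @ W2) = W1 @ W2"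
     by (rule filter_True) (use dW m in \<open>unfold W(1), auto\<close>)
    then show ?thesis unfolding W using m by auto
   qed
   show "pos (word r t ?L) y < pos (word r t ?L) x \<longleftrightarrow> pos (word r t ?L') y < pos (word r t ?L') x"
    if "x \<in> set (?U @ ?T)" "y \<in> set (?U @ ?T)" for x y
    unfolding W' using pos_filter_less[of y "word r t ?L" x "\<lambda>l. l \<noteq> Mk e \<and> l \<noteq> Mk e'"] ne[OF that(1)] ne[OF that(2)]
    by blast
  qed simp
  ultimately show ?thesis unfolding seqL seqL' by simp
 qed
 have as: "arrow_signs ?L (steps P') = (if x = y then \<epsilon> else 1) * arrow_signs ?L' (steps P')"
 proof -
  have 1: "arrow_sign ?L q = (if x = y then \<epsilon> else 1)"
  proof -
   have "(\<exists>a. Arrow e a \<in> set ?L \<and> a \<noteq> dst q) \<longleftrightarrow> x \<noteq> dst q"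
    using inL(1) carriers_cases(3)[OF dc] by blast
   then show ?thesis unfolding arrow_sign_def q(2) using xq yq by auto
  qed
  have 2: "arrow_sign ?L q' = 1" "arrow_sign ?L' q = 1" "arrow_sign ?L' q' = 1"
   unfolding arrow_sign_def q(2) q'(2) using kinds by presburger+
  show ?thesis unfolding st_eq arrow_signs_simps 1 2 using offs off by simp
 qed
 have wP: "weight is_top ?L lab P' = (if x = y then \<epsilon> else 1) * weight is_top ?L' lab P'"
  unfolding weight_def as by (simp only: mult_ac)
 have wR: "map (weight is_top ?L lab) R = map (weight is_top ?L' lab) R"
  by (rule map_cong[OF HOL.refl], rule weight_marking_cong) (use offR bL in metis)
 have "state is_top (word r t ?L) ?L lab (P' # R) =
   (if x = y then \<epsilon> else 1) * (if m = Bead e' then \<epsilon> else 1) * state is_top (word r t ?L') ?L' lab (P' # R)"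
  unfolding state_def inv list.map prod_list.Cons wP wR koszul_add by (simp add: eps mult_ac)
 then show "state is_top (word r t ?L) ?L lab Ps =
   (if x = y then \<epsilon> else 1) * (if m = Bead e' then \<epsilon> else 1) * state is_top (word r t ?L') ?L' lab Ps"
  using state_rearrangement[OF R(1) admissible_valid[OF adm]] state_rearrangement[OF R(1) admissible_valid[OF adm']]
  by simp
qed

text \<open>Scalar times state is preserved by each rule. Iterated, this covers every run, hence
  also the unknown one behind a chosen composite.\<close>

lemma simplify_step_invariant:
 assumes "simplify_step \<epsilon> SS x y" "admissible (snd x)"
 shows "admissible (snd y) \<and> fst x * state is_top (word r t (snd x)) (snd x) lab Ps =
  fst y * state is_top (word r t (snd y)) (snd y) lab Ps"
 using assms
proof (induction rule: simplify_step.induct)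
 case (interchange c xs m m' ys)
 then show ?case using interchange_step(1)[of xs m m' ys] interchange_step(2)[of xs m m' ys lab] by (simp add: mult_ac)
next
 case (arrow_above_towards xs s x s' ys c)
 then obtain y ss z where "trail SS y (s # ss @ [s']) z"
  "\<forall>m\<in>set (xs @ [Arrow s x, Bead s'] @ ys). carrier_edge m \<notin> set ss" "x \<noteq> y"
  unfolding points_towards_def by blast
 then show ?case using cancel_step(1)[of xs "Arrow s x" "Bead s'" ys s x s' y ss z] cancel_step(2)[of xs "Arrow s x" "Bead s'" ys s x s' y ss z lab] arrow_above_towards.prems by simp
next
 case (bead_above_away xs s' s x ys c)
 then obtain y ss z where "trail SS y (s # ss @ [s']) z"
  "\<forall>m\<in>set (xs @ [Bead s', Arrow s x] @ ys). carrier_edge m \<notin> set ss" "x = y"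
  unfolding points_away_def by blast
 then show ?case using cancel_step(1)[of xs "Bead s'" "Arrow s x" ys s x s' y ss z] cancel_step(2)[of xs "Bead s'" "Arrow s x" ys s x s' y ss z lab] bead_above_away.prems by simp
next
 case (arrow_above_away xs s x s' ys c)
 then obtain y ss z where "trail SS y (s # ss @ [s']) z"
  "\<forall>m\<in>set (xs @ [Arrow s x, Bead s'] @ ys). carrier_edge m \<notin> set ss" "x = y"
  unfolding points_away_def by blast
 then show ?case using cancel_step(1)[of xs "Arrow s x" "Bead s'" ys s x s' y ss z] cancel_step(2)[of xs "Arrow s x" "Bead s'" ys s x s' y ss z lab] arrow_above_away.prems
  by (simp add: mult_ac)
next
 case (bead_above_towards xs s' s x ys c)
 then obtain y ss z where "trail SS y (s # ss @ [s']) z"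
  "\<forall>m\<in>set (xs @ [Bead s', Arrow s x] @ ys). carrier_edge m \<notin> set ss" "x \<noteq> y"
  unfolding points_towards_def by blast
 then show ?case using cancel_step(1)[of xs "Bead s'" "Arrow s x" ys s x s' y ss z] cancel_step(2)[of xs "Bead s'" "Arrow s x" ys s x s' y ss z lab] bead_above_towards.prems
  by (simp add: mult_ac)
qed

lemma simplify_steps_invariant:
 assumes "(simplify_step \<epsilon> SS)\<^sup>*\<^sup>* x y" "admissible (snd x)"
 shows "admissible (snd y) \<and> fst x * state is_top (word r t (snd x)) (snd x) lab Ps =
  fst y * state is_top (word r t (snd y)) (snd y) lab Ps"
 using assms by (induction rule: rtranclp_induct) (auto dest: simplify_step_invariant)

end

section \<open>Composites exist, and their matrices are products\<close>

section \<open>Composites of diagrams\<close>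

lemma list_all2_set1: "list_all2 R xs ys \<Longrightarrow> x \<in> set xs \<Longrightarrow> \<exists>y\<in>set ys. R x y"
 by (induction rule: list_all2_induct) auto

lemma list_all2_set2: "list_all2 R xs ys \<Longrightarrow> y \<in> set ys \<Longrightarrow> \<exists>x\<in>set xs. R x y"
 by (induction rule: list_all2_induct) auto

lemma distinct_endpoint_sets:
 "distinct (ends Ps) \<Longrightarrow> distinct (map (\<lambda>P. {fst P, dst P}) Ps)"
proof (induction Ps)
 case (Cons P Ps)
 obtain x st y where P: "P = (x, st, y)" by (cases P) auto
 have "{x, y} \<noteq> {fst Q, dst Q}" if "Q \<in> set Ps" for Q
 proof -
  have "fst Q \<in> set (ends Ps)" using that unfolding set_ends by blast
  then have "fst Q \<notin> {x, y}" using Cons.prems P by auto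
  then show ?thesis by blast
 qed
 then show ?case using Cons P by auto
qed simp

context decomposed
begin

text \<open>The composite edge containing a segment; meaningful for segments on strands only, where
  it is unique.\<close>

definition edge_of :: "segment \<Rightarrow> vertex set" where
 "edge_of e0 = (SOME e. \<exists>P\<in>set Ps. e0 \<in> set (segs (steps P)) \<and> e = {fst P, dst P})"

lemma edge_of_eq:
 assumes "P \<in> set Ps" "e0 \<in> set (segs (steps P))"
 shows "edge_of e0 = {fst P, dst P}"
 unfolding edge_of_def
proof (rule some_equality)
 show "\<exists>Q\<in>set Ps. e0 \<in> set (segs (steps Q)) \<and> {fst P, dst P} = {fst Q, dst Q}"
  using assms by blast
 fix e assume "\<exists>P\<in>set Ps. e0 \<in> set (segs (steps P)) \<and> e = {fst P, dst P}"
 then obtain Q where Q: "Q \<in> set Ps" "e0 \<in> set (segs (steps Q))" "e = {fst Q, dst Q}" by blast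
 then have "P = Q" using strand_unique_seg[OF str_segs_distinct assms(1) Q(1) assms(2) Q(2)] by simp
 then show "e = {fst P, dst P}" using Q(3) by simp
qed

lemma marking_Bead:
 assumes "P \<in> set Ps" "e0 \<in> set (segs (steps P))"
 shows "composite_marking SS (Bead e0) M \<longleftrightarrow> M = Bead (edge_of e0)"
 unfolding edge_of_eq[OF assms]
 using composite_marking_Bead[of "fst P" "steps P" "dst P" e0 M] assms by simp

lemma marking_Arrow:
 assumes "P \<in> set Ps" "q \<in> set (steps P)" "composite_marking SS (Arrow (seg q) a0) M"
 shows "(a0 = dst q \<and> M = Arrow (edge_of (seg q)) (dst P)) \<or>
  (a0 = fst q \<and> M = Arrow (edge_of (seg q)) (fst P))"
proof -
 obtain ps1 ps2 where st: "steps P = ps1 @ q # ps2" using split_list[OF assms(2)] by blast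
 have s: "seg q \<in> set (segs (steps P))" using st by simp
 have "(fst P, ps1 @ (fst q, seg q, dst q) # ps2, dst P) \<in> set Ps"
  using assms(1) st by (metis prod.collapse)
 from composite_marking_Arrow[OF this assms(3)] show ?thesis unfolding edge_of_eq[OF assms(1) s] by simp
qed

lemma marking_ArrowI:
 assumes "P \<in> set Ps" "q \<in> set (steps P)"
 shows "composite_marking SS (Arrow (seg q) (dst q)) (Arrow (edge_of (seg q)) (dst P))"
  "composite_marking SS (Arrow (seg q) (fst q)) (Arrow (edge_of (seg q)) (fst P))"
proof -
 obtain ps1 ps2 where st: "steps P = ps1 @ q # ps2" using split_list[OF assms(2)] by blast
 have s: "seg q \<in> set (segs (steps P))" using st by simp
 have "(fst P, ps1 @ (fst q, seg q, dst q) # ps2, dst P) \<in> set Ps"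
  using assms(1) st by (metis prod.collapse)
 from composite_marking_ArrowI[OF this]
 show "composite_marking SS (Arrow (seg q) (dst q)) (Arrow (edge_of (seg q)) (dst P))"
  "composite_marking SS (Arrow (seg q) (fst q)) (Arrow (edge_of (seg q)) (fst P))"
  unfolding edge_of_eq[OF assms(1) s] .
qed

lemma carrier_on_strand:
 assumes "admissible L" "m \<in> set L"
 obtains P q where "P \<in> set Ps" "q \<in> set (steps P)" "seg q = carrier_edge m"
proof -
 have "carrier_edge m \<in> set (str_segs Ps)" using assms unfolding admissible_def by blast
 then show ?thesis using that unfolding set_strand_segs by auto
qed

lemma marking_carrier:
 assumes "admissible L" "m \<in> set L" "composite_marking SS m M"
 shows "carrier_edge M = edge_of (carrier_edge m)"
proof -
 obtain P q where P: "P \<in> set Ps" "q \<in> set (steps P)" "seg q = carrier_edge m"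
  using carrier_on_strand[OF assms(1,2)] by blast
 have s: "carrier_edge m \<in> set (segs (steps P))" using P by force
 show ?thesis
 proof (cases m)
  case (Bead s')
  then show ?thesis using marking_Bead[OF P(1), of s' M] s assms(3) by simp
 next
  case (Arrow s' t)
  then show ?thesis using marking_Arrow[OF P(1,2), of t M] P(3) assms(3) by auto
 qed
qed

lemma enumerates_strands: "enumerates (map (\<lambda>P. (fst P, dst P)) Ps) (composite_edges SS)"
 unfolding enumerates_def
proof (intro conjI)
 show "distinct (map edge (map (\<lambda>P. (fst P, dst P)) Ps))"
  using distinct_endpoint_sets[OF distinct_ends_strands] by (simp add: comp_def)
 show "edge ` set (map (\<lambda>P. (fst P, dst P)) Ps) = composite_edges SS"
  unfolding composite_edges_eq by (simp add: image_image)
 show "\<forall>(x, y)\<in>set (map (\<lambda>P. (fst P, dst P)) Ps). x \<noteq> y"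
  using ends_distinct by auto
qed

text \<open>Different markings of \<open>D\<close> lie on different edges, so at the end each strand
  carries at most one marking. Renaming segments to composite edges then identifies word, letters
  and arrow signs of the strands with those of \<open>D\<close>.\<close>

lemma state_final:
 assumes adm: "admissible L" and all: "list_all2 (composite_marking SS) L (snd D)"
  and D: "D \<in> marked r t" and edges: "fst D = composite_edges SS"
 shows "state is_top (word r t L) L (vertex_label is js) Ps = dgm_matrix r t D is js"
proof -
 let ?es = "map (\<lambda>P. (fst P, dst P)) Ps" and ?lab = "vertex_label is js"
 let ?f = "map_letter id edge_of :: (vertex, segment) letter \<Rightarrow> (vertex, vertex set) letter"
 have dD: "distinct (map carrier_edge (snd D))" by (rule markedD(2)[OF D])
 have dL: "distinct (map carrier_edge L)" using adm by (simp add: admissible_def)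
 have cm: "map carrier_edge (snd D) = map edge_of (map carrier_edge L)"
 proof -
  have "list_all2 (\<lambda>m M. carrier_edge M = edge_of (carrier_edge m)) L (snd D)"
   by (rule list.rel_mono_strong[OF all]) (use marking_carrier[OF adm] in blast)
  then show ?thesis by (induction rule: list_all2_induct) auto
 qed
 have inj: "inj_on edge_of (carriers L)"
  using dD unfolding cm distinct_map by auto
 have carD: "carriers (snd D) = edge_of ` carriers L" using arg_cong[OF cm, of set] by (simp add: image_image)
 have word: "word r t (snd D) = map ?f (word r t L)"
 proof -
  have "word r t (snd D) = map (\<lambda>i. Pt (Top i)) [0..<r] @ map Mk (map carrier_edge (snd D))
    @ map (\<lambda>i. Pt (Bot i)) (rev [0..<t])" by (simp add: word_def)
  also have "\<dots> = map ?f (word r t L)" unfolding cm by (simp add: word_def)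
  finally show ?thesis .
 qed
 define F where "F P = filter (\<lambda>q. seg q \<in> carriers L) (steps P)" for P :: "(vertex, segment, node) strand"
 \<comment> \<open>\<open>edge_of\<close> is injective on the marked segments but constant along a
   strand.\<close>
 have len: "length (F P) \<le> 1" if P: "P \<in> set Ps" for P
 proof -
  have "distinct (segs (F P))"
   using distinct_steps[of "fst P" "steps P" "dst P"] P by (simp add: F_def distinct_map_filter)
  moreover have "edge_of k = {fst P, dst P}" if "k \<in> set (segs (F P))" for k
   by (rule edge_of_eq[OF P]) (use that in \<open>auto simp: F_def\<close>)
  then have "edge_of ` set (segs (F P)) \<subseteq> {{fst P, dst P}}" by blast
  moreover have "inj_on edge_of (set (segs (F P)))"
   by (rule inj_on_subset[OF inj]) (auto simp: F_def)
  ultimately have "card (set (segs (F P))) \<le> 1"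
   using card_mono[of "{{fst P, dst P}}" "edge_of ` set (segs (F P))"] card_image[of edge_of "set (segs (F P))"] by simp
  then show ?thesis using distinct_card[OF \<open>distinct (segs (F P))\<close>] by simp
 qed
 have key: "map ?f (letters L P) = letters (snd D) (estrand (fst P, dst P))"
  "arrow_signs L (steps P) = arrow_sign (snd D) (fst P, {fst P, dst P}, dst P)" if P: "P \<in> set Ps" for P
 proof -
  let ?e = "{fst P, dst P}"
  have mem: "?e \<in> carriers (snd D) \<longleftrightarrow> F P \<noteq> []"
  proof
   assume "?e \<in> carriers (snd D)"
   then obtain k where k: "k \<in> carriers L" "edge_of k = ?e" unfolding carD by blast
   then obtain Q q where Q: "Q \<in> set Ps" "q \<in> set (steps Q)" "seg q = k"
    using carrier_on_strand[OF adm] by blast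
   have "edge_of k = {fst Q, dst Q}" by (rule edge_of_eq[OF Q(1)]) (use Q in force)
   then have e: "{fst Q, dst Q} = ?e" using k by simp
   have "P = Q"
   proof (rule inj_onD[of "\<lambda>P. {fst P, dst P}" "set Ps"])
    show "inj_on (\<lambda>P. {fst P, dst P}) (set Ps)"
     using distinct_endpoint_sets[OF distinct_ends_strands] by (simp add: distinct_map)
   qed (use e P Q in auto)
   then have "q \<in> set (F P)" using Q k by (simp add: F_def)
   then show "F P \<noteq> []" by auto
  next
   assume "F P \<noteq> []"
   then obtain q where q: "q \<in> set (steps P)" "seg q \<in> carriers L"
    using filter_empty_conv[of "\<lambda>q. seg q \<in> carriers L" "steps P"] unfolding F_def by blast
   have "edge_of (seg q) = ?e" by (rule edge_of_eq[OF P]) (use q in force)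
   then show "?e \<in> carriers (snd D)" unfolding carD using q(2) by (metis imageI)
  qed
  have es: "edge_of (seg q) = ?e" if "q \<in> set (steps P)" for q
   by (rule edge_of_eq[OF P]) (use that in force)
  show "map ?f (letters L P) = letters (snd D) (estrand (fst P, dst P))"
  proof (cases "F P")
   case Nil
   then show ?thesis using mem unfolding letters_def F_def[symmetric] by simp
  next
   case (Cons q l)
   then have "F P = [q]" using len[OF P] by simp
   moreover have "q \<in> set (F P)" using Cons by simp
   then have "q \<in> set (steps P)" unfolding F_def by simp
   ultimately show ?thesis using mem es unfolding letters_def F_def[symmetric] by simp
  qed
  have off: "arrow_signs L st = 1" if "filter (\<lambda>q. seg q \<in> carriers L) st = []" for st
   using that
  proof (induction st)
   case (Cons q st)
   then have "seg q \<notin> carriers L" "filter (\<lambda>q. seg q \<in> carriers L) st = []" by (simp_all split: if_splits)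
   moreover have "Arrow (seg q) a \<notin> set L" for a using \<open>seg q \<notin> carriers L\<close> by force
   ultimately show ?case using Cons.IH by (simp add: arrow_sign_def)
  qed simp
  show "arrow_signs L (steps P) = arrow_sign (snd D) (fst P, ?e, dst P)"
  proof (cases "F P")
   case Nil
   then have "?e \<notin> carriers (snd D)" using mem by simp
   then have "Arrow ?e a \<notin> set (snd D)" for a by force
   then show ?thesis using off[OF Nil[unfolded F_def]] by (simp add: arrow_sign_def)
  next
   case (Cons q l)
   then have Fq: "F P = [q]" using len[OF P] by simp
   obtain l1 l2 where l: "steps P = l1 @ q # l2" "filter (\<lambda>q. seg q \<in> carriers L) l1 = []"
    "filter (\<lambda>q. seg q \<in> carriers L) l2 = []" "seg q \<in> carriers L"
    using filter_eq_Cons_iff[of "\<lambda>q. seg q \<in> carriers L" "steps P" q "[]"] Fq[unfolded F_def]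
    by (metis filter_False)
   have as: "arrow_signs L (steps P) = arrow_sign L q" unfolding l(1) by (simp add: off[OF l(2)] off[OF l(3)])
   have q: "q \<in> set (steps P)" using l(1) by simp
   have fq: "fst q \<noteq> dst q" "fst P \<noteq> dst P"
    using strand_proper[OF P, of L] adm q ends_distinct[of "fst P" "steps P" "dst P"] P
    unfolding proper_def admissible_def by auto
   consider "Bead (seg q) \<in> set L" | a where "Arrow (seg q) a \<in> set L"
    using carriers_cases(1)[OF dL] l(4) by blast
   then show ?thesis
   proof cases
    case 1
    then obtain M where M: "M \<in> set (snd D)" "composite_marking SS (Bead (seg q)) M"
     using list_all2_set1[OF all] by blast
    have "M = Bead ?e" using M(2) marking_Bead[OF P, of "seg q" M] es[OF q] q by auto
    then have "Arrow ?e a \<notin> set (snd D)" for a using carriers_cases(2)[OF dD] M(1) by blast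
    moreover have "Arrow (seg q) a \<notin> set L" for a using carriers_cases(2)[OF dL] 1 by blast
    ultimately show ?thesis unfolding as by (simp add: arrow_sign_def)
   next
    case 2
    then obtain M where M: "M \<in> set (snd D)" "composite_marking SS (Arrow (seg q) a) M"
     using list_all2_set1[OF all] by blast
    from marking_Arrow[OF P q M(2)] obtain x where x: "M = Arrow ?e x"
     "x = dst P \<longleftrightarrow> a = dst q" using fq es[OF q] by auto
    have "(\<exists>b. Arrow ?e b \<in> set (snd D) \<and> b \<noteq> dst P) \<longleftrightarrow> x \<noteq> dst P"
     using M(1) x(1) carriers_cases(3)[OF dD] by blast
    moreover have "(\<exists>b. Arrow (seg q) b \<in> set L \<and> b \<noteq> dst q) \<longleftrightarrow> a \<noteq> dst q"
     using 2 carriers_cases(3)[OF dL] by blast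
    ultimately show ?thesis unfolding as arrow_sign_def using x(2) by simp
   qed
  qed
 qed
 have seq: "sequence (snd D) (map estrand ?es) = map ?f (sequence L Ps)"
 proof -
  have "map (\<lambda>P. letters (snd D) (estrand (fst P, dst P))) Ps = map (\<lambda>P. map ?f (letters L P)) Ps"
   by (rule map_cong[OF HOL.refl]) (simp only: key(1))
  then show ?thesis by (simp only: sequence_def map_concat map_map comp_def)
 qed
 have v: "valid is_top (word r t L) L Ps" by (rule admissible_valid[OF adm])
 have inv: "invs (word r t (snd D)) (degree ?lab) (map ?f (sequence L Ps)) =
   invs (word r t L) (degree ?lab) (sequence L Ps)"
  unfolding word
 proof (rule invs_map)
  show "degree ?lab (?f x) = degree ?lab x" for x by (cases x) auto
  have "set (word r t L) \<union> set (sequence L Ps) = set (word r t L)" using v unfolding valid_def by blast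
  moreover have "inj_on ?f (set (word r t L))"
  proof (rule inj_onI)
   fix x y assume "x \<in> set (word r t L)" "y \<in> set (word r t L)" "?f x = ?f y"
   then show "x = y" unfolding set_word using inj
    by (cases x; cases y) (auto dest: inj_onD)
  qed
  ultimately show "inj_on ?f (set (word r t L) \<union> set (sequence L Ps))" by simp
 qed
 have ws: "map (weight is_top (snd D) ?lab) (map estrand ?es) = map (weight is_top L ?lab) Ps"
  unfolding map_map
  by (rule map_cong[OF HOL.refl]) (simp add: weight_def key(2))
 have "state is_top (word r t (snd D)) (snd D) ?lab (map estrand ?es) = state is_top (word r t L) L ?lab Ps"
  unfolding state_def seq inv ws ..
 moreover have "enumerates ?es (fst D)" unfolding edges by (rule enumerates_strands)
 ultimately show ?thesis using dgm_matrix_eq[OF D] by simp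
qed

text \<open>Serves to make two markings adjacent. Only the existence of a scalar is recorded; its
  value is controlled by the invariance of the state.\<close>

lemma move_right:
 "\<exists>c'. (simplify_step \<epsilon> SS)\<^sup>*\<^sup>* (c, xs @ m # zs @ ys) (c', xs @ zs @ m # ys)"
proof (induction zs arbitrary: c xs)
 case Nil
 then show ?case by auto
next
 case (Cons z zs)
 have "simplify_step \<epsilon> SS (c, xs @ [m, z] @ (zs @ ys)) (\<epsilon> * c, xs @ [z, m] @ (zs @ ys))"
  by (rule simplify_step.interchange)
 moreover obtain c' where "(simplify_step \<epsilon> SS)\<^sup>*\<^sup>* (\<epsilon> * c, (xs @ [z]) @ m # zs @ ys) (c', (xs @ [z]) @ zs @ m # ys)"
  using Cons.IH[of "\<epsilon> * c" "xs @ [z]"] by blast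
 ultimately have "(simplify_step \<epsilon> SS)\<^sup>*\<^sup>* (c, xs @ m # (z # zs) @ ys) (c', xs @ (z # zs) @ m # ys)"
  by (simp add: converse_rtranclp_into_rtranclp)
 then show ?case by blast
qed

lemma adjacent_kinds:
 assumes "\<exists>x\<in>set l. K x" "\<exists>x\<in>set l. \<not> K x"
 shows "\<exists>l1 x y l2. l = l1 @ [x, y] @ l2 \<and> K x \<noteq> K y"
 using assms
proof (induction l)
 case (Cons x l)
 show ?case
 proof (cases "(\<exists>y\<in>set l. K y) \<and> (\<exists>y\<in>set l. \<not> K y)")
  case True
  then obtain l1 a b l2 where "l = l1 @ [a, b] @ l2" "K a \<noteq> K b" using Cons.IH by blast
  then show ?thesis by (intro exI[of _ "x # l1"] exI[of _ a] exI[of _ b] exI[of _ l2]) simp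
 next
  case False
  then obtain b l2 where "l = b # l2" using Cons.prems by (cases l) auto
  moreover have "K x \<noteq> K b" using False Cons.prems calculation by auto
  ultimately show ?thesis by (intro exI[of _ "[]"] exI[of _ x] exI[of _ b] exI[of _ l2]) simp
 qed
qed simp

lemma filter_adjacent:
 assumes "filter K l = l1 @ [x, y] @ l2"
 obtains a b c where "l = a @ x # b @ y # c" "\<forall>z\<in>set b. \<not> K z" "K x" "K y"
proof -
 have split: "\<exists>us vs. l = us @ vs \<and> filter K vs = l2" if "filter K l = l1 @ l2" for l l1 l2
  using that
 proof (induction l1 arbitrary: l)
  case Nil
  then show ?case by (intro exI[of _ "[]"] exI[of _ l]) simp
 next
  case (Cons a l1)
  then obtain us vs where "l = us @ a # vs" "filter K vs = l1 @ l2"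
   by (auto simp: filter_eq_Cons_iff)
  moreover obtain us' vs' where "vs = us' @ vs'" "filter K vs' = l2" using Cons.IH calculation(2) by blast
  ultimately show ?case by (intro exI[of _ "us @ a # us'"] exI[of _ vs']) simp
 qed
 obtain us vs where uv: "l = us @ vs" "filter K vs = x # (y # l2)"
  using split[of l l1 "x # y # l2"] assms by auto
 from filter_eq_Cons_iff[THEN iffD1, OF uv(2)] obtain us1 vs1 where
  v1: "vs = us1 @ x # vs1" "K x" "y # l2 = filter K vs1" by blast
 from filter_eq_Cons_iff[THEN iffD1, OF v1(3)[symmetric]] obtain us2 vs2 where
  v2: "vs1 = us2 @ y # vs2" "\<forall>u\<in>set us2. \<not> K u" "K y" by blast
 show ?thesis by (rule that[of "us @ us1" us2 vs2]) (use uv v1 v2 in auto)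
qed

text \<open>By balance the numbers of beads and arrows on a strand differ by at most one. A strand
  with at least two markings thus carries both kinds, and somewhere along it two consecutive
  markings are of different kinds. The walk between them is read from the arrow to the bead.\<close>

lemma cancellable_pair:
 assumes adm: "admissible L" and P: "P \<in> set Ps"
  and many: "length (filter (\<lambda>q. seg q \<in> carriers L) (steps P)) > 1"
 obtains y e x ss e' z where "Arrow e x \<in> set L" "Bead e' \<in> set L" "trail SS y (e # ss @ [e']) z"
  "\<forall>m\<in>set L. carrier_edge m \<notin> set ss"
proof -
 let ?F = "filter (\<lambda>q. seg q \<in> carriers L) (steps P)"
 have dL: "distinct (map carrier_edge L)" using adm by (simp add: admissible_def)
 have "beads L (steps P) + arrows L (steps P) > 1" using many unfolding length_marked[OF dL] .
 moreover have "balanced is_top L P" using adm P by (simp add: admissible_def)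
 ultimately have ba: "beads L (steps P) > 0" "arrows L (steps P) > 0"
  unfolding balanced_def by (auto split: if_splits)
 define K where "K q \<longleftrightarrow> Bead (seg q) \<in> set L" for q :: "node \<times> segment \<times> node"
 have "\<exists>q\<in>set ?F. K q"
 proof -
  obtain q where "q \<in> set (steps P)" "Bead (seg q) \<in> set L"
   using ba(1) unfolding beads_def by (auto simp: filter_empty_conv)
  then show ?thesis by (intro bexI[of _ q]) (auto simp: K_def carriers_cases(1)[OF dL])
 qed
 moreover have "\<exists>q\<in>set ?F. \<not> K q"
 proof -
  obtain q t where "q \<in> set (steps P)" "Arrow (seg q) t \<in> set L"
   using ba(2) unfolding arrows_def by (auto simp: filter_empty_conv)
  then show ?thesis using carriers_cases(2)[OF dL, of "seg q" t]
   by (intro bexI[of _ q]) (auto simp: K_def carriers_cases(1)[OF dL])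
 qed
 ultimately obtain l1 q q' l2 where F: "?F = l1 @ [q, q'] @ l2" "K q \<noteq> K q'"
  using adjacent_kinds[of ?F K] by blast
 from filter_adjacent[OF F(1)] obtain a b c where abc: "steps P = a @ q # b @ q' # c"
  "\<forall>k\<in>set b. seg k \<notin> carriers L" "seg q \<in> carriers L" "seg q' \<in> carriers L" .
 have ds: "distinct (segs (steps P))" using distinct_steps[of "fst P" "steps P" "dst P"] P by simp
 have wP: "walk SS (outer_node (fst P)) (a @ (q # b @ [q']) @ c) (outer_node (dst P))"
  using strand_walk'[OF P] unfolding abc(1) by simp
 then obtain y z where w: "walk SS y (q # b @ [q']) z" unfolding walk_append by blast
 have d: "distinct (segs (q # b @ [q']))" using ds unfolding abc(1) by auto
 have free: "\<forall>m\<in>set L. carrier_edge m \<notin> set (segs b)"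
 proof (intro ballI notI)
  fix m assume m: "m \<in> set L" "carrier_edge m \<in> set (segs b)"
  then obtain k where "k \<in> set b" "carrier_edge m = seg k" by auto
  then show False using abc(2) imageI[OF m(1), of carrier_edge] by simp
 qed
 show ?thesis
 proof (cases "K q")
  case False
  then obtain x where "Arrow (seg q) x \<in> set L" "Bead (seg q') \<in> set L"
   using F(2) abc(3) carriers_cases(1)[OF dL] unfolding K_def by blast
  moreover have "trail SS y (seg q # segs b @ [seg q']) z" using walk_trail[OF w d] by simp
  ultimately show ?thesis using that free by blast
 next
  case True
  then obtain x where 1: "Arrow (seg q') x \<in> set L" "Bead (seg q) \<in> set L"
   using F(2) abc(4) carriers_cases(1)[OF dL] unfolding K_def by blast
  have "walk SS z (rev_steps (q # b @ [q'])) y" by (rule walk_back[OF w])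
  moreover have "distinct (segs (rev_steps (q # b @ [q'])))" unfolding rev_steps_simps(5) distinct_rev by (rule d)
  ultimately have "trail SS z (segs (rev_steps (q # b @ [q']))) y" by (rule walk_trail)
  then have "trail SS z (seg q' # rev (segs b) @ [seg q]) y" by simp
  moreover have "\<forall>m\<in>set L. carrier_edge m \<notin> set (rev (segs b))" using free by simp
  ultimately show ?thesis using that[OF 1] by blast
 qed
qed

text \<open>Each round brings a cancellable pair into adjacent heights and removes it, which
  shortens the list of markings by two.\<close>

lemma simplification_exists:
 assumes "admissible L"
 shows "\<exists>c' L'. (simplify_step \<epsilon> SS)\<^sup>*\<^sup>* (c, L) (c', L') \<and> admissible L' \<and>
  (\<forall>P\<in>set Ps. length (filter (\<lambda>q. seg q \<in> carriers L') (steps P)) \<le> 1)"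
 using assms
proof (induction "length L" arbitrary: c L rule: less_induct)
 case less
 show ?case
 proof (cases "\<forall>P\<in>set Ps. length (filter (\<lambda>q. seg q \<in> carriers L) (steps P)) \<le> 1")
  case True
  then show ?thesis using less.prems by blast
 next
  case False
  then obtain P where P: "P \<in> set Ps" "length (filter (\<lambda>q. seg q \<in> carriers L) (steps P)) > 1"
   by (meson not_le)
  from cancellable_pair[OF less.prems P] obtain y e x ss e' z where m:
   "Arrow e x \<in> set L" "Bead e' \<in> set L" "trail SS y (e # ss @ [e']) z" "\<forall>m\<in>set L. carrier_edge m \<notin> set ss" .
  obtain m m' xs zs ys where L: "L = xs @ m # zs @ m' # ys"
   and mm: "(m = Arrow e x \<and> m' = Bead e') \<or> (m = Bead e' \<and> m' = Arrow e x)"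
  proof -
   obtain xs ys where xy: "L = xs @ Arrow e x # ys" using split_list[OF m(1)] by blast
   then consider "Bead e' \<in> set xs" | "Bead e' \<in> set ys" using m(2) by auto
   then show ?thesis
   proof cases
    case 1
    then obtain as bs where "xs = as @ Bead e' # bs" using split_list by metis
    then show ?thesis using that[of as "Bead e'" bs "Arrow e x" ys] xy by simp
   next
    case 2
    then obtain as bs where "ys = as @ Bead e' # bs" using split_list by metis
    then show ?thesis using that[of xs "Arrow e x" as "Bead e'" bs] xy by simp
   qed
  qed
  obtain c1 where c1: "(simplify_step \<epsilon> SS)\<^sup>*\<^sup>* (c, xs @ m # zs @ (m' # ys)) (c1, xs @ zs @ m # (m' # ys))"
   using move_right by blast
  let ?L1 = "(xs @ zs) @ [m, m'] @ ys"
  have free: "\<forall>n\<in>set ?L1. carrier_edge n \<notin> set ss" using m(4) unfolding L by auto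
  have "\<exists>c2. simplify_step \<epsilon> SS (c1, ?L1) (c2, (xs @ zs) @ ys)"
  proof (cases "x = y")
   case True
   then have pa: "points_away SS ?L1 e x e'" unfolding points_away_def using m(3) free by blast
   from mm show ?thesis
   proof
    assume *: "m = Arrow e x \<and> m' = Bead e'"
    show ?thesis using simplify_step.arrow_above_away[OF pa[unfolded conjunct1[OF *] conjunct2[OF *]]] * by blast
   next
    assume *: "m = Bead e' \<and> m' = Arrow e x"
    show ?thesis using simplify_step.bead_above_away[OF pa[unfolded conjunct1[OF *] conjunct2[OF *]]] * by blast
   qed
  next
   case False
   then have pt: "points_towards SS ?L1 e x e'" unfolding points_towards_def using m(3) free by blast
   from mm show ?thesis
   proof
    assume *: "m = Arrow e x \<and> m' = Bead e'"
    show ?thesis using simplify_step.arrow_above_towards[OF pt[unfolded conjunct1[OF *] conjunct2[OF *]]] * by blast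
   next
    assume *: "m = Bead e' \<and> m' = Arrow e x"
    show ?thesis using simplify_step.bead_above_towards[OF pt[unfolded conjunct1[OF *] conjunct2[OF *]]] * by blast
   qed
  qed
  then obtain c2 where c2: "simplify_step \<epsilon> SS (c1, ?L1) (c2, (xs @ zs) @ ys)" by blast
  have run: "(simplify_step \<epsilon> SS)\<^sup>*\<^sup>* (c, L) (c2, (xs @ zs) @ ys)"
   using rtranclp.rtrancl_into_rtrancl[OF c1, of "(c2, (xs @ zs) @ ys)"] c2 unfolding L by simp
  then have "admissible ((xs @ zs) @ ys)"
   using simplify_steps_invariant[OF run] less.prems by simp
  moreover have "length ((xs @ zs) @ ys) < length L" unfolding L by simp
  ultimately obtain c' L' where "(simplify_step \<epsilon> SS)\<^sup>*\<^sup>* (c2, (xs @ zs) @ ys) (c', L')" "admissible L'"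
   "\<forall>P\<in>set Ps. length (filter (\<lambda>q. seg q \<in> carriers L') (steps P)) \<le> 1"
   using less.hyps[of "(xs @ zs) @ ys" c2] by blast
  then show ?thesis using rtranclp_trans[OF run] by blast
 qed
qed

lemma composite_edges_brauer: "composite_edges SS \<in> brauer r t"
proof -
 have un: "\<Union> (composite_edges SS) = vertices r t"
  unfolding composite_edges_eq ends_Ps[symmetric] set_ends by simp
 have "disjoint (composite_edges SS)"
 proof -
  have disj: "P = Q" if "distinct (ends Rs)" "P \<in> set Rs" "Q \<in> set Rs" "x \<in> {fst P, dst P}" "x \<in> {fst Q, dst Q}"
   for Rs and P Q :: "(vertex, segment, node) strand" and x
   using that
  proof (induction Rs)
   case (Cons R Rs)
   have "{fst R, dst R} \<inter> set (ends Rs) = {}" "distinct (ends Rs)" using Cons.prems(1) by (cases R; auto)+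
   moreover have "x \<in> set (ends Rs)" if "X \<in> set Rs" "x \<in> {fst X, dst X}" for X
    using that unfolding set_ends by blast
   ultimately have no: "x \<notin> {fst R, dst R}" if "X \<in> set Rs" "x \<in> {fst X, dst X}" for X
    using that by blast
   show ?case
   proof (cases "P = R \<or> Q = R")
    case True
    then show ?thesis using no Cons.prems by (metis set_ConsD)
   next
    case False
    then show ?thesis using Cons.IH Cons.prems by (cases R) auto
   qed
  qed simp
  have same: "e = e'" if e: "e \<in> composite_edges SS" "e' \<in> composite_edges SS" and x: "x \<in> e" "x \<in> e'" for e e' x
  proof -
   obtain P Q where "P \<in> set Ps" "e = {fst P, dst P}" "Q \<in> set Ps" "e' = {fst Q, dst Q}"
    using e unfolding composite_edges_eq by blast
   then show ?thesis using disj[OF distinct_ends_strands, of P Q x] x by simp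
  qed
  show ?thesis unfolding disjoint_def
  proof (intro ballI impI)
   fix e e' assume "e \<in> composite_edges SS" "e' \<in> composite_edges SS" "e \<noteq> e'"
   then show "e \<inter> e' = {}" using same by (metis disjoint_iff)
  qed
 qed
 moreover have "card e = 2" if e: "e \<in> composite_edges SS" for e
 proof -
  obtain P where P: "P \<in> set Ps" "e = {fst P, dst P}" using e unfolding composite_edges_eq by blast
  then show ?thesis using ends_distinct[of "fst P" "steps P" "dst P"] by simp
 qed
 moreover have "{} \<notin> composite_edges SS" unfolding composite_edges_eq by auto
 ultimately show ?thesis using un unfolding brauer_diagrams_def partition_on_def by blast
qed

text \<open>Ensures that the choice in \<open>compose_diagrams\<close> is an actual composite. With
  at most one marking left on a strand, balance forces a bead on a cup, an arrow on a cap and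
  nothing on a through string.\<close>

lemma composite_exists: "\<exists>c D. composite \<delta> \<epsilon> r t D1 D2 c D"
proof -
 obtain c L where run: "(simplify_step \<epsilon> SS)\<^sup>*\<^sup>* (\<delta> ^ card (closed_loops SS), initial_markings) (c, L)"
  and adm: "admissible L" and one: "\<forall>P\<in>set Ps. length (filter (\<lambda>q. seg q \<in> carriers L) (steps P)) \<le> 1"
  using simplification_exists[OF admissible_initial] by blast
 have dL: "distinct (map carrier_edge L)" using adm by (simp add: admissible_def)
 have ex: "\<exists>M. composite_marking SS m M" if m: "m \<in> set L" for m
 proof -
  obtain P q where P: "P \<in> set Ps" "q \<in> set (steps P)" "seg q = carrier_edge m"
   using carrier_on_strand[OF adm m] by blast
  show ?thesis
  proof (cases m)
   case (Bead s')
   then have "s' \<in> set (segs (steps P))" using P by force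
   then show ?thesis using marking_Bead[OF P(1)] Bead by blast
  next
   case (Arrow s' a)
   then have "a = fst q \<or> a = dst q"
    using strand_proper[OF P(1), of L] adm m P unfolding proper_def admissible_def by auto
   then show ?thesis using marking_ArrowI[OF P(1,2)] P(3) Arrow by auto
  qed
 qed
 define \<phi> where "\<phi> m = (SOME M. composite_marking SS m M)" for m
 have \<phi>: "composite_marking SS m (\<phi> m)" if "m \<in> set L" for m
  unfolding \<phi>_def by (rule someI_ex[OF ex[OF that]])
 define D where "D = (composite_edges SS, map \<phi> L)"
 have all: "list_all2 (composite_marking SS) L (snd D)"
  unfolding D_def by (simp add: list_all2_map2 list.rel_refl_strong \<phi>)
 have car: "carrier_edge (\<phi> m) = edge_of (carrier_edge m)" if "m \<in> set L" for m
  by (rule marking_carrier[OF adm that \<phi>[OF that]])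
 have inj: "inj_on edge_of (carriers L)"
 proof (rule inj_onI)
  fix k k' assume k: "k \<in> carriers L" "k' \<in> carriers L" "edge_of k = edge_of k'"
  obtain P q where P: "P \<in> set Ps" "q \<in> set (steps P)" "seg q = k" using carrier_on_strand[OF adm] k(1) by blast
  obtain Q q' where Q: "Q \<in> set Ps" "q' \<in> set (steps Q)" "seg q' = k'" using carrier_on_strand[OF adm] k(2) by blast
  have "edge_of k = {fst P, dst P}" by (rule edge_of_eq[OF P(1)]) (use P in force)
  moreover have "edge_of k' = {fst Q, dst Q}" by (rule edge_of_eq[OF Q(1)]) (use Q in force)
  ultimately have "{fst P, dst P} = {fst Q, dst Q}" using k(3) by simp
  moreover have "inj_on (\<lambda>P. {fst P, dst P}) (set Ps)"
   using distinct_endpoint_sets[OF distinct_ends_strands] by (simp add: distinct_map)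
  ultimately have "P = Q" using P(1) Q(1) by (auto dest: inj_onD)
  have "q \<in> set (filter (\<lambda>q. seg q \<in> carriers L) (steps P))" "q' \<in> set (filter (\<lambda>q. seg q \<in> carriers L) (steps P))"
   using P Q k \<open>P = Q\<close> by auto
  moreover have "length (filter (\<lambda>q. seg q \<in> carriers L) (steps P)) \<le> 1" using one P(1) by blast
  ultimately have "q = q'"
   by (cases "filter (\<lambda>q. seg q \<in> carriers L) (steps P)") auto
  then show "k = k'" using P Q by simp
 qed
 have carD: "map carrier_edge (snd D) = map edge_of (map carrier_edge L)"
  unfolding D_def using car by simp
 have kinds: "beads L (steps P) + arrows L (steps P) \<le> 1"
  "beads L (steps P) + 1 = arrows L (steps P) + (if is_top (fst P) then 1 else 0) + (if is_top (dst P) then 1 else 0)"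
  if P: "P \<in> set Ps" for P
 proof -
  show "beads L (steps P) + arrows L (steps P) \<le> 1" using one P length_marked[OF dL] by metis
  show "beads L (steps P) + 1 = arrows L (steps P) + (if is_top (fst P) then 1 else 0) + (if is_top (dst P) then 1 else 0)"
   using adm P unfolding admissible_def balanced_def by blast
 qed
 have beads_pos: "0 < beads L st" if "q \<in> set st" "Bead (seg q) \<in> set L" for q st
  using that unfolding beads_def by (auto simp: filter_empty_conv)
 have arrows_pos: "0 < arrows L st" if "q \<in> set st" "Arrow (seg q) a \<in> set L" for q st a
  using that unfolding arrows_def by (auto simp: filter_empty_conv)
 have "D \<in> marked r t"
 proof -
  have "carriers (snd D) = {e \<in> composite_edges SS. is_cup e \<or> is_cap e}"
  proof (intro set_eqI iffI)
   fix e assume "e \<in> carriers (snd D)"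
   then have "e \<in> set (map carrier_edge (snd D))" by simp
   then obtain m where m: "m \<in> set L" "e = edge_of (carrier_edge m)" unfolding carD by auto
   obtain P q where P: "P \<in> set Ps" "q \<in> set (steps P)" "seg q = carrier_edge m"
    using carrier_on_strand[OF adm m(1)] by blast
   have e: "e = {fst P, dst P}" unfolding m(2) by (rule edge_of_eq[OF P(1)]) (use P in force)
   have "0 < beads L (steps P) + arrows L (steps P)"
    using beads_pos[OF P(2)] arrows_pos[OF P(2)] m(1) P(3) by (cases m) auto
   then have "is_top (fst P) = is_top (dst P)" using kinds[OF P(1)] by (auto split: if_splits)
   then show "e \<in> {e \<in> composite_edges SS. is_cup e \<or> is_cap e}"
    unfolding composite_edges_eq e using P(1) by (auto simp: cup_cap_iff)
  next
   fix e assume "e \<in> {e \<in> composite_edges SS. is_cup e \<or> is_cap e}"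
   then obtain P where P: "P \<in> set Ps" "e = {fst P, dst P}" "is_top (fst P) = is_top (dst P)"
    unfolding composite_edges_eq by (auto simp: cup_cap_iff)
   have "length (filter (\<lambda>q. seg q \<in> carriers L) (steps P)) \<noteq> 0"
    using kinds[OF P(1)] P(3) unfolding length_marked[OF dL] by (auto split: if_splits)
   then obtain q where q: "q \<in> set (steps P)" "seg q \<in> carriers L" by (auto simp: filter_empty_conv)
   have "edge_of (seg q) = e" unfolding P(2) by (rule edge_of_eq[OF P(1)]) (use q in force)
   then have "e \<in> set (map carrier_edge (snd D))" unfolding carD using q(2) by auto
   then show "e \<in> carriers (snd D)" by simp
  qed
  moreover have "distinct (map carrier_edge (snd D))"
   unfolding carD using comp_inj_on[of carrier_edge "set L" edge_of] inj dL by (simp add: distinct_map)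
  moreover have "is_cup e" if M: "Bead e \<in> set (snd D)" for e
  proof -
   obtain m where m: "m \<in> set L" "composite_marking SS m (Bead e)"
    using list_all2_set2[OF all M] by blast
   obtain P q where P: "P \<in> set Ps" "q \<in> set (steps P)" "seg q = carrier_edge m"
    using carrier_on_strand[OF adm m(1)] by blast
   have e: "e = {fst P, dst P}"
    using marking_carrier[OF adm m] edge_of_eq[OF P(1), of "carrier_edge m"] P by force
   have "Bead (seg q) \<in> set L"
   proof (cases m)
    case (Arrow s' a)
    then show ?thesis using marking_Arrow[OF P(1,2), of a "Bead e"] P(3) m by auto
   qed (use m(1) P(3) in auto)
   then have "0 < beads L (steps P)" using beads_pos[OF P(2)] by blast
   then show ?thesis using kinds[OF P(1)] unfolding e by (auto simp: cup_cap_iff split: if_splits)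
  qed
  moreover have "is_cap e \<and> x \<in> e" if M: "Arrow e x \<in> set (snd D)" for e x
  proof -
   obtain m where m: "m \<in> set L" "composite_marking SS m (Arrow e x)"
    using list_all2_set2[OF all M] by blast
   obtain P q where P: "P \<in> set Ps" "q \<in> set (steps P)" "seg q = carrier_edge m"
    using carrier_on_strand[OF adm m(1)] by blast
   have e: "e = {fst P, dst P}"
    using marking_carrier[OF adm m] edge_of_eq[OF P(1), of "carrier_edge m"] P by force
   obtain a where a: "m = Arrow (seg q) a"
   proof (cases m)
    case (Bead s')
    then have "s' \<in> set (segs (steps P))" using P by force
    then show ?thesis using marking_Bead[OF P(1), of s' "Arrow e x"] Bead m by auto
   qed (use P(3) that in auto)
   have "0 < arrows L (steps P)" using arrows_pos[OF P(2)] m(1) a by blast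
   moreover have "x \<in> e" using marking_Arrow[OF P(1,2), of a "Arrow e x"] m(2) a e by auto
   ultimately show ?thesis using kinds[OF P(1)] unfolding e by (auto simp: cup_cap_iff split: if_splits)
  qed
  ultimately show ?thesis unfolding marked_diagrams_def using composite_edges_brauer by (auto simp: D_def)
 qed
 then have "composite \<delta> \<epsilon> r t D1 D2 c D"
  unfolding composite_def Let_def using run all by (auto simp: D_def)
 then show ?thesis by blast
qed

end

text \<open>Contraction gives a power of \<delta> times the state of the initial markings. The
  exponent is the number of closed loops, so the power is the scalar from which the simplification
  starts.\<close>

lemma (in supermatrix) composite_matrix:
 assumes D: "D1 \<in> marked r s" "D2 \<in> marked s t" and c: "composite \<delta> \<epsilon> r t D1 D2 c D"
 shows "(\<Sum>l\<in>indices N s. dgm_matrix r s D1 is l * dgm_matrix s t D2 l js) = c * dgm_matrix r t D is js"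
proof -
 interpret stacking N p d g \<epsilon> \<delta> r s t D1 D2 by unfold_locales (rule D)+
 obtain Ps Ls where P: "complete_system SS Ps Ls" "set (ends Ps) = vertices r t"
  "\<And>P. P \<in> set Ps \<Longrightarrow> balanced is_top LL P \<and> proper LL P"
  "\<And>is js. (\<Sum>l\<in>indices N s. dgm_matrix r s D1 is l * dgm_matrix s t D2 l js) =
   \<delta> ^ length Ls * (koszul (invs WW (degree (\<lambda>x. vertex_label is js (case_sum id id x)))
    (sequence LL (map (map_strand outer_point id id) Ps)))
   * prod_list (map (weight is_top LL (vertex_label is js)) Ps))" by (rule glued) blast
 interpret decomposed N p d g \<epsilon> \<delta> r s t D1 D2 Ps Ls by unfold_locales (use P in auto)
 from c obtain L where L: "D \<in> marked r t" "fst D = composite_edges SS"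
  "(simplify_step \<epsilon> SS)\<^sup>*\<^sup>* (\<delta> ^ card (closed_loops SS), initial_markings) (c, L)"
  "list_all2 (composite_marking SS) L (snd D)" unfolding composite_def Let_def by blast
 note inv = simplify_steps_invariant[OF L(3), of "vertex_label is js", unfolded fst_conv snd_conv, OF admissible_initial]
 show ?thesis unfolding P(4) state_initial_markings
  using inv state_final[OF _ L(4,1,2), of "is" js] card_closed_loops by simp
qed

lemma (in supermatrix) composite_exists:
 assumes D: "D1 \<in> marked r s" "D2 \<in> marked s t"
 shows "\<exists>c D. composite \<delta> \<epsilon> r t D1 D2 c D"
proof -
 interpret stacking N p d g \<epsilon> \<delta> r s t D1 D2 by unfold_locales (rule D)+
 obtain Ps Ls where P: "complete_system SS Ps Ls" "set (ends Ps) = vertices r t"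
  "\<And>P. P \<in> set Ps \<Longrightarrow> balanced is_top LL P \<and> proper LL P" by (rule glued) blast
 interpret decomposed N p d g \<epsilon> \<delta> r s t D1 D2 Ps Ls by unfold_locales (use P in auto)
 show ?thesis by (rule composite_exists)
qed

section \<open>Matrices of diagrams\<close>

text \<open>Each letter of the word lies on exactly one strand, so the sequence is a permutation of
  the word and sums over their letters agree.\<close>

lemma sequence_word:
 assumes "D \<in> marked r s" "enumerates es (fst D)"
 shows "set (sequence (snd D) (map estrand es)) = set (word r s (snd D))"
  "distinct (sequence (snd D) (map estrand es))" "distinct (word r s (snd D))"
proof -
 note E = markedD(1)[OF assms(1)]
 have "fst D \<inter> carriers (snd D) = carriers (snd D)" using markedD(3)[OF assms(1)] by blast
 then show "set (sequence (snd D) (map estrand es)) = set (word r s (snd D))"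
  unfolding set_sequence set_word enumerates_ends(2)[OF assms(2) E] enumerates_segs(2)[OF assms(2)] by simp
 show "distinct (sequence (snd D) (map estrand es))"
  using edge_strands_valid[OF assms] by (simp add: valid_def)
 show "distinct (word r s (snd D))" by (rule distinct_word[OF markedD(2)[OF assms(1)]])
qed

lemma sum_list_reorder:
 fixes f :: "'a \<Rightarrow> 'b::comm_monoid_add"
 assumes "distinct xs" "distinct ys" "set xs = set ys"
 shows "sum_list (map f xs) = sum_list (map f ys)"
 using assms by (simp add: sum_list_distinct_conv_sum_set)

section \<open>Parities of labels, and tensor products of diagrams\<close>

definition parity :: "(nat \<Rightarrow> bit) \<Rightarrow> nat list \<Rightarrow> bit" where
 "parity p is = sum_list (map p is)"

lemma parity_simps [simp]:
 "parity p [] = 0" "parity p (i # is) = p i + parity p is"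
 "parity p (is @ js) = parity p is + parity p js" "parity p (rev is) = parity p is"
 by (simp_all add: parity_def sum_list_rev flip: rev_map)

lemma map_nth_upt: "length is = r \<Longrightarrow> map (\<lambda>i. is ! i) [0..<r] = is"
 using map_nth[of "is"] by simp

fun is_mark :: "('p, 's) letter \<Rightarrow> bool" where
 "is_mark (Pt x) = False"
| "is_mark (Mk s) = True"

lemma shift_vertex_inject [simp]: "shift_vertex r s u = shift_vertex r s w \<longleftrightarrow> u = w"
 by (cases u; cases w) auto

lemma is_top_shift [simp]: "is_top (shift_vertex r s v) = is_top v"
 by (cases v) auto

lemma shift_notin_vertices: "shift_vertex r s v \<notin> vertices r s"
 by (cases v) (auto simp: vertices_def)

lemma vertices_add: "vertices (r + r') (s + s') = vertices r s \<union> shift_vertex r s ` vertices r' s'"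
proof (intro set_eqI iffI)
 fix v assume v: "v \<in> vertices (r + r') (s + s')"
 show "v \<in> vertices r s \<union> shift_vertex r s ` vertices r' s'"
 proof (cases v)
  case (Top i)
  show ?thesis
  proof (cases "i < r")
   case False
   then have "v = shift_vertex r s (Top (i - r))" "Top (i - r) \<in> vertices r' s'"
    using v Top by (auto simp: vertices_def)
   then show ?thesis by blast
  qed (auto simp: Top vertices_def)
 next
  case (Bot i)
  show ?thesis
  proof (cases "i < s")
   case False
   then have "v = shift_vertex r s (Bot (i - s))" "Bot (i - s) \<in> vertices r' s'"
    using v Bot by (auto simp: vertices_def)
   then show ?thesis by blast
  qed (auto simp: Bot vertices_def)
 qed
qed (auto simp: vertices_def)

lemma tensor_brauer:
 assumes "E1 \<in> brauer r s" "E2 \<in> brauer r' s'"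
 shows "E1 \<union> (`) (shift_vertex r s) ` E2 \<in> brauer (r + r') (s + s')"
proof -
 have inj: "inj (shift_vertex r s)" by (simp add: inj_def)
 have 1: "\<Union> E1 = vertices r s" "disjoint E1" "{} \<notin> E1" "\<Union> E2 = vertices r' s'" "disjoint E2" "{} \<notin> E2"
  using assms by (auto simp: brauer_diagrams_def partition_on_def)
 have u: "\<Union> (E1 \<union> (`) (shift_vertex r s) ` E2) = vertices (r + r') (s + s')"
  unfolding Union_Un_distrib vertices_add 1(1,4)[symmetric] by blast
 have d: "disjoint (E1 \<union> (`) (shift_vertex r s) ` E2)"
 proof (rule disjoint_union)
  show "disjoint ((`) (shift_vertex r s) ` E2)"
   unfolding disjoint_def
  proof (intro ballI impI)
   fix a b assume "a \<in> (`) (shift_vertex r s) ` E2" "b \<in> (`) (shift_vertex r s) ` E2" "a \<noteq> b"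
   then obtain a' b' where ab: "a' \<in> E2" "b' \<in> E2" "a = shift_vertex r s ` a'" "b = shift_vertex r s ` b'" "a' \<noteq> b'"
    by blast
   then have "a' \<inter> b' = {}" using 1(5) by (auto simp: disjoint_def)
   then show "a \<inter> b = {}" unfolding ab(3,4) image_Int[OF inj, symmetric] by simp
  qed
  show "\<Union> E1 \<inter> \<Union> ((`) (shift_vertex r s) ` E2) = {}"
   unfolding 1(1) using shift_notin_vertices by auto
 qed (rule 1)
 have "card e = 2" if "e \<in> E1 \<union> (`) (shift_vertex r s) ` E2" for e
 proof -
  from that consider "e \<in> E1" | e' where "e' \<in> E2" "e = shift_vertex r s ` e'" by blast
  then show ?thesis
  proof cases
   case 1
   then show ?thesis by (rule brauer_edge(2)[OF assms(1)])
  next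
   case 2
   then show ?thesis using brauer_edge(2)[OF assms(2) 2(1)] inj by (simp add: card_image inj_on_subset)
  qed
 qed
 moreover have "{} \<notin> E1 \<union> (`) (shift_vertex r s) ` E2" using 1 by auto
 ultimately show ?thesis using u d unfolding brauer_diagrams_def partition_on_def by blast
qed

lemma shift_cup_cap: "is_cup (shift_vertex r s ` e) \<longleftrightarrow> is_cup e" "is_cap (shift_vertex r s ` e) \<longleftrightarrow> is_cap e"
proof -
 have h: "shift_vertex r s v \<in> range Top \<longleftrightarrow> v \<in> range Top" "shift_vertex r s v \<in> range Bot \<longleftrightarrow> v \<in> range Bot" for v
  by (cases v; auto)+
 show "is_cup (shift_vertex r s ` e) \<longleftrightarrow> is_cup e" "is_cap (shift_vertex r s ` e) \<longleftrightarrow> is_cap e"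
  unfolding is_cup_def is_cap_def image_subset_iff h by blast+
qed

lemma shift_edge_notin:
 assumes "E \<in> brauer r s"
 shows "shift_vertex r s ` e \<notin> E"
proof
 assume "shift_vertex r s ` e \<in> E"
 then have "shift_vertex r s ` e \<subseteq> vertices r s" "shift_vertex r s ` e \<noteq> {}"
  using brauer_edge[OF assms, of "shift_vertex r s ` e"] by auto
 then show False using shift_notin_vertices by blast
qed

lemma Arrow_map_marking: "inj f \<Longrightarrow> Arrow (f e) z \<in> map_marking f h ` X \<longleftrightarrow> (\<exists>x. z = h x \<and> Arrow e x \<in> X)"
proof -
 assume "inj f"
 then have "Arrow (f e) z = map_marking f h m \<longleftrightarrow> (\<exists>x. z = h x \<and> m = Arrow e x)" for m
  by (cases m) (auto dest: injD)
 then show ?thesis by (auto simp: image_iff)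
qed

lemma tensor_marked:
 assumes D1: "D1 \<in> marked r s" and D2: "D2 \<in> marked r' s'"
 shows "tensor_diagrams r s D1 D2 \<in> marked (r + r') (s + s')"
proof -
 let ?sh = "shift_vertex r s"
 let ?L = "snd D1 @ map (map_marking ((`) ?sh) ?sh) (snd D2)"
 note m1 = markedD[OF D1] and m2 = markedD[OF D2]
 have inj: "inj ?sh" by (simp add: inj_def)
 then have inj': "inj ((`) ?sh)" by (simp add: inj_image_eq_iff inj_def)
 have car: "map carrier_edge ?L = map carrier_edge (snd D1) @ map ((`) ?sh) (map carrier_edge (snd D2))"
  by (simp add: carrier_map_marking)
 have "distinct (map carrier_edge ?L)"
 proof -
  have "?sh ` e \<notin> carriers (snd D1)" for e using shift_edge_notin[OF m1(1)] m1(3) by blast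
  then have "set (map carrier_edge (snd D1)) \<inter> set (map ((`) ?sh) (map carrier_edge (snd D2))) = {}" by auto
  moreover have "distinct (map ((`) ?sh) (map carrier_edge (snd D2)))"
   unfolding distinct_map[of "(`) ?sh"] using m2(2) inj' by (blast intro: inj_on_subset)
  ultimately show ?thesis unfolding car using m1(2) by simp
 qed
 moreover have "carriers ?L = {e \<in> fst D1 \<union> (`) ?sh ` fst D2. is_cup e \<or> is_cap e}"
 proof -
  have "carriers ?L = carriers (snd D1) \<union> (`) ?sh ` carriers (snd D2)"
   using arg_cong[OF car, of set] by (simp add: image_Un image_image)
  also have "\<dots> = {e \<in> fst D1 \<union> (`) ?sh ` fst D2. is_cup e \<or> is_cap e}"
   unfolding m1(3) m2(3) using shift_cup_cap by blast
  finally show ?thesis .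
 qed
 moreover have "is_cup e" if e: "Bead e \<in> set ?L" for e
 proof -
  consider "Bead e \<in> set (snd D1)" | m where "m \<in> set (snd D2)" "Bead e = map_marking ((`) ?sh) ?sh m"
   using e by auto
  then show ?thesis
  proof cases
   case 2
   from 2(2) obtain e' where "m = Bead e'" "e = ?sh ` e'" by (cases m) auto
   then show ?thesis using m2(4) 2 shift_cup_cap by blast
  qed (rule m1(4))
 qed
 moreover have "is_cap e \<and> x \<in> e" if e: "Arrow e x \<in> set ?L" for e x
 proof -
  consider "Arrow e x \<in> set (snd D1)" | m where "m \<in> set (snd D2)" "Arrow e x = map_marking ((`) ?sh) ?sh m"
   using e by auto
  then show ?thesis
  proof cases
   case 2
   from 2(2) obtain e' x' where "m = Arrow e' x'" "e = ?sh ` e'" "x = ?sh x'" by (cases m) auto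
   then show ?thesis using m2(5) 2 shift_cup_cap by blast
  qed (rule m1(5))
 qed
 ultimately show ?thesis
  unfolding tensor_diagrams_def marked_diagrams_def using tensor_brauer[OF m1(1) m2(1)] by blast
qed

lemma enumerates_tensor:
 assumes "enumerates es1 E1" "enumerates es2 E2" "E1 \<in> brauer r s"
 shows "enumerates (es1 @ map (map_prod (shift_vertex r s) (shift_vertex r s)) es2)
  (E1 \<union> (`) (shift_vertex r s) ` E2)"
proof -
 let ?sh = "shift_vertex r s"
 have e: "edge (map_prod ?sh ?sh q) = ?sh ` edge q" for q by (cases q) simp
 have inj: "inj ((`) ?sh)" by (simp add: inj_image_eq_iff inj_def)
 have 1: "map edge (es1 @ map (map_prod ?sh ?sh) es2) = map edge es1 @ map ((`) ?sh) (map edge es2)"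
  by (simp add: e)
 have E: "set (map edge es1) = E1" "set (map edge es2) = E2"
  "distinct (map edge es1)" "distinct (map edge es2)"
  using assms by (simp_all add: enumerates_def)
 have "distinct (map edge (es1 @ map (map_prod ?sh ?sh) es2))"
  unfolding 1 distinct_append distinct_map[of "(`) ?sh"] set_map[of "(`) ?sh"] E
  using E inj shift_edge_notin[OF assms(3)] by (auto intro: inj_on_subset)
 moreover have "edge ` set (es1 @ map (map_prod ?sh ?sh) es2) = E1 \<union> (`) ?sh ` E2"
  unfolding E(1,2)[symmetric] by (simp add: image_Un image_image e)
 moreover have "\<forall>(x, y)\<in>set (es1 @ map (map_prod ?sh ?sh) es2). x \<noteq> y"
  using assms(1,2) by (auto simp: enumerates_def)
 ultimately show ?thesis unfolding enumerates_def by blast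
qed

context supermatrix
begin

lemma state_nonzero_weights: "state tp W L lab Ps \<noteq> 0 \<Longrightarrow> P \<in> set Ps \<Longrightarrow> weight tp L lab P \<noteq> 0"
 unfolding state_def by (auto simp: prod_list_zero_iff)

lemma sequence_even:
 assumes "\<And>P. P \<in> set Ps \<Longrightarrow> balanced tp L P \<and> weight tp L lab P \<noteq> 0" "distinct (map carrier_edge L)"
 shows "total (degree lab) (sequence L Ps) = 0"
 using assms(1)
proof (induction Ps)
 case (Cons P Ps)
 have "total (degree lab) (letters L P) = 0"
  by (rule weight_nonzero[OF _ assms(2)]) (use Cons.prems[of P] in auto)
 then show ?case using Cons by simp
qed simp

lemma total_word:
 assumes "length is = r" "length js = s"
 shows "total (degree (vertex_label is js)) (word r s L) = parity p is + of_nat (length L) * d + parity p js"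
proof -
 have t: "total (degree lab) (map (\<lambda>i. Pt (f i)) xs) = sum_list (map (\<lambda>i. p (lab (f i))) xs)"
  for lab :: "vertex \<Rightarrow> nat" and f :: "nat \<Rightarrow> vertex" and xs
  by (simp add: total_def comp_def)
 have u: "sum_list (map (\<lambda>i. p (l ! i)) [0..<n]) = parity p l" if "length l = n" for l n
  unfolding parity_def using arg_cong[OF map_nth_upt[OF that], of "\<lambda>l. sum_list (map p l)"]
  by (simp add: comp_def)
 have "total (degree (vertex_label is js)) (map (\<lambda>m. Mk (carrier_edge m)) L) = of_nat (length L) * d"
  by (induction L) (auto simp: algebra_simps)
 then show ?thesis unfolding word_def rev_map[symmetric] total_simps t
  by (simp add: u[OF assms(1)] u[OF assms(2)] add.assoc)
qed

text \<open>For a nonzero entry the letters of every strand are even, hence so is the whole word;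
  its total degree consists of the two rows and the markings.\<close>

lemma dgm_matrix_homogeneous:
 assumes D: "D \<in> marked r s" and "length is = r" "length js = s" "dgm_matrix r s D is js \<noteq> 0"
 shows "parity p is + parity p js = of_nat (length (snd D)) * d"
proof -
 let ?lab = "vertex_label is js" and ?es = "enumeration (fst D)"
 note en = enumeration[OF markedD(1)[OF D]]
 have "total (degree ?lab) (sequence (snd D) (map estrand ?es)) = 0"
  by (rule sequence_even)
   (use assms(4) estrand_balanced(1)[OF D en] state_nonzero_weights markedD(2)[OF D]
    in \<open>unfold dgm_matrix_def, blast+\<close>)
 moreover have "total (degree ?lab) (sequence (snd D) (map estrand ?es)) = total (degree ?lab) (word r s (snd D))"
  unfolding total_def by (rule sum_list_reorder) (use sequence_word[OF D en] in auto)
 ultimately have "parity p is + of_nat (length (snd D)) * d + parity p js = 0"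
  using total_word[OF assms(2,3)] by metis
 then show ?thesis by (metis bit_eq_add_iff add.commute add.assoc add_0_right)
qed

text \<open>The word of the tensor product is top row 1, top row 2, markings 1, markings 2, bottom
  row 2, bottom row 1. A letter in top row 1 is preceded by nothing of the second diagram, a marking
  of the first by top row 2 alone, and a letter in bottom row 1 by everything of the second diagram,
  which is even. So only the markings of the first diagram produce a sign.\<close>

lemma dgm_matrix_tensor:
 assumes D1: "D1 \<in> marked r s" and D2: "D2 \<in> marked r' s'"
  and len: "length is = r" "length js = s" "length is' = r'" "length js' = s'"
 shows "dgm_matrix (r + r') (s + s') (tensor_diagrams r s D1 D2) (is @ is') (js @ js') =
  koszul (of_nat (length (snd D1)) * d * parity p is') * dgm_matrix r s D1 is js * dgm_matrix r' s' D2 is' js'"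
proof -
 let ?sh = "shift_vertex r s"
 let ?im = "(`) ?sh :: vertex set \<Rightarrow> vertex set"
 let ?D = "tensor_diagrams r s D1 D2"
 note E1 = markedD(1)[OF D1] and E2 = markedD(1)[OF D2]
 define es1 es2 where "es1 = enumeration (fst D1)" and "es2 = enumeration (fst D2)"
 note en1 = enumeration[OF E1, folded es1_def] and en2 = enumeration[OF E2, folded es2_def]
 let ?lab = "vertex_label (is @ is') (js @ js')" and ?lab1 = "vertex_label is js" and ?lab2 = "vertex_label is' js'"
 let ?S1 = "map estrand es1" and ?S2 = "map estrand es2"
 let ?f = "map_letter ?sh ?im"
 let ?W = "word (r + r') (s + s') (snd ?D)" and ?W1 = "word r s (snd D1)" and ?W2 = "word r' s' (snd D2)"
 let ?Q1 = "sequence (snd D1) ?S1" and ?Q2 = "sequence (snd D2) ?S2"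
 let ?w = "weight is_top (snd ?D) ?lab" and ?w1 = "weight is_top (snd D1) ?lab1" and ?w2 = "weight is_top (snd D2) ?lab2"
 let ?p1 = "prod_list (map ?w1 ?S1)" and ?p2 = "prod_list (map ?w2 ?S2)"
 let ?deg = "degree ?lab :: (vertex, vertex set) letter \<Rightarrow> bit"
 let ?b = "before ?W ?deg" and ?less = "\<lambda>x y. pos ?W x < pos ?W y"
 note tm = tensor_marked[OF D1 D2]
 have inj: "inj ?sh" by (simp add: inj_def)
 have inj': "inj ?im" by (rule injI) (simp add: inj_image_eq_iff[OF inj])
 have injf: "inj ?f" by (rule letter.inj_map[OF inj inj'])
 have fstD: "fst ?D = fst D1 \<union> ?im ` fst D2" by (simp add: tensor_diagrams_def)
 have sndD: "snd ?D = snd D1 @ map (map_marking ?im ?sh) (snd D2)" by (simp add: tensor_diagrams_def)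
 have notin1: "?im e \<notin> carriers (snd D1)" for e
  using shift_edge_notin[OF E1] markedD(3)[OF D1] by blast
 have carD: "carriers (snd ?D) = carriers (snd D1) \<union> ?im ` carriers (snd D2)"
  unfolding sndD by (simp add: image_Un image_image carrier_map_marking)
 have car2: "?im e \<in> carriers (snd ?D) \<longleftrightarrow> e \<in> carriers (snd D2)" for e
  unfolding carD Un_iff inj_image_mem_iff[OF inj'] using notin1[of e] by (simp only: simp_thms)
 have car1: "e \<in> carriers (snd ?D) \<longleftrightarrow> e \<in> carriers (snd D1)" if "e \<in> fst D1" for e
  unfolding carD using that shift_edge_notin[OF E1] by blast
 have en: "enumerates (es1 @ map (map_prod ?sh ?sh) es2) (fst ?D)"
  unfolding fstD by (rule enumerates_tensor[OF en1 en2 E1])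
 have es_strand: "estrand (map_prod ?sh ?sh q) = map_strand ?sh ?im ?sh (estrand q)" for q
  by (cases q) simp
 have strands: "map estrand (es1 @ map (map_prod ?sh ?sh) es2) = ?S1 @ map (map_strand ?sh ?im ?sh) ?S2"
  by (simp add: es_strand)
 have seq: "sequence (snd ?D) (map estrand (es1 @ map (map_prod ?sh ?sh) es2)) = ?Q1 @ map ?f ?Q2"
 proof -
  have "sequence (snd ?D) ?S1 = ?Q1"
   by (rule sequence_cong, rule car1) (simp add: enumerates_segs(2)[OF en1])
  then show ?thesis unfolding strands sequence_simps
   using sequence_map_strand[of ?im "snd ?D" "snd D2", OF car2, of ?sh ?sh ?S2] by simp
 qed
 have labs: "?lab v = ?lab1 v" if "v \<in> vertices r s" for v
  using that len by (cases v) (auto simp: vertices_def nth_append)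
 have labsh: "?lab (?sh v) = ?lab2 v" for v
  using len by (cases v) (auto simp: nth_append)
 have w1: "map (?w) ?S1 = map (?w1) ?S1"
 proof (rule map_cong[OF HOL.refl])
  fix P assume P: "P \<in> set ?S1"
  then obtain x y where xy: "(x, y) \<in> set es1" "P = estrand (x, y)" by auto
  have e: "{x, y} \<in> fst D1" using en1 imageI[OF xy(1), of edge] by (auto simp: enumerates_def)
  have "fst P \<in> vertices r s" "dst P \<in> vertices r s"
   using brauer_edge(1)[OF E1 e] xy(2) by auto
  then have "?w P = weight is_top (snd ?D) ?lab1 P"
   by (intro weight_cong) (simp_all add: labs)
  also have "\<dots> = ?w1 P"
  proof (rule weight_marking_cong)
   fix q t assume "q \<in> set (steps P)"
   then have q: "seg q \<in> fst D1" using e xy(2) by simp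
   have "Arrow (seg q) t \<notin> map_marking ?im ?sh ` X" for X
   proof
    assume "Arrow (seg q) t \<in> map_marking ?im ?sh ` X"
    then obtain m where "Arrow (seg q) t = map_marking ?im ?sh m" by blast
    then have "seg q = ?im (carrier_edge m)" by (metis carrier_edge.simps(2) carrier_map_marking)
    then show False using q shift_edge_notin[OF E1] by metis
   qed
   then show "Arrow (seg q) t \<in> set (snd ?D) \<longleftrightarrow> Arrow (seg q) t \<in> set (snd D1)"
    unfolding sndD by auto
  qed
  finally show "?w P = ?w1 P" .
 qed
 have arr2: "Arrow (?im e) z \<in> set (snd ?D) \<longleftrightarrow> (\<exists>x. z = ?sh x \<and> Arrow e x \<in> set (snd D2))" for e z
 proof -
  have "Arrow (?im e) z \<notin> set (snd D1)"
   using notin1[of e] by (metis carrier_edge.simps(2) imageI)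
  then show ?thesis unfolding sndD set_append set_map Un_iff Arrow_map_marking[OF inj'] by blast
 qed
 have w2: "?w (map_strand ?sh ?im ?sh P) = ?w2 P" for P
  by (rule weight_map_strand) (auto simp: labsh arr2)
 have weights: "prod_list (map (?w) (?S1 @ map (map_strand ?sh ?im ?sh) ?S2)) =
  ?p1 * ?p2"
  unfolding map_append prod_list.append w1 by (simp add: w2 comp_def)
 have M: "dgm_matrix (r + r') (s + s') ?D (is @ is') (js @ js') =
  koszul (invs ?W ?deg (?Q1 @ map ?f ?Q2)) *
   (?p1 * ?p2)"
  unfolding dgm_matrix_eq[OF tm en] state_def seq[unfolded strands, folded strands] weights[folded strands] ..
 have M1: "dgm_matrix r s D1 is js = koszul (invs ?W1 (degree ?lab1) ?Q1) * ?p1"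
  and M2: "dgm_matrix r' s' D2 is' js' = koszul (invs ?W2 (degree ?lab2) ?Q2) * ?p2"
  unfolding dgm_matrix_def state_def es1_def es2_def by simp_all
 show ?thesis
 proof (cases "?p2 = 0")
  case True
  then show ?thesis unfolding M M1 M2 by simp
 next
  case False
  have even2: "total (degree ?lab2) ?Q2 = 0"
  proof (rule sequence_even[where tp = is_top])
   fix P assume P: "P \<in> set ?S2"
   then have "?w2 P \<in> set (map (?w2) ?S2)"
    unfolding set_map[of "?w2"] by (rule imageI)
   then have "?w2 P \<noteq> 0" using False prod_list_zero_iff by metis
   then show "balanced is_top (snd D2) P \<and> ?w2 P \<noteq> 0"
    using estrand_balanced(1)[OF D2 en2 P] by blast
  qed (rule markedD(2)[OF D2])
  define T1 M1' B1 T2 M2' B2 where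
   "T1 = map (\<lambda>i. Pt (Top i) :: (vertex, vertex set) letter) [0..<r]"
   and "M1' = map (\<lambda>m. Mk (carrier_edge m) :: (vertex, vertex set) letter) (snd D1)"
   and "B1 = map (\<lambda>i. Pt (Bot i) :: (vertex, vertex set) letter) (rev [0..<s])"
   and "T2 = map (\<lambda>i. Pt (Top i) :: (vertex, vertex set) letter) [0..<r']"
   and "M2' = map (\<lambda>m. Mk (carrier_edge m) :: (vertex, vertex set) letter) (snd D2)"
   and "B2 = map (\<lambda>i. Pt (Bot i) :: (vertex, vertex set) letter) (rev [0..<s'])"
  let ?T2 = "map ?f T2" and ?M2 = "map ?f M2'" and ?B2 = "map ?f B2"
  have W1: "?W1 = T1 @ M1' @ B1" and W2: "?W2 = T2 @ M2' @ B2"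
   by (simp_all add: word_def T1_def M1'_def B1_def T2_def M2'_def B2_def)
  have W: "?W = T1 @ ?T2 @ M1' @ ?M2 @ ?B2 @ B1"
  proof -
   have "[0..<r + r'] = [0..<r] @ map (\<lambda>i. r + i) [0..<r']" "[0..<s + s'] = [0..<s] @ map (\<lambda>i. s + i) [0..<s']"
    using upt_add_eq_append[of 0 r r'] upt_add_eq_append[of 0 s s'] map_add_upt[of r r'] map_add_upt[of s s']
    by (simp_all add: add.commute)
   then show ?thesis unfolding word_def sndD T1_def M1'_def B1_def T2_def M2'_def B2_def
    by (simp add: carrier_map_marking rev_map comp_def)
  qed
  have dW: "distinct ?W" by (rule sequence_word(3)[OF tm en])
  have dW': "distinct (T1 @ ?T2 @ M1' @ ?M2 @ ?B2 @ B1)" using dW unfolding W .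
  have sQ1: "set ?Q1 = set T1 \<union> set M1' \<union> set B1" using sequence_word(1)[OF D1 en1] unfolding W1 by auto
  have sQ2: "set (map ?f ?Q2) = set ?T2 \<union> set ?M2 \<union> set ?B2"
   using sequence_word(1)[OF D2 en2] unfolding W2 by auto
  have deg1: "?deg l = degree ?lab1 l" if "l \<in> set ?Q1" for l
  proof -
   have "l \<in> Pt ` vertices r s \<union> Mk ` carriers (snd D1)"
    using that unfolding sequence_word(1)[OF D1 en1] set_word .
   then show ?thesis by (auto simp: labs)
  qed
  have deg2: "?deg (?f l) = degree ?lab2 l" for l by (cases l) (auto simp: labsh)
  have i1: "invs ?W ?deg ?Q1 = invs ?W1 (degree ?lab1) ?Q1"
  proof (rule invs_cong)
   define K where "K l \<longleftrightarrow> l \<in> set ?W1" for l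
   have "filter K ?W = ?W1"
   proof -
    have "filter K T1 = T1" "filter K M1' = M1'" "filter K B1 = B1"
     by (auto simp: K_def W1 intro!: filter_True)
    moreover have "filter K ?T2 = []" "filter K ?M2 = []" "filter K ?B2 = []"
     using dW' by (auto simp: K_def W1 filter_empty_conv)
    ultimately show ?thesis unfolding W W1 filter_append by simp
   qed
   then have W1f: "?W1 = filter K ?W" ..
   show "?less y x \<longleftrightarrow> pos ?W1 y < pos ?W1 x" if "x \<in> set ?Q1" "y \<in> set ?Q1" for x y
   proof -
    have "K x" "K y" using that unfolding K_def sequence_word(1)[OF D1 en1] .
    moreover from this have "x \<in> set ?W" "y \<in> set ?W" unfolding K_def by (auto simp: W W1)
    ultimately show ?thesis unfolding W1f by (simp only: pos_filter_less)
   qed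
  qed (rule deg1)
  have i2: "invs ?W ?deg (map ?f ?Q2) = invs ?W2 (degree ?lab2) ?Q2"
  proof -
   define K where "K l \<longleftrightarrow> l \<in> set (map ?f ?W2)" for l
   have fl: "filter K ?W = map ?f ?W2"
   proof -
    have "filter K ?T2 = ?T2" "filter K ?M2 = ?M2" "filter K ?B2 = ?B2"
     by (rule filter_True, force simp: K_def W2)+
    moreover have "filter K T1 = []" "filter K M1' = []" "filter K B1 = []"
     using dW' by (auto simp: K_def W2 filter_empty_conv)
    ultimately show ?thesis unfolding W W2 filter_append map_append by simp
   qed
   have inW: "x \<in> set ?W" "K x" if "x \<in> set (map ?f ?Q2)" for x
    using that sequence_word(1)[OF D2 en2] arg_cong[OF fl, of set] by (auto simp: K_def)
   have "invs ?W ?deg (map ?f ?Q2) = invs (filter K ?W) ?deg (map ?f ?Q2)"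
   proof (rule invs_cong)
    show "?less y x \<longleftrightarrow> pos (filter K ?W) y < pos (filter K ?W) x"
     if "x \<in> set (map ?f ?Q2)" "y \<in> set (map ?f ?Q2)" for x y
     using pos_filter_less[OF inW(1)[OF that(2)] inW(1)[OF that(1)] inW(2)[OF that(2)] inW(2)[OF that(1)]] ..
   qed (rule HOL.refl)
   also have "\<dots> = invs (map ?f ?W2) ?deg (map ?f ?Q2)" unfolding fl ..
   also have "\<dots> = invs ?W2 (degree ?lab2) ?Q2"
    by (rule invs_map[OF inj_on_subset[OF injf]]) (auto simp: deg2)
   finally show ?thesis .
  qed
  have tot2: "total ?deg (map ?f ?Q2) = 0"
   using even2 unfolding total_def by (simp add: comp_def deg2)
  have bef: "?b x (map ?f ?Q2) = (if is_mark x then parity p is' else 0)" if x: "x \<in> set ?Q1" for x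
  proof -
   have "?b x (map ?f ?Q2) = ?b x (map ?f ?W2)"
    unfolding before_def by (rule sum_list_reorder)
     (use sequence_word[OF D2 en2] injf in \<open>auto simp: distinct_map intro: inj_on_subset\<close>)
   also have "\<dots> = ?b x ?T2 + ?b x ?M2 + ?b x ?B2"
    unfolding W2 map_append before_simps by (simp add: add.assoc)
   finally have b: "?b x (map ?f ?Q2) = \<dots>" .
   have bt: "?b x Y = total ?deg Y" if "\<And>y. y \<in> set Y \<Longrightarrow> ?less y x" for Y
    using that by (induction Y) auto
   have b0: "?b x Y = 0" if "\<And>y. y \<in> set Y \<Longrightarrow> \<not> ?less y x" for Y
    using that by (induction Y) auto
   have tT: "total ?deg ?T2 = parity p is'"
    unfolding T2_def total_def parity_def using arg_cong[OF map_nth_upt[OF len(3)], of "\<lambda>l. sum_list (map p l)"] labsh[of "Top _"]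
    by (simp add: comp_def)
   have tot: "total ?deg ?T2 + total ?deg ?M2 + total ?deg ?B2 = 0"
   proof -
    have "total ?deg (map ?f ?W2) = total ?deg (map ?f ?Q2)"
     unfolding total_def by (rule sum_list_reorder)
      (use sequence_word[OF D2 en2] injf in \<open>auto simp: distinct_map intro: inj_on_subset\<close>)
    then show ?thesis unfolding tot2 W2 map_append total_simps by (simp add: add.assoc)
   qed
   from x consider "x \<in> set T1" | "x \<in> set M1'" | "x \<in> set B1" unfolding sQ1 by blast
   then show ?thesis
   proof cases
    case 1
    have lt: "pos ?W x < length T1" using pos_less[OF 1] 1 by (simp add: W pos_append)
    have nn: "\<not> ?less y x" if "y \<notin> set T1" for y using lt that by (simp add: W pos_append)
    have n: "\<not> ?less y x" if "y \<in> set ?T2 \<or> y \<in> set ?M2 \<or> y \<in> set ?B2" for y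
     by (rule nn) (use that dW' in auto)
    have "\<not> is_mark x" using 1 by (auto simp: T1_def)
    moreover have "?b x ?T2 = 0" "?b x ?M2 = 0"
     "?b x ?B2 = 0" by (rule b0, rule n, blast)+
    ultimately show ?thesis unfolding b by simp
   next
    case 2
    have x': "x \<notin> set T1" "x \<notin> set ?T2" using dW' 2 by auto
    then have px: "pos ?W x = length T1 + length T2 + pos M1' x" using 2 by (simp add: W pos_append)
    have lt2: "?less y x" if "y \<in> set ?T2" for y
    proof -
     have "y \<notin> set T1" using dW' that by auto
     then show ?thesis using that pos_less[OF that] px by (simp add: W pos_append)
    qed
    have 3: "?b x ?T2 = parity p is'"
     unfolding tT[symmetric] by (rule bt) (rule lt2)
    have n: "\<not> ?less y x" if "y \<in> set ?M2 \<or> y \<in> set ?B2" for y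
    proof -
     have "y \<notin> set T1" "y \<notin> set ?T2" "y \<notin> set M1'" using dW' that by auto
     then show ?thesis using pos_less[OF 2] px by (simp add: W pos_append)
    qed
    have "is_mark x" using 2 by (auto simp: M1'_def)
    moreover have "?b x ?M2 = 0" "?b x ?B2 = 0"
     by (rule b0, rule n, blast)+
    ultimately show ?thesis unfolding b 3 by simp
   next
    case 3
    have split: "?W = (T1 @ ?T2 @ M1' @ ?M2 @ ?B2) @ B1" unfolding W by simp
    have x': "x \<notin> set (T1 @ ?T2 @ M1' @ ?M2 @ ?B2)" using dW' 3 by auto
    have "?less y x" if y: "y \<in> set (T1 @ ?T2 @ M1' @ ?M2 @ ?B2)" for y
     unfolding split pos_append[of "T1 @ ?T2 @ M1' @ ?M2 @ ?B2"]
     using y x' pos_less[OF y] by simp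
    then have 4: "?less y x" if "y \<in> set ?T2 \<or> y \<in> set ?M2 \<or> y \<in> set ?B2" for y
     using that by auto
    have "\<not> is_mark x" using 3 by (auto simp: B1_def)
    moreover have "?b x ?T2 = total ?deg ?T2"
     "?b x ?M2 = total ?deg ?M2"
     "?b x ?B2 = total ?deg ?B2" by (rule bt, rule 4, blast)+
    ultimately show ?thesis unfolding b using tot by simp
   qed
  qed
  let ?h = "\<lambda>x. ?deg x * (if is_mark x then parity p is' else 0)"
  have cr: "crossing ?W ?deg ?Q1 (map ?f ?Q2) = of_nat (length (snd D1)) * d * parity p is'"
  proof -
   have "crossing ?W ?deg ?Q1 (map ?f ?Q2) =
     sum_list (map ?h ?Q1)"
    unfolding crossing_def by (rule arg_cong[where f = sum_list], rule map_cong[OF HOL.refl]) (simp add: bef)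
   also have "\<dots> = sum_list (map ?h ?W1)"
    by (rule sum_list_reorder) (use sequence_word[OF D1 en1] in auto)
   also have "\<dots> = of_nat (length (snd D1)) * d * parity p is'"
   proof -
    have m: "sum_list (map ?h M1') = of_nat (length (snd D1)) * d * parity p is'"
     unfolding M1'_def by (induction "snd D1" arbitrary: D1) (auto simp: algebra_simps comp_def)
    have z: "sum_list (map ?h Y) = 0"
     if "\<And>y. y \<in> set Y \<Longrightarrow> \<not> is_mark y" for Y
     using that by (induction Y) auto
    have "sum_list (map ?h T1) = 0"
     "sum_list (map ?h B1) = 0"
     by (rule z, force simp: T1_def B1_def)+
    then show ?thesis unfolding W1 using m by simp
   qed
   finally show ?thesis .
  qed
  show ?thesis unfolding M M1 M2 invs_append i1 i2 cr by (simp add: koszul_add mult_ac)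
 qed
qed

end

section \<open>Matrices of combinations, and diagrams modulo the relations\<close>

section \<open>Combinations of diagrams\<close>

interpretation fun_space: vector_space "fun_scale :: 'k::field \<Rightarrow> ('x \<Rightarrow> 'k) \<Rightarrow> 'x \<Rightarrow> 'k"
 by unfold_locales (auto simp: fun_scale_def algebra_simps)

lemma fun_scale_apply [simp]: "fun_scale c f x = c * f x"
 by (simp add: fun_scale_def)

lemma sum_fun_apply: "(\<Sum>i\<in>A. f i) x = (\<Sum>i\<in>A. f i x)"
 by (induction A rule: infinite_finite_induct) auto

lemma basis_vec_apply: "basis_vec D D' = (if D' = D then 1 else 0)"
 by (simp add: basis_vec_def)

lemma enumeration_strands:
 "D \<in> marked r s \<Longrightarrow> set (str_segs (map estrand (enumeration (fst D)))) = fst D"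
 by (rule enumerates_segs(2)[OF enumeration[OF markedD(1)]])

context supermatrix
begin

lemma eps_nonzero [simp]: "\<epsilon> \<noteq> 0"
 by (simp add: eps)

lemma matrix_height_swap:
 assumes "(D, D') \<in> height_swaps r s"
 shows "dgm_matrix r s D is js = \<epsilon> * dgm_matrix r s D' is js"
proof -
 obtain E xs m m' ys where D: "D = (E, xs @ [m, m'] @ ys)" "D' = (E, xs @ [m', m] @ ys)"
  "D \<in> marked r s" using assms unfolding height_swaps_def by blast
 have v: "valid is_top (word r s (xs @ [m, m'] @ ys)) (xs @ [m, m'] @ ys) (map estrand (enumeration E))"
  using edge_strands_valid[OF D(3) enumeration[OF markedD(1)[OF D(3)]]] unfolding D(1) by simp
 have c: "carriers (xs @ [m, m'] @ ys) \<subseteq> set (str_segs (map estrand (enumeration E)))"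
  using enumeration_strands[OF D(3)] markedD(3)[OF D(3)] unfolding D(1) by auto
 show ?thesis unfolding dgm_matrix_def D fst_conv snd_conv by (rule state_interchange[OF v c])
qed

text \<open>The word does not see the directions of arrows; what changes is the arrow sign of the
  one strand through \<open>e\<close>.\<close>

lemma matrix_arrow_reversal:
 assumes "(D, D') \<in> arrow_reversals r s"
 shows "dgm_matrix r s D is js = \<epsilon> * dgm_matrix r s D' is js"
proof -
 obtain E xs e x x' ys where D: "D = (E, xs @ [Arrow e x] @ ys)" "D' = (E, xs @ [Arrow e x'] @ ys)" "x \<noteq> x'"
  "D \<in> marked r s" "D' \<in> marked r s" using assms unfolding arrow_reversals_def by blast
 let ?L = "xs @ [Arrow e x] @ ys" and ?L' = "xs @ [Arrow e x'] @ ys" and ?lab = "vertex_label is js"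
 define es where "es = enumeration E"
 have E: "E \<in> brauer r s" using markedD(1)[OF D(4)] D(1) by simp
 have en: "enumerates es E" unfolding es_def by (rule enumeration[OF E])
 have eE: "e \<in> E" using markedD(3)[OF D(4)] unfolding D(1) by auto
 have xe: "x \<in> e" "x' \<in> e"
  using markedD(5)[OF D(4), of e x] markedD(5)[OF D(5), of e x'] unfolding D(1,2) by auto
 have dL: "distinct (map carrier_edge ?L)" "distinct (map carrier_edge ?L')"
  using markedD(2)[OF D(4)] markedD(2)[OF D(5)] unfolding D(1,2) by simp_all
 have word: "word r s ?L = word r s ?L'" by (simp add: word_def)
 have seq: "sequence ?L (map estrand es) = sequence ?L' (map estrand es)"
  by (rule sequence_cong) simp
 have other: "weight is_top ?L ?lab (estrand q) = weight is_top ?L' ?lab (estrand q)" if "edge q \<noteq> e" for q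
 proof (rule weight_marking_cong)
  fix k t assume "k \<in> set (steps (estrand q))"
  then have "seg k = edge q" by (cases q) auto
  then show "Arrow (seg k) t \<in> set ?L \<longleftrightarrow> Arrow (seg k) t \<in> set ?L'" using that by auto
 qed
 have own: "weight is_top ?L ?lab (estrand q) = \<epsilon> * weight is_top ?L' ?lab (estrand q)"
  if "edge q = e" for q
 proof -
  obtain a b where q: "q = (a, b)" by (cases q) auto
  have ab: "e = {a, b}" using that q by simp
  have "arrow_sign ?L (a, e, b) = (if x \<noteq> b then \<epsilon> else 1)"
  proof -
   have "(\<exists>t. Arrow e t \<in> set ?L \<and> t \<noteq> b) \<longleftrightarrow> x \<noteq> b"
    using carriers_cases(3)[OF dL(1), of e x] by auto
   then show ?thesis unfolding arrow_sign_def by simp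
  qed
  moreover have "arrow_sign ?L' (a, e, b) = (if x' \<noteq> b then \<epsilon> else 1)"
  proof -
   have "(\<exists>t. Arrow e t \<in> set ?L' \<and> t \<noteq> b) \<longleftrightarrow> x' \<noteq> b"
    using carriers_cases(3)[OF dL(2), of e x'] by auto
   then show ?thesis unfolding arrow_sign_def by simp
  qed
  moreover have "(x = b \<and> x' = a \<and> x' \<noteq> b) \<or> (x = a \<and> x \<noteq> b \<and> x' = b)" using xe D(3) unfolding ab by auto
  ultimately have "arrow_sign ?L (a, e, b) = \<epsilon> * arrow_sign ?L' (a, e, b)" by auto
  then show ?thesis unfolding q estrand_simps weight_def ab[symmetric] by simp
 qed
 have prod: "prod_list (map (weight is_top ?L ?lab) (map estrand fs)) =
   (if e \<in> edge ` set fs then \<epsilon> else 1) * prod_list (map (weight is_top ?L' ?lab) (map estrand fs))"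
  if "distinct (map edge fs)" for fs
  using that
 proof (induction fs)
  case (Cons q fs)
  show ?case
  proof (cases "edge q = e")
   case True
   then have "e \<notin> edge ` set fs" using Cons.prems by auto
   then show ?thesis using Cons own[OF True] True by simp
  next
   case False
   then show ?thesis using Cons other[OF False] by auto
  qed
 qed simp
 have "distinct (map edge es)" "e \<in> edge ` set es" using en eE by (auto simp: enumerates_def)
 then show ?thesis
  unfolding dgm_matrix_def D(1,2) fst_conv snd_conv es_def[symmetric] state_def word seq prod[OF \<open>distinct (map edge es)\<close>]
  by simp
qed

definition comb_matrix :: "nat \<Rightarrow> nat \<Rightarrow> 'k combination \<Rightarrow> nat list \<Rightarrow> nat list \<Rightarrow> 'k" where
 "comb_matrix r s x is js = (\<Sum>D\<in>marked r s. x D * dgm_matrix r s D is js)"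

lemma comb_matrix_add: "comb_matrix r s (x + y) is js = comb_matrix r s x is js + comb_matrix r s y is js"
 by (simp add: comb_matrix_def sum.distrib algebra_simps)

lemma comb_matrix_diff: "comb_matrix r s (x - y) is js = comb_matrix r s x is js - comb_matrix r s y is js"
 by (simp add: comb_matrix_def sum_subtractf algebra_simps)

lemma comb_matrix_scale: "comb_matrix r s (fun_scale c x) is js = c * comb_matrix r s x is js"
 by (simp add: comb_matrix_def sum_distrib_left algebra_simps)

lemma comb_matrix_sum: "comb_matrix r s (\<Sum>i\<in>A. x i) is js = (\<Sum>i\<in>A. comb_matrix r s (x i) is js)"
 unfolding comb_matrix_def sum_fun_apply sum_distrib_right by (rule sum.swap)

lemma comb_matrix_basis:
 "D \<in> marked r s \<Longrightarrow> comb_matrix r s (basis_vec D) is js = dgm_matrix r s D is js"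
 using finite_marked_diagrams[of r s] by (simp add: comb_matrix_def basis_vec_apply if_distrib[of "\<lambda>c. c * _"] cong: if_cong)

text \<open>Makes the matrix a function of the class of a combination.\<close>

lemma relations_matrix:
 assumes "x \<in> rels r s"
 shows "comb_matrix r s x is js = 0"
 using assms unfolding relations_def
proof (induction rule: fun_space.span_induct_alt)
 case base
 then show ?case by (simp add: comb_matrix_def)
next
 case (step c x y)
 then obtain D D' where x: "x = basis_vec D - fun_scale \<epsilon> (basis_vec D')"
  and DD: "(D, D') \<in> height_swaps r s \<union> arrow_reversals r s" by blast
 have m: "D \<in> marked r s" "D' \<in> marked r s"
  using DD by (auto simp: height_swaps_def arrow_reversals_def)
 have "dgm_matrix r s D is js = \<epsilon> * dgm_matrix r s D' is js"
  using DD matrix_height_swap matrix_arrow_reversal by blast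
 then show ?case
  unfolding x comb_matrix_add comb_matrix_diff comb_matrix_scale
   comb_matrix_basis[OF m(1)] comb_matrix_basis[OF m(2)] using step by simp
qed

text \<open>Edges have disjoint endpoints, so labels can be chosen edge by edge with nonzero value
  of the form; for each of the four combinations of top and bottom ends such labels exist.\<close>

lemma dgm_matrix_nonzero:
 assumes N: "0 < N" and D: "D \<in> marked r s"
 obtains "is" js where "is \<in> indices N r" "js \<in> indices N s" "dgm_matrix r s D is js \<noteq> 0"
proof -
 let ?es = "enumeration (fst D)"
 note E = markedD(1)[OF D]
 note en = enumeration[OF E]
 have g1: "g True 0 False 0 = 1" using g_dual N by simp
 have g2: "g False 0 True 0 \<noteq> 0" using g_symmetric[of False 0 True 0] g1 by simp
 \<comment> \<open>By contraction a nonzero mixed value is a sum of products of a bottom-bottom and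
   a top-top value, so some product of this kind is nonzero.\<close>
 have "(\<Sum>l<N. g False 0 False l * g True l True 0) \<noteq> 0" using g_contract[of False 0 True 0] g2 by simp
 then obtain l where l: "l < N" "g False 0 False l \<noteq> 0" "g True l True 0 \<noteq> 0"
  by (metis (no_types, lifting) lessThan_iff mult_zero_left mult_zero_right sum.neutral)
 have ex: "\<exists>i j. i < N \<and> j < N \<and> g a i b j \<noteq> 0" for a b
  by (metis (full_types) N g1 g2 l zero_neq_one)
 have "\<exists>lab. (\<forall>v. lab v < N) \<and> (\<forall>(x, y)\<in>set fs. g (is_top x) (lab x) (is_top y) (lab y) \<noteq> 0)"
  if "distinct (ends (map estrand fs))" for fs
  using that
 proof (induction fs)
  case Nil
  show ?case using N by auto
 next
  case (Cons q fs)
  obtain x y where q: "q = (x, y)" by (cases q) auto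
  obtain lab where lab: "\<forall>v. lab v < N" "\<forall>(x, y)\<in>set fs. g (is_top x) (lab x) (is_top y) (lab y) \<noteq> 0"
   using Cons q by auto
  obtain i j where ij: "i < N" "j < N" "g (is_top x) i (is_top y) j \<noteq> 0" using ex by blast
  have xy: "x \<noteq> y" "x \<notin> set (ends (map estrand fs))" "y \<notin> set (ends (map estrand fs))"
   using Cons.prems q by auto
  have "a \<in> set (ends (map estrand fs)) \<and> b \<in> set (ends (map estrand fs))" if "(a, b) \<in> set fs" for a b
   using that by (force simp: set_ends)
  then have ne: "a \<noteq> x" "a \<noteq> y" "b \<noteq> x" "b \<noteq> y" if "(a, b) \<in> set fs" for a b using xy that by blast+
  have "g (is_top a) ((lab(x := i, y := j)) a) (is_top b) ((lab(x := i, y := j)) b) \<noteq> 0"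
   if ab: "(a, b) \<in> set (q # fs)" for a b
  proof (cases "(a, b) = q")
   case True
   then show ?thesis using ij(3) xy(1) q by simp
  next
   case False
   then have "(a, b) \<in> set fs" using ab by auto
   moreover from this have "g (is_top a) (lab a) (is_top b) (lab b) \<noteq> 0" using lab(2) by blast
   ultimately show ?thesis using ne by simp
  qed
  then have "\<forall>(a, b)\<in>set (q # fs). g (is_top a) ((lab(x := i, y := j)) a) (is_top b) ((lab(x := i, y := j)) b) \<noteq> 0"
   by blast
  moreover have "\<forall>v. (lab(x := i, y := j)) v < N" using lab(1) ij by simp
  ultimately show ?case by blast
 qed
 from this[OF enumerates_ends(1)[OF en E]] obtain lab where lab: "\<forall>v. lab v < N"
  "\<forall>(x, y)\<in>set ?es. g (is_top x) (lab x) (is_top y) (lab y) \<noteq> 0" by blast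
 define "is" js where "is = map (\<lambda>i. lab (Top i)) [0..<r]" and "js = map (\<lambda>i. lab (Bot i)) [0..<s]"
 have vl: "vertex_label is js v = lab v" if "v \<in> vertices r s" for v
  using that by (cases v) (auto simp: is_def js_def vertices_def)
 have "weight is_top (snd D) (vertex_label is js) (estrand (x, y)) \<noteq> 0" if xy: "(x, y) \<in> set ?es" for x y
 proof -
  have "{x, y} \<in> fst D" using en imageI[OF xy, of edge] by (auto simp: enumerates_def)
  then have "vertex_label is js x = lab x" "vertex_label is js y = lab y" using brauer_edge(1)[OF E] vl by auto
  then show ?thesis using lab(2) xy by (auto simp: weight_def arrow_sign_def)
 qed
 then have "dgm_matrix r s D is js \<noteq> 0"
  unfolding dgm_matrix_def state_def by (auto simp: prod_list_zero_iff)
 moreover have "is \<in> indices N r" "js \<in> indices N s" using lab(1) by (auto simp: indices_def is_def js_def)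
 ultimately show ?thesis using that by blast
qed

text \<open>The factor \<open>\<eta>\<close> is left open here. Where its value matters, it is
  recovered from a nonzero matrix entry.\<close>

definition related :: "nat \<Rightarrow> nat \<Rightarrow> diagram \<Rightarrow> diagram \<Rightarrow> bool" where
 "related r s D D' \<longleftrightarrow> (\<exists>\<eta>. basis_vec D - fun_scale \<eta> (basis_vec D') \<in> rels r s)"

lemma relations_subspace: "fun_space.subspace (rels r s)"
 unfolding relations_def by (rule fun_space.subspace_span)

lemmas relations_add = fun_space.subspace_add[OF relations_subspace]
 and relations_diff = fun_space.subspace_diff[OF relations_subspace]
 and relations_scale = fun_space.subspace_scale[OF relations_subspace]
 and relations_zero = fun_space.subspace_0[OF relations_subspace]
 and relations_sum = fun_space.subspace_sum[OF relations_subspace]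

lemma related_refl: "related r s D D"
 unfolding related_def using relations_zero by (intro exI[of _ 1]) (simp add: fun_scale_def)

lemma related_trans: "related r s D1 D2 \<Longrightarrow> related r s D2 D3 \<Longrightarrow> related r s D1 D3"
 unfolding related_def
proof (elim exE)
 fix \<eta> \<eta>' assume 1: "basis_vec D1 - fun_scale \<eta> (basis_vec D2) \<in> rels r s"
  and 2: "basis_vec D2 - fun_scale \<eta>' (basis_vec D3) \<in> rels r s"
 have "basis_vec D1 - fun_scale (\<eta> * \<eta>') (basis_vec D3) =
  (basis_vec D1 - fun_scale \<eta> (basis_vec D2)) + fun_scale \<eta> (basis_vec D2 - fun_scale \<eta>' (basis_vec D3))"
  by (rule ext) (simp add: algebra_simps)
 then show "\<exists>\<eta>. basis_vec D1 - fun_scale \<eta> (basis_vec D3) \<in> rels r s"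
  using relations_add[OF 1 relations_scale[OF 2]] by metis
qed

lemma related_generator: "(D, D') \<in> height_swaps r s \<union> arrow_reversals r s \<Longrightarrow> related r s D D'"
 unfolding related_def relations_def by (rule exI[of _ \<epsilon>], rule fun_space.span_base) blast

lemma marked_reorder:
 assumes "(E, L) \<in> marked r s" "distinct (map carrier_edge L')" "set L' = set L"
 shows "(E, L') \<in> marked r s"
 using assms unfolding marked_diagrams_def by simp

lemma related_rotate:
 assumes "(E, xs @ as @ m # bs) \<in> marked r s"
 shows "related r s (E, xs @ as @ m # bs) (E, xs @ m # as @ bs)"
 using assms
proof (induction as arbitrary: xs)
 case (Cons a as)
 have 1: "related r s (E, (xs @ [a]) @ as @ m # bs) (E, (xs @ [a]) @ m # as @ bs)"
  by (rule Cons.IH) (use Cons.prems in simp)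
 have d: "distinct (map carrier_edge (xs @ (a # as) @ m # bs))" using markedD(2)[OF Cons.prems] by simp
 have "(E, xs @ [a, m] @ as @ bs) \<in> marked r s" "(E, xs @ [m, a] @ as @ bs) \<in> marked r s"
  by (rule marked_reorder[OF Cons.prems]; use d in auto)+
 then have "((E, xs @ [a, m] @ as @ bs), (E, xs @ [m, a] @ as @ bs)) \<in> height_swaps r s"
  unfolding height_swaps_def by blast
 then have "related r s (E, xs @ [a, m] @ as @ bs) (E, xs @ [m, a] @ as @ bs)"
  by (intro related_generator) blast
 then show ?case using related_trans[OF 1] by simp
qed (simp add: related_refl)

text \<open>Both lists mark the same edges. Below the common prefix \<open>xs\<close> the markings
  are put in place one by one: the one on the edge of \<open>m'\<close> is moved up by interchanges
  and, if it is an arrow, turned when necessary.\<close>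

lemma related_markings:
 assumes "(E, xs @ M) \<in> marked r s" "(E, xs @ M') \<in> marked r s"
 shows "related r s (E, xs @ M) (E, xs @ M')"
 using assms
proof (induction M' arbitrary: xs M)
 case Nil
 have "length (xs @ M) = card (carriers (xs @ M))" "length xs = card (carriers xs)"
  using markedD(2)[OF Nil.prems(1)] distinct_card[of "map carrier_edge (xs @ M)"]
   distinct_card[of "map carrier_edge xs"] by (auto simp: image_Un)
 moreover have "carriers (xs @ M) = carriers xs"
  using markedD(3)[OF Nil.prems(1)] markedD(3)[OF Nil.prems(2)] by simp
 ultimately have "M = []" by simp
 then show ?case by (simp add: related_refl)
next
 case (Cons m' M')
 note d = markedD(2)[OF Cons.prems(1)] markedD(2)[OF Cons.prems(2)]
 have "carrier_edge m' \<in> carriers (xs @ M)"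
  using markedD(3)[OF Cons.prems(1)] markedD(3)[OF Cons.prems(2)] by auto
 moreover have "carrier_edge m' \<notin> carriers xs" using d(2) by auto
 ultimately obtain m where m: "m \<in> set M" "carrier_edge m = carrier_edge m'" by auto
 obtain as bs where M: "M = as @ m # bs" using split_list[OF m(1)] by blast
 have 1: "related r s (E, xs @ M) (E, xs @ m # as @ bs)"
  unfolding M by (rule related_rotate) (use Cons.prems(1) M in simp)
 have q1: "(E, xs @ m # as @ bs) \<in> marked r s"
  by (rule marked_reorder[OF Cons.prems(1)]) (use d(1) M in auto)
 \<comment> \<open>No edge is both a cup and a cap, so two markings of the same edge can differ only
   in the direction of an arrow.\<close>
 have kind: "m = m' \<or> (\<exists>e x x'. m = Arrow e x \<and> m' = Arrow e x' \<and> x \<noteq> x')"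
 proof -
  have no: "\<not> (is_cup e \<and> is_cap e)" if "e \<in> E" for e
  proof
   assume "is_cup e \<and> is_cap e"
   then have "e \<subseteq> range Top \<inter> range Bot" unfolding is_cup_def is_cap_def by blast
   then have "e = {}" by blast
   then show False using brauer_edge(2)[of E r s e] markedD(1)[OF Cons.prems(1)] that by simp
  qed
  have e: "carrier_edge m \<in> E" using markedD(3)[OF q1] by auto
  have c: "m = Bead k \<Longrightarrow> is_cup k" "m = Arrow k x \<Longrightarrow> is_cap k" "m' = Bead k \<Longrightarrow> is_cup k" "m' = Arrow k x \<Longrightarrow> is_cap k" for k x
  proof -
   show "m = Bead k \<Longrightarrow> is_cup k" using markedD(4)[OF q1, of k] by simp
   show "m = Arrow k x \<Longrightarrow> is_cap k" using markedD(5)[OF q1, of k x] by simp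
   show "m' = Bead k \<Longrightarrow> is_cup k" using markedD(4)[OF Cons.prems(2), of k] by simp
   show "m' = Arrow k x \<Longrightarrow> is_cap k" using markedD(5)[OF Cons.prems(2), of k x] by simp
  qed
  show ?thesis using m(2) e no c by (cases m; cases m') auto
 qed
 have q2: "(E, xs @ m' # as @ bs) \<in> marked r s"
 proof (cases "m = m'")
  case True
  then show ?thesis using q1 by simp
 next
  case False
  then obtain e x x' where k: "m = Arrow e x" "m' = Arrow e x'" using kind by blast
  have "is_cap e \<and> x' \<in> e" using markedD(5)[OF Cons.prems(2), of e x'] k by simp
  then show ?thesis using q1 unfolding marked_diagrams_def k by auto
 qed
 have 2: "related r s (E, xs @ m # as @ bs) (E, xs @ m' # as @ bs)"
 proof (cases "m = m'")
  case False
  then obtain e x x' where k: "m = Arrow e x" "m' = Arrow e x'" "x \<noteq> x'" using kind by blast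
  have "((E, xs @ [Arrow e x] @ (as @ bs)), (E, xs @ [Arrow e x'] @ (as @ bs))) \<in> arrow_reversals r s"
  proof -
   have "(E, xs @ [Arrow e x] @ (as @ bs)) \<in> marked r s" "(E, xs @ [Arrow e x'] @ (as @ bs)) \<in> marked r s"
    using q1 q2 k by simp_all
   then show ?thesis using k(3) unfolding arrow_reversals_def by blast
  qed
  then show ?thesis unfolding k by (intro related_generator) simp
 qed (simp add: related_refl)
 have 3: "related r s (E, (xs @ [m']) @ as @ bs) (E, (xs @ [m']) @ M')"
  by (rule Cons.IH) (use q2 Cons.prems in simp_all)
 show ?case using related_trans[OF 1 related_trans[OF 2]] 3 by simp
qed

text \<open>The way back from matrices to classes: the two diagrams are proportional modulo
  relations, and a nonzero entry of the matrix of \<open>D'\<close> forces the unknown factor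
  \<open>\<eta>\<close> to satisfy \<open>a * \<eta> = b\<close>.\<close>

lemma scaled_eq_mod_relations:
 assumes N: "0 < N" and D: "D \<in> marked r s" "D' \<in> marked r s" "fst D = fst D'"
  and eq: "\<And>is js. is \<in> indices N r \<Longrightarrow> js \<in> indices N s \<Longrightarrow>
   a * dgm_matrix r s D is js = b * dgm_matrix r s D' is js"
 shows "fun_scale a (basis_vec D) - fun_scale b (basis_vec D') \<in> rels r s"
proof -
 have "related r s (fst D, [] @ snd D) (fst D, [] @ snd D')"
  by (rule related_markings) (use D in \<open>metis append_Nil prod.collapse\<close>)+
 then have "related r s D D'" using D(3) by (metis append_Nil prod.collapse)
 then obtain \<eta> where \<eta>: "basis_vec D - fun_scale \<eta> (basis_vec D') \<in> rels r s"
  unfolding related_def by blast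
 obtain "is" js where ij: "is \<in> indices N r" "js \<in> indices N s" "dgm_matrix r s D' is js \<noteq> 0"
  using dgm_matrix_nonzero[OF N D(2)] by blast
 have "dgm_matrix r s D is js = \<eta> * dgm_matrix r s D' is js"
  using relations_matrix[OF \<eta>, of "is" js] D
  by (simp add: comb_matrix_diff comb_matrix_scale comb_matrix_basis)
 then have "a * \<eta> = b" using eq[OF ij(1,2)] ij(3) by simp
 then have "fun_scale a (basis_vec D) - fun_scale b (basis_vec D') = fun_scale a (basis_vec D - fun_scale \<eta> (basis_vec D'))"
  by (auto simp: algebra_simps)
 then show ?thesis using relations_scale[OF \<eta>] by simp
qed

lemma compose_diagrams_composite:
 assumes "D1 \<in> marked r s" "D2 \<in> marked s t"
 obtains c D where "compose_dgm r t D1 D2 = fun_scale c (basis_vec D)" "composite \<delta> \<epsilon> r t D1 D2 c D"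
  "D \<in> marked r t" "fst D = composite_edges (stack_segments D1 D2)"
proof -
 have "\<exists>p. case p of (c, D) \<Rightarrow> composite \<delta> \<epsilon> r t D1 D2 c D" using composite_exists[OF assms] by auto
 then have c: "case (SOME p. case p of (c, D) \<Rightarrow> composite \<delta> \<epsilon> r t D1 D2 c D) of (c, D) \<Rightarrow> composite \<delta> \<epsilon> r t D1 D2 c D"
  by (rule someI_ex)
 obtain c' D' where p: "(SOME p. case p of (c, D) \<Rightarrow> composite \<delta> \<epsilon> r t D1 D2 c D) = (c', D')"
  by (metis surj_pair)
 have "composite \<delta> \<epsilon> r t D1 D2 c' D'" using c unfolding p by simp
 moreover have "compose_dgm r t D1 D2 = fun_scale c' (basis_vec D')"
  unfolding compose_diagrams_def p by simp
 ultimately show ?thesis using that unfolding composite_def Let_def by blast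
qed

lemma matrix_compose_diagrams:
 assumes "D1 \<in> marked r s" "D2 \<in> marked s t"
 shows "comb_matrix r t (compose_dgm r t D1 D2) is js =
  (\<Sum>l\<in>indices N s. dgm_matrix r s D1 is l * dgm_matrix s t D2 l js)"
proof -
 obtain c D where D: "compose_dgm r t D1 D2 = fun_scale c (basis_vec D)" "composite \<delta> \<epsilon> r t D1 D2 c D"
  "D \<in> marked r t" by (rule compose_diagrams_composite[OF assms])
 show ?thesis unfolding D(1) composite_matrix[OF assms D(2)] comb_matrix_scale comb_matrix_basis[OF D(3)] ..
qed

lemma matrix_compose:
 "comb_matrix r t (compose_comb r s t x y) is js =
  (\<Sum>l\<in>indices N s. comb_matrix r s x is l * comb_matrix s t y l js)"
proof -
 have "comb_matrix r t (compose_comb r s t x y) is js =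
  (\<Sum>D1\<in>marked r s. \<Sum>D2\<in>marked s t. \<Sum>l\<in>indices N s.
   (x D1 * y D2) * (dgm_matrix r s D1 is l * dgm_matrix s t D2 l js))"
  unfolding compose_combinations_def comb_matrix_sum comb_matrix_scale
  by (intro sum.cong HOL.refl) (simp add: matrix_compose_diagrams sum_distrib_left)
 also have "\<dots> = (\<Sum>D1\<in>marked r s. \<Sum>l\<in>indices N s. \<Sum>D2\<in>marked s t.
   (x D1 * y D2) * (dgm_matrix r s D1 is l * dgm_matrix s t D2 l js))"
  by (rule sum.cong[OF HOL.refl]) (rule sum.swap)
 also have "\<dots> = (\<Sum>l\<in>indices N s. \<Sum>D1\<in>marked r s. \<Sum>D2\<in>marked s t.
   (x D1 * y D2) * (dgm_matrix r s D1 is l * dgm_matrix s t D2 l js))"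
  by (rule sum.swap)
 also have "\<dots> = (\<Sum>l\<in>indices N s. comb_matrix r s x is l * comb_matrix s t y l js)"
  unfolding comb_matrix_def sum_product by (intro sum.cong HOL.refl) (simp add: mult_ac)
 finally show ?thesis .
qed

text \<open>By homogeneity the number of markings of the first factor may be replaced by the
  parities of its labels. The sign is then the same for all diagrams of a combination.\<close>

lemma matrix_tensor:
 assumes len: "length is = r" "length js = s" "length is' = r'" "length js' = s'"
 shows "comb_matrix (r + r') (s + s') (tensor_combinations r s r' s' x y) (is @ is') (js @ js') =
  koszul ((parity p is + parity p js) * parity p is') * comb_matrix r s x is js * comb_matrix r' s' y is' js'"
proof -
 have t: "dgm_matrix (r + r') (s + s') (tensor_diagrams r s D1 D2) (is @ is') (js @ js') =
  koszul ((parity p is + parity p js) * parity p is') * (dgm_matrix r s D1 is js * dgm_matrix r' s' D2 is' js')"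
  if D: "D1 \<in> marked r s" "D2 \<in> marked r' s'" for D1 D2
 proof (cases "dgm_matrix r s D1 is js = 0")
  case True
  then show ?thesis using dgm_matrix_tensor[OF D len] by simp
 next
  case False
  then show ?thesis using dgm_matrix_tensor[OF D len] dgm_matrix_homogeneous[OF D(1) len(1,2) False]
   by (simp add: mult.assoc)
 qed
 have "comb_matrix (r + r') (s + s') (tensor_combinations r s r' s' x y) (is @ is') (js @ js') =
  (\<Sum>D1\<in>marked r s. \<Sum>D2\<in>marked r' s'. koszul ((parity p is + parity p js) * parity p is') *
   ((x D1 * dgm_matrix r s D1 is js) * (y D2 * dgm_matrix r' s' D2 is' js')))"
  unfolding tensor_combinations_def comb_matrix_sum comb_matrix_scale
  by (intro sum.cong HOL.refl) (simp add: comb_matrix_basis[OF tensor_marked] t mult_ac)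
 also have "\<dots> = koszul ((parity p is + parity p js) * parity p is') *
  (comb_matrix r s x is js * comb_matrix r' s' y is' js')"
 proof -
  have "comb_matrix r s x is js * comb_matrix r' s' y is' js' =
   (\<Sum>D1\<in>marked r s. \<Sum>D2\<in>marked r' s'.
    (x D1 * dgm_matrix r s D1 is js) * (y D2 * dgm_matrix r' s' D2 is' js'))"
   unfolding comb_matrix_def by (rule sum_product)
  then show ?thesis by (simp only: sum_distrib_left)
 qed
 finally show ?thesis by (simp add: mult.assoc)
qed

section \<open>Matrices of the generators and of identities\<close>

lemma matrix_cup:
 "dgm_matrix 2 0 ({{Top 0, Top 1}}, [Bead {Top 0, Top 1}]) [i, j] [] = g True i True j"
 "({{Top 0, Top 1}}, [Bead {Top 0, Top 1}]) \<in> marked 2 0"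
proof -
 have v: "vertices 2 0 = {Top 0, Top 1}" by (auto simp: vertices_def numeral_2_eq_2 lessThan_Suc)
 show m: "({{Top 0, Top 1}}, [Bead {Top 0, Top 1}]) \<in> marked 2 0"
  by (auto simp: marked_diagrams_def brauer_diagrams_def partition_on_def v is_cup_def disjoint_def)
 have en: "enumerates [(Top 0, Top 1)] {{Top 0, Top 1}}" by (simp add: enumerates_def)
 have u: "[0..<2] = [0, 1::nat]" by (simp add: upt_rec)
 show "dgm_matrix 2 0 ({{Top 0, Top 1}}, [Bead {Top 0, Top 1}]) [i, j] [] = g True i True j"
  unfolding dgm_matrix_eq[OF m, of "[(Top 0, Top 1)]", unfolded fst_conv, OF en]
  by (simp_all add: state_def word_def u weight_def arrow_sign_def pos_Cons)
qed

text \<open>The inversions give the exponent \<open>p i * (p j + d)\<close>, and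
  \<open>p j + d = p i\<close> unless the value of the form is zero. This is the sign in
  \<open>coform_map\<close>.\<close>

lemma matrix_cap:
 "dgm_matrix 0 2 ({{Bot 0, Bot 1}}, [Arrow {Bot 0, Bot 1} (Bot 1)]) [] [i, j] = koszul (p i) * g False i False j"
 "({{Bot 0, Bot 1}}, [Arrow {Bot 0, Bot 1} (Bot 1)]) \<in> marked 0 2"
proof -
 have v: "vertices 0 2 = {Bot 0, Bot 1}" by (auto simp: vertices_def numeral_2_eq_2 lessThan_Suc)
 show m: "({{Bot 0, Bot 1}}, [Arrow {Bot 0, Bot 1} (Bot 1)]) \<in> marked 0 2"
  by (auto simp: marked_diagrams_def brauer_diagrams_def partition_on_def v is_cap_def disjoint_def)
 have en: "enumerates [(Bot 0, Bot 1)] {{Bot 0, Bot 1}}" by (simp add: enumerates_def)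
 have u: "[0..<2] = [0, 1::nat]" by (simp add: upt_rec)
 have "dgm_matrix 0 2 ({{Bot 0, Bot 1}}, [Arrow {Bot 0, Bot 1} (Bot 1)]) [] [i, j] =
  koszul (p i * (p j + d)) * g False i False j"
  unfolding dgm_matrix_eq[OF m, of "[(Bot 0, Bot 1)]", unfolded fst_conv, OF en]
  by (simp_all add: state_def word_def u weight_def arrow_sign_def pos_Cons algebra_simps)
 also have "\<dots> = koszul (p i) * g False i False j"
 proof (cases "g False i False j = 0")
  case False
  have "p i + p j = d" using g_homogeneous[OF False] by simp
  then have "p j + d = p i" by (metis bit_add_self2 add.commute)
  then show ?thesis by simp
 qed simp
 finally show "dgm_matrix 0 2 ({{Bot 0, Bot 1}}, [Arrow {Bot 0, Bot 1} (Bot 1)]) [] [i, j] = koszul (p i) * g False i False j" .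
qed

lemma matrix_crossing:
 "dgm_matrix 2 2 ({{Top 0, Bot 1}, {Top 1, Bot 0}}, []) [i, j] [k, l] = koszul (p j * p l) * g True i False l * g True j False k"
 "({{Top 0, Bot 1}, {Top 1, Bot 0}}, []) \<in> marked 2 2"
proof -
 have v: "vertices 2 2 = {Top 0, Top 1, Bot 0, Bot 1}" by (auto simp: vertices_def numeral_2_eq_2 lessThan_Suc)
 show m: "({{Top 0, Bot 1}, {Top 1, Bot 0}}, []) \<in> marked 2 2"
  by (auto simp: marked_diagrams_def brauer_diagrams_def partition_on_def v is_cap_def is_cup_def disjoint_def)
 have en: "enumerates [(Top 0, Bot 1), (Top 1, Bot 0)] {{Top 0, Bot 1}, {Top 1, Bot 0}}"
  by (auto simp: enumerates_def doubleton_eq_iff)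
 have u: "[0..<2] = [0, 1::nat]" by (simp add: upt_rec)
 show "dgm_matrix 2 2 ({{Top 0, Bot 1}, {Top 1, Bot 0}}, []) [i, j] [k, l] = koszul (p j * p l) * g True i False l * g True j False k"
  unfolding dgm_matrix_eq[OF m, of "[(Top 0, Bot 1), (Top 1, Bot 0)]", unfolded fst_conv, OF en]
  by (simp_all add: state_def word_def u weight_def arrow_sign_def pos_Cons mult_ac)
qed

lemma matrix_strand:
 "dgm_matrix 1 1 ({{Top 0, Bot 0}}, []) [i] [j] = g True i False j"
 "({{Top 0, Bot 0}}, []) \<in> marked 1 1"
proof -
 have v: "vertices (Suc 0) (Suc 0) = {Top 0, Bot 0}" by (auto simp: vertices_def)
 show m: "({{Top 0, Bot 0}}, []) \<in> marked 1 1"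
  by (auto simp: marked_diagrams_def brauer_diagrams_def partition_on_def v is_cap_def is_cup_def disjoint_def)
 have en: "enumerates [(Top 0, Bot 0)] {{Top 0, Bot 0}}" by (simp add: enumerates_def)
 show "dgm_matrix 1 1 ({{Top 0, Bot 0}}, []) [i] [j] = g True i False j"
  unfolding dgm_matrix_eq[OF m, of "[(Top 0, Bot 0)]", unfolded fst_conv, OF en]
  by (simp_all add: state_def word_def weight_def arrow_sign_def pos_Cons)
qed

text \<open>Induction by tensoring with one more through string; in the absence of markings no sign
  arises.\<close>

lemma identity_marked: "identity_diagram a \<in> marked a a"
 and matrix_identity: "is \<in> indices N a \<Longrightarrow> js \<in> indices N a \<Longrightarrow>
  dgm_matrix a a (identity_diagram a) is js = (if is = js then 1 else 0)"
proof -
 have "identity_diagram a \<in> marked a a \<and> (\<forall>is\<in>indices N a. \<forall>js\<in>indices N a.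
  dgm_matrix a a (identity_diagram a) is js = (if is = js then 1 else 0))"
 proof (induction a)
  case 0
  have m: "identity_diagram 0 \<in> marked 0 0"
   by (auto simp: identity_diagram_def marked_diagrams_def brauer_diagrams_def partition_on_def vertices_def disjoint_def)
  have en: "enumerates [] (fst (identity_diagram 0))" by (simp add: enumerates_def identity_diagram_def)
  have "dgm_matrix 0 0 (identity_diagram 0) [] [] = 1"
   unfolding dgm_matrix_eq[OF m en]
  by (simp_all add: identity_diagram_def state_def)
  then show ?case using m by simp
 next
  case (Suc a)
  have t: "identity_diagram (Suc a) = tensor_diagrams a a (identity_diagram a) ({{Top 0, Bot 0}}, [])"
   by (auto simp: identity_diagram_def tensor_diagrams_def lessThan_Suc)
  have "dgm_matrix (Suc a) (Suc a) (identity_diagram (Suc a)) is js = (if is = js then 1 else 0)"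
   if ij: "is \<in> indices N (Suc a)" "js \<in> indices N (Suc a)" for "is" js
  proof -
   have "is \<noteq> []" "js \<noteq> []" using ij by (auto simp: indices_def)
   then obtain is0 i js0 j where s: "is = is0 @ [i]" "js = js0 @ [j]" by (metis append_butlast_last_id)
   have m: "is0 \<in> indices N a" "js0 \<in> indices N a" "i < N" "j < N" using ij unfolding s by (auto simp: indices_def)
   have "dgm_matrix (a + 1) (a + 1) (tensor_diagrams a a (identity_diagram a) ({{Top 0, Bot 0}}, [])) (is0 @ [i]) (js0 @ [j]) =
    dgm_matrix a a (identity_diagram a) is0 js0 * dgm_matrix 1 1 ({{Top 0, Bot 0}}, []) [i] [j]"
    by (subst dgm_matrix_tensor) (use Suc m matrix_strand(2) in \<open>auto simp: indices_def identity_diagram_def\<close>)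
   then show ?thesis unfolding t s using Suc m matrix_strand(1)[of i j] g_dual[OF m(3,4)] by auto
  qed
  moreover have "identity_diagram (Suc a) \<in> marked (Suc a) (Suc a)"
   unfolding t using tensor_marked[OF _ matrix_strand(2), of "identity_diagram a" a a] Suc by simp
  ultimately show ?case by blast
 qed
 then show "identity_diagram a \<in> marked a a"
  "is \<in> indices N a \<Longrightarrow> js \<in> indices N a \<Longrightarrow> dgm_matrix a a (identity_diagram a) is js = (if is = js then 1 else 0)"
  by auto
qed

end

section \<open>Dual homogeneous bases and the superdimension\<close>

section \<open>The form in dual bases\<close>

locale osp_form =
 fixes scale :: "'k::field \<Rightarrow> 'v::ab_group_add \<Rightarrow> 'v"
  and V :: "bit \<Rightarrow> 'v set" and m n :: nat
  and b :: "'v \<Rightarrow> 'v \<Rightarrow> 'k" and d :: bit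
  and v v' :: "nat \<Rightarrow> 'v"
  and \<delta> \<epsilon> :: 'k
 assumes char: "CHAR('k) \<noteq> 2"
  and superspace: "superspace scale V m n"
  and bilinear: "bilinear_form scale b"
  and homogeneous: "homogeneous_form V d b"
  and supersymmetric: "supersymmetric_form V b"
  and eps_eq: "\<epsilon> = koszul d"
  and delta_eq: "\<delta> = of_nat m - of_nat n"
  and basis: "homogeneous_basis scale V (m + n) v"
  and basis': "homogeneous_basis scale V (m + n) v'"
  and dual: "\<forall>i<m + n. \<forall>j<m + n. b (v i) (v' j) = (if i = j then 1 else 0)"
begin

abbreviation "tp \<equiv> tpow scale"

sublocale vector_space scale
 using superspace by (simp add: superspace_def)

definition dm :: nat where "dm = m + n"

abbreviation "ix \<equiv> indices dm"

definition p :: "nat \<Rightarrow> bit" where "p i = par V (v i)"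

lemma subspace_V: "subspace (V q)"
 using superspace by (simp add: superspace_def)

lemma V_Int: "x \<in> V 0 \<Longrightarrow> x \<in> V 1 \<Longrightarrow> x = 0"
 using superspace by (auto simp: superspace_def)

lemma V_unique: "x \<in> V q \<Longrightarrow> x \<in> V q' \<Longrightarrow> x \<noteq> 0 \<Longrightarrow> q = q'"
 using V_Int by (cases q; cases q') auto

lemma V_par: "Defs.homogeneous V x \<Longrightarrow> x \<in> V (par V x)"
 by (auto simp: Defs.homogeneous_def par_def)

lemma V_homogeneous: "x \<in> V q \<Longrightarrow> Defs.homogeneous V x"
 by (cases q) (auto simp: Defs.homogeneous_def)

lemmas V_add = subspace_add[OF subspace_V]
 and V_scale = subspace_scale[OF subspace_V]
 and V_zero = subspace_0[OF subspace_V]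
 and V_sum = subspace_sum[OF subspace_V]
 and V_diff = subspace_diff[OF subspace_V]

lemma b_linear:
 "b (x + y) z = b x z + b y z" "b z (x + y) = b z x + b z y"
 "b (scale c x) z = c * b x z" "b z (scale c x) = c * b z x"
 "b 0 z = 0" "b z 0 = 0"
proof -
 have 1: "Vector_Spaces.linear scale (*) (\<lambda>y. b x y)" "Vector_Spaces.linear scale (*) (\<lambda>x. b x y)" for x y
  using bilinear by (auto simp: bilinear_form_def)
 show *: "b (x + y) z = b x z + b y z" "b z (x + y) = b z x + b z y"
  "b (scale c x) z = c * b x z" "b z (scale c x) = c * b z x"
  by (simp_all add: 1(1)[of z, unfolded Vector_Spaces.linear_iff] 1(2)[of z, unfolded Vector_Spaces.linear_iff])
 have "b 0 z = b (scale 0 0) z" "b z 0 = b z (scale 0 0)" by simp_all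
 then show "b 0 z = 0" "b z 0 = 0"
  by (simp_all only: 1(1)[of z, unfolded Vector_Spaces.linear_iff] 1(2)[of z, unfolded Vector_Spaces.linear_iff] mult_zero_left)
qed

lemma b_sum: "b (\<Sum>i\<in>A. f i) z = (\<Sum>i\<in>A. b (f i) z)" "b z (\<Sum>i\<in>A. f i) = (\<Sum>i\<in>A. b z (f i))"
 by (induction A rule: infinite_finite_induct) (auto simp: b_linear)

lemma b_homogeneous: "x \<in> V q \<Longrightarrow> y \<in> V q' \<Longrightarrow> b x y \<noteq> 0 \<Longrightarrow> q + q' = d"
proof -
 assume "x \<in> V q" "y \<in> V q'" "b x y \<noteq> 0"
 then have "q + q' + d = 0" using homogeneous unfolding homogeneous_form_def by blast
 then show "q + q' = d" by (cases q; cases q'; cases d) simp_all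
qed

lemma b_symmetric: "x \<in> V q \<Longrightarrow> y \<in> V q' \<Longrightarrow> b x y = koszul (q * q') * b y x"
 using supersymmetric unfolding supersymmetric_form_def by blast

lemma basis_V:
 assumes "homogeneous_basis scale V (m + n) w" "i < dm"
 shows "w i \<in> V (par V (w i))" "w i \<noteq> 0"
proof -
 show "w i \<in> V (par V (w i))"
  by (rule V_par) (use assms in \<open>simp add: homogeneous_basis_def dm_def\<close>)
 show "w i \<noteq> 0"
 proof
  assume "w i = 0"
  then have "0 \<in> w ` {..<m + n}" using assms(2) unfolding dm_def by (metis imageI lessThan_iff)
  moreover have "independent (w ` {..<m + n})" using assms(1) by (simp add: homogeneous_basis_def)
  ultimately show False using dependent_zero by simp
 qed
qed

lemma basis_coefficients:
 assumes "homogeneous_basis scale V (m + n) w"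
 shows "\<exists>c. x = (\<Sum>i<dm. scale (c i) (w i))"
proof -
 have "x \<in> span (w ` {..<dm})" using assms by (simp add: homogeneous_basis_def dm_def)
 then obtain u where u: "x = (\<Sum>y\<in>w ` {..<dm}. scale (u y) y)" by (auto simp: span_finite)
 have "inj_on w {..<dm}" using assms by (simp add: homogeneous_basis_def dm_def)
 then have "x = (\<Sum>i<dm. scale (u (w i)) (w i))" unfolding u by (simp add: sum.reindex)
 then show ?thesis by (rule exI[of _ "\<lambda>i. u (w i)"])
qed

lemma sum_delta_scale: "i < dm \<Longrightarrow> (\<Sum>j<dm. c j * (if i = j then 1 else 0)) = (c i :: 'k)"
 by (simp add: if_distrib cong: if_cong)

text \<open>Pairing with the other basis isolates the coefficients.\<close>

lemma expand: "x = (\<Sum>i<dm. scale (b x (v' i)) (v i))"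
 and expand': "x = (\<Sum>i<dm. scale (b (v i) x) (v' i))"
proof -
 obtain c where c: "x = (\<Sum>i<dm. scale (c i) (v i))" using basis_coefficients[OF basis] by blast
 have "b x (v' i) = c i" if "i < dm" for i
 proof -
  have "b x (v' i) = (\<Sum>j<dm. c j * b (v j) (v' i))" unfolding c by (simp add: b_sum b_linear)
  also have "\<dots> = (\<Sum>j<dm. c j * (if i = j then 1 else 0))"
   by (rule sum.cong) (use dual that in \<open>auto simp: dm_def\<close>)
  also have "\<dots> = c i" by (rule sum_delta_scale[OF that])
  finally show ?thesis .
 qed
 then have "(\<Sum>i<dm. scale (b x (v' i)) (v i)) = (\<Sum>i<dm. scale (c i) (v i))" by simp
 then show "x = (\<Sum>i<dm. scale (b x (v' i)) (v i))" unfolding c[symmetric] ..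
next
 obtain c where c: "x = (\<Sum>i<dm. scale (c i) (v' i))" using basis_coefficients[OF basis'] by blast
 have "b (v i) x = c i" if "i < dm" for i
 proof -
  have "b (v i) x = (\<Sum>j<dm. c j * b (v i) (v' j))" unfolding c by (simp add: b_sum b_linear)
  also have "\<dots> = (\<Sum>j<dm. c j * (if i = j then 1 else 0))"
   by (rule sum.cong) (use dual that in \<open>auto simp: dm_def\<close>)
  also have "\<dots> = c i" by (rule sum_delta_scale[OF that])
  finally show ?thesis .
 qed
 then have "(\<Sum>i<dm. scale (b (v i) x) (v' i)) = (\<Sum>i<dm. scale (c i) (v' i))" by simp
 then show "x = (\<Sum>i<dm. scale (b (v i) x) (v' i))" unfolding c[symmetric] ..
qed

lemma contract: "(\<Sum>i<dm. b x (v' i) * b (v i) y) = b x y"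
proof -
 have "b x y = b (\<Sum>i<dm. scale (b x (v' i)) (v i)) y" using expand[of x] by simp
 then show ?thesis by (simp add: b_sum b_linear)
qed

lemma contract': "(\<Sum>i<dm. b (v i) x * b (v' i) y) = b x y"
proof -
 have "b x y = b (\<Sum>i<dm. scale (b (v i) x) (v' i)) y" using expand'[of x] by simp
 then show ?thesis by (simp add: b_sum b_linear)
qed

lemma dual_eq: "i < dm \<Longrightarrow> j < dm \<Longrightarrow> b (v i) (v' j) = (if i = j then 1 else 0)"
 using dual by (simp add: dm_def)

lemma v_V: "i < dm \<Longrightarrow> v i \<in> V (p i)"
 unfolding p_def by (rule basis_V(1)[OF basis])

lemma v'_V: "i < dm \<Longrightarrow> v' i \<in> V (p i + d)"
proof -
 assume i: "i < dm"
 have "b (v i) (v' i) \<noteq> 0" using dual_eq[OF i i] by simp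
 then have "p i + par V (v' i) = d" by (rule b_homogeneous[OF v_V[OF i] basis_V(1)[OF basis' i]])
 then have "par V (v' i) = p i + d" by (metis bit_add_self2)
 then show ?thesis using basis_V(1)[OF basis' i] by simp
qed

text \<open>Sorted by degree, a homogeneous basis consists of bases of the two homogeneous parts.
  The statement is for arbitrary homogeneous bases because it is applied to \<open>v\<close> as well
  as to \<open>v'\<close>.\<close>

lemma superdimension:
 assumes w: "homogeneous_basis scale V (m + n) w"
 shows "(\<Sum>i<dm. koszul (par V (w i))) = (of_nat m - of_nat n :: 'k)"
proof -
 let ?I = "\<lambda>q. {i. i < dm \<and> par V (w i) = q}"
 have inj: "inj_on w {..<dm}" and ind: "independent (w ` {..<dm})"
  using w by (simp_all add: homogeneous_basis_def dm_def)
 have sp: "V q \<subseteq> span (w ` ?I q)" for q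
 proof
  fix x assume x: "x \<in> V q"
  obtain c where c: "x = (\<Sum>i<dm. scale (c i) (w i))" using basis_coefficients[OF w] by blast
  let ?y = "\<Sum>i\<in>?I q. scale (c i) (w i)" and ?z = "\<Sum>i\<in>?I (q + 1). scale (c i) (w i)"
  have "{..<dm} = ?I q \<union> ?I (q + 1)" by (cases q) auto
  moreover have "?I q \<inter> ?I (q + 1) = {}" by (cases q) auto
  ultimately have xs: "x = ?y + ?z" unfolding c by (subst sum.union_disjoint[symmetric]) auto
  have y: "?y \<in> V q" and z: "?z \<in> V (q + 1)"
   by (rule V_sum; auto intro!: V_scale simp: basis_V(1)[OF w] dest: sym)+
  \<comment> \<open>The part of the expansion in the opposite degree lies in both homogeneous parts,
    hence vanishes.\<close>
  have "?z = x - ?y" using xs by simp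
  then have "?z \<in> V q" using V_diff[OF x y] by simp
  then have "?z = 0" using z V_unique[of ?z q "q + 1"] by (cases q) auto
  then have "x = ?y" using xs by simp
  show "x \<in> span (w ` ?I q)" by (subst \<open>x = ?y\<close>, rule span_sum, rule span_scale, rule span_base) blast
 qed
 have "card (?I q) = dim (V q)" for q
 proof -
  have "card (w ` ?I q) = dim (V q)"
  proof (rule basis_card_eq_dim[OF _ sp])
   show "w ` ?I q \<subseteq> V q" using basis_V(1)[OF w] by auto
   show "independent (w ` ?I q)" by (rule independent_mono[OF ind]) auto
  qed
  moreover have "inj_on w (?I q)" by (rule inj_on_subset[OF inj]) auto
  ultimately show ?thesis by (simp add: card_image)
 qed
 then have c: "card (?I 0) = m" "card (?I 1) = n" using superspace by (simp_all add: superspace_def)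
 have u: "{..<dm} = ?I 0 \<union> ?I 1" "?I 0 \<inter> ?I 1 = {}" by auto
 have "(\<Sum>i<dm. koszul (par V (w i)) :: 'k) = (\<Sum>i\<in>?I 0. koszul (par V (w i))) + (\<Sum>i\<in>?I 1. koszul (par V (w i)))"
  by (subst u(1), rule sum.union_disjoint) (use u(2) in auto)
 also have "\<dots> = of_nat m - of_nat n" using c by simp
 finally show ?thesis .
qed

lemma delta_sum: "\<delta> = (\<Sum>i<dm. koszul (p i))"
 unfolding p_def delta_eq superdimension[OF basis] ..

lemma two_nonzero: "(2 :: 'k) \<noteq> 0"
proof
 assume "(2 :: 'k) = 0"
 then have "of_nat 2 = (0 :: 'k)" by simp
 then have "CHAR('k) dvd 2" by (simp only: of_nat_eq_0_iff_char_dvd)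
 then have "CHAR('k) = 1 \<or> CHAR('k) = 2" using prime_nat_iff two_is_prime_nat by blast
 then show False using char CHAR_not_1 by auto
qed

text \<open>For an odd form \<open>v'\<close> is a homogeneous basis with the parities of
  \<open>v\<close> exchanged, so \<delta> = - \<delta>; and 2 is invertible.\<close>

lemma delta_zero: "d = 1 \<Longrightarrow> \<delta> = 0"
proof -
 assume d: "d = 1"
 have "\<delta> = (\<Sum>i<dm. koszul (par V (v' i)))" unfolding delta_eq superdimension[OF basis'] ..
 also have "\<dots> = (\<Sum>i<dm. - koszul (p i))"
 proof (rule sum.cong[OF HOL.refl])
  fix i assume "i \<in> {..<dm}"
  then have i: "i < dm" by simp
  have "par V (v' i) = p i + d"
   using V_unique[OF basis_V(1)[OF basis' i] v'_V[OF i] basis_V(2)[OF basis' i]] .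
  then show "koszul (par V (v' i)) = - koszul (p i)" by (simp add: d koszul_add)
 qed
 also have "\<dots> = - \<delta>" unfolding delta_sum by (rule sum_negf)
 finally have "2 * \<delta> = 0" by simp
 then show "\<delta> = 0" using two_nonzero by simp
qed

definition u :: "bool \<Rightarrow> nat \<Rightarrow> 'v" where
 "u s i = (if s then v i else v' i)"

text \<open>Extended by zero, so that the identities of \<open>supermatrix\<close> that are stated
  without bounds on the labels hold for all natural numbers.\<close>

definition g :: "bool \<Rightarrow> nat \<Rightarrow> bool \<Rightarrow> nat \<Rightarrow> 'k" where
 "g s i t j = (if i < dm \<and> j < dm then b (u s i) (u t j) else 0)"

lemma u_V: "i < dm \<Longrightarrow> u s i \<in> V (p i + (if s then 0 else d))"
 using v_V v'_V by (simp add: u_def)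

sublocale supermatrix dm p d g \<epsilon> \<delta>
proof
 show "g s i t j = koszul ((p i + (if s then 0 else d)) * (p j + (if t then 0 else d))) * g t j s i" for s i t j
  using b_symmetric[OF u_V[of i s] u_V[of j t]] by (simp add: g_def)
 show "p i + p j = d + (if s then 0 else d) + (if t then 0 else d)" if "g s i t j \<noteq> 0" for s i t j
 proof -
  have ij: "i < dm" "j < dm" and nz: "b (u s i) (u t j) \<noteq> 0" using that by (auto simp: g_def split: if_splits)
  have "(p i + (if s then 0 else d)) + (p j + (if t then 0 else d)) = d"
   by (rule b_homogeneous[OF u_V[OF ij(1)] u_V[OF ij(2)] nz])
  then show ?thesis by (cases "p i"; cases "p j"; cases d; cases s; cases t) auto
 qed
 show "(\<Sum>l<dm. g s i False l * g True l t j) = g s i t j" for s i t j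
  using contract[of "u s i" "u t j"] by (cases "i < dm"; cases "j < dm") (simp_all add: g_def u_def)
 show "g True i False j = (if i = j then 1 else 0)" if "i < dm" "j < dm" for i j
  using that dual_eq by (simp add: g_def u_def)
 show "\<epsilon> = koszul d" by (rule eps_eq)
 show "\<delta> = (\<Sum>i<dm. koszul (p i))" by (rule delta_sum)
 show "\<delta> = 0" if "d = 1" by (rule delta_zero[OF that])
qed

end

section \<open>Tensor powers and their linear maps in coordinates\<close>

section \<open>Linear maps between tensor powers as matrices\<close>

text \<open>Tensors are functions. From here on their sums and multiples are treated as vectors and
  are evaluated only on demand, through \<open>pointwise\<close>.\<close>

declare plus_fun_apply [simp del] zero_fun_apply [simp del] fun_scale_apply [simp del]

lemmas pointwise = plus_fun_apply zero_fun_apply fun_scale_apply sum_fun_apply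

lemma fun_scale_0 [simp]: "fun_scale 0 f = 0"
 by (rule ext) (simp add: pointwise)

lemma sum_indices_Cons:
 "(\<Sum>l\<in>indices N (Suc k). f l) = (\<Sum>i<N. \<Sum>l\<in>indices N k. f (i # l))"
proof -
 have "indices N (Suc k) = (\<lambda>(i, l). i # l) ` ({..<N} \<times> indices N k)"
  by (auto simp: indices_def length_Suc_conv image_iff)
 moreover have "inj_on (\<lambda>(i, l). i # l) ({..<N} \<times> indices N k)" by (auto simp: inj_on_def)
 ultimately show ?thesis
  by (simp add: sum.reindex sum.cartesian_product comp_def split_def)
qed

lemma sum_indices_append:
 "(\<Sum>l\<in>indices N (j + k). f l) = (\<Sum>l\<in>indices N j. \<Sum>l'\<in>indices N k. f (l @ l'))"
proof (induction j arbitrary: f)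
 case (Suc j)
 show ?case unfolding add_Suc sum_indices_Cons by (simp add: Suc)
qed simp

lemma indices_appendE:
 assumes "l \<in> indices N (j + k)"
 obtains l1 l2 where "l = l1 @ l2" "l1 \<in> indices N j" "l2 \<in> indices N k"
proof -
 have "l = take j l @ drop j l" by simp
 moreover have "take j l \<in> indices N j" "drop j l \<in> indices N k"
  using assms by (auto simp: indices_def dest: in_set_takeD in_set_dropD)
 ultimately show ?thesis using that by blast
qed

lemma sum_indices_delta:
 "is \<in> indices N k \<Longrightarrow> (\<Sum>l\<in>indices N k. (if l = is then 1 else 0) * f l) = (f is :: 'a::comm_ring_1)"
 "is \<in> indices N k \<Longrightarrow> (\<Sum>l\<in>indices N k. f l * (if l = is then 1 else 0)) = (f is :: 'a::comm_ring_1)"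
 "is \<in> indices N k \<Longrightarrow> (\<Sum>l\<in>indices N k. (if is = l then 1 else 0) * f l) = (f is :: 'a::comm_ring_1)"
 by (simp_all add: if_distrib[of "\<lambda>c. c * _"] if_distrib[of "\<lambda>c. _ * c"] cong: if_cong)

lemma ptens_Nil: "ptens scale [] \<phi>s = (if \<phi>s = [] then 1 else 0)"
 by (auto simp: ptens_def)

lemma ptens_Cons:
 "ptens scale (x # vs) [] = 0"
 "ptens scale (x # vs) (f # \<phi>s) = (if Vector_Spaces.linear scale (*) f then f x * ptens scale vs \<phi>s else 0)"
 unfolding ptens_def by (auto simp: prod.lessThan_Suc_shift simp del: prod.lessThan_Suc)

lemma ptens_nonlinear: "\<not> (\<forall>f\<in>set \<phi>s. Vector_Spaces.linear scale (*) f) \<Longrightarrow> ptens scale vs \<phi>s = 0"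
 by (auto simp: ptens_def)

lemma ptens_length: "length \<phi>s \<noteq> length vs \<Longrightarrow> ptens scale vs \<phi>s = 0"
 by (auto simp: ptens_def)

lemma ptens_append: "ptens scale (vs @ ws) = tprod (length vs) (ptens scale vs) (ptens scale ws)"
proof
 fix \<phi>s show "ptens scale (vs @ ws) \<phi>s = tprod (length vs) (ptens scale vs) (ptens scale ws) \<phi>s"
 proof (induction vs arbitrary: \<phi>s)
  case Nil
  then show ?case by (simp add: tprod_def ptens_Nil)
 next
  case (Cons x vs)
  then show ?case by (cases \<phi>s) (simp_all add: tprod_def ptens_Cons)
 qed
qed

context osp_form
begin

text \<open>The functionals dual to the basis \<open>v\<close>.\<close>

definition \<phi> :: "nat \<Rightarrow> 'v \<Rightarrow> 'k" where
 "\<phi> i x = b x (v' i)"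

abbreviation functional :: "('v \<Rightarrow> 'k) \<Rightarrow> bool" where
 "functional f \<equiv> Vector_Spaces.linear scale (*) f"

lemma \<phi>_linear [simp]: "functional (\<phi> i)"
 using bilinear unfolding bilinear_form_def \<phi>_def by blast

lemma \<phi>_v: "i < dm \<Longrightarrow> j < dm \<Longrightarrow> \<phi> i (v j) = (if i = j then 1 else 0)"
 using dual_eq by (auto simp: \<phi>_def)

lemma \<phi>_homogeneous: "x \<in> V q \<Longrightarrow> i < dm \<Longrightarrow> \<phi> i x \<noteq> 0 \<Longrightarrow> p i = q"
proof -
 assume x: "x \<in> V q" and i: "i < dm" and "\<phi> i x \<noteq> 0"
 then have "b x (v' i) \<noteq> 0" by (simp add: \<phi>_def)
 then have "q + (p i + d) = d" by (rule b_homogeneous[OF x v'_V[OF i]])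
 then show "p i = q" by (cases q; cases "p i"; cases d) simp_all
qed

lemma functional_expand:
 assumes "functional f"
 shows "(\<Sum>i<dm. \<phi> i x * f (v i)) = f x"
proof -
 have f: "f (y + z) = f y + f z" "f (scale c y) = c * f y" for y z c
  using assms unfolding Vector_Spaces.linear_iff by auto
 have "f 0 = 0" using f(2)[of 0 0] by simp
 then have s: "f (\<Sum>i\<in>A. h i) = (\<Sum>i\<in>A. f (h i))" for A :: "nat set" and h
  by (induction A rule: infinite_finite_induct) (auto simp: f)
 have "f x = f (\<Sum>i<dm. scale (b x (v' i)) (v i))" using expand[of x] by simp
 then show ?thesis by (simp add: s f \<phi>_def)
qed

definition e :: "nat list \<Rightarrow> ('v, 'k) tensor" where
 "e is = ptens scale (map v is)"

text \<open>A tensor is a function of lists of functionals, so its coordinates are its values on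
  lists of dual basis functionals.\<close>

definition coord :: "('v, 'k) tensor \<Rightarrow> nat list \<Rightarrow> 'k" where
 "coord x is = x (map \<phi> is)"

lemma coord_simps [simp]:
 "coord (x + y) is = coord x is + coord y is" "coord (fun_scale c x) is = c * coord x is"
 "coord (\<Sum>i\<in>A. f i) is = (\<Sum>i\<in>A. coord (f i) is)" "coord 0 is = 0"
 by (simp_all add: coord_def pointwise)

text \<open>Multilinear expansion, one factor at a time. It is carried out at a fixed argument,
  where it amounts to expanding each functional; at a list of wrong length or with a nonlinear entry
  both sides are zero by convention.\<close>

lemma ptens_expand_apply: "(\<Sum>is\<in>ix (length vs). ptens scale vs (map \<phi> is) * e is \<phi>s) = ptens scale vs \<phi>s"
proof (induction vs arbitrary: \<phi>s)
 case Nil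
 then show ?case by (simp add: ptens_Nil e_def)
next
 case (Cons x vs)
 show ?case
 proof (cases \<phi>s)
  case Nil
  have "e is [] = 0" if "is \<in> ix (length (x # vs))" for "is"
   using that unfolding e_def by (intro ptens_length) (auto simp: indices_def)
  then show ?thesis unfolding Nil ptens_Cons by (intro sum.neutral) simp
 next
  case f: (Cons f fs)
  show ?thesis
  proof (cases "functional f")
   case True
   have "(\<Sum>is\<in>ix (length (x # vs)). ptens scale (x # vs) (map \<phi> is) * e is \<phi>s) =
    (\<Sum>i<dm. \<Sum>l\<in>ix (length vs). (\<phi> i x * f (v i)) * (ptens scale vs (map \<phi> l) * e l fs))"
    unfolding list.size add_Suc_right add_0_right sum_indices_Cons f e_def list.map
    by (intro sum.cong HOL.refl) (simp add: ptens_Cons True mult_ac)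
   also have "\<dots> = (\<Sum>i<dm. \<phi> i x * f (v i)) * (\<Sum>l\<in>ix (length vs). ptens scale vs (map \<phi> l) * e l fs)"
    by (rule sum_product[symmetric])
   finally show ?thesis unfolding Cons.IH functional_expand[OF True] by (simp add: f ptens_Cons True)
  next
   case False
   then have "ptens scale (map v is) \<phi>s = 0" for "is" by (intro ptens_nonlinear) (simp add: f)
   then show ?thesis unfolding e_def by (simp add: f ptens_Cons False)
  qed
 qed
qed

lemma tpow_base: "length vs = a \<Longrightarrow> ptens scale vs \<in> tp a"
 unfolding tpow_def by (rule fun_space.span_base) blast

lemma tpow_subspace: "fun_space.subspace (tp a)"
 unfolding tpow_def by (rule fun_space.subspace_span)

lemmas tpow_add = fun_space.subspace_add[OF tpow_subspace]
 and tpow_scale = fun_space.subspace_scale[OF tpow_subspace]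
 and tpow_sum = fun_space.subspace_sum[OF tpow_subspace]
 and tpow_zero = fun_space.subspace_0[OF tpow_subspace]

lemma e_tpow [simp]: "is \<in> ix a \<Longrightarrow> e is \<in> tp a"
 unfolding e_def by (rule tpow_base) (simp add: indices_def)

lemma tpow_induct [consumes 1, case_names zero step]:
 assumes "x \<in> tp a" "P 0"
  "\<And>c vs y. length vs = a \<Longrightarrow> y \<in> tp a \<Longrightarrow> P y \<Longrightarrow> P (fun_scale c (ptens scale vs) + y)"
 shows "P x"
proof -
 have "x \<in> tp a \<and> P x" using assms(1) unfolding tpow_def
 proof (induction rule: fun_space.span_induct_alt)
  case base
  show ?case using assms(2) tpow_zero unfolding tpow_def by blast
 next
  case (step c x y)
  then obtain vs where "x = ptens scale vs" "length vs = a" by blast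
  then show ?case using step assms(3) tpow_add[OF tpow_scale[OF tpow_base]] unfolding tpow_def[symmetric] by blast
 qed
 then show ?thesis ..
qed

lemma tpow_expand:
 assumes "x \<in> tp a"
 shows "x = (\<Sum>is\<in>ix a. fun_scale (coord x is) (e is))"
 using assms
proof (induction rule: tpow_induct)
 case zero
 show ?case by simp
next
 case (step c vs y)
 have 1: "ptens scale vs = (\<Sum>is\<in>ix a. fun_scale (coord (ptens scale vs) is) (e is))"
  by (rule ext) (use ptens_expand_apply[of vs] step(1) in \<open>simp add: coord_def pointwise\<close>)
 show ?case
 proof
  fix \<phi>s
  show "(fun_scale c (ptens scale vs) + y) \<phi>s = (\<Sum>is\<in>ix a. fun_scale (coord (fun_scale c (ptens scale vs) + y) is) (e is)) \<phi>s"
   using fun_cong[OF 1, of \<phi>s] fun_cong[OF step(3), of \<phi>s]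
   by (simp add: pointwise sum.distrib sum_distrib_left algebra_simps)
 qed
qed

lemma tpow_eqI:
 assumes "x \<in> tp a" "y \<in> tp a" "\<And>is. is \<in> ix a \<Longrightarrow> coord x is = coord y is"
 shows "x = y"
 using tpow_expand[OF assms(1)] tpow_expand[OF assms(2)] assms(3) by simp

lemma coord_e: "is \<in> ix a \<Longrightarrow> js \<in> ix a \<Longrightarrow> coord (e is) js = (if is = js then 1 else 0)"
proof (induction a arbitrary: "is" js)
 case 0
 then show ?case by (simp add: coord_def e_def ptens_Nil)
next
 case (Suc a)
 obtain i i' j j' where "is = i # i'" "js = j # j'" using Suc.prems by (auto simp: indices_def length_Suc_conv)
 then show ?case using Suc by (auto simp: coord_def e_def ptens_Cons \<phi>_v indices_def)
qed

lemma coord_linear_combination: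
 "js \<in> ix a \<Longrightarrow> coord (\<Sum>is\<in>ix a. fun_scale (c is) (e is)) js = c js"
 by (simp add: coord_e if_distrib cong: if_cong)

text \<open>The first index of \<open>K\<close> belongs to the source, in accordance with maps
  written on the right; composition is then the matrix product in the order of writing.\<close>

definition lmat :: "nat \<Rightarrow> nat \<Rightarrow> (nat list \<Rightarrow> nat list \<Rightarrow> 'k) \<Rightarrow> ('v, 'k) tensor \<Rightarrow> ('v, 'k) tensor" where
 "lmat a c K = (\<lambda>x\<in>tp a. \<Sum>js\<in>ix c. fun_scale (\<Sum>is\<in>ix a. coord x is * K is js) (e js))"

lemma lmat_tpow: "x \<in> tp a \<Longrightarrow> lmat a c K x \<in> tp c"
 unfolding lmat_def by (simp, rule tpow_sum, rule tpow_scale, rule e_tpow)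

lemma coord_lmat:
 "x \<in> tp a \<Longrightarrow> js \<in> ix c \<Longrightarrow> coord (lmat a c K x) js = (\<Sum>is\<in>ix a. coord x is * K is js)"
 unfolding lmat_def by (simp add: coord_linear_combination del: coord_simps(3))

lemma coord_lmat_e: "is \<in> ix a \<Longrightarrow> js \<in> ix c \<Longrightarrow> coord (lmat a c K (e is)) js = K is js"
proof -
 assume 1: "is \<in> ix a" "js \<in> ix c"
 have "(\<Sum>l\<in>ix a. coord (e is) l * K l js) = (\<Sum>l\<in>ix a. (if is = l then 1 else 0) * K l js)"
  by (rule sum.cong) (use coord_e[OF 1(1)] in auto)
 then show ?thesis using coord_lmat[OF e_tpow[OF 1(1)] 1(2)] sum_indices_delta(3)[OF 1(1)] by simp
qed

lemma lmat_lin: "lmat a c K \<in> lin scale a c"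
 unfolding lin_def
proof (intro CollectI conjI ballI allI)
 show "lmat a c K \<in> tp a \<rightarrow>\<^sub>E tp c"
  by (rule PiE_I, erule lmat_tpow) (simp add: lmat_def)
 show "lmat a c K (x + y) = lmat a c K x + lmat a c K y" if "x \<in> tp a" "y \<in> tp a" for x y
  by (rule tpow_eqI[of _ c]) (use that in \<open>auto intro!: lmat_tpow tpow_add simp: coord_lmat tpow_add algebra_simps sum.distrib\<close>)
 show "lmat a c K (fun_scale t x) = fun_scale t (lmat a c K x)" if "x \<in> tp a" for t x
  by (rule tpow_eqI[of _ c]) (use that in \<open>auto intro!: lmat_tpow tpow_scale simp: coord_lmat tpow_scale sum_distrib_left mult_ac\<close>)
qed

lemma linD:
 assumes "f \<in> lin scale a c"
 shows "x \<in> tp a \<Longrightarrow> f x \<in> tp c" "x \<notin> tp a \<Longrightarrow> f x = undefined"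
  "x \<in> tp a \<Longrightarrow> y \<in> tp a \<Longrightarrow> f (x + y) = f x + f y"
  "x \<in> tp a \<Longrightarrow> f (fun_scale t x) = fun_scale t (f x)"
proof -
 have f: "f \<in> tp a \<rightarrow>\<^sub>E tp c" using assms by (simp add: lin_def)
 show "x \<in> tp a \<Longrightarrow> f x \<in> tp c" using f by (rule PiE_mem)
 show "x \<notin> tp a \<Longrightarrow> f x = undefined" using f by (rule PiE_arb)
 show "x \<in> tp a \<Longrightarrow> y \<in> tp a \<Longrightarrow> f (x + y) = f x + f y"
  "x \<in> tp a \<Longrightarrow> f (fun_scale t x) = fun_scale t (f x)"
  using assms unfolding lin_def by blast+
qed

lemma lin_sum:
 assumes f: "f \<in> lin scale a c" and "\<And>i. i \<in> A \<Longrightarrow> x i \<in> tp a"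
 shows "f (\<Sum>i\<in>A. x i) = (\<Sum>i\<in>A. f (x i))"
 using assms(2)
proof (induction A rule: infinite_finite_induct)
 case (insert i A)
 have "(\<Sum>i\<in>A. x i) \<in> tp a" by (rule tpow_sum) (use insert in auto)
 then show ?case using insert linD(3)[OF f, of "x i" "\<Sum>i\<in>A. x i"] by simp
next
 case empty
 show ?case using linD(4)[OF f tpow_zero, of 0] by simp
next
 case (infinite A)
 then show ?case using linD(4)[OF f tpow_zero, of 0] by simp
qed

lemma lin_eqI:
 assumes f: "f \<in> lin scale a c" and f': "f' \<in> lin scale a c"
  and eq: "\<And>is. is \<in> ix a \<Longrightarrow> f (e is) = f' (e is)"
 shows "f = f'"
proof
 fix x show "f x = f' x"
 proof (cases "x \<in> tp a")
  case True
  have "h x = (\<Sum>is\<in>ix a. fun_scale (coord x is) (h (e is)))" if h: "h \<in> lin scale a c" for h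
  proof -
   have "h x = h (\<Sum>is\<in>ix a. fun_scale (coord x is) (e is))" using tpow_expand[OF True] by simp
   also have "\<dots> = (\<Sum>is\<in>ix a. h (fun_scale (coord x is) (e is)))"
    by (rule lin_sum[OF h]) (auto intro: tpow_scale)
   also have "\<dots> = (\<Sum>is\<in>ix a. fun_scale (coord x is) (h (e is)))"
    by (rule sum.cong) (simp_all add: linD(4)[OF h])
   finally show ?thesis .
  qed
  then show ?thesis using f f' eq by simp
 next
  case False
  then show ?thesis using linD(2)[OF f] linD(2)[OF f'] by simp
 qed
qed

lemma lin_coord_eqI:
 assumes f: "f \<in> lin scale a c" and f': "f' \<in> lin scale a c"
  and eq: "\<And>is js. is \<in> ix a \<Longrightarrow> js \<in> ix c \<Longrightarrow> coord (f (e is)) js = coord (f' (e is)) js"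
 shows "f = f'"
 by (rule lin_eqI[OF f f'], rule tpow_eqI[of _ c]) (use linD(1)[OF f] linD(1)[OF f'] eq in auto)

lemma lmat_eqI:
 "(\<And>is js. is \<in> ix a \<Longrightarrow> js \<in> ix c \<Longrightarrow> K is js = K' is js) \<Longrightarrow> lmat a c K = lmat a c K'"
 by (rule lin_coord_eqI[OF lmat_lin lmat_lin]) (simp add: coord_lmat_e)

lemma lmat_comp:
 "(\<lambda>x\<in>tp a. lmat c f K' (lmat a c K x)) = lmat a f (\<lambda>is js. \<Sum>l\<in>ix c. K is l * K' l js)"
proof
 fix x
 show "(\<lambda>x\<in>tp a. lmat c f K' (lmat a c K x)) x = lmat a f (\<lambda>is js. \<Sum>l\<in>ix c. K is l * K' l js) x"
 proof (cases "x \<in> tp a")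
  case True
  have "lmat c f K' (lmat a c K x) = lmat a f (\<lambda>is js. \<Sum>l\<in>ix c. K is l * K' l js) x"
  proof (rule tpow_eqI[of _ f])
   fix js assume js: "js \<in> ix f"
   have "coord (lmat c f K' (lmat a c K x)) js = (\<Sum>l\<in>ix c. (\<Sum>is\<in>ix a. coord x is * K is l) * K' l js)"
    using True js by (simp add: coord_lmat lmat_tpow)
   also have "\<dots> = (\<Sum>is\<in>ix a. \<Sum>l\<in>ix c. coord x is * (K is l * K' l js))"
    unfolding sum_distrib_right by (subst sum.swap) (simp add: mult.assoc)
   finally show "coord (lmat c f K' (lmat a c K x)) js = coord (lmat a f (\<lambda>is js. \<Sum>l\<in>ix c. K is l * K' l js) x) js"
    using True js by (simp add: coord_lmat sum_distrib_left)
  qed (use True in \<open>auto intro: lmat_tpow\<close>)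
  then show ?thesis using True by simp
 qed (simp add: lmat_def)
qed

lemma lmat_plus: "(\<lambda>x\<in>tp a. lmat a c K x + lmat a c K' x) = lmat a c (\<lambda>is js. K is js + K' is js)"
proof
 fix x
 show "(\<lambda>x\<in>tp a. lmat a c K x + lmat a c K' x) x = lmat a c (\<lambda>is js. K is js + K' is js) x"
 proof (cases "x \<in> tp a")
  case True
  have "lmat a c K x + lmat a c K' x = lmat a c (\<lambda>is js. K is js + K' is js) x"
   by (rule tpow_eqI[of _ c])
    (use True in \<open>auto intro!: lmat_tpow tpow_add simp: coord_lmat algebra_simps sum.distrib\<close>)
  then show ?thesis using True by simp
 qed (simp add: lmat_def)
qed

lemma lmat_smult: "(\<lambda>x\<in>tp a. fun_scale t (lmat a c K x)) = lmat a c (\<lambda>is js. t * K is js)"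
proof
 fix x
 show "(\<lambda>x\<in>tp a. fun_scale t (lmat a c K x)) x = lmat a c (\<lambda>is js. t * K is js) x"
 proof (cases "x \<in> tp a")
  case True
  have "fun_scale t (lmat a c K x) = lmat a c (\<lambda>is js. t * K is js) x"
   by (rule tpow_eqI[of _ c])
    (use True in \<open>auto intro!: lmat_tpow tpow_scale simp: coord_lmat sum_distrib_left mult_ac\<close>)
  then show ?thesis using True by simp
 qed (simp add: lmat_def)
qed

lemma lmat_ident: "(\<lambda>x\<in>tp a. x) = lmat a a (\<lambda>is js. if is = js then 1 else 0)"
proof
 fix x
 show "(\<lambda>x\<in>tp a. x) x = lmat a a (\<lambda>is js. if is = js then 1 else 0) x"
 proof (cases "x \<in> tp a")
  case True
  have "x = lmat a a (\<lambda>is js. if is = js then 1 else 0) x"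
   by (rule tpow_eqI[of _ a]) (use True in \<open>auto intro: lmat_tpow simp: coord_lmat if_distrib cong: if_cong\<close>)
  then show ?thesis using True by simp
 qed (simp add: lmat_def)
qed

lemma v_homogeneous: "i < dm \<Longrightarrow> Defs.homogeneous V (v i)"
 using v_V V_homogeneous by blast

lemma e_homogeneous:
 assumes "is \<in> ix a"
 shows "length (map v is) = a" "\<forall>x\<in>set (map v is). Defs.homogeneous V x"
  "sum_list (map (par V) (map v is)) = parity p is"
 using assms v_homogeneous by (auto simp: indices_def parity_def p_def[abs_def] comp_def)

lemma e_tpow_deg: "is \<in> ix a \<Longrightarrow> e is \<in> tpow_deg scale V a (parity p is)"
 unfolding tpow_deg_def e_def
 by (rule fun_space.span_base, rule CollectI, rule exI[of _ "map v is"])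
  (intro conjI HOL.refl e_homogeneous)

lemma tpow_deg_subspace: "fun_space.subspace (tpow_deg scale V a q)"
 unfolding tpow_deg_def by (rule fun_space.subspace_span)

lemma ptens_homogeneous_coord:
 assumes "\<forall>x\<in>set vs. Defs.homogeneous V x" "is \<in> ix (length vs)" "coord (ptens scale vs) is \<noteq> 0"
 shows "parity p is = sum_list (map (par V) vs)"
 using assms
proof (induction vs arbitrary: "is")
 case Nil
 then show ?case by simp
next
 case (Cons x vs)
 obtain i i' where i: "is = i # i'" "i < dm" "i' \<in> ix (length vs)"
  using Cons.prems(2) by (auto simp: indices_def length_Suc_conv)
 then have "\<phi> i x \<noteq> 0" "coord (ptens scale vs) i' \<noteq> 0" using Cons.prems(3) by (auto simp: coord_def ptens_Cons)
 moreover have "x \<in> V (par V x)" using Cons.prems(1) V_par by simp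
 ultimately show ?case using \<phi>_homogeneous[of x "par V x" i] Cons.IH[OF _ i(3)] Cons.prems(1) i by simp
qed

lemma tpow_deg_coord:
 assumes "x \<in> tpow_deg scale V a q"
 shows "x \<in> tp a \<and> (\<forall>is\<in>ix a. coord x is \<noteq> 0 \<longrightarrow> parity p is = q)"
 using assms unfolding tpow_deg_def
proof (induction rule: fun_space.span_induct_alt)
 case base
 show ?case using tpow_zero coord_simps(4) by blast
next
 case (step c x y)
 then obtain vs where vs: "x = ptens scale vs" "length vs = a" "\<forall>x\<in>set vs. Defs.homogeneous V x"
  "sum_list (map (par V) vs) = q" by blast
 have "parity p is = q" if "is \<in> ix a" "coord x is \<noteq> 0" for "is"
  using ptens_homogeneous_coord[OF vs(3), of "is"] that vs by simp
 moreover have "x \<in> tp a" unfolding vs(1) by (rule tpow_base[OF vs(2)])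
 ultimately show ?case using step.IH tpow_add[OF tpow_scale] by (metis add_0_right coord_simps(1,2) mult_zero_right)
qed

lemma tpow_degI:
 assumes "x \<in> tp a" "\<And>is. is \<in> ix a \<Longrightarrow> coord x is \<noteq> 0 \<Longrightarrow> parity p is = q"
 shows "x \<in> tpow_deg scale V a q"
proof -
 have "fun_scale (coord x is) (e is) \<in> tpow_deg scale V a q" if i: "is \<in> ix a" for "is"
 proof (cases "coord x is = 0")
  case True
  then show ?thesis using fun_space.subspace_0[OF tpow_deg_subspace] by simp
 next
  case False
  then show ?thesis using fun_space.subspace_scale[OF tpow_deg_subspace] e_tpow_deg[OF i] assms(2)[OF i] by simp
 qed
 then have "(\<Sum>is\<in>ix a. fun_scale (coord x is) (e is)) \<in> tpow_deg scale V a q"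
  by (rule fun_space.subspace_sum[OF tpow_deg_subspace])
 then show ?thesis using tpow_expand[OF assms(1)] by simp
qed

lemma lmat_deg:
 assumes "\<And>is js. is \<in> ix a \<Longrightarrow> js \<in> ix c \<Longrightarrow> K is js \<noteq> 0 \<Longrightarrow> parity p is + parity p js = q"
 shows "lmat a c K \<in> lin_deg scale V a c q"
 unfolding lin_deg_def
proof (intro CollectI conjI allI image_subsetI lmat_lin)
 fix q' x assume x: "x \<in> tpow_deg scale V a q'"
 show "lmat a c K x \<in> tpow_deg scale V c (q + q')"
 proof (rule tpow_degI)
  show "lmat a c K x \<in> tp c" using tpow_deg_coord[OF x] lmat_tpow by blast
  fix js assume js: "js \<in> ix c" "coord (lmat a c K x) js \<noteq> 0"
  then have "(\<Sum>is\<in>ix a. coord x is * K is js) \<noteq> 0" using tpow_deg_coord[OF x] coord_lmat by simp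
  then obtain "is" where i: "is \<in> ix a" "coord x is * K is js \<noteq> 0" by (meson sum.neutral)
  then have "parity p is = q'" "parity p is + parity p js = q"
   using tpow_deg_coord[OF x] assms[OF i(1) js(1)] by auto
  then show "parity p js = q + q'" by (cases "parity p is"; cases "parity p js") auto
 qed
qed

text \<open>Resolves the definite description: basis tensors are products of homogeneous vectors,
  and a linear map is determined by its values on them.\<close>

lemma lin_map_eq:
 assumes f: "f \<in> lin scale a c"
  and F: "\<And>vs. length vs = a \<Longrightarrow> \<forall>x\<in>set vs. Defs.homogeneous V x \<Longrightarrow> f (ptens scale vs) = F vs"
 shows "lin_map scale V a c F = f"
 unfolding lin_map_def
proof (rule the_equality)
 show "f \<in> lin scale a c \<and> (\<forall>vs. length vs = a \<and> (\<forall>v\<in>set vs. Defs.homogeneous V v) \<longrightarrow> f (ptens scale vs) = F vs)"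
  using f F by blast
 fix h assume h: "h \<in> lin scale a c \<and> (\<forall>vs. length vs = a \<and> (\<forall>v\<in>set vs. Defs.homogeneous V v) \<longrightarrow> h (ptens scale vs) = F vs)"
 show "h = f"
 proof (rule lin_eqI[OF _ f])
  show "h \<in> lin scale a c" using h by blast
  fix "is" assume "is \<in> ix a"
  then show "h (e is) = f (e is)" using h F e_homogeneous unfolding e_def by metis
 qed
qed

lemma lmat_ptens_eq:
 assumes "length vs = a" "y \<in> tp c"
  "\<And>js. js \<in> ix c \<Longrightarrow> (\<Sum>is\<in>ix a. coord (ptens scale vs) is * K is js) = coord y js"
 shows "lmat a c K (ptens scale vs) = y"
 by (rule tpow_eqI[of _ c]) (use assms in \<open>auto intro: lmat_tpow tpow_base simp: coord_lmat tpow_base\<close>)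

lemma tprod_tpow:
 assumes "x \<in> tp a" "y \<in> tp a'"
 shows "tprod a x y \<in> tp (a + a')"
proof -
 have "tprod a x y = (\<Sum>is\<in>ix a. \<Sum>is'\<in>ix a'. fun_scale (coord x is * coord y is') (e (is @ is')))"
 proof
  fix \<phi>s
  have ee: "e (is @ is') \<phi>s = e is (take a \<phi>s) * e is' (drop a \<phi>s)" if "is \<in> ix a" for "is" is'
   using that unfolding e_def by (simp add: ptens_append tprod_def indices_def)
  have "tprod a x y \<phi>s = (\<Sum>is\<in>ix a. coord x is * e is (take a \<phi>s)) * (\<Sum>is'\<in>ix a'. coord y is' * e is' (drop a \<phi>s))"
   unfolding tprod_def
   using fun_cong[OF tpow_expand[OF assms(1)], of "take a \<phi>s"] fun_cong[OF tpow_expand[OF assms(2)], of "drop a \<phi>s"]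
   by (simp add: pointwise)
  also have "\<dots> = (\<Sum>is\<in>ix a. \<Sum>is'\<in>ix a'. (coord x is * e is (take a \<phi>s)) * (coord y is' * e is' (drop a \<phi>s)))"
   by (rule sum_product)
  also have "\<dots> = (\<Sum>is\<in>ix a. \<Sum>is'\<in>ix a'. fun_scale (coord x is * coord y is') (e (is @ is'))) \<phi>s"
   unfolding sum_fun_apply by (intro sum.cong HOL.refl) (simp add: ee pointwise mult_ac)
  finally show "tprod a x y \<phi>s = \<dots>" .
 qed
 moreover have "e (is @ is') \<in> tp (a + a')" if "is \<in> ix a" "is' \<in> ix a'" for "is" is'
  by (rule e_tpow) (use that in \<open>auto simp: indices_def\<close>)
 ultimately show ?thesis by (auto intro!: tpow_sum tpow_scale)
qed

lemma coord_tprod: "is \<in> ix a \<Longrightarrow> coord (tprod a x y) (is @ js) = coord x is * coord y js"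
 by (simp add: coord_def tprod_def indices_def)

text \<open>An entry of the first matrix has the parity of its two labels together, and it passes
  the input of the second map, whence the sign.\<close>

definition tensor_matrix ::
 "nat \<Rightarrow> nat \<Rightarrow> (nat list \<Rightarrow> nat list \<Rightarrow> 'k) \<Rightarrow> (nat list \<Rightarrow> nat list \<Rightarrow> 'k) \<Rightarrow> nat list \<Rightarrow> nat list \<Rightarrow> 'k" where
 "tensor_matrix a c K K' is js =
  koszul ((parity p (take a is) + parity p (take c js)) * parity p (drop a is)) *
   K (take a is) (take c js) * K' (drop a is) (drop c js)"

lemma tensor_matrix_append:
 "length is = a \<Longrightarrow> length js = c \<Longrightarrow> tensor_matrix a c K K' (is @ is') (js @ js') =
  koszul ((parity p is + parity p js) * parity p is') * K is js * K' is' js'"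
 by (simp add: tensor_matrix_def)

text \<open>Existence splits \<open>K\<close> into its entries of degree 0 and of degree 1. For
  uniqueness, any admissible \<open>f0\<close> and \<open>f1\<close> agree with these parts on basis
  tensors, since by parity each coordinate of an image comes from only one of them.\<close>

lemma hom_tensor_lmat:
 "hom_tensor scale V a c a' c' (lmat a c K) (lmat a' c' K') = lmat (a + a') (c + c') (tensor_matrix a c K K')"
 unfolding hom_tensor_def
proof (rule the_equality)
 let ?T = "lmat (a + a') (c + c') (tensor_matrix a c K K')" and ?L' = "lmat a' c' K'"
 define K0 where "K0 q is js = (if parity p is + parity p js = q then K is js else 0)" for q "is" js
 let ?L = "\<lambda>q. lmat a c (K0 q)"
 have deg: "?L q \<in> lin_deg scale V a c q" for q
  by (rule lmat_deg) (simp add: K0_def split: if_splits)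
 have split: "K is js = K0 0 is js + K0 1 is js" for "is" js
  by (simp add: K0_def)
 have 1: "lmat a c K x = ?L 0 x + ?L 1 x" if "x \<in> tp a" for x
  by (rule tpow_eqI[of _ c])
   (use that in \<open>auto intro!: lmat_tpow tpow_add simp: coord_lmat split algebra_simps sum.distrib\<close>)
 have 2: "?T (tprod a x y) =
   tprod c (?L 0 x) (?L' y) + fun_scale (koszul q) (tprod c (?L 1 x) (?L' y))"
  if x: "x \<in> tp a" and y: "y \<in> tpow_deg scale V a' q" for x q y
 proof (rule tpow_eqI[of _ "c + c'"])
  have y': "y \<in> tp a'" using tpow_deg_coord[OF y] by blast
  show "?T (tprod a x y) \<in> tp (c + c')"
   by (rule lmat_tpow[OF tprod_tpow[OF x y']])
  show "tprod c (?L 0 x) (?L' y) + fun_scale (koszul q) (tprod c (?L 1 x) (?L' y)) \<in> tp (c + c')"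
   using x y' by (auto intro!: tpow_add tpow_scale tprod_tpow lmat_tpow)
  fix ks assume ks: "ks \<in> ix (c + c')"
  then obtain js js' where js: "ks = js @ js'" "js \<in> ix c" "js' \<in> ix c'" by (rule indices_appendE)
  have "coord (?T (tprod a x y)) ks =
   (\<Sum>l\<in>ix a. \<Sum>l'\<in>ix a'. (coord x l * coord y l') * tensor_matrix a c K K' (l @ l') (js @ js'))"
   unfolding coord_lmat[OF tprod_tpow[OF x y'] ks] sum_indices_append
   unfolding js(1)
   by (intro sum.cong HOL.refl) (simp add: coord_tprod)
  also have "\<dots> = (\<Sum>l\<in>ix a. \<Sum>l'\<in>ix a'.
   (coord x l * (K0 0 l js + koszul q * K0 1 l js)) * (coord y l' * K' l' js'))"
  proof (intro sum.cong HOL.refl)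
   fix l l' assume l: "l \<in> ix a" "l' \<in> ix a'"
   have t: "tensor_matrix a c K K' (l @ l') (js @ js') = koszul ((parity p l + parity p js) * parity p l') * K l js * K' l' js'"
    by (rule tensor_matrix_append) (use l js in \<open>auto simp: indices_def\<close>)
   show "(coord x l * coord y l') * tensor_matrix a c K K' (l @ l') (js @ js') =
    (coord x l * (K0 0 l js + koszul q * K0 1 l js)) * (coord y l' * K' l' js')"
   proof (cases "coord y l' = 0")
    case False
    then have "parity p l' = q" using tpow_deg_coord[OF y] l by blast
    then have "koszul ((parity p l + parity p js) * parity p l') * K l js = K0 0 l js + koszul q * K0 1 l js"
     by (cases "parity p l + parity p js") (simp_all add: K0_def)
    then show ?thesis unfolding t by (simp add: mult_ac)
   qed simp
  qed
  also have "\<dots> = (\<Sum>l\<in>ix a. coord x l * (K0 0 l js + koszul q * K0 1 l js)) * (\<Sum>l'\<in>ix a'. coord y l' * K' l' js')"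
   by (rule sum_product[symmetric])
  also have "\<dots> = coord (tprod c (?L 0 x) (?L' y) + fun_scale (koszul q) (tprod c (?L 1 x) (?L' y))) ks"
   using js x y' by (simp add: coord_tprod coord_lmat algebra_simps sum.distrib sum_distrib_left sum_distrib_right)
  finally show "coord (?T (tprod a x y)) ks = \<dots>" .
 qed
 show "?T \<in> lin scale (a + a') (c + c') \<and>
  (\<exists>f0\<in>lin_deg scale V a c 0. \<exists>f1\<in>lin_deg scale V a c 1.
   (\<forall>x\<in>tp a. lmat a c K x = f0 x + f1 x) \<and>
   (\<forall>x\<in>tp a. \<forall>q. \<forall>y\<in>tpow_deg scale V a' q.
    ?T (tprod a x y) =
     tprod c (f0 x) (?L' y) + fun_scale (koszul q) (tprod c (f1 x) (?L' y))))"
  using lmat_lin deg 1 2 by blast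
 fix h assume "h \<in> lin scale (a + a') (c + c') \<and>
  (\<exists>f0\<in>lin_deg scale V a c 0. \<exists>f1\<in>lin_deg scale V a c 1.
   (\<forall>x\<in>tp a. lmat a c K x = f0 x + f1 x) \<and>
   (\<forall>x\<in>tp a. \<forall>q. \<forall>y\<in>tpow_deg scale V a' q.
    h (tprod a x y) = tprod c (f0 x) (?L' y) + fun_scale (koszul q) (tprod c (f1 x) (?L' y))))"
 then obtain f0 f1 where h: "h \<in> lin scale (a + a') (c + c')" and f: "f0 \<in> lin_deg scale V a c 0" "f1 \<in> lin_deg scale V a c 1"
  "\<And>x. x \<in> tp a \<Longrightarrow> lmat a c K x = f0 x + f1 x"
  and hf: "\<And>x q y. x \<in> tp a \<Longrightarrow> y \<in> tpow_deg scale V a' q \<Longrightarrow>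
   h (tprod a x y) = tprod c (f0 x) (?L' y) + fun_scale (koszul q) (tprod c (f1 x) (?L' y))" by blast
 have fe: "f0 (e is) = ?L 0 (e is) \<and> f1 (e is) = ?L 1 (e is)" if i: "is \<in> ix a" for "is"
 proof -
  have d0: "f0 (e is) \<in> tpow_deg scale V c (0 + parity p is)" and d1: "f1 (e is) \<in> tpow_deg scale V c (1 + parity p is)"
   using f(1,2) e_tpow_deg[OF i] unfolding lin_deg_def by blast+
  have c: "coord (f0 (e is)) js = K0 0 is js \<and> coord (f1 (e is)) js = K0 1 is js" if js: "js \<in> ix c" for js
  proof -
   have s: "coord (f0 (e is)) js + coord (f1 (e is)) js = K is js"
    using f(3)[OF e_tpow[OF i]] coord_lmat_e[OF i js, of K] by simp
   have z0: "coord (f0 (e is)) js \<noteq> 0 \<Longrightarrow> parity p js = 0 + parity p is"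
    and z1: "coord (f1 (e is)) js \<noteq> 0 \<Longrightarrow> parity p js = 1 + parity p is"
    using tpow_deg_coord[OF d0] tpow_deg_coord[OF d1] js by blast+
   show ?thesis
   proof (cases "parity p js = parity p is")
    case True
    then have "coord (f1 (e is)) js = 0" using z1 by (cases "parity p is") auto
    then show ?thesis using s True by (simp add: K0_def)
   next
    case False
    then have "coord (f0 (e is)) js = 0" using z0 by auto
    moreover have "parity p is + parity p js = 1" using False by (cases "parity p is"; cases "parity p js") auto
    ultimately show ?thesis using s by (simp add: K0_def)
   qed
  qed
  have t: "f0 (e is) \<in> tp c" "f1 (e is) \<in> tp c" using tpow_deg_coord[OF d0] tpow_deg_coord[OF d1] by blast+
  show ?thesis
  proof
   show "f0 (e is) = ?L 0 (e is)"
    by (rule tpow_eqI[OF t(1) lmat_tpow[OF e_tpow[OF i]]]) (simp add: c coord_lmat_e[OF i])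
   show "f1 (e is) = ?L 1 (e is)"
    by (rule tpow_eqI[OF t(2) lmat_tpow[OF e_tpow[OF i]]]) (simp add: c coord_lmat_e[OF i])
  qed
 qed
 show "h = ?T"
 proof (rule lin_eqI[OF h lmat_lin])
  fix ks assume "ks \<in> ix (a + a')"
  then obtain "is" is' where k: "ks = is @ is'" "is \<in> ix a" "is' \<in> ix a'" by (rule indices_appendE)
  have "e ks = tprod a (e is) (e is')" using k unfolding e_def by (simp add: ptens_append indices_def)
  then show "h (e ks) = ?T (e ks)"
   using hf[OF e_tpow[OF k(2)] e_tpow_deg[OF k(3)]] 2[OF e_tpow[OF k(2)] e_tpow_deg[OF k(3)]] fe[OF k(2)] by simp
 qed
qed

end

section \<open>Equivariance\<close>

lemma sum_indices_2: "(\<Sum>l\<in>indices N 2. f l) = (\<Sum>i<N. \<Sum>j<N. f [i, j])"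
 by (simp add: numeral_2_eq_2 sum_indices_Cons)

lemma indices_2E:
 assumes "is \<in> indices N 2"
 obtains i j where "is = [i, j]" "i < N" "j < N"
 using assms by (auto simp: indices_def numeral_2_eq_2 length_Suc_conv)

section \<open>The action of the Lie superalgebra in coordinates\<close>

context osp_form
begin

text \<open>The Leibniz rule evaluated on functionals, as a recursion that splits off the first
  factor; by \<open>act_sum\<close> it is the sum occurring in \<open>tensor_action\<close>.\<close>

fun act :: "bit \<Rightarrow> ('v \<Rightarrow> 'v) \<Rightarrow> 'v list \<Rightarrow> ('v \<Rightarrow> 'k) list \<Rightarrow> 'k" where
 "act q A [] fs = 0"
| "act q A (x # vs) [] = 0"
| "act q A (x # vs) (f # fs) = (if functional f
  then f (A x) * ptens scale vs fs + koszul (q * par V x) * (f x * act q A vs fs) else 0)"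

lemma act_Nil [simp]: "act q A vs [] = 0"
 by (cases vs) auto

lemma act_sum:
 "(\<Sum>i<length vs. fun_scale (koszul (q * sum_list (map (par V) (take i vs))))
  (ptens scale (vs[i := A (vs ! i)]))) fs = act q A vs fs"
proof (induction vs arbitrary: fs)
 case Nil
 then show ?case by (simp add: pointwise)
next
 case (Cons x vs)
 show ?case
 proof (cases fs)
  case Nil
  have "ptens scale ((x # vs)[i := y]) [] = 0" for i y by (rule ptens_length) (simp del: list_update.simps)
  then show ?thesis by (simp add: Nil pointwise del: sum.lessThan_Suc)
 next
  case f: (Cons f fs')
  have "(\<Sum>i<length (x # vs). fun_scale (koszul (q * sum_list (map (par V) (take i (x # vs)))))
   (ptens scale ((x # vs)[i := A ((x # vs) ! i)]))) fs =
   ptens scale (A x # vs) fs + (\<Sum>i<length vs. koszul (q * (par V x + sum_list (map (par V) (take i vs)))) *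
    ptens scale (x # vs[i := A (vs ! i)]) fs)"
   by (simp add: pointwise sum.lessThan_Suc_shift del: sum.lessThan_Suc)
  also have "(\<Sum>i<length vs. koszul (q * (par V x + sum_list (map (par V) (take i vs)))) *
    ptens scale (x # vs[i := A (vs ! i)]) fs) =
   (if functional f then koszul (q * par V x) * (f x * act q A vs fs') else 0)"
   unfolding Cons.IH[of fs', symmetric]
   by (simp add: f ptens_Cons pointwise sum_distrib_left distrib_left koszul_add mult_ac)
  finally show ?thesis by (simp add: f ptens_Cons)
 qed
qed

text \<open>Compatibility of the action with the expansion of homogeneous vectors: a coefficient
  \<open>\<phi> i x\<close> is nonzero only if \<open>v i\<close> has the degree of
  \<open>x\<close>, so the signs of the Leibniz rule match.\<close>

lemma act_expand:
 assumes A: "Vector_Spaces.linear scale scale A" and "\<forall>x\<in>set vs. Defs.homogeneous V x"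
 shows "(\<Sum>is\<in>ix (length vs). ptens scale vs (map \<phi> is) * act q A (map v is) fs) = act q A vs fs"
 using assms(2)
proof (induction vs arbitrary: fs)
 case Nil
 then show ?case by simp
next
 case (Cons x vs)
 show ?case
 proof (cases fs)
  case Nil
  then show ?thesis by simp
 next
  case f: (Cons f fs')
  show ?thesis
  proof (cases "functional f")
   case True
   have fA: "functional (\<lambda>x. f (A x))"
    using Vector_Spaces.linear_compose[OF A True] by (simp add: comp_def)
   have x: "x \<in> V (par V x)" using Cons.prems V_par by simp
   have sgn: "\<phi> i x * koszul (q * p i) = koszul (q * par V x) * \<phi> i x" if "i < dm" for i
    using \<phi>_homogeneous[OF x that] by (cases "\<phi> i x = 0") simp_all
   have "(\<Sum>is\<in>ix (length (x # vs)). ptens scale (x # vs) (map \<phi> is) * act q A (map v is) fs) =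
    (\<Sum>i<dm. \<Sum>l\<in>ix (length vs). (\<phi> i x * f (A (v i))) * (ptens scale vs (map \<phi> l) * e l fs') +
     (koszul (q * par V x) * (\<phi> i x * f (v i))) * (ptens scale vs (map \<phi> l) * act q A (map v l) fs'))"
    unfolding list.size add_Suc_right add_0_right sum_indices_Cons f e_def list.map act.simps p_def[symmetric]
   proof (intro sum.cong HOL.refl)
    fix i l assume "i \<in> {..<dm}"
    then have i: "\<phi> i x * koszul (q * p i) = koszul (q * par V x) * \<phi> i x" using sgn by simp
    have "ptens scale (x # vs) (\<phi> i # map \<phi> l) * (if functional f then f (A (v i)) * ptens scale (map v l) fs' +
      koszul (q * p i) * (f (v i) * act q A (map v l) fs') else 0) =
     \<phi> i x * f (A (v i)) * (ptens scale vs (map \<phi> l) * ptens scale (map v l) fs') +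
     (\<phi> i x * koszul (q * p i)) * (f (v i) * (ptens scale vs (map \<phi> l) * act q A (map v l) fs'))"
     by (simp add: True ptens_Cons algebra_simps)
    then show "ptens scale (x # vs) (\<phi> i # map \<phi> l) * (if functional f then f (A (v i)) * ptens scale (map v l) fs' +
      koszul (q * p i) * (f (v i) * act q A (map v l) fs') else 0) =
     \<phi> i x * f (A (v i)) * (ptens scale vs (map \<phi> l) * ptens scale (map v l) fs') +
     koszul (q * par V x) * (\<phi> i x * f (v i)) * (ptens scale vs (map \<phi> l) * act q A (map v l) fs')"
     unfolding i by (simp only: mult.assoc)
   qed
   also have "\<dots> = (\<Sum>i<dm. \<phi> i x * f (A (v i))) * (\<Sum>l\<in>ix (length vs). ptens scale vs (map \<phi> l) * e l fs') +
    (\<Sum>i<dm. koszul (q * par V x) * (\<phi> i x * f (v i))) * (\<Sum>l\<in>ix (length vs). ptens scale vs (map \<phi> l) * act q A (map v l) fs')"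
    by (simp only: sum_product sum.distrib)
   also have "(\<Sum>i<dm. koszul (q * par V x) * (\<phi> i x * f (v i))) = koszul (q * par V x) * f x"
    unfolding sum_distrib_left[symmetric] functional_expand[OF True] ..
   finally show ?thesis
    using Cons.prems unfolding functional_expand[OF fA] ptens_expand_apply
    by (simp add: Cons.IH f True mult.assoc)
  next
   case False
   have "act q A (map v is) fs = 0" if "is \<in> ix (length (x # vs))" for "is"
    using that False by (cases "is") (auto simp: f)
   then show ?thesis by (simp add: f False)
  qed
 qed
qed

lemma act_append:
 "length vs = length fs \<Longrightarrow> act q A (vs @ ws) (fs @ gs) =
  act q A vs fs * ptens scale ws gs + koszul (q * sum_list (map (par V) vs)) * ptens scale vs fs * act q A ws gs"
proof (induction vs fs rule: list_induct2)
 case Nil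
 then show ?case by (simp add: ptens_Nil)
next
 case (Cons x vs f fs)
 have "ptens scale (vs @ ws) (fs @ gs) = ptens scale vs fs * ptens scale ws gs"
  using Cons.hyps by (simp add: ptens_append tprod_def)
 then show ?case by (simp add: Cons.IH ptens_Cons algebra_simps koszul_add)
qed

definition Act :: "bit \<Rightarrow> ('v \<Rightarrow> 'v) \<Rightarrow> nat list \<Rightarrow> nat list \<Rightarrow> 'k" where
 "Act q A is js = act q A (map v is) (map \<phi> js)"

lemma tensor_action_eq:
 assumes A: "Vector_Spaces.linear scale scale A"
 shows "tensor_action scale V a q A = lmat a a (Act q A)"
 unfolding tensor_action_def
proof (rule lin_map_eq[OF lmat_lin])
 fix vs :: "'v list" assume vs: "length vs = a" "\<forall>x\<in>set vs. Defs.homogeneous V x"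
 let ?y = "\<Sum>i<a. fun_scale (koszul (q * sum_list (map (par V) (take i vs)))) (ptens scale (vs[i := A (vs ! i)]))"
 show "lmat a a (Act q A) (ptens scale vs) = ?y"
 proof (rule lmat_ptens_eq[OF vs(1)])
  show "?y \<in> tp a" by (rule tpow_sum, rule tpow_scale, rule tpow_base) (simp add: vs(1))
  show "(\<Sum>is\<in>ix a. coord (ptens scale vs) is * Act q A is js) = coord ?y js" for js
   using act_expand[OF A vs(2)] act_sum[of q vs A "map \<phi> js"] by (simp only: coord_def Act_def vs(1))
 qed
qed

lemma osp_linear: "A \<in> osp scale V b q \<Longrightarrow> Vector_Spaces.linear scale scale A"
 and osp_degree: "A \<in> osp scale V b q \<Longrightarrow> x \<in> V q' \<Longrightarrow> A x \<in> V (q + q')"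
 and osp_form: "A \<in> osp scale V b q \<Longrightarrow> x \<in> V q' \<Longrightarrow> y \<in> V q'' \<Longrightarrow> b (A x) y = - (koszul (q * q') * b x (A y))"
 unfolding osp_def by (blast, blast, simp add: eq_neg_iff_add_eq_0)

lemma Act_append:
 assumes "is \<in> ix a" "js \<in> ix a" "is' \<in> ix a'" "js' \<in> ix a'"
 shows "Act q A (is @ is') (js @ js') = Act q A is js * (if is' = js' then 1 else 0) +
  koszul (q * parity p is) * (if is = js then 1 else 0) * Act q A is' js'"
proof -
 have "ptens scale (map v is) (map \<phi> js) = (if is = js then 1 else 0)"
  "ptens scale (map v is') (map \<phi> js') = (if is' = js' then 1 else 0)"
  using coord_e[OF assms(1,2)] coord_e[OF assms(3,4)] by (simp_all add: coord_def e_def)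
 moreover have "length (map v is) = length (map \<phi> js)" using assms by (simp add: indices_def)
 ultimately show ?thesis
  using e_homogeneous(3)[OF assms(1)] by (simp only: Act_def map_append act_append)
qed

lemma Act_single: "i < dm \<Longrightarrow> j < dm \<Longrightarrow> Act q A [i] [j] = \<phi> j (A (v i))"
 by (simp add: Act_def ptens_Nil)

lemma Act_degree:
 assumes A: "A \<in> osp scale V b q" and "is \<in> ix a" "js \<in> ix a" "Act q A is js \<noteq> 0"
 shows "parity p is + parity p js = q"
 using assms(2-)
proof (induction a arbitrary: "is" js)
 case 0
 then show ?case by (simp add: Act_def)
next
 case (Suc a)
 obtain i i' j j' where ij: "is = i # i'" "js = j # j'" "i < dm" "j < dm" "i' \<in> ix a" "j' \<in> ix a"
  using Suc.prems by (auto simp: indices_def length_Suc_conv)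
 have s: "[i] \<in> ix 1" "[j] \<in> ix 1" using ij by (simp_all add: indices_def)
 have eq: "Act q A is js = Act q A [i] [j] * (if i' = j' then 1 else 0) +
  koszul (q * parity p [i]) * (if [i] = [j] then 1 else 0) * Act q A i' j'"
  using Act_append[OF s ij(5,6)] ij by simp
 consider "Act q A [i] [j] \<noteq> 0" "i' = j'" | "i = j" "Act q A i' j' \<noteq> 0"
  using Suc.prems(3) unfolding eq by (cases "Act q A [i] [j] = 0"; cases "Act q A i' j' = 0"; auto split: if_splits)
 then show ?case
 proof cases
  case 1
  then have "p j = q + p i"
   using \<phi>_homogeneous[OF osp_degree[OF A v_V[OF ij(3)]] ij(4)] Act_single ij by simp
  then show ?thesis using 1 ij by (cases "p i"; cases q; cases "parity p j'") simp_all
 next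
  case 2
  then have "parity p i' + parity p j' = q" using Suc.IH ij by blast
  then show ?thesis using 2 ij by (cases "p i"; cases "parity p i'"; cases "parity p j'") simp_all
 qed
qed

text \<open>The matrix form of the module condition. With maps on the right, \<open>K\<close>
  commutes with the action without a sign, whatever its degree.\<close>

definition equivariant :: "nat \<Rightarrow> nat \<Rightarrow> (nat list \<Rightarrow> nat list \<Rightarrow> 'k) \<Rightarrow> bool" where
 "equivariant a c K \<longleftrightarrow> (\<forall>q. \<forall>A\<in>osp scale V b q. \<forall>is\<in>ix a. \<forall>js\<in>ix c.
  (\<Sum>l\<in>ix c. K is l * Act q A l js) = (\<Sum>l\<in>ix a. Act q A is l * K l js))"

lemma equivariantI:
 assumes "\<And>q A is js. A \<in> osp scale V b q \<Longrightarrow> is \<in> ix a \<Longrightarrow> js \<in> ix c \<Longrightarrow>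
  (\<Sum>l\<in>ix c. K is l * Act q A l js) = (\<Sum>l\<in>ix a. Act q A is l * K l js)"
 shows "equivariant a c K"
 using assms unfolding equivariant_def by blast

lemma equivariantD:
 assumes "equivariant a c K" "A \<in> osp scale V b q" "is \<in> ix a" "js \<in> ix c"
 shows "(\<Sum>l\<in>ix c. K is l * Act q A l js) = (\<Sum>l\<in>ix a. Act q A is l * K l js)"
 using assms unfolding equivariant_def by blast

lemma equivariant_module_hom:
 assumes "equivariant a c K"
 shows "lmat a c K \<in> Defs.module_hom scale V b a c"
 unfolding Defs.module_hom_def
proof (intro CollectI conjI lmat_lin allI ballI)
 fix q A w assume A: "A \<in> osp scale V b q" and w: "w \<in> tp a"
 have "lmat a c (\<lambda>is js. \<Sum>l\<in>ix a. Act q A is l * K l js) = lmat a c (\<lambda>is js. \<Sum>l\<in>ix c. K is l * Act q A l js)"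
  by (rule lmat_eqI) (simp add: equivariantD[OF assms A])
 then have "(\<lambda>x\<in>tp a. lmat a c K (lmat a a (Act q A) x)) w = (\<lambda>x\<in>tp a. lmat c c (Act q A) (lmat a c K x)) w"
  by (simp only: lmat_comp)
 then show "lmat a c K (tensor_action scale V a q A w) = tensor_action scale V c q A (lmat a c K w)"
  using w by (simp add: tensor_action_eq[OF osp_linear[OF A]])
qed

lemma equivariant_cong:
 assumes "equivariant a c K" "\<And>is js. is \<in> ix a \<Longrightarrow> js \<in> ix c \<Longrightarrow> K is js = K' is js"
 shows "equivariant a c K'"
proof (rule equivariantI)
 fix q A "is" js assume A: "A \<in> osp scale V b q" and i: "is \<in> ix a" "js \<in> ix c"
 show "(\<Sum>l\<in>ix c. K' is l * Act q A l js) = (\<Sum>l\<in>ix a. Act q A is l * K' l js)"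
  using equivariantD[OF assms(1) A i] assms(2) i by simp
qed

lemma equivariant_smult: "equivariant a c K \<Longrightarrow> equivariant a c (\<lambda>is js. t * K is js)"
 unfolding equivariant_def by (simp add: mult.assoc mult.left_commute[of _ t] sum_distrib_left[symmetric])

lemma equivariant_plus: "equivariant a c K \<Longrightarrow> equivariant a c K' \<Longrightarrow> equivariant a c (\<lambda>is js. K is js + K' is js)"
 unfolding equivariant_def by (simp add: distrib_left distrib_right sum.distrib)

lemma equivariant_ident: "equivariant a a (\<lambda>is js. if is = js then 1 else 0)"
 by (rule equivariantI) (simp add: sum_indices_delta(2,3))

lemma equivariant_comp:
 assumes K: "equivariant a c K" and K': "equivariant c f K'"
 shows "equivariant a f (\<lambda>is js. \<Sum>l\<in>ix c. K is l * K' l js)"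
proof (rule equivariantI)
 fix q A "is" js assume A: "A \<in> osp scale V b q" and i: "is \<in> ix a" "js \<in> ix f"
 have "(\<Sum>l\<in>ix f. (\<Sum>k\<in>ix c. K is k * K' k l) * Act q A l js) =
  (\<Sum>k\<in>ix c. K is k * (\<Sum>l\<in>ix f. K' k l * Act q A l js))"
  unfolding sum_distrib_left sum_distrib_right by (subst sum.swap) (simp add: mult.assoc)
 also have "\<dots> = (\<Sum>k\<in>ix c. K is k * (\<Sum>l\<in>ix c. Act q A k l * K' l js))"
  by (rule sum.cong) (simp_all add: equivariantD[OF K' A _ i(2)])
 also have "\<dots> = (\<Sum>l\<in>ix c. (\<Sum>k\<in>ix c. K is k * Act q A k l) * K' l js)"
  unfolding sum_distrib_left sum_distrib_right by (subst sum.swap) (simp add: mult.assoc)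
 also have "\<dots> = (\<Sum>l\<in>ix c. (\<Sum>k\<in>ix a. Act q A is k * K k l) * K' l js)"
  by (rule sum.cong) (simp_all add: equivariantD[OF K A i(1)])
 also have "\<dots> = (\<Sum>k\<in>ix a. Act q A is k * (\<Sum>l\<in>ix c. K k l * K' l js))"
  unfolding sum_distrib_left sum_distrib_right by (subst sum.swap) (simp add: mult.assoc)
 finally show "(\<Sum>l\<in>ix f. (\<Sum>k\<in>ix c. K is k * K' k l) * Act q A l js) = \<dots>" .
qed

text \<open>The Leibniz rule for a concatenation splits both sides into the action on the first and
  on the second block. As nonzero entries of an action matrix have degree \<open>q\<close>, the
  signs collect to one constant in each part, and equivariance of the two factors applies.\<close>

lemma equivariant_tensor:
 assumes K: "equivariant a c K" and K': "equivariant a' c' K'"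
 shows "equivariant (a + a') (c + c') (tensor_matrix a c K K')"
proof (rule equivariantI)
 fix q A ks ls assume A: "A \<in> osp scale V b q" and "ks \<in> ix (a + a')" "ls \<in> ix (c + c')"
 then obtain "is" is' js js' where ks: "ks = is @ is'" "ls = js @ js'"
  and i: "is \<in> ix a" "is' \<in> ix a'" "js \<in> ix c" "js' \<in> ix c'"
  by (metis indices_appendE)
 have T: "tensor_matrix a c K K' (k @ k') (l @ l') = koszul ((parity p k + parity p l) * parity p k') * K k l * K' k' l'"
  if "k \<in> ix a" "l \<in> ix c" for k k' l l'
  by (rule tensor_matrix_append) (use that in \<open>auto simp: indices_def\<close>)
 \<comment> \<open>\<open>?s\<close> and \<open>?t\<close> are the signs common to both sides when
   \<open>A\<close> acts on the first and on the second block, respectively.\<close>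
 let ?s = "koszul ((parity p is + parity p js + q) * parity p is') :: 'k"
 let ?t = "koszul ((parity p is + parity p js) * parity p is' + q * parity p js) :: 'k"
 have "(\<Sum>l\<in>ix (c + c'). tensor_matrix a c K K' ks l * Act q A l ls) =
  (\<Sum>l\<in>ix c. \<Sum>l'\<in>ix c'.
   (?s * K' is' l' * (if l' = js' then 1 else 0)) * (K is l * Act q A l js) +
   (?t * K is l * (if l = js then 1 else 0)) * (K' is' l' * Act q A l' js'))"
  unfolding sum_indices_append ks
 proof (intro sum.cong HOL.refl)
  fix l l' assume l: "l \<in> ix c" "l' \<in> ix c'"
  have 1: "koszul ((parity p is + parity p l) * parity p is') * Act q A l js = ?s * Act q A l js"
  proof (cases "Act q A l js = 0")
   case False
   then have "parity p l + parity p js = q" by (rule Act_degree[OF A l(1) i(3)])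
   then have "parity p is + parity p l = parity p is + parity p js + q"
    by (cases "parity p is"; cases "parity p l"; cases "parity p js") auto
   then show ?thesis by (simp only:)
  qed simp
  have 2: "koszul ((parity p is + parity p l) * parity p is') * koszul (q * parity p l) = ?t" if "l = js"
   by (simp add: that koszul_add)
  have "tensor_matrix a c K K' (is @ is') (l @ l') * Act q A (l @ l') (js @ js') =
   (koszul ((parity p is + parity p l) * parity p is') * Act q A l js) * (K is l * K' is' l' * (if l' = js' then 1 else 0)) +
   (koszul ((parity p is + parity p l) * parity p is') * koszul (q * parity p l)) * K is l * (if l = js then 1 else 0) * (K' is' l' * Act q A l' js')"
   unfolding T[OF i(1) l(1)] Act_append[OF l(1) i(3) l(2) i(4)] by (simp add: algebra_simps)
  then show "tensor_matrix a c K K' (is @ is') (l @ l') * Act q A (l @ l') (js @ js') =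
   (?s * K' is' l' * (if l' = js' then 1 else 0)) * (K is l * Act q A l js) +
   (?t * K is l * (if l = js then 1 else 0)) * (K' is' l' * Act q A l' js')"
   unfolding 1 using 2 by (cases "l = js") (simp_all add: mult_ac)
 qed
 also have "\<dots> = ?s * K' is' js' * (\<Sum>l\<in>ix c. K is l * Act q A l js) +
  ?t * K is js * (\<Sum>l'\<in>ix c'. K' is' l' * Act q A l' js')"
  unfolding sum.distrib sum_product[symmetric] sum_indices_delta(2)[OF i(4)] sum_indices_delta(2)[OF i(3)]
  by (subst (1) sum.swap) (simp only: sum_product[symmetric] sum_indices_delta(2)[OF i(4)] sum_indices_delta(2)[OF i(3)])
 finally have L: "(\<Sum>l\<in>ix (c + c'). tensor_matrix a c K K' ks l * Act q A l ls) = \<dots>" .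
 have "(\<Sum>l\<in>ix (a + a'). Act q A ks l * tensor_matrix a c K K' l ls) =
  (\<Sum>l\<in>ix a. \<Sum>l'\<in>ix a'.
   (?s * K' l' js' * (if l' = is' then 1 else 0)) * (Act q A is l * K l js) +
   (?t * K l js * (if l = is then 1 else 0)) * (Act q A is' l' * K' l' js'))"
  unfolding sum_indices_append ks
 proof (intro sum.cong HOL.refl)
  fix l l' assume l: "l \<in> ix a" "l' \<in> ix a'"
  have 1: "koszul ((parity p l + parity p js) * parity p is') * Act q A is l = ?s * Act q A is l"
  proof (cases "Act q A is l = 0")
   case False
   then have "parity p is + parity p l = q" by (rule Act_degree[OF A i(1) l(1)])
   then have "parity p l + parity p js = parity p is + parity p js + q"
    by (cases "parity p is"; cases "parity p l"; cases "parity p js") auto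
   then show ?thesis by (simp only:)
  qed simp
  have 2: "koszul ((parity p is + parity p js) * parity p l') * koszul (q * parity p is) * Act q A is' l' = ?t * Act q A is' l'"
  proof (cases "Act q A is' l' = 0")
   case False
   then have "parity p is' + parity p l' = q" by (rule Act_degree[OF A i(2) l(2)])
   then have "(parity p is + parity p js) * parity p l' + q * parity p is = (parity p is + parity p js) * parity p is' + q * parity p js"
    by (cases "parity p is"; cases "parity p is'"; cases "parity p l'"; cases "parity p js") auto
   then show ?thesis by (simp only: koszul_add[symmetric])
  qed simp
  have "Act q A (is @ is') (l @ l') * tensor_matrix a c K K' (l @ l') (js @ js') =
   (koszul ((parity p l + parity p js) * parity p l') * Act q A is l) * (K l js * K' l' js' * (if is' = l' then 1 else 0)) +
   (koszul ((parity p l + parity p js) * parity p l') * koszul (q * parity p is) * Act q A is' l') * (K l js * (if is = l then 1 else 0) * K' l' js')"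
   unfolding T[OF l(1) i(3)] Act_append[OF i(1) l(1) i(2) l(2)] by (simp add: algebra_simps)
  also have "\<dots> = (koszul ((parity p l + parity p js) * parity p is') * Act q A is l) * (K l js * K' l' js' * (if l' = is' then 1 else 0)) +
   (koszul ((parity p is + parity p js) * parity p l') * koszul (q * parity p is) * Act q A is' l') * (K l js * (if l = is then 1 else 0) * K' l' js')"
   by (cases "l' = is'"; cases "l = is") simp_all
  finally show "Act q A (is @ is') (l @ l') * tensor_matrix a c K K' (l @ l') (js @ js') =
   (?s * K' l' js' * (if l' = is' then 1 else 0)) * (Act q A is l * K l js) +
   (?t * K l js * (if l = is then 1 else 0)) * (Act q A is' l' * K' l' js')"
   unfolding 1 2 by (simp add: mult_ac)
 qed
 also have "\<dots> = ?s * K' is' js' * (\<Sum>l\<in>ix a. Act q A is l * K l js) +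
  ?t * K is js * (\<Sum>l'\<in>ix a'. Act q A is' l' * K' l' js')"
  unfolding sum.distrib
  by (subst (1) sum.swap) (simp only: sum_product[symmetric] sum_indices_delta(2)[OF i(1)] sum_indices_delta(2)[OF i(2)])
 finally show "(\<Sum>l\<in>ix (c + c'). tensor_matrix a c K K' ks l * Act q A l ls) =
  (\<Sum>l\<in>ix (a + a'). Act q A ks l * tensor_matrix a c K K' l ls)"
  unfolding L equivariantD[OF K A i(1,3)] equivariantD[OF K' A i(2,4)] by simp
qed

end

section \<open>The generating morphisms as matrices, and their equivariance\<close>

context osp_form
begin

lemma sum_delta:
 "i < dm \<Longrightarrow> (\<Sum>j<dm. (if i = j then 1 else 0) * h j) = (h i :: 'k)"
 "i < dm \<Longrightarrow> (\<Sum>j<dm. (if j = i then 1 else 0) * h j) = (h i :: 'k)"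
 by (simp_all add: if_distrib[of "\<lambda>c. c * _"] cong: if_cong)

lemma ptens_2: "functional f \<Longrightarrow> functional f' \<Longrightarrow> ptens scale [x, y] [f, f'] = f x * f' y"
 by (simp add: ptens_Cons ptens_Nil)

lemma coord_ptens_2: "coord (ptens scale [x, y]) [i, j] = \<phi> i x * \<phi> j y"
 by (simp add: coord_def ptens_2)

lemma length_2E:
 assumes "length vs = 2"
 obtains x y where "vs = [x, y]"
 using assms by (auto simp: numeral_2_eq_2 length_Suc_conv)

lemma sum_\<phi>_b: "(\<Sum>i<dm. \<phi> i x * b (v i) y) = b x y"
 unfolding \<phi>_def by (rule contract)

lemma sum_\<phi>_b2: "(\<Sum>i<dm. \<Sum>j<dm. (\<phi> i x * \<phi> j y) * b (v i) (v j)) = b x y"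
proof -
 have 1: "(\<Sum>j<dm. \<phi> j y * b z (v j)) = b z y" for z
 proof -
  have "b z y = b z (\<Sum>j<dm. scale (b y (v' j)) (v j))" using expand[of y] by simp
  then show ?thesis by (simp add: b_sum b_linear \<phi>_def)
 qed
 have "(\<Sum>i<dm. \<Sum>j<dm. (\<phi> i x * \<phi> j y) * b (v i) (v j)) = (\<Sum>i<dm. \<phi> i x * (\<Sum>j<dm. \<phi> j y * b (v i) (v j)))"
  by (simp only: sum_distrib_left mult.assoc)
 then show ?thesis by (simp only: 1 sum_\<phi>_b)
qed

definition cup_matrix :: "nat list \<Rightarrow> nat list \<Rightarrow> 'k" where
 "cup_matrix is js = b (v (is ! 0)) (v (is ! 1))"

definition crossing_matrix :: "nat list \<Rightarrow> nat list \<Rightarrow> 'k" where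
 "crossing_matrix is js = koszul (p (is ! 1) * p (is ! 0)) *
  ((if is ! 0 = js ! 1 then 1 else 0) * (if is ! 1 = js ! 0 then 1 else 0))"

definition cap_matrix :: "nat list \<Rightarrow> nat list \<Rightarrow> 'k" where
 "cap_matrix is js = koszul (p (js ! 0)) * b (v' (js ! 0)) (v' (js ! 1))"

lemma form_map_eq: "form_map scale V b = lmat 2 0 cup_matrix"
 unfolding form_map_def
proof (rule lin_map_eq[OF lmat_lin])
 fix vs :: "'v list" assume vs: "length vs = 2"
 then obtain x y where xy: "vs = [x, y]" by (rule length_2E)
 show "lmat 2 0 cup_matrix (ptens scale vs) = fun_scale (b (vs ! 0) (vs ! 1)) (ptens scale [])"
 proof (rule lmat_ptens_eq[OF vs])
  show "fun_scale (b (vs ! 0) (vs ! 1)) (ptens scale []) \<in> tp 0"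
   by (rule tpow_scale, rule tpow_base) simp
  show "(\<Sum>is\<in>ix 2. coord (ptens scale vs) is * cup_matrix is js) =
   coord (fun_scale (b (vs ! 0) (vs ! 1)) (ptens scale [])) js" if "js \<in> ix 0" for js
   using that sum_\<phi>_b2[of x y] by (simp add: sum_indices_2 xy coord_ptens_2 cup_matrix_def) (simp add: coord_def ptens_Nil)
 qed
qed

text \<open>A nonzero coordinate forces the label to have the degree of its vector, so the sign
  attached to labels agrees with the one attached to vectors.\<close>

lemma swap_map_eq: "swap_map scale V = lmat 2 2 crossing_matrix"
 unfolding swap_map_def
proof (rule lin_map_eq[OF lmat_lin])
 fix vs :: "'v list" assume vs: "length vs = 2" "\<forall>x\<in>set vs. Defs.homogeneous V x"
 then obtain x y where xy: "vs = [x, y]" by (elim length_2E)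
 show "lmat 2 2 crossing_matrix (ptens scale vs) =
  fun_scale (koszul (par V (vs ! 0) * par V (vs ! 1))) (ptens scale [vs ! 1, vs ! 0])"
 proof (rule lmat_ptens_eq[OF vs(1)])
  show "fun_scale (koszul (par V (vs ! 0) * par V (vs ! 1))) (ptens scale [vs ! 1, vs ! 0]) \<in> tp 2"
   by (rule tpow_scale, rule tpow_base) simp
  fix js assume "js \<in> ix 2"
  then obtain k l where kl: "js = [k, l]" "k < dm" "l < dm" by (rule indices_2E)
  have xyV: "x \<in> V (par V x)" "y \<in> V (par V y)" using vs(2) V_par xy by simp_all
  have "(\<Sum>is\<in>ix 2. coord (ptens scale vs) is * crossing_matrix is js) =
   (\<Sum>i<dm. \<Sum>j<dm. ((if i = l then 1 else 0) * (\<phi> i x * koszul (p k * p l))) * ((if j = k then 1 else 0) * \<phi> j y))"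
   unfolding sum_indices_2 xy coord_ptens_2
   by (intro sum.cong HOL.refl) (auto simp: crossing_matrix_def kl mult_ac)
  also have "\<dots> = \<phi> l x * koszul (p k * p l) * \<phi> k y"
   unfolding sum_product[symmetric] sum_delta(2)[OF kl(2)] sum_delta(2)[OF kl(3)] ..
  also have "\<dots> = koszul (par V x * par V y) * (\<phi> k y * \<phi> l x)"
  proof (cases "\<phi> l x = 0 \<or> \<phi> k y = 0")
   case False
   then have "p l = par V x" "p k = par V y" using \<phi>_homogeneous xyV kl by blast+
   then show ?thesis by (simp add: mult_ac)
  qed auto
  also have "\<dots> = coord (fun_scale (koszul (par V (vs ! 0) * par V (vs ! 1))) (ptens scale [vs ! 1, vs ! 0])) js"
   by (simp add: kl xy coord_ptens_2)
  finally show "(\<Sum>is\<in>ix 2. coord (ptens scale vs) is * crossing_matrix is js) = \<dots>" .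
 qed
qed

lemma coform_map_eq: "coform_map scale V (m + n) v v' = lmat 0 2 cap_matrix"
 unfolding coform_map_def dm_def[symmetric]
proof (rule lin_map_eq[OF lmat_lin])
 fix vs :: "'v list" assume vs: "length vs = 0"
 let ?y = "\<Sum>i<dm. fun_scale (koszul (par V (v i))) (ptens scale [v i, v' i])"
 show "lmat 0 2 cap_matrix (ptens scale vs) = ?y"
 proof (rule lmat_ptens_eq[OF vs])
  show "?y \<in> tp 2" by (rule tpow_sum, rule tpow_scale, rule tpow_base) simp
  fix js assume "js \<in> ix 2"
  then obtain k l where kl: "js = [k, l]" "k < dm" "l < dm" by (rule indices_2E)
  have "coord ?y js = (\<Sum>i<dm. (if k = i then 1 else 0) * (koszul (p i) * \<phi> l (v' i)))"
   unfolding kl coord_simps coord_ptens_2 p_def[symmetric]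
   by (intro sum.cong HOL.refl) (use kl \<phi>_v in \<open>auto simp: mult_ac\<close>)
  also have "\<dots> = koszul (p k) * \<phi> l (v' k)" by (rule sum_delta(1)[OF kl(2)])
  finally show "(\<Sum>is\<in>ix 0. coord (ptens scale vs) is * cap_matrix is js) = coord ?y js"
   using vs by (simp add: cap_matrix_def kl \<phi>_def) (simp add: coord_def ptens_Nil)
 qed
qed

lemma matrix_generators:
 "is \<in> ix 2 \<Longrightarrow> js \<in> ix 0 \<Longrightarrow>
  dgm_matrix 2 0 ({{Top 0, Top 1}}, [Bead {Top 0, Top 1}]) is js = cup_matrix is js"
 "is \<in> ix 2 \<Longrightarrow> js \<in> ix 2 \<Longrightarrow>
  dgm_matrix 2 2 ({{Top 0, Bot 1}, {Top 1, Bot 0}}, []) is js = crossing_matrix is js"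
 "is \<in> ix 0 \<Longrightarrow> js \<in> ix 2 \<Longrightarrow>
  dgm_matrix 0 2 ({{Bot 0, Bot 1}}, [Arrow {Bot 0, Bot 1} (Bot 1)]) is js = cap_matrix is js"
 by (elim indices_2E; simp only: indices_0 singleton_iff matrix_cup(1) matrix_crossing(1) matrix_cap(1);
   auto simp: g_def u_def cup_matrix_def cap_matrix_def crossing_matrix_def dual_eq)+

lemma Act_2:
 assumes "i < dm" "j < dm" "k < dm" "l < dm"
 shows "Act q A [i, j] [k, l] = \<phi> k (A (v i)) * (if j = l then 1 else 0) +
  koszul (q * p i) * (if i = k then 1 else 0) * \<phi> l (A (v j))"
proof -
 have s: "[x] \<in> ix 1" if "x < dm" for x using that by (simp add: indices_def)
 show ?thesis
  using Act_append[OF s[OF assms(1)] s[OF assms(3)] s[OF assms(2)] s[OF assms(4)], of q A] assms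
  by (simp add: Act_single)
qed

lemma Act_2':
 assumes "i < dm" "j < dm" "k < dm" "l < dm"
 shows "Act q A [i, j] [k, l] = \<phi> k (A (v i)) * \<phi> l (v j) + koszul (q * p i) * (\<phi> k (v i) * \<phi> l (A (v j)))"
 using assms by (simp add: Act_2 \<phi>_v)

lemma Act_Nil [simp]: "Act q A [] js = 0"
 by (simp add: Act_def)

text \<open>For basis vectors this is the defining identity of \<open>osp\<close>.\<close>

lemma equivariant_cup: "equivariant 2 0 cup_matrix"
proof (rule equivariantI)
 fix q A "is" js assume A: "A \<in> osp scale V b q" and "is \<in> ix 2" "js \<in> ix 0"
 then obtain i j where ij: "is = [i, j]" "i < dm" "j < dm" "js = []" by (elim indices_2E) simp
 have "(\<Sum>l\<in>ix 2. Act q A is l * cup_matrix l js) =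
  (\<Sum>k<dm. \<Sum>l<dm. (\<phi> k (A (v i)) * \<phi> l (v j)) * b (v k) (v l) +
   koszul (q * p i) * ((\<phi> k (v i) * \<phi> l (A (v j))) * b (v k) (v l)))"
  unfolding sum_indices_2 ij by (intro sum.cong HOL.refl) (simp add: Act_2' ij cup_matrix_def algebra_simps)
 also have "\<dots> = b (A (v i)) (v j) + koszul (q * p i) * b (v i) (A (v j))"
  unfolding sum.distrib sum_distrib_left[symmetric] sum_\<phi>_b2 ..
 also have "\<dots> = 0" using osp_form[OF A v_V[OF ij(2)] v_V[OF ij(3)]] by simp
 finally show "(\<Sum>l\<in>ix 0. cup_matrix is l * Act q A l js) = (\<Sum>l\<in>ix 2. Act q A is l * cup_matrix l js)"
  by (simp add: ij)
qed

lemma equivariant_crossing: "equivariant 2 2 crossing_matrix"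
proof (rule equivariantI)
 fix q A "is" js assume A: "A \<in> osp scale V b q" and "is \<in> ix 2" "js \<in> ix 2"
 then obtain i j k l where ij: "is = [i, j]" "js = [k, l]" "i < dm" "j < dm" "k < dm" "l < dm"
  by (elim indices_2E) blast
 have "(\<Sum>s\<in>ix 2. crossing_matrix is s * Act q A s js) =
  (\<Sum>s<dm. \<Sum>t<dm. (if j = s then 1 else 0) * ((if i = t then 1 else 0) * (koszul (p j * p i) * Act q A [s, t] [k, l])))"
  unfolding sum_indices_2 ij by (intro sum.cong HOL.refl) (simp add: crossing_matrix_def)
 also have "\<dots> = koszul (p j * p i) * Act q A [j, i] [k, l]"
  unfolding sum_distrib_left[symmetric] sum_delta(1)[OF ij(3)] sum_delta(1)[OF ij(4)] ..
 finally have L: "(\<Sum>s\<in>ix 2. crossing_matrix is s * Act q A s js) = \<dots>" .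
 have "(\<Sum>s\<in>ix 2. Act q A is s * crossing_matrix s js) =
  (\<Sum>s<dm. \<Sum>t<dm. (if l = s then 1 else 0) * ((if k = t then 1 else 0) * (koszul (p t * p s) * Act q A [i, j] [s, t])))"
  unfolding sum_indices_2 ij by (intro sum.cong HOL.refl) (simp add: crossing_matrix_def)
 also have "\<dots> = koszul (p k * p l) * Act q A [i, j] [l, k]"
  unfolding sum_distrib_left[symmetric] sum_delta(1)[OF ij(5)] sum_delta(1)[OF ij(6)] ..
 finally have R: "(\<Sum>s\<in>ix 2. Act q A is s * crossing_matrix s js) = \<dots>" .
 have 1: "koszul (p k * p l) * (\<phi> l (A (v i)) * (if j = k then 1 else 0)) =
  koszul (p j * p i) * (koszul (q * p j) * (if j = k then 1 else 0) * \<phi> l (A (v i)))"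
 proof (cases "\<phi> l (A (v i)) = 0 \<or> j \<noteq> k")
  case False
  then have "p l = q + p i" "j = k" using \<phi>_homogeneous[OF osp_degree[OF A v_V] ij(6)] ij by auto
  then show ?thesis by (simp add: distrib_left koszul_add mult_ac)
 qed auto
 have 2: "koszul (p k * p l) * (koszul (q * p i) * (if i = l then 1 else 0) * \<phi> k (A (v j))) =
  koszul (p j * p i) * (\<phi> k (A (v j)) * (if i = l then 1 else 0))"
 proof (cases "\<phi> k (A (v j)) = 0 \<or> i \<noteq> l")
  case False
  then have "p k = q + p j" "i = l" using \<phi>_homogeneous[OF osp_degree[OF A v_V] ij(5)] ij by auto
  then show ?thesis by (simp add: distrib_left distrib_right koszul_add mult_ac)
 qed auto
 show "(\<Sum>s\<in>ix 2. crossing_matrix is s * Act q A s js) = (\<Sum>s\<in>ix 2. Act q A is s * crossing_matrix s js)"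
  unfolding L R Act_2[OF ij(4,3,5,6)] Act_2[OF ij(3,4,6,5)] distrib_left 1 2 by (rule add.commute)
qed

text \<open>Where \<open>A\<close> acts on the first factor, the defining identity of
  \<open>osp\<close> moves it to \<open>v' k\<close>. Both terms then become the same value of the
  form with opposite signs.\<close>

lemma equivariant_cap: "equivariant 0 2 cap_matrix"
proof (rule equivariantI)
 fix q A "is" js assume A: "A \<in> osp scale V b q" and "is \<in> ix 0" "js \<in> ix 2"
 then obtain k l where kl: "is = []" "js = [k, l]" "k < dm" "l < dm" by (elim indices_2E) simp
 let ?c = "koszul ((1 + q) * p k) :: 'k"
 have 1: "(\<Sum>i<dm. koszul (p i) * b (v' i) (v' l) * \<phi> k (A (v i))) = - (?c * b (A (v' k)) (v' l))"
 proof -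
  have "koszul (p i) * b (v' i) (v' l) * \<phi> k (A (v i)) = - ?c * (b (v i) (A (v' k)) * b (v' i) (v' l))" if i: "i < dm" for i
  proof (cases "\<phi> k (A (v i)) = 0")
   case True
   then have "b (v i) (A (v' k)) = 0" using osp_form[OF A v_V[OF i] v'_V[OF kl(3)]] by (simp add: \<phi>_def)
   then show ?thesis using True by simp
  next
   case False
   then have "p k = q + p i" by (rule \<phi>_homogeneous[OF osp_degree[OF A v_V[OF i]] kl(3)])
   then have h1: "koszul (p i) * koszul (q * p i) = ?c" by (cases q; cases "p i") simp_all
   have h2: "\<phi> k (A (v i)) = - (koszul (q * p i) * b (v i) (A (v' k)))"
    unfolding \<phi>_def by (rule osp_form[OF A v_V[OF i] v'_V[OF kl(3)]])
   show ?thesis unfolding h2 h1[symmetric] by (simp add: mult_ac)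
  qed
  then have "(\<Sum>i<dm. koszul (p i) * b (v' i) (v' l) * \<phi> k (A (v i))) =
   (\<Sum>i<dm. - ?c * (b (v i) (A (v' k)) * b (v' i) (v' l)))" by (intro sum.cong) auto
  then show ?thesis by (simp add: sum_distrib_left[symmetric] contract' del: mult_minus_left) simp
 qed
 have 2: "(\<Sum>j<dm. b (v' k) (v' j) * \<phi> l (A (v j))) = b (A (v' k)) (v' l)"
 proof -
  interpret A: Vector_Spaces.linear scale scale A by (rule osp_linear[OF A])
  have "A (v' k) = (\<Sum>j<dm. scale (b (v' k) (v' j)) (A (v j)))"
   by (subst expand[of "v' k"]) (simp only: A.sum A.scale)
  then show ?thesis by (simp add: b_sum b_linear \<phi>_def)
 qed
 have "(\<Sum>s\<in>ix 2. cap_matrix is s * Act q A s js) =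
  (\<Sum>i<dm. \<Sum>j<dm. (if j = l then 1 else 0) * (koszul (p i) * b (v' i) (v' j) * \<phi> k (A (v i)))) +
  (\<Sum>i<dm. (if i = k then 1 else 0) * (\<Sum>j<dm. koszul (p i) * koszul (q * p i) * (b (v' i) (v' j) * \<phi> l (A (v j)))))"
  unfolding sum_indices_2 kl sum_distrib_left sum.distrib[symmetric]
  by (intro sum.cong HOL.refl) (simp add: cap_matrix_def Act_2 kl algebra_simps)
 also have "\<dots> = - (?c * b (A (v' k)) (v' l)) + koszul (p k) * koszul (q * p k) * b (A (v' k)) (v' l)"
  unfolding sum_delta(2)[OF kl(3)] sum_delta(2)[OF kl(4)] 1 sum_distrib_left[symmetric] 2 ..
 also have "\<dots> = 0" by (simp add: distrib_right koszul_add)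
 finally show "(\<Sum>s\<in>ix 2. cap_matrix is s * Act q A s js) = (\<Sum>s\<in>ix 0. Act q A is s * cap_matrix s js)"
  by (simp add: kl)
qed

end

section \<open>Stacking with a permutation diagram, and splitting off an edge\<close>

section \<open>Composition with permutations\<close>

text \<open>Each edge of \<open>E\<close>, embedded by \<open>\<kappa>\<close>, is prolonged at its
  vertices \<open>x\<close> by paths \<open>pre x\<close> to the outer vertices
  \<open>\<rho> x\<close>. Paths at different vertices are disjoint, so the prolonged edges form a
  complete system without loops.\<close>

lemma relabel_stack:
 assumes E: "E \<in> brauer r s" and reg: "regular S"
  and S: "S = \<kappa> ` E \<union> (\<Union>x\<in>vertices r s. set (segs (pre x)))"
  and ends_seg: "\<And>e. seg_ends (\<kappa> e) = nd ` e"
  and walk_pre: "\<And>x. x \<in> vertices r s \<Longrightarrow> walk S (outer_node (\<rho> x)) (pre x) (nd x)"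
  and dist: "\<And>x. distinct (segs (pre x))"
  and disj: "\<And>x y z. x \<in> vertices r s \<Longrightarrow> y \<in> vertices r s \<Longrightarrow> z \<in> set (segs (pre x)) \<Longrightarrow>
   z \<in> set (segs (pre y)) \<Longrightarrow> x = y"
  and core: "\<And>x e. \<kappa> e \<notin> set (segs (pre x))"
  and inj: "inj \<kappa>" "inj_on \<rho> (vertices r s)"
  and outer: "\<And>w z. z \<in> S \<Longrightarrow> outer_node w \<in> seg_ends z \<Longrightarrow> w \<in> \<rho> ` vertices r s"
 shows "composite_edges S = (`) \<rho> ` E \<and> closed_loops S = {}"
proof -
 define es where "es = enumeration E"
 have es: "enumerates es E" unfolding es_def by (rule enumeration[OF E])
 define str :: "vertex \<times> vertex \<Rightarrow> (vertex, segment, node) strand" where "str q =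
  (\<rho> (fst q), pre (fst q) @ (nd (fst q), \<kappa> (edge q), nd (snd q)) # rev_steps (pre (snd q)), \<rho> (snd q))" for q
 define Ps where "Ps = map str es"
 note ee = enumerates_ends[OF es E]
 have inV: "x \<in> vertices r s" "y \<in> vertices r s" "{x, y} \<in> E" if "(x, y) \<in> set es" for x y
 proof -
  show "{x, y} \<in> E" using es imageI[OF that, of edge] by (simp add: enumerates_def)
  then show "x \<in> vertices r s" "y \<in> vertices r s" using brauer_edge(1)[OF E] by auto
 qed
 have ends_str: "ends (map str fs) = map \<rho> (ends (map estrand fs))" for fs
  by (induction fs) (auto simp: str_def)
 have segs_str: "set (str_segs (map str fs)) =
  \<kappa> ` edge ` set fs \<union> (\<Union>x\<in>set (ends (map estrand fs)). set (segs (pre x)))" for fs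
 proof (induction fs)
  case (Cons q fs)
  obtain x y where q: "q = (x, y)" by (cases q) auto
  have "set (str_segs (map str (q # fs))) =
   set (segs (pre x)) \<union> ({\<kappa> {x, y}} \<union> (set (segs (pre y)) \<union> set (str_segs (map str fs))))"
   by (simp add: q str_def Un_assoc insert_is_Un[symmetric])
  then show ?case unfolding Cons.IH by (simp add: q Un_ac del: set_map)
 qed simp
 have distinct_segs: "distinct (str_segs (map str fs))"
  if "distinct (ends (map estrand fs))" "set fs \<subseteq> set es" "distinct (map edge fs)" for fs
  using that
 proof (induction fs)
  case Nil
  then show ?case by simp
 next
  case (Cons q fs)
  obtain x y where q: "q = (x, y)" by (cases q) auto
  have xy: "x \<noteq> y" "x \<notin> set (ends (map estrand fs))" "y \<notin> set (ends (map estrand fs))"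
   "{x, y} \<notin> edge ` set fs" using Cons.prems q by auto
  have V: "x \<in> vertices r s" "y \<in> vertices r s" using inV[of x y] Cons.prems(2) q by auto
  have Vf: "set (ends (map estrand fs)) \<subseteq> vertices r s"
  proof -
   have "set (ends (map estrand fs)) \<subseteq> set (ends (map estrand es))"
    using Cons.prems(2) by (auto simp: set_ends)
   then show ?thesis using ee(2) by simp
  qed
  have IH: "distinct (str_segs (map str fs))" using Cons q by simp
  have 1: "z \<notin> set (str_segs (map str fs))" if "z \<in> set (segs (pre w))" "w \<in> {x, y}" for z w
  proof
   assume "z \<in> set (str_segs (map str fs))"
   then consider e where "z = \<kappa> e" | w' where "w' \<in> set (ends (map estrand fs))" "z \<in> set (segs (pre w'))"
    unfolding segs_str by auto
   then show False
   proof cases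
    case 1
    then show ?thesis using core that(1) by blast
   next
    case 2
    then have "w = w'" using disj[of w w' z] that V Vf by auto
    then show ?thesis using 2(1) that(2) xy by auto
   qed
  qed
  have 2: "\<kappa> {x, y} \<notin> set (str_segs (map str fs))"
  proof
   assume "\<kappa> {x, y} \<in> set (str_segs (map str fs))"
   then have "\<kappa> {x, y} \<in> \<kappa> ` edge ` set fs" unfolding segs_str using core by auto
   then show False using xy(4) injD[OF inj(1)] by auto
  qed
  have 3: "z \<notin> set (segs (pre y))" if "z \<in> set (segs (pre x))" for z
   using disj[OF V that] xy(1) by blast
  have "str_segs (map str (q # fs)) = segs (pre x) @ \<kappa> {x, y} # rev (segs (pre y)) @ str_segs (map str fs)"
   by (simp add: q str_def)
  then show ?case using IH 1 2 3 dist core by auto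
 qed
 have "complete_strands S Ps []"
 proof (unfold_locales, rule reg, rule complete_systemI)
  show "walk S (outer_node x) st (outer_node y)" if P: "(x, st, y) \<in> set Ps" for x st y
  proof -
   obtain a c where ac: "(a, c) \<in> set es" "(x, st, y) = str (a, c)" using P unfolding Ps_def by auto
   note ac' = inV[OF ac(1)]
   have "\<kappa> {a, c} \<in> S" unfolding S using ac'(3) by blast
   moreover have "seg_ends (\<kappa> {a, c}) = {nd a, nd c}" using ends_seg by simp
   ultimately show ?thesis
    using ac(2) walk_pre[OF ac'(1)] walk_back[OF walk_pre[OF ac'(2)]] by (auto simp: str_def walk_append)
  qed
  show "distinct (str_segs Ps @ loop_segs [])"
   using distinct_segs[OF ee(1)] es by (simp add: Ps_def enumerates_def)
  show "set (str_segs Ps @ loop_segs []) = S"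
   using es ee(2) by (simp add: Ps_def segs_str S enumerates_def)
  show "distinct (ends Ps)" unfolding Ps_def ends_str using ee inj(2) by (simp add: distinct_map)
  show "w \<in> set (ends Ps)" if "z \<in> S" "outer_node w \<in> seg_ends z" for w z
   unfolding Ps_def ends_str using outer[OF that] ee(2) by simp
 qed simp
 then interpret complete_strands S Ps "[]" .
 have "closed_loops S = {}" unfolding closed_loops_eq by simp
 moreover have "(\<lambda>P. {fst P, dst P}) ` set Ps = (`) \<rho> ` edge ` set es"
  unfolding Ps_def by (auto simp: str_def image_image edge_def)
 ultimately show ?thesis unfolding composite_edges_eq using es by (simp add: enumerates_def)
qed

fun relabel :: "bool \<Rightarrow> (nat \<Rightarrow> nat) \<Rightarrow> vertex \<Rightarrow> vertex" where
 "relabel t \<sigma> (Top i) = Top (if t then \<sigma> i else i)"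
| "relabel t \<sigma> (Bot i) = Bot (if t then i else \<sigma> i)"

text \<open>Only used for involutions \<open>\<sigma>\<close>, for which it is immaterial which endpoint carries \<open>\<sigma>\<close>.\<close>

definition permutation_edges :: "(nat \<Rightarrow> nat) \<Rightarrow> nat \<Rightarrow> vertex set set" where
 "permutation_edges \<sigma> r = (\<lambda>i. {Top (\<sigma> i), Bot i}) ` {..<r}"

lemma relabel_bij:
 assumes \<sigma>: "\<And>i. \<sigma> (\<sigma> i) = i" "\<sigma> ` {..<if t then r else s} = {..<if t then r else s}"
 shows "inj (relabel t \<sigma>)" "relabel t \<sigma> ` vertices r s = vertices r s" "relabel t \<sigma> (relabel t \<sigma> x) = x"
proof -
 show 1: "relabel t \<sigma> (relabel t \<sigma> x) = x" for x using \<sigma>(1) by (cases x) auto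
 then show "inj (relabel t \<sigma>)" by (rule inj_on_inverseI)
 have "relabel t \<sigma> ` Top ` {..<r} = Top ` (if t then \<sigma> ` {..<r} else {..<r})"
  "relabel t \<sigma> ` Bot ` {..<s} = Bot ` (if t then {..<s} else \<sigma> ` {..<s})" by (simp_all add: image_image)
 then show "relabel t \<sigma> ` vertices r s = vertices r s"
  unfolding vertices_def image_Un using \<sigma>(2) by (cases t) simp_all
qed

text \<open>A permutation diagram prolongs the edges on one side by one through string each, while
  on the other side the prolongation is empty. The flag \<open>t\<close> says that it is stacked
  above.\<close>

lemma composite_permutation:
 assumes E: "fst D \<in> brauer r s" and D': "fst D' = permutation_edges \<sigma> k" "fst D' \<in> brauer k k"
  and k: "k = (if t then r else s)" and \<sigma>: "\<And>i. \<sigma> (\<sigma> i) = i" "\<sigma> ` {..<k} = {..<k}"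
  and S: "S = (if t then stack_segments D' D else stack_segments D D')"
 shows "composite_edges S = (`) (relabel t \<sigma>) ` fst D \<and> closed_loops S = {}"
proof -
 define pre :: "vertex \<Rightarrow> (node \<times> segment \<times> node) list" where "pre x = (case x of
  Top i \<Rightarrow> if t then [(Upper (\<sigma> i), Inl {Top (\<sigma> i), Bot i}, Middle i)] else []
 | Bot i \<Rightarrow> if t then [] else [(Lower (\<sigma> i), Inr {Top i, Bot (\<sigma> i)}, Middle i)])" for x
 have "permutation_edges \<sigma> k = (\<lambda>i. {Top (\<sigma> i), Bot i}) ` \<sigma> ` {..<k}" by (simp add: permutation_edges_def \<sigma>(2))
 then have perm: "permutation_edges \<sigma> k = (\<lambda>i. {Top i, Bot (\<sigma> i)}) ` {..<k}" by (simp add: image_image \<sigma>(1))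
 have S': "S = (if t then Inr else Inl) ` fst D \<union> (\<Union>x\<in>vertices r s. set (segs (pre x)))"
 proof (cases t)
  case True
  then show ?thesis using k
   by (auto simp: S stack_segments_def D'(1) permutation_edges_def pre_def vertices_def)
 next
  case False
  then have "k = s" using k by simp
  then show ?thesis using False by (auto simp: S stack_segments_def D'(1) perm[unfolded \<open>k = s\<close>] pre_def vertices_def)
 qed
 have reg: "regular S" using regular_stack[OF D'(2), of D s] regular_stack[OF E, of D' s] E D'(2) k S by (cases t) simp_all
 note bij = relabel_bij[of \<sigma> t r s, OF \<sigma>(1) \<sigma>(2)[unfolded k]]
 show ?thesis
 proof (rule relabel_stack[OF E reg S', where \<rho> = "relabel t \<sigma>" and nd = "if t then node2 else node1"])
  show "walk S (outer_node (relabel t \<sigma> x)) (pre x) ((if t then node2 else node1) x)" if "x \<in> vertices r s" for x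
   unfolding S' using that
   by (cases t; cases x) (auto simp: pre_def vertices_def insert_commute intro!: bexI[of _ x])
  show "x = y" if "z \<in> set (segs (pre x))" "z \<in> set (segs (pre y))" for x y z
   using that by (auto simp: pre_def doubleton_eq_iff split: vertex.splits if_splits)
  show "w \<in> relabel t \<sigma> ` vertices r s" if z: "z \<in> S" "outer_node w \<in> seg_ends z" for w z
  proof (cases t)
   case True
   then show ?thesis using outer_stack[of D' r r D s z w] D'(2) E z bij(2) k S by simp
  next
   case False
   then show ?thesis using outer_stack[of D r s D' s z w] D'(2) E z bij(2) k S by simp
  qed
  show "inj_on (relabel t \<sigma>) (vertices r s)" using bij(1) by (rule inj_on_subset) simp
 qed (auto simp: pre_def split: vertex.splits)
qed

lemma image_brauer:
 assumes E: "partition_on A E" "\<forall>e\<in>E. card e = 2" and inj: "inj_on f A"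
 shows "partition_on (f ` A) ((`) f ` E)" "\<forall>e\<in>(`) f ` E. card e = 2"
proof -
 have sub: "e \<subseteq> A" if "e \<in> E" for e using E(1) that unfolding partition_on_def by blast
 have "(`) f ` E - {{}} = (`) f ` E" using E(1) unfolding partition_on_def by auto
 then show "partition_on (f ` A) ((`) f ` E)" using partition_on_inj_image[OF E(1) inj] by simp
 show "\<forall>e\<in>(`) f ` E. card e = 2"
 proof
  fix e assume "e \<in> (`) f ` E"
  then obtain e' where e': "e = f ` e'" "e' \<in> E" by blast
  then show "card e = 2" using E(2) card_image[OF inj_on_subset[OF inj sub[OF e'(2)]]] by simp
 qed
qed

text \<open>For \<open>vertices a c\<close> to be an edge, a + c = 2: it is then the leftmost cup,
  cap or through string. Removing it and shifting the remaining vertices to the left leaves a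
  smaller diagram.\<close>

lemma split_edge:
 assumes E: "E \<in> brauer (a + r) (c + s)" and e0: "vertices a c \<in> E"
 obtains E' where "E' \<in> brauer r s" "E = {vertices a c} \<union> (`) (shift_vertex a c) ` E'"
proof -
 have pt: "partition_on (vertices (a + r) (c + s)) E" "\<forall>e\<in>E. card e = 2" using E by (auto simp: brauer_diagrams_def)
 define f where "f x = (case x of Top i \<Rightarrow> Top (i - a) | Bot i \<Rightarrow> Bot (i - c))" for x
 have f: "f (shift_vertex a c x) = x" for x by (cases x) (auto simp: f_def)
 have V: "vertices (a + r) (c + s) - vertices a c = shift_vertex a c ` vertices r s"
  unfolding vertices_add using shift_notin_vertices by auto
 have U: "\<Union> (E - {vertices a c}) = shift_vertex a c ` vertices r s"
 proof -
  have "\<Union> (E - {vertices a c}) = \<Union> E - vertices a c"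
   using e0 brauer_disjoint[OF E] by blast
  then show ?thesis using pt(1) V by (simp add: partition_on_def)
 qed
 have p: "partition_on (shift_vertex a c ` vertices r s) (E - {vertices a c})"
  using pt(1) U unfolding partition_on_def disjoint_def by auto
 have c: "\<forall>e\<in>E - {vertices a c}. card e = 2" using pt(2) by blast
 have inj: "inj_on f (shift_vertex a c ` vertices r s)"
  by (rule inj_on_inverseI[of _ "shift_vertex a c"]) (auto simp: f)
 note image_brauer[OF p c inj]
 moreover have "f ` shift_vertex a c ` vertices r s = vertices r s" by (simp add: image_image f)
 ultimately have 1: "(`) f ` (E - {vertices a c}) \<in> brauer r s" by (simp add: brauer_diagrams_def)
 have "shift_vertex a c ` f ` e = e" if "e \<in> E - {vertices a c}" for e
 proof -
  have "e \<subseteq> shift_vertex a c ` vertices r s" using U that by blast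
  then have "shift_vertex a c (f x) = x" if "x \<in> e" for x using that f by auto
  then show ?thesis by (simp add: image_image)
 qed
 then have "(`) (shift_vertex a c) ` (`) f ` (E - {vertices a c}) = E - {vertices a c}"
  by (simp add: image_comp[symmetric] image_image cong: image_cong_simp)
 then have "E = {vertices a c} \<union> (`) (shift_vertex a c) ` (`) f ` (E - {vertices a c})" using e0 by blast
 then show ?thesis using that 1 by blast
qed

text \<open>The edges are bracketed as those of an identity, the crossing and an identity tensored
  together, which makes the transposition available from the generators.\<close>

lemma adjacent_transposition_edges:
 fixes a c :: nat
 defines "\<sigma> \<equiv> (\<lambda>i. if i = a then Suc a else if i = Suc a then a else i)"
 shows "permutation_edges \<sigma> (a + (2 + c)) = fst (identity_diagram a) \<union>
   (`) (shift_vertex a a) ` ({{Top 0, Bot 1}, {Top 1, Bot 0}} \<union> (`) (shift_vertex 2 2) ` fst (identity_diagram c))"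
  "\<And>i. \<sigma> (\<sigma> i) = i" "\<sigma> ` {..<a + (2 + c)} = {..<a + (2 + c)}"
proof -
 have u: "{..<a + (2 + c)} = {..<a} \<union> {a, Suc a} \<union> (\<lambda>i. a + (2 + i)) ` {..<c}"
 proof (intro set_eqI iffI)
  fix x assume "x \<in> {..<a + (2 + c)}"
  then consider "x < a" | "x = a" | "x = Suc a" | "x = a + (2 + (x - a - 2))" "x - a - 2 < c" by force
  then show "x \<in> {..<a} \<union> {a, Suc a} \<union> (\<lambda>i. a + (2 + i)) ` {..<c}" by cases auto
 qed auto
 show "\<sigma> (\<sigma> i) = i" for i by (simp add: \<sigma>_def)
 show "\<sigma> ` {..<a + (2 + c)} = {..<a + (2 + c)}" unfolding u image_Un by (auto simp: \<sigma>_def image_image)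
 have 1: "(\<lambda>i. {Top (\<sigma> i), Bot i}) ` {..<a} = (\<lambda>i. {Top i, Bot i}) ` {..<a}" by (intro image_cong) (auto simp: \<sigma>_def)
 show "permutation_edges \<sigma> (a + (2 + c)) = fst (identity_diagram a) \<union>
   (`) (shift_vertex a a) ` ({{Top 0, Bot 1}, {Top 1, Bot 0}} \<union> (`) (shift_vertex 2 2) ` fst (identity_diagram c))"
  unfolding permutation_edges_def u image_Un 1 identity_diagram_def fst_conv
  by (auto simp: image_image \<sigma>_def)
qed

section \<open>Compatibility of composition and tensor product with the relations\<close>

section \<open>Operations on classes\<close>

text \<open>Common form of composition and tensor product of combinations; the reduction of their
  compatibility with relations to single diagrams is done once for both.\<close>

definition bilin_ext ::
 "('a \<Rightarrow> 'b \<Rightarrow> 'c \<Rightarrow> 'k::field) \<Rightarrow> 'a set \<Rightarrow> 'b set \<Rightarrow> ('a \<Rightarrow> 'k) \<Rightarrow> ('b \<Rightarrow> 'k) \<Rightarrow> 'c \<Rightarrow> 'k" where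
 "bilin_ext f A B x y = (\<Sum>D1\<in>A. \<Sum>D2\<in>B. fun_scale (x D1 * y D2) (f D1 D2))"

lemma bilin_ext_flip:
 "bilin_ext f A B x y = bilin_ext (\<lambda>D2 D1. f D1 D2) B A y x"
 unfolding bilin_ext_def by (subst sum.swap) (simp add: mult.commute)

lemma bilin_ext_zero: "bilin_ext f A B 0 y = 0"
 by (simp add: bilin_ext_def pointwise)

lemma bilin_ext_add:
 "bilin_ext f A B (fun_scale c x + x') y = fun_scale c (bilin_ext f A B x y) + bilin_ext f A B x' y"
 by (rule ext) (simp add: bilin_ext_def pointwise sum.distrib sum_distrib_left algebra_simps)

lemma bilin_ext_diff:
 "bilin_ext f A B (x - x') y = bilin_ext f A B x y - bilin_ext f A B x' y"
 "bilin_ext f A B x (y - y') = bilin_ext f A B x y - bilin_ext f A B x y'"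
 by (rule ext, simp add: bilin_ext_def pointwise sum_subtractf algebra_simps)+

lemma bilin_ext_basis:
 assumes "finite A" "D \<in> A"
 shows "bilin_ext f A B (basis_vec D) y = (\<Sum>D2\<in>B. fun_scale (y D2) (f D D2))"
proof -
 have "bilin_ext f A B (basis_vec D) y = (\<Sum>D1\<in>A. if D1 = D then \<Sum>D2\<in>B. fun_scale (y D2) (f D D2) else 0)"
  unfolding bilin_ext_def by (rule sum.cong) (auto simp: basis_vec_apply)
 then show ?thesis using assms by simp
qed

lemma bilin_ext_basis2:
 assumes "finite A" "D1 \<in> A" "finite B" "D2 \<in> B"
 shows "bilin_ext f A B (basis_vec D1) (basis_vec D2) = f D1 D2"
proof -
 have "(\<Sum>D\<in>B. fun_scale (basis_vec D2 D) (f D1 D)) = (\<Sum>D\<in>B. if D = D2 then f D1 D2 else 0)"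
  by (rule sum.cong) (auto simp: basis_vec_apply)
 then show ?thesis using assms by (simp add: bilin_ext_basis)
qed

lemma compose_combinations_eq:
 "compose_combinations \<delta> \<epsilon> r s t = bilin_ext (compose_diagrams \<delta> \<epsilon> r t) (marked r s) (marked s t)"
 by (intro ext) (simp add: compose_combinations_def bilin_ext_def)

lemma tensor_combinations_eq:
 "tensor_combinations r s r' s' = bilin_ext (\<lambda>D1 D2. basis_vec (tensor_diagrams r s D1 D2))
  (marked r s) (marked r' s')"
 by (intro ext) (simp add: tensor_combinations_def bilin_ext_def)

lemma combinations_subspace: "fun_space.subspace (combinations r s)"
 unfolding fun_space.subspace_def combinations_def by (auto simp: pointwise) (metis add.right_neutral)

lemmas combinations_add = fun_space.subspace_add[OF combinations_subspace]
 and combinations_scale = fun_space.subspace_scale[OF combinations_subspace]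
 and combinations_sum = fun_space.subspace_sum[OF combinations_subspace]
 and combinations_zero = fun_space.subspace_0[OF combinations_subspace]

lemma basis_vec_combination [simp]: "D \<in> marked r s \<Longrightarrow> basis_vec D \<in> combinations r s"
 by (simp add: combinations_def basis_vec_apply)

lemma combination_expand:
 assumes "x \<in> combinations r s"
 shows "x = (\<Sum>D\<in>marked r s. fun_scale (x D) (basis_vec D))"
proof
 fix D
 have "(\<Sum>D'\<in>marked r s. x D' * basis_vec D' D) = (\<Sum>D'\<in>marked r s. if D' = D then x D else 0)"
  by (rule sum.cong) (auto simp: basis_vec_apply)
 also have "\<dots> = x D" using assms finite_marked_diagrams[of r s] by (auto simp: combinations_def simp del: split_paired_All)
 finally show "x D = (\<Sum>D\<in>marked r s. fun_scale (x D) (basis_vec D)) D" by (simp add: pointwise)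
qed

lemma bilin_ext_combination:
 assumes "\<And>D1 D2. D1 \<in> A \<Longrightarrow> D2 \<in> B \<Longrightarrow> f D1 D2 \<in> combinations r s"
 shows "bilin_ext f A B x y \<in> combinations r s"
 unfolding bilin_ext_def by (intro combinations_sum combinations_scale assms)

context supermatrix
begin

lemma bilin_ext_relations:
 assumes fin: "finite B"
  and gen: "\<And>D D' D2. (D, D') \<in> height_swaps r s \<union> arrow_reversals r s \<Longrightarrow> D2 \<in> B \<Longrightarrow>
   f D D2 - fun_scale \<epsilon> (f D' D2) \<in> rels r' s'"
  and x: "x \<in> rels r s"
 shows "bilin_ext f (marked r s) B x y \<in> rels r' s'"
 using x unfolding relations_def[of \<epsilon> r s]
proof (induction rule: fun_space.span_induct_alt)
 case base
 show ?case unfolding bilin_ext_zero by (rule relations_zero)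
next
 case (step c z x)
 then obtain D D' where z: "z = basis_vec D - fun_scale \<epsilon> (basis_vec D')"
  and DD: "(D, D') \<in> height_swaps r s \<union> arrow_reversals r s" by blast
 have m: "D \<in> marked r s" "D' \<in> marked r s"
  using DD by (auto simp: height_swaps_def arrow_reversals_def)
 let ?E = "bilin_ext f (marked r s) B"
 note fm = finite_marked_diagrams[of r s]
 have "?E z y = ?E (basis_vec D) y - ?E (fun_scale \<epsilon> (basis_vec D') + 0) y"
  unfolding z bilin_ext_diff by simp
 also have "\<dots> = (\<Sum>D2\<in>B. fun_scale (y D2) (f D D2 - fun_scale \<epsilon> (f D' D2)))"
  unfolding bilin_ext_add bilin_ext_basis[OF fm m(1)] bilin_ext_basis[OF fm m(2)] bilin_ext_zero
  by (rule ext) (simp add: pointwise sum_subtractf[symmetric] sum_distrib_left algebra_simps)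
 also have "\<dots> \<in> rels r' s'" by (rule relations_sum, rule relations_scale, rule gen[OF DD])
 finally show ?case unfolding bilin_ext_add using step.IH relations_add relations_scale by blast
qed

lemma bilin_ext_cong_relations:
 assumes gen1: "\<And>D D' D2. (D, D') \<in> height_swaps r s \<union> arrow_reversals r s \<Longrightarrow> D2 \<in> marked r' s' \<Longrightarrow>
   f D D2 - fun_scale \<epsilon> (f D' D2) \<in> rels r'' s''"
  and gen2: "\<And>D D' D1. (D, D') \<in> height_swaps r' s' \<union> arrow_reversals r' s' \<Longrightarrow> D1 \<in> marked r s \<Longrightarrow>
   f D1 D - fun_scale \<epsilon> (f D1 D') \<in> rels r'' s''"
  and x: "x - x' \<in> rels r s" and y: "y - y' \<in> rels r' s'"
 shows "bilin_ext f (marked r s) (marked r' s') x y -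
  bilin_ext f (marked r s) (marked r' s') x' y' \<in> rels r'' s''"
proof -
 let ?E = "bilin_ext f (marked r s) (marked r' s')"
 have 1: "?E (x - x') y \<in> rels r'' s''"
  by (rule bilin_ext_relations[OF finite_marked_diagrams gen1 x])
 have 2: "?E x' (y - y') \<in> rels r'' s''"
  unfolding bilin_ext_flip[of f]
  by (rule bilin_ext_relations[OF finite_marked_diagrams gen2 y])
 have "?E x y - ?E x' y' = ?E (x - x') y + ?E x' (y - y')" unfolding bilin_ext_diff by simp
 then show ?thesis using relations_add[OF 1 2] by simp
qed

lemma generator_pair:
 assumes "(D, D') \<in> height_swaps r s \<union> arrow_reversals r s"
 shows "D \<in> marked r s" "D' \<in> marked r s" "fst D = fst D'"
  "dgm_matrix r s D is js = \<epsilon> * dgm_matrix r s D' is js"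
proof -
 show "D \<in> marked r s" "D' \<in> marked r s" "fst D = fst D'"
  using assms by (auto simp: height_swaps_def arrow_reversals_def)
 show "dgm_matrix r s D is js = \<epsilon> * dgm_matrix r s D' is js"
  using assms matrix_height_swap matrix_arrow_reversal by blast
qed

text \<open>The two composites are chosen independently of each other, but their edges depend only
  on the edges of the factors. So they can be compared through their matrices.\<close>

lemma compose_diagrams_relation:
 assumes N: "0 < N" and D: "D1 \<in> marked r s" "D2 \<in> marked s t"
  "D1' \<in> marked r s" "D2' \<in> marked s t" "fst D1 = fst D1'" "fst D2 = fst D2'"
  and eq: "\<And>is js. (\<Sum>l\<in>indices N s. dgm_matrix r s D1 is l * dgm_matrix s t D2 l js) =
   \<epsilon> * (\<Sum>l\<in>indices N s. dgm_matrix r s D1' is l * dgm_matrix s t D2' l js)"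
 shows "compose_dgm r t D1 D2 - fun_scale \<epsilon> (compose_dgm r t D1' D2') \<in> rels r t"
proof -
 obtain c E where E: "compose_dgm r t D1 D2 = fun_scale c (basis_vec E)" "composite \<delta> \<epsilon> r t D1 D2 c E"
  "E \<in> marked r t" "fst E = composite_edges (stack_segments D1 D2)" by (rule compose_diagrams_composite[OF D(1,2)])
 obtain c' E' where E': "compose_dgm r t D1' D2' = fun_scale c' (basis_vec E')" "composite \<delta> \<epsilon> r t D1' D2' c' E'"
  "E' \<in> marked r t" "fst E' = composite_edges (stack_segments D1' D2')" by (rule compose_diagrams_composite[OF D(3,4)])
 have "fst E = fst E'" unfolding E(4) E'(4) stack_segments_def D(5,6) ..
 moreover have "c * dgm_matrix r t E is js = \<epsilon> * c' * dgm_matrix r t E' is js" for "is" js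
  using composite_matrix[OF D(1,2) E(2)] composite_matrix[OF D(3,4) E'(2)] eq by (simp add: mult.assoc)
 ultimately have "fun_scale c (basis_vec E) - fun_scale (\<epsilon> * c') (basis_vec E') \<in> rels r t"
  by (intro scaled_eq_mod_relations[OF N E(3) E'(3)])
 then show ?thesis unfolding E(1) E'(1) by (simp add: fun_scale_def mult.assoc)
qed

lemma compose_combinations_cong:
 assumes N: "0 < N" and x: "x - x' \<in> rels r s" and y: "y - y' \<in> rels s t"
 shows "compose_comb r s t x y - compose_comb r s t x' y' \<in> rels r t"
 unfolding compose_combinations_eq
proof (rule bilin_ext_cong_relations[OF _ _ x y])
 fix D D' D2 assume DD: "(D, D') \<in> height_swaps r s \<union> arrow_reversals r s" and D2: "D2 \<in> marked s t"
 note g = generator_pair[OF DD]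
 show "compose_dgm r t D D2 - fun_scale \<epsilon> (compose_dgm r t D' D2) \<in> rels r t"
  by (rule compose_diagrams_relation[OF N g(1) D2 g(2) D2 g(3)]) (simp_all add: g(4) sum_distrib_left mult.assoc)
next
 fix D D' D1 assume DD: "(D, D') \<in> height_swaps s t \<union> arrow_reversals s t" and D1: "D1 \<in> marked r s"
 note g = generator_pair[OF DD]
 show "compose_dgm r t D1 D - fun_scale \<epsilon> (compose_dgm r t D1 D') \<in> rels r t"
  by (rule compose_diagrams_relation[OF N D1 g(1) D1 g(2) _ g(3)]) (simp_all add: g(4) sum_distrib_left mult_ac)
qed

lemma tensor_diagrams_relation:
 assumes N: "0 < N" and D: "D1 \<in> marked r s" "D2 \<in> marked r' s'"
  "D1' \<in> marked r s" "D2' \<in> marked r' s'" "fst D1 = fst D1'" "fst D2 = fst D2'"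
  and eq: "\<And>is js is' js'. dgm_matrix r s D1 is js * dgm_matrix r' s' D2 is' js' =
   \<epsilon> * (dgm_matrix r s D1' is js * dgm_matrix r' s' D2' is' js')"
 shows "basis_vec (tensor_diagrams r s D1 D2) - fun_scale \<epsilon> (basis_vec (tensor_diagrams r s D1' D2')) \<in> rels (r + r') (s + s')"
proof -
 have mat: "dgm_matrix (r + r') (s + s') (tensor_diagrams r s E1 E2) (is @ is') (js @ js') =
  koszul ((parity p is + parity p js) * parity p is') * (dgm_matrix r s E1 is js * dgm_matrix r' s' E2 is' js')"
  if E: "E1 \<in> marked r s" "E2 \<in> marked r' s'" and len: "length is = r" "length js = s" "length is' = r'" "length js' = s'"
  for E1 E2 "is" js is' js'
  using matrix_tensor[OF len, of "basis_vec E1" "basis_vec E2"] E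
  by (simp add: tensor_combinations_eq bilin_ext_basis2 finite_marked_diagrams comb_matrix_basis tensor_marked mult.assoc)
 have "fun_scale 1 (basis_vec (tensor_diagrams r s D1 D2)) - fun_scale \<epsilon> (basis_vec (tensor_diagrams r s D1' D2')) \<in> rels (r + r') (s + s')"
 proof (rule scaled_eq_mod_relations[OF N tensor_marked[OF D(1,2)] tensor_marked[OF D(3,4)]])
  show "fst (tensor_diagrams r s D1 D2) = fst (tensor_diagrams r s D1' D2')" by (simp add: tensor_diagrams_def D(5,6))
  fix ks ls assume "ks \<in> indices N (r + r')" "ls \<in> indices N (s + s')"
  then obtain "is" is' js js' where "ks = is @ is'" "ls = js @ js'" "length is = r" "length js = s" "length is' = r'" "length js' = s'"
   by (elim indices_appendE) (simp add: indices_def)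
  then show "1 * dgm_matrix (r + r') (s + s') (tensor_diagrams r s D1 D2) ks ls =
   \<epsilon> * dgm_matrix (r + r') (s + s') (tensor_diagrams r s D1' D2') ks ls"
   by (simp add: mat[OF D(1,2)] mat[OF D(3,4)] eq mult.left_commute)
 qed
 then show ?thesis by (simp add: fun_scale_def)
qed

lemma tensor_combinations_cong:
 assumes N: "0 < N" and x: "x - x' \<in> rels r s" and y: "y - y' \<in> rels r' s'"
 shows "tensor_combinations r s r' s' x y - tensor_combinations r s r' s' x' y' \<in> rels (r + r') (s + s')"
 unfolding tensor_combinations_eq
proof (rule bilin_ext_cong_relations[OF _ _ x y])
 fix D D' D2 assume DD: "(D, D') \<in> height_swaps r s \<union> arrow_reversals r s" and D2: "D2 \<in> marked r' s'"
 note g = generator_pair[OF DD]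
 show "basis_vec (tensor_diagrams r s D D2) - fun_scale \<epsilon> (basis_vec (tensor_diagrams r s D' D2)) \<in> rels (r + r') (s + s')"
  by (rule tensor_diagrams_relation[OF N g(1) D2 g(2) D2 g(3)]) (simp_all add: g(4) mult.assoc)
next
 fix D D' D1 assume DD: "(D, D') \<in> height_swaps r' s' \<union> arrow_reversals r' s'" and D1: "D1 \<in> marked r s"
 note g = generator_pair[OF DD]
 show "basis_vec (tensor_diagrams r s D1 D) - fun_scale \<epsilon> (basis_vec (tensor_diagrams r s D1 D')) \<in> rels (r + r') (s + s')"
  by (rule tensor_diagrams_relation[OF N D1 g(1) D1 g(2) _ g(3)]) (simp_all add: g(4) mult_ac)
qed

section \<open>Calculating with classes and representatives\<close>

lemma mem_brauer_class:
 "x \<in> combinations r s \<Longrightarrow> y \<in> cls r s x \<longleftrightarrow> y \<in> combinations r s \<and> x - y \<in> rels r s"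
 by (auto simp: brauer_class_def diagram_equiv_def)

lemma brauer_class_eqI:
 assumes "x \<in> combinations r s" "y \<in> combinations r s" "x - y \<in> rels r s"
 shows "cls r s x = cls r s y"
proof -
 have "x - z \<in> rels r s \<longleftrightarrow> y - z \<in> rels r s" for z
 proof
  assume "x - z \<in> rels r s"
  then show "y - z \<in> rels r s" using relations_diff[OF _ assms(3), of "x - z"] by simp
 next
  assume "y - z \<in> rels r s"
  then show "x - z \<in> rels r s" using relations_add[OF assms(3), of "y - z"] by simp
 qed
 then show ?thesis by (intro set_eqI) (simp add: mem_brauer_class[OF assms(1)] mem_brauer_class[OF assms(2)])
qed

lemma rep_brauer_class:
 assumes "x \<in> combinations r s"
 shows "rep (cls r s x) \<in> combinations r s" "x - rep (cls r s x) \<in> rels r s"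
proof -
 have "x \<in> cls r s x" using mem_brauer_class[OF assms] assms relations_zero by simp
 then have "rep (cls r s x) \<in> cls r s x" unfolding rep_def by (rule someI[of "\<lambda>y. y \<in> cls r s x"])
 then show "rep (cls r s x) \<in> combinations r s" "x - rep (cls r s x) \<in> rels r s"
  using mem_brauer_class[OF assms] by blast+
qed

lemma brauer_class_hom: "x \<in> combinations r s \<Longrightarrow> cls r s x \<in> bhom r s"
 unfolding brauer_hom_def brauer_class_def by (rule quotientI)

lemma brauer_hom_rep:
 assumes "X \<in> bhom r s"
 shows "rep X \<in> combinations r s" "X = cls r s (rep X)"
proof -
 obtain x where x: "x \<in> combinations r s" "X = cls r s x"
  using assms unfolding brauer_hom_def brauer_class_def quotient_def by blast
 note rx = rep_brauer_class[OF x(1)]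
 show "rep X \<in> combinations r s" using rx(1) x(2) by simp
 show "X = cls r s (rep X)" using brauer_class_eqI[OF x(1) rx] x(2) by simp
qed

lemma compose_combination: "compose_comb r s t x y \<in> combinations r t"
 unfolding compose_combinations_eq
proof (rule bilin_ext_combination)
 fix D1 D2 assume D: "D1 \<in> marked r s" "D2 \<in> marked s t"
 obtain c E where "compose_dgm r t D1 D2 = fun_scale c (basis_vec E)" "composite \<delta> \<epsilon> r t D1 D2 c E"
  "E \<in> marked r t" by (rule compose_diagrams_composite[OF D])
 then show "compose_dgm r t D1 D2 \<in> combinations r t" by (simp add: combinations_scale)
qed

lemma tensor_combination: "tensor_combinations r s r' s' x y \<in> combinations (r + r') (s + s')"
 unfolding tensor_combinations_eq by (rule bilin_ext_combination) (simp add: tensor_marked)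

abbreviation \<B> where "\<B> \<equiv> marked_brauer \<delta> \<epsilon>"

lemma Hom_marked_brauer: "Hom \<B> r s = bhom r s"
 by (simp add: marked_brauer_def)

lemma Ident_class: "Ident \<B> a = cls a a (basis_vec (identity_diagram a))"
 by (simp add: marked_brauer_def)

text \<open>Allows any representatives in place of the ones chosen inside
  \<open>Comp\<close>.\<close>

lemma Comp_class:
 assumes "0 < N" "x \<in> combinations r s" "y \<in> combinations s t"
 shows "Comp \<B> r s t (cls r s x) (cls s t y) = cls r t (compose_comb r s t x y)"
proof -
 have "compose_comb r s t x y - compose_comb r s t (rep (cls r s x)) (rep (cls s t y)) \<in> rels r t"
  by (rule compose_combinations_cong[OF assms(1) rep_brauer_class(2)[OF assms(2)] rep_brauer_class(2)[OF assms(3)]])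
 then show ?thesis unfolding marked_brauer_def tensor_category.simps
  by (rule brauer_class_eqI[OF compose_combination compose_combination, symmetric])
qed

lemma Tens_class:
 assumes "0 < N" "x \<in> combinations r s" "y \<in> combinations r' s'"
 shows "Tens \<B> r s r' s' (cls r s x) (cls r' s' y) = cls (r + r') (s + s') (tensor_combinations r s r' s' x y)"
proof -
 have "tensor_combinations r s r' s' x y - tensor_combinations r s r' s' (rep (cls r s x)) (rep (cls r' s' y)) \<in> rels (r + r') (s + s')"
  by (rule tensor_combinations_cong[OF assms(1) rep_brauer_class(2)[OF assms(2)] rep_brauer_class(2)[OF assms(3)]])
 then show ?thesis unfolding marked_brauer_def tensor_category.simps
  by (rule brauer_class_eqI[OF tensor_combination tensor_combination, symmetric])
qed

lemma Plus_class:
 assumes "x \<in> combinations r s" "y \<in> combinations r s"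
 shows "Plus \<B> r s (cls r s x) (cls r s y) = cls r s (x + y)"
proof -
 note 1 = rep_brauer_class[OF assms(1)] and 2 = rep_brauer_class[OF assms(2)]
 have "(x + y) - (rep (cls r s x) + rep (cls r s y)) \<in> rels r s"
  using relations_add[OF 1(2) 2(2)] by (simp add: algebra_simps)
 then show ?thesis unfolding marked_brauer_def tensor_category.simps
  by (rule brauer_class_eqI[OF combinations_add[OF assms] combinations_add[OF 1(1) 2(1)], symmetric])
qed

lemma Smult_class:
 assumes "x \<in> combinations r s"
 shows "Smult \<B> r s c (cls r s x) = cls r s (fun_scale c x)"
proof -
 note 1 = rep_brauer_class[OF assms(1)]
 have "fun_scale c x - fun_scale c (rep (cls r s x)) \<in> rels r s"
  using relations_scale[OF 1(2), of c] by (simp add: fun_space.scale_right_diff_distrib)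
 then show ?thesis unfolding marked_brauer_def tensor_category.simps
  by (rule brauer_class_eqI[OF combinations_scale[OF assms] combinations_scale[OF 1(1)], symmetric])
qed

end

section \<open>Generation of all morphisms by the crossing, the cup and the cap\<close>

section \<open>Generation\<close>

lemma vertices_small:
 "vertices 2 0 = {Top 0, Top 1}" "vertices 0 2 = {Bot 0, Bot 1}" "vertices 1 1 = {Top 0, Bot 0}"
 by (auto simp: vertices_def numeral_2_eq_2 lessThan_Suc)

definition swap_at :: "nat \<Rightarrow> nat \<Rightarrow> nat" where
 "swap_at a = (\<lambda>i. if i = a then Suc a else if i = Suc a then a else i)"

lemma swap_at_props:
 "swap_at a (swap_at a i) = i" "Suc a < r \<Longrightarrow> swap_at a ` {..<r} = {..<r}"
proof -
 show "swap_at a (swap_at a i) = i" by (simp add: swap_at_def)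
 assume "Suc a < r"
 then have r: "a + (2 + (r - a - 2)) = r" by simp
 then show "swap_at a ` {..<r} = {..<r}"
  using adjacent_transposition_edges(3)[of a "r - a - 2"] unfolding r swap_at_def by blast
qed

lemma relabel_brauer:
 assumes "E \<in> brauer r s" "inj \<rho>" "\<rho> ` vertices r s = vertices r s"
 shows "(`) \<rho> ` E \<in> brauer r s"
proof -
 have p: "partition_on (vertices r s) E" "\<forall>e\<in>E. card e = 2" using assms(1) by (auto simp: brauer_diagrams_def)
 have "inj_on \<rho> (vertices r s)" by (rule inj_on_subset[OF assms(2)]) simp
 from image_brauer[OF p this] show ?thesis unfolding assms(3) by (simp add: brauer_diagrams_def)
qed

fun position :: "vertex \<Rightarrow> nat" where
 "position (Top i) = i"
| "position (Bot i) = i"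

context supermatrix
begin

inductive generated :: "nat \<Rightarrow> nat \<Rightarrow> 'k combination set \<Rightarrow> bool" where
 zero: "generated r s (cls r s 0)"
| ident: "generated a a (Ident \<B> a)"
| crossing: "generated 2 2 (gen_X \<epsilon>)"
| cup: "generated 2 0 (gen_cup \<epsilon>)"
| cap: "generated 0 2 (gen_cap \<epsilon>)"
| comp: "generated r s X \<Longrightarrow> generated s t Y \<Longrightarrow> generated r t (Comp \<B> r s t X Y)"
| tens: "generated r s X \<Longrightarrow> generated r' s' Y \<Longrightarrow> generated (r + r') (s + s') (Tens \<B> r s r' s' X Y)"
| plus: "generated r s X \<Longrightarrow> generated r s Y \<Longrightarrow> generated r s (Plus \<B> r s X Y)"
| smult: "generated r s X \<Longrightarrow> generated r s (Smult \<B> r s c X)"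

lemma generated_hom: "generated r s X \<Longrightarrow> X \<in> bhom r s"
proof (induction rule: generated.induct)
 case (zero r s)
 show ?case by (intro brauer_class_hom combinations_zero)
next
 case (ident a)
 show ?case unfolding Ident_class by (intro brauer_class_hom basis_vec_combination identity_marked)
next
 case crossing
 show ?case unfolding gen_X_def by (intro brauer_class_hom basis_vec_combination matrix_crossing(2))
next
 case cup
 show ?case unfolding gen_cup_def by (intro brauer_class_hom basis_vec_combination matrix_cup(2))
next
 case cap
 show ?case unfolding gen_cap_def by (intro brauer_class_hom basis_vec_combination matrix_cap(2))
next
 case (comp r s X t Y)
 show ?case unfolding marked_brauer_def tensor_category.simps by (intro brauer_class_hom compose_combination)
next
 case (tens r s X r' s' Y)
 show ?case unfolding marked_brauer_def tensor_category.simps by (intro brauer_class_hom tensor_combination)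
next
 case (plus r s X Y)
 then show ?case unfolding marked_brauer_def tensor_category.simps by (intro brauer_class_hom combinations_add brauer_hom_rep)
next
 case (smult r s X c)
 then show ?case unfolding marked_brauer_def tensor_category.simps by (intro brauer_class_hom combinations_scale brauer_hom_rep)
qed

text \<open>Diagrams with the same edges are multiples of each other modulo the relations, so
  generation is a question about sets of edges, and one choice of markings suffices.\<close>

definition gen_edges :: "nat \<Rightarrow> nat \<Rightarrow> vertex set set \<Rightarrow> bool" where
 "gen_edges r s E \<longleftrightarrow> (\<exists>D\<in>marked r s. fst D = E \<and> generated r s (cls r s (basis_vec D)))"

lemma generated_same_edges:
 assumes D: "D \<in> marked r s" "D' \<in> marked r s" "fst D = fst D'"
  and c: "c \<noteq> 0" and gen: "generated r s (cls r s (fun_scale c (basis_vec D)))"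
 shows "generated r s (cls r s (basis_vec D'))"
proof -
 have "related r s (fst D, [] @ snd D') (fst D, [] @ snd D)"
  by (rule related_markings) (use D in \<open>metis append_Nil prod.collapse\<close>)+
 then have "related r s D' D" using D(3) by (metis append_Nil prod.collapse)
 then obtain \<eta> where \<eta>: "basis_vec D' - fun_scale \<eta> (basis_vec D) \<in> rels r s" unfolding related_def by blast
 have comb: "basis_vec D \<in> combinations r s" "basis_vec D' \<in> combinations r s" using D by simp_all
 have "cls r s (basis_vec D') = cls r s (fun_scale (\<eta> / c) (fun_scale c (basis_vec D)))"
  using brauer_class_eqI[OF comb(2) combinations_scale[OF comb(1)] \<eta>] c by simp
 also have "\<dots> = Smult \<B> r s (\<eta> / c) (cls r s (fun_scale c (basis_vec D)))"
  by (rule Smult_class[OF combinations_scale[OF comb(1)], symmetric])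
 finally show ?thesis using generated.smult[OF gen] by simp
qed

lemma generated_edgesD:
 assumes "gen_edges r s (fst D)" "D \<in> marked r s"
 shows "generated r s (cls r s (basis_vec D))"
proof -
 obtain D' where D': "D' \<in> marked r s" "fst D' = fst D" "generated r s (cls r s (basis_vec D'))"
  using assms(1) unfolding gen_edges_def by blast
 show ?thesis by (rule generated_same_edges[OF D'(1) assms(2) D'(2), of 1]) (use D'(3) in simp_all)
qed

text \<open>Simplification multiplies the scalar by powers of \<open>\<epsilon>\<close> only.
  Together with the absence of loops this makes a composite a nonzero multiple of a diagram.\<close>

lemma simplify_nonzero: "(simplify_step \<epsilon> S)\<^sup>*\<^sup>* (a, L) (c, L') \<Longrightarrow> a \<noteq> 0 \<Longrightarrow> c \<noteq> 0"
proof (induction rule: rtranclp_induct2)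
 case (step a' L1 c' L2)
 then show ?case by (auto elim!: simplify_step.cases)
qed simp

lemma gen_edges_comp:
 assumes N: "0 < N" and D1: "D1 \<in> marked r s" "generated r s (cls r s (basis_vec D1))"
  and D2: "D2 \<in> marked s t" "generated s t (cls s t (basis_vec D2))"
  and loops: "closed_loops (stack_segments D1 D2) = {}"
 shows "gen_edges r t (composite_edges (stack_segments D1 D2))"
proof -
 obtain c D where D: "compose_dgm r t D1 D2 = fun_scale c (basis_vec D)" "composite \<delta> \<epsilon> r t D1 D2 c D"
  "D \<in> marked r t" "fst D = composite_edges (stack_segments D1 D2)" by (rule compose_diagrams_composite[OF D1(1) D2(1)])
 have "c \<noteq> 0"
 proof -
  obtain L0 L where "(simplify_step \<epsilon> (stack_segments D1 D2))\<^sup>*\<^sup>* (1, L0) (c, L)"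
   using D(2) unfolding composite_def Let_def loops by auto
  then show ?thesis by (rule simplify_nonzero) simp
 qed
 moreover have "generated r t (cls r t (fun_scale c (basis_vec D)))"
  using generated.comp[OF D1(2) D2(2)] D1(1) D2(1)
  by (simp add: Comp_class[OF N] compose_combinations_eq bilin_ext_basis2 finite_marked_diagrams D(1))
 ultimately have "generated r t (cls r t (basis_vec D))"
  by (intro generated_same_edges[OF D(3) D(3) HOL.refl])
 then show ?thesis unfolding gen_edges_def using D(3,4) by blast
qed

lemma gen_edges_tensor:
 assumes N: "0 < N" and "gen_edges r s E" "gen_edges r' s' E'"
 shows "gen_edges (r + r') (s + s') (E \<union> (`) (shift_vertex r s) ` E')"
proof -
 obtain D D' where D: "D \<in> marked r s" "fst D = E" "generated r s (cls r s (basis_vec D))"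
  "D' \<in> marked r' s'" "fst D' = E'" "generated r' s' (cls r' s' (basis_vec D'))"
  using assms(2,3) unfolding gen_edges_def by blast
 have "generated (r + r') (s + s') (cls (r + r') (s + s') (basis_vec (tensor_diagrams r s D D')))"
  using generated.tens[OF D(3,6)] D(1,4)
  by (simp add: Tens_class[OF N] tensor_combinations_eq bilin_ext_basis2 finite_marked_diagrams)
 moreover have "fst (tensor_diagrams r s D D') = E \<union> (`) (shift_vertex r s) ` E'"
  by (simp add: tensor_diagrams_def D(2,5))
 ultimately show ?thesis unfolding gen_edges_def using tensor_marked[OF D(1,4)] by blast
qed

lemma gen_edges_ident: "gen_edges a a (fst (identity_diagram a))"
 unfolding gen_edges_def
 using identity_marked[of a] generated.ident[of a] unfolding Ident_class by blast

lemma gen_edges_generators: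
 "gen_edges 2 2 {{Top 0, Bot 1}, {Top 1, Bot 0}}" "gen_edges 2 0 {vertices 2 0}"
 "gen_edges 0 2 {vertices 0 2}" "gen_edges 1 1 {vertices 1 1}"
proof -
 show "gen_edges 2 2 {{Top 0, Bot 1}, {Top 1, Bot 0}}" unfolding gen_edges_def
  by (rule bexI[OF _ matrix_crossing(2)]) (use generated.crossing in \<open>simp add: gen_X_def\<close>)
 show "gen_edges 2 0 {vertices 2 0}" unfolding gen_edges_def vertices_small
  by (rule bexI[OF _ matrix_cup(2)]) (use generated.cup in \<open>simp add: gen_cup_def\<close>)
 show "gen_edges 0 2 {vertices 0 2}" unfolding gen_edges_def vertices_small
  by (rule bexI[OF _ matrix_cap(2)]) (use generated.cap in \<open>simp add: gen_cap_def\<close>)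
 have "fst (identity_diagram 1) = {vertices 1 1}" unfolding vertices_small by (auto simp: identity_diagram_def)
 then show "gen_edges 1 1 {vertices 1 1}" using gen_edges_ident[of 1] by simp
qed

lemma gen_edges_swap:
 assumes N: "0 < N" and a: "Suc a < r"
 shows "gen_edges r r (permutation_edges (swap_at a) r)"
proof -
 define c where "c = r - a - 2"
 have r: "r = a + (2 + c)" using a by (simp add: c_def)
 show ?thesis unfolding r swap_at_def adjacent_transposition_edges(1)
  by (intro gen_edges_tensor[OF N] gen_edges_ident gen_edges_generators)
qed

lemma gen_edges_relabel:
 assumes N: "0 < N" and E: "gen_edges r s E" and a: "Suc a < (if t then r else s)"
 shows "gen_edges r s ((`) (relabel t (swap_at a)) ` E)"
proof -
 obtain D where D: "D \<in> marked r s" "fst D = E" "generated r s (cls r s (basis_vec D))"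
  using E unfolding gen_edges_def by blast
 define k where "k = (if t then r else s)"
 have a: "Suc a < k" using a by (simp add: k_def)
 obtain P where P: "P \<in> marked k k" "fst P = permutation_edges (swap_at a) k" "generated k k (cls k k (basis_vec P))"
  using gen_edges_swap[OF N a] unfolding gen_edges_def by blast
 note c = composite_permutation[OF markedD(1)[OF D(1)] P(2) markedD(1)[OF P(1)] k_def
  swap_at_props(1) swap_at_props(2)[OF a] HOL.refl]
 show ?thesis
 proof (cases t)
  case True
  then show ?thesis using gen_edges_comp[OF N _ _ D(1,3), of P r] P(1,3) c D(2) k_def by simp
 next
  case False
  then show ?thesis using gen_edges_comp[OF N D(1,3), of P s] P(1,3) c D(2) k_def by simp
 qed
qed

text \<open>To generate \<open>E\<close> it suffices to generate its image under an involution that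
  preserves generation, since applying the involution again recovers \<open>E\<close>.\<close>

lemma gen_edges_involution:
 assumes E: "E \<in> brauer r s" and inv: "\<And>x. \<rho> (\<rho> x) = x" and V: "\<rho> ` vertices r s = vertices r s"
  and closed: "\<And>E. gen_edges r s E \<Longrightarrow> gen_edges r s ((`) \<rho> ` E)"
  and gen: "(`) \<rho> ` E \<in> brauer r s \<Longrightarrow> gen_edges r s ((`) \<rho> ` E)"
 shows "gen_edges r s E"
proof -
 have "inj \<rho>" using inv by (rule inj_on_inverseI)
 then have "gen_edges r s ((`) \<rho> ` (`) \<rho> ` E)" by (intro closed gen relabel_brauer[OF E _ V])
 then show ?thesis by (simp add: image_image inv)
qed

lemma gen_edges_peel:
 assumes N: "0 < N" and gen: "gen_edges a c {vertices a c}" and E: "E \<in> brauer r s"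
  and e: "vertices a c \<in> E" and le: "a \<le> r" "c \<le> s"
  and IH: "\<And>E'. E' \<in> brauer (r - a) (s - c) \<Longrightarrow> gen_edges (r - a) (s - c) E'"
 shows "gen_edges r s E"
proof -
 have E': "E \<in> brauer (a + (r - a)) (c + (s - c))" using E le by simp
 obtain F where F: "F \<in> brauer (r - a) (s - c)" "E = {vertices a c} \<union> (`) (shift_vertex a c) ` F"
  using split_edge[OF E' e] .
 have "gen_edges (a + (r - a)) (c + (s - c)) E"
  unfolding F(2) by (rule gen_edges_tensor[OF N gen IH[OF F(1)]])
 then show ?thesis using le by simp
qed

text \<open>Inside an induction on the number of vertices, supplied by \<open>IH\<close>, the sum of
  the positions of the ends of one edge decreases: an end moves one place to the left unless the
  other end is there. When no end can move, the edge is leftmost and splits off.\<close>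

lemma gen_edges_edge:
 assumes N: "0 < N"
  and IH: "\<And>r' s' E'. r' + s' < r + s \<Longrightarrow> E' \<in> brauer r' s' \<Longrightarrow> gen_edges r' s' E'"
 shows "E \<in> brauer r s \<Longrightarrow> {x, y} \<in> E \<Longrightarrow> gen_edges r s E"
proof (induction "position x + position y" arbitrary: x y E rule: less_induct)
 case less
 note E = less.prems(1)
 have move: "gen_edges r s E"
  if xy: "{x', y'} = {x, y}" and i: "x' = (if t then Top (Suc i) else Bot (Suc i))" "y' \<noteq> z" "z = (if t then Top i else Bot i)"
  for x' y' t i z
 proof -
  have e: "{x', y'} \<in> E" using less.prems(2) xy by simp
  have V: "x' \<in> vertices r s" and ne: "x' \<noteq> y'"
   using brauer_edge[OF E e] by auto
  let ?\<rho> = "relabel t (swap_at i)"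
  have ir: "Suc i < (if t then r else s)" using V i by (auto simp: vertices_def split: if_splits)
  have \<rho>: "?\<rho> x' = z" "?\<rho> y' = y'" using i ne by (cases y'; cases t; simp add: swap_at_def)+
  note bij = relabel_bij[OF swap_at_props(1) swap_at_props(2)[OF ir]]
  show ?thesis
  proof (rule gen_edges_involution[OF E bij(3) bij(2)])
   show "gen_edges r s ((`) ?\<rho> ` F)" if "gen_edges r s F" for F
    by (rule gen_edges_relabel[OF N that ir])
   have "{z, y'} \<in> (`) ?\<rho> ` E" using imageI[OF e, of "(`) ?\<rho>"] \<rho> by simp
   moreover have "position z < position x'" using i by simp
   then have "position z + position y' < position x + position y" using xy by (auto simp: doubleton_eq_iff)
   ultimately show "gen_edges r s ((`) ?\<rho> ` E)" if "(`) ?\<rho> ` E \<in> brauer r s"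
    using less.hyps[of z y'] that by blast
  qed
 qed
 have V: "{x, y} \<subseteq> vertices r s" and ne: "x \<noteq> y" using brauer_edge[OF E less.prems(2)] by auto
 let ?R = "\<lambda>x y. (\<exists>i. x = Top (Suc i) \<and> y \<noteq> Top i) \<or> (\<exists>i. x = Bot (Suc i) \<and> y \<noteq> Bot i)"
 \<comment> \<open>If an end is blocked by the other one in the same row, that other end lies
   further left and can move instead, unless it is at position 0.\<close>
 have base: "?R x y \<or> ?R y x \<or> {x, y} = vertices 2 0 \<or> {x, y} = vertices 0 2 \<or> {x, y} = vertices 1 1"
 proof (cases x)
  case x: (Top i)
  show ?thesis
  proof (cases y)
   case y: (Top j)
   consider "i = 0" "j = 0" | i' where "i = Suc i'" "j \<noteq> i'" | j' where "j = Suc j'" "i \<noteq> j'"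
    | "i = Suc j" "j = 0" | "j = Suc i" "i = 0"
    by (cases i; cases j; force)
   then show ?thesis using ne unfolding vertices_small x y by cases auto
  next
   case y: (Bot j)
   then show ?thesis unfolding vertices_small x y by (cases i; cases j; simp)
  qed
 next
  case x: (Bot i)
  show ?thesis
  proof (cases y)
   case y: (Bot j)
   consider "i = 0" "j = 0" | i' where "i = Suc i'" "j \<noteq> i'" | j' where "j = Suc j'" "i \<noteq> j'"
    | "i = Suc j" "j = 0" | "j = Suc i" "i = 0"
    by (cases i; cases j; force)
   then show ?thesis using ne unfolding vertices_small x y by cases auto
  next
   case y: (Top j)
   then show ?thesis unfolding vertices_small x y by (cases i; cases j; auto)
  qed
 qed
 consider "?R x y" | "?R y x"
  | "{x, y} = vertices 2 0" | "{x, y} = vertices 0 2" | "{x, y} = vertices 1 1"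
  using base by argo
 then show ?case
 proof cases
  case 1
  then show ?thesis using move[OF HOL.refl, of True] move[OF HOL.refl, of False] by auto
 next
  case 2
  then show ?thesis using move[OF insert_commute, of True] move[OF insert_commute, of False] by auto
 next
  case 3
  have le: "2 \<le> r" "0 \<le> s" using V unfolding 3 unfolding vertices_small by (auto simp: vertices_def)
  show ?thesis
  proof (rule gen_edges_peel[OF N gen_edges_generators(2) E _ le])
   show "vertices 2 0 \<in> E" using less.prems(2) 3 by simp
   show "gen_edges (r - 2) (s - 0) E'" if "E' \<in> brauer (r - 2) (s - 0)" for E'
    by (rule IH[OF _ that]) (use le in linarith)
  qed
 next
  case 4
  have le: "0 \<le> r" "2 \<le> s" using V unfolding 4 unfolding vertices_small by (auto simp: vertices_def)
  show ?thesis
  proof (rule gen_edges_peel[OF N gen_edges_generators(3) E _ le])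
   show "vertices 0 2 \<in> E" using less.prems(2) 4 by simp
   show "gen_edges (r - 0) (s - 2) E'" if "E' \<in> brauer (r - 0) (s - 2)" for E'
    by (rule IH[OF _ that]) (use le in linarith)
  qed
 next
  case 5
  have le: "1 \<le> r" "1 \<le> s" using V unfolding 5 unfolding vertices_small by (auto simp: vertices_def)
  show ?thesis
  proof (rule gen_edges_peel[OF N gen_edges_generators(4) E _ le])
   show "vertices 1 1 \<in> E" using less.prems(2) 5 by simp
   show "gen_edges (r - 1) (s - 1) E'" if "E' \<in> brauer (r - 1) (s - 1)" for E'
    by (rule IH[OF _ that]) (use le in linarith)
  qed
 qed
qed

lemma gen_edges_empty:
 assumes "E \<in> brauer 0 0"
 shows "gen_edges 0 0 E"
proof -
 have "E = {}" using assms by (auto simp: brauer_diagrams_def partition_on_def vertices_def)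
 then show ?thesis using gen_edges_ident[of 0] by (simp add: identity_diagram_def)
qed

lemma all_edges_generated:
 assumes N: "0 < N"
 shows "E \<in> brauer r s \<Longrightarrow> gen_edges r s E"
proof (induction "r + s" arbitrary: r s E rule: less_induct)
 case less
 show ?case
 proof (cases "E = {}")
  case True
  then have "vertices r s = {}" using less.prems by (simp add: brauer_diagrams_def partition_on_def)
  then have "r = 0" "s = 0" by (auto simp: vertices_def)
  then show ?thesis using gen_edges_empty less.prems by blast
 next
  case False
  then obtain e where e: "e \<in> E" by blast
  then obtain x y where "e = {x, y}" using brauer_edge(2)[OF less.prems] card_2_iff by metis
  then show ?thesis using gen_edges_edge[OF N less.hyps less.prems] e by blast
 qed
qed

text \<open>For r = s = 0 the empty diagram is the only one and is an identity, so this case holds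
  for N = 0 too.\<close>

lemma all_generated:
 assumes N: "0 < N \<or> r = 0 \<and> s = 0" and X: "X \<in> bhom r s"
 shows "generated r s X"
proof -
 have D: "generated r s (cls r s (basis_vec D))" if "D \<in> marked r s" for D
  using generated_edgesD[OF _ that] all_edges_generated gen_edges_empty markedD(1)[OF that] N by blast
 have sum: "generated r s (cls r s (\<Sum>D\<in>A. fun_scale (x D) (basis_vec D)))"
  if "finite A" "A \<subseteq> marked r s" for A and x :: "diagram \<Rightarrow> 'k"
  using that
 proof (induction A rule: finite_induct)
  case empty
  then show ?case using generated.zero by simp
 next
  case (insert D A)
  have 1: "fun_scale (x D) (basis_vec D) \<in> combinations r s" "(\<Sum>D\<in>A. fun_scale (x D) (basis_vec D)) \<in> combinations r s"
   using insert.prems by (auto intro!: combinations_scale combinations_sum)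
  have 2: "generated r s (cls r s (fun_scale (x D) (basis_vec D)))"
   using generated.smult[OF D] insert.prems by (simp add: Smult_class[symmetric])
  have 3: "generated r s (cls r s (\<Sum>D\<in>A. fun_scale (x D) (basis_vec D)))"
   using insert by simp
  show ?case unfolding sum.insert[OF insert.hyps] Plus_class[OF 1, symmetric] by (rule generated.plus[OF 2 3])
 qed
 note rX = brauer_hom_rep[OF X]
 show ?thesis
  using sum[OF finite_marked_diagrams order_refl, of "rep X"] combination_expand[OF rX(1)] rX(2) by simp
qed

end

section \<open>Existence, compatibility with the grading and uniqueness\<close>

section \<open>The functor\<close>

context osp_form
begin

abbreviation \<T> where "\<T> \<equiv> tensor_powers scale V b"

text \<open>Computed from the chosen representative; by \<open>functor_class\<close> any other gives
  the same map.\<close>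

definition functor_map :: "nat \<Rightarrow> nat \<Rightarrow> 'k combination set \<Rightarrow> ('v, 'k) tensor \<Rightarrow> ('v, 'k) tensor" where
 "functor_map r s X = lmat r s (comb_matrix r s (rep X))"

lemma rep_matrix:
 "x \<in> combinations r s \<Longrightarrow> comb_matrix r s (rep (cls r s x)) is js = comb_matrix r s x is js"
 using relations_matrix[OF rep_brauer_class(2), of x r s "is" js] by (simp add: comb_matrix_diff)

lemma functor_class:
 "x \<in> combinations r s \<Longrightarrow> functor_map r s (cls r s x) = lmat r s (comb_matrix r s x)"
 unfolding functor_map_def by (rule lmat_eqI) (rule rep_matrix)

lemma functor_basis:
 assumes "D \<in> marked r s" "\<And>is js. is \<in> ix r \<Longrightarrow> js \<in> ix s \<Longrightarrow> dgm_matrix r s D is js = K is js"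
 shows "functor_map r s (cls r s (basis_vec D)) = lmat r s K"
 unfolding functor_class[OF basis_vec_combination[OF assms(1)]]
 by (rule lmat_eqI) (simp add: comb_matrix_basis[OF assms(1)] assms(2))

lemma functor_generators:
 "functor_map a a (Ident \<B> a) = (\<lambda>x\<in>tp a. x)"
 "functor_map 2 2 (gen_X \<epsilon>) = swap_map scale V"
 "functor_map 2 0 (gen_cup \<epsilon>) = form_map scale V b"
 "functor_map 0 2 (gen_cap \<epsilon>) = coform_map scale V (m + n) v v'"
proof -
 show "functor_map a a (Ident \<B> a) = (\<lambda>x\<in>tp a. x)"
  unfolding Ident_class lmat_ident by (rule functor_basis[OF identity_marked matrix_identity])
 show "functor_map 2 2 (gen_X \<epsilon>) = swap_map scale V"
  unfolding gen_X_def swap_map_eq by (rule functor_basis[OF matrix_crossing(2) matrix_generators(2)])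
 show "functor_map 2 0 (gen_cup \<epsilon>) = form_map scale V b"
  unfolding gen_cup_def form_map_eq by (rule functor_basis[OF matrix_cup(2) matrix_generators(1)])
 show "functor_map 0 2 (gen_cap \<epsilon>) = coform_map scale V (m + n) v v'"
  unfolding gen_cap_def coform_map_eq by (rule functor_basis[OF matrix_cap(2) matrix_generators(3)])
qed

lemma gen_I_eq: "gen_I \<epsilon> = Ident \<B> 1"
 by (simp add: gen_I_def Ident_class identity_diagram_def lessThan_Suc)

lemma tensor_combination_matrix:
 assumes "ks \<in> ix (r + r')" "ls \<in> ix (s + s')"
 shows "comb_matrix (r + r') (s + s') (tensor_combinations r s r' s' x y) ks ls =
  tensor_matrix r s (comb_matrix r s x) (comb_matrix r' s' y) ks ls"
proof -
 obtain "is" is' js js' where k: "ks = is @ is'" "ls = js @ js'" "length is = r" "length js = s" "length is' = r'" "length js' = s'"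
  using assms by (elim indices_appendE) (simp add: indices_def)
 show ?thesis unfolding k(1,2) matrix_tensor[OF k(3-6)] tensor_matrix_append[OF k(3,4)] ..
qed

lemma equivariant_basis:
 assumes D: "D \<in> marked r s" and K: "equivariant r s K"
  and eq: "\<And>is js. is \<in> ix r \<Longrightarrow> js \<in> ix s \<Longrightarrow> dgm_matrix r s D is js = K is js"
 shows "equivariant r s (comb_matrix r s (rep (cls r s (basis_vec D))))"
 by (rule equivariant_cong[OF K])
  (simp add: rep_matrix[OF basis_vec_combination[OF D]] comb_matrix_basis[OF D] eq)

text \<open>Equivariance is inherited from the generators along the operations of the category. Each
  operation returns a class whose representatives all have the matrix of the operation performed on
  the arguments.\<close>

lemma generated_equivariant: "generated r s X \<Longrightarrow> equivariant r s (comb_matrix r s (rep X))"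
proof (induction rule: generated.induct)
 case (zero r s)
 have z: "comb_matrix r s (rep (cls r s 0)) is js = 0" for "is" js
  using rep_matrix[OF combinations_zero] by (simp add: comb_matrix_def pointwise)
 show ?case by (rule equivariantI) (simp add: z)
next
 case (ident a)
 show ?case unfolding Ident_class by (rule equivariant_basis[OF identity_marked equivariant_ident matrix_identity])
next
 case crossing
 show ?case unfolding gen_X_def by (rule equivariant_basis[OF matrix_crossing(2) equivariant_crossing matrix_generators(2)])
next
 case cup
 show ?case unfolding gen_cup_def by (rule equivariant_basis[OF matrix_cup(2) equivariant_cup matrix_generators(1)])
next
 case cap
 show ?case unfolding gen_cap_def by (rule equivariant_basis[OF matrix_cap(2) equivariant_cap matrix_generators(3)])
next
 case (comp r s X t Y)
 show ?case unfolding marked_brauer_def tensor_category.simps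
  by (rule equivariant_cong[OF equivariant_comp[OF comp.IH]]) (simp add: rep_matrix[OF compose_combination] matrix_compose)
next
 case (tens r s X r' s' Y)
 show ?case unfolding marked_brauer_def tensor_category.simps
  by (rule equivariant_cong[OF equivariant_tensor[OF tens.IH]]) (simp add: rep_matrix[OF tensor_combination] tensor_combination_matrix)
next
 case (plus r s X Y)
 have "rep X + rep Y \<in> combinations r s"
  using plus.hyps by (intro combinations_add brauer_hom_rep(1) generated_hom)
 then show ?case unfolding marked_brauer_def tensor_category.simps
  by (intro equivariant_cong[OF equivariant_plus[OF plus.IH]]) (simp add: rep_matrix comb_matrix_add)
next
 case (smult r s X c)
 have "fun_scale c (rep X) \<in> combinations r s"
  using smult.hyps by (intro combinations_scale brauer_hom_rep(1) generated_hom)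
 then show ?case unfolding marked_brauer_def tensor_category.simps
  by (intro equivariant_cong[OF equivariant_smult[OF smult.IH, of c]]) (simp add: rep_matrix comb_matrix_scale)
qed

lemma indices_empty: "dm = 0 \<Longrightarrow> 0 < a \<Longrightarrow> ix a = {}"
 by (auto simp: indices_def)

text \<open>Beyond the reach of generation, one of the two index sets is empty, and the matrix
  condition is vacuous.\<close>

lemma functor_module_hom:
 assumes "X \<in> bhom r s"
 shows "functor_map r s X \<in> Defs.module_hom scale V b r s"
 unfolding functor_map_def
proof (rule equivariant_module_hom)
 show "equivariant r s (comb_matrix r s (rep X))"
 proof (cases "0 < dm \<or> r = 0 \<and> s = 0")
  case True
  then show ?thesis by (rule generated_equivariant[OF all_generated[OF _ assms]])
 next
  case False
  then have "ix r = {} \<or> ix s = {}" using indices_empty by auto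
  then show ?thesis by (auto intro!: equivariantI)
 qed
qed

text \<open>The operations of \<open>marked_brauer\<close> and the map itself start from the same
  representatives, so each law is an identity between matrices of combinations.\<close>

lemma functor_tensor_functor: "tensor_functor \<B> \<T> (\<lambda>a. a) functor_map"
 unfolding tensor_functor_def
proof (intro conjI allI ballI)
 fix a c e a' c' t X Y
 show "functor_map a c X \<in> Hom \<T> a c" if "X \<in> Hom \<B> a c"
  using functor_module_hom that by (simp add: Hom_marked_brauer tensor_powers_def)
 show "functor_map a a (Ident \<B> a) = Ident \<T> a"
  by (simp add: functor_generators(1) tensor_powers_def)
 show "functor_map a e (Comp \<B> a c e X Y) = Comp \<T> a c e (functor_map a c X) (functor_map c e Y)"
 proof -
  have "functor_map a e (Comp \<B> a c e X Y) = lmat a e (comb_matrix a e (compose_comb a c e (rep X) (rep Y)))"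
   unfolding marked_brauer_def tensor_category.simps by (rule functor_class[OF compose_combination])
  also have "\<dots> = lmat a e (\<lambda>is js. \<Sum>l\<in>ix c. comb_matrix a c (rep X) is l * comb_matrix c e (rep Y) l js)"
   by (rule lmat_eqI) (rule matrix_compose)
  finally show ?thesis by (simp add: tensor_powers_def functor_map_def lmat_comp)
 qed
 show "functor_map a c (Plus \<B> a c X Y) = Plus \<T> a c (functor_map a c X) (functor_map a c Y)" if "X \<in> Hom \<B> a c" "Y \<in> Hom \<B> a c"
 proof -
  have "functor_map a c (Plus \<B> a c X Y) = lmat a c (comb_matrix a c (rep X + rep Y))"
   unfolding marked_brauer_def tensor_category.simps
   by (rule functor_class) (use that in \<open>intro combinations_add brauer_hom_rep(1), simp_all add: Hom_marked_brauer\<close>)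
  also have "\<dots> = lmat a c (\<lambda>is js. comb_matrix a c (rep X) is js + comb_matrix a c (rep Y) is js)"
   by (rule lmat_eqI) (rule comb_matrix_add)
  finally show ?thesis by (simp add: tensor_powers_def functor_map_def lmat_plus)
 qed
 show "functor_map a c (Smult \<B> a c t X) = Smult \<T> a c t (functor_map a c X)" if "X \<in> Hom \<B> a c"
 proof -
  have "functor_map a c (Smult \<B> a c t X) = lmat a c (comb_matrix a c (fun_scale t (rep X)))"
   unfolding marked_brauer_def tensor_category.simps
   by (rule functor_class) (use that in \<open>intro combinations_scale brauer_hom_rep(1), simp_all add: Hom_marked_brauer\<close>)
  also have "\<dots> = lmat a c (\<lambda>is js. t * comb_matrix a c (rep X) is js)"
   by (rule lmat_eqI) (rule comb_matrix_scale)
  finally show ?thesis by (simp add: tensor_powers_def functor_map_def lmat_smult)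
 qed
 show "Tens_obj \<B> a c = Tens_obj \<T> a c" by (simp add: marked_brauer_def tensor_powers_def)
 show "functor_map (Tens_obj \<B> a a') (Tens_obj \<B> c c') (Tens \<B> a c a' c' X Y) = Tens \<T> a c a' c' (functor_map a c X) (functor_map a' c' Y)"
 proof -
  have "functor_map (a + a') (c + c') (Tens \<B> a c a' c' X Y) =
   lmat (a + a') (c + c') (comb_matrix (a + a') (c + c') (tensor_combinations a c a' c' (rep X) (rep Y)))"
   unfolding marked_brauer_def tensor_category.simps by (rule functor_class[OF tensor_combination])
  also have "\<dots> = lmat (a + a') (c + c') (tensor_matrix a c (comb_matrix a c (rep X)) (comb_matrix a' c' (rep Y)))"
   by (rule lmat_eqI) (rule tensor_combination_matrix)
  also have "\<dots> = Tens \<T> a c a' c' (functor_map a c X) (functor_map a' c' Y)"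
   by (simp add: tensor_powers_def functor_map_def hom_tensor_lmat)
  finally show ?thesis by (simp add: marked_brauer_def)
 qed
qed

lemma functor_realizes: "realizes_generators scale V b \<epsilon> (m + n) v v' (\<lambda>a. a) functor_map"
 unfolding realizes_generators_def gen_I_eq by (simp only: functor_generators) simp

text \<open>\<open>diagram_degree\<close> asks whether \<open>\<epsilon> = 1\<close>; in
  characteristic different from 2 this is so exactly for an even form.\<close>

lemma degree_eq: "diagram_degree \<epsilon> D = of_nat (length (snd D)) * d"
proof (cases "d = 0")
 case True
 then show ?thesis by (simp add: diagram_degree_def eps_eq)
next
 case False
 then have d: "d = 1" by simp
 have "(-1 :: 'k) \<noteq> 1"
 proof
  assume "(-1 :: 'k) = 1"
  then have "(2 :: 'k) = 0" by (metis add.right_inverse one_add_one)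
  then show False using two_nonzero by blast
 qed
 then show ?thesis using d by (simp add: diagram_degree_def eps_eq)
qed

lemma functor_grading: "preserves_grading \<B> \<T> (\<lambda>a. a) functor_map"
 unfolding preserves_grading_def
proof (intro allI ballI)
 fix r s q X assume "X \<in> Hom_deg \<B> r s q"
 then obtain x where x: "X = cls r s x" "x \<in> combinations r s" "\<And>D. x D \<noteq> 0 \<Longrightarrow> diagram_degree \<epsilon> D = q"
  by (auto simp: marked_brauer_def brauer_hom_deg_def)
 have "lmat r s (comb_matrix r s x) \<in> lin_deg scale V r s q"
 proof (rule lmat_deg)
  fix "is" js assume i: "is \<in> ix r" "js \<in> ix s" and nz: "comb_matrix r s x is js \<noteq> 0"
  obtain D where D: "D \<in> marked r s" "x D * dgm_matrix r s D is js \<noteq> 0"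
   using nz unfolding comb_matrix_def by (meson sum.neutral)
  have "parity p is + parity p js = of_nat (length (snd D)) * d"
   by (rule dgm_matrix_homogeneous[OF D(1)]) (use i D(2) in \<open>auto simp: indices_def\<close>)
  then show "parity p is + parity p js = q" using x(3)[of D] D(2) degree_eq[of D] by simp
 qed
 moreover have "functor_map r s X \<in> Defs.module_hom scale V b r s"
  using functor_module_hom brauer_class_hom[OF x(2)] x(1) by simp
 ultimately show "functor_map r s X \<in> Hom_deg \<T> r s q"
  using x(1) functor_class[OF x(2)] by (simp add: tensor_powers_def)
qed

lemma functor_laws:
 assumes "tensor_functor \<B> \<T> (\<lambda>a. a) G"
 shows "X \<in> bhom r s \<Longrightarrow> G r s X \<in> Defs.module_hom scale V b r s"
  "G a a (Ident \<B> a) = Ident \<T> a"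
  "X \<in> bhom r s \<Longrightarrow> Y \<in> bhom s t \<Longrightarrow> G r t (Comp \<B> r s t X Y) = Comp \<T> r s t (G r s X) (G s t Y)"
  "X \<in> bhom r s \<Longrightarrow> Y' \<in> bhom r s \<Longrightarrow> G r s (Plus \<B> r s X Y') = Plus \<T> r s (G r s X) (G r s Y')"
  "X \<in> bhom r s \<Longrightarrow> G r s (Smult \<B> r s c X) = Smult \<T> r s c (G r s X)"
  "X \<in> bhom r s \<Longrightarrow> Z \<in> bhom r' s' \<Longrightarrow>
   G (r + r') (s + s') (Tens \<B> r s r' s' X Z) = Tens \<T> r s r' s' (G r s X) (G r' s' Z)"
 using assms by (simp_all add: tensor_functor_def marked_brauer_def tensor_powers_def)

text \<open>Induction on generation: each law of a functor determines its value on the result of an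
  operation from the values on the arguments. The zero class is covered because it is its own
  multiple by 0.\<close>

lemma functors_agree:
 assumes F: "tensor_functor \<B> \<T> (\<lambda>a. a) F" "realizes_generators scale V b \<epsilon> (m + n) v v' (\<lambda>a. a) F"
  and G: "tensor_functor \<B> \<T> (\<lambda>a. a) G" "realizes_generators scale V b \<epsilon> (m + n) v v' (\<lambda>a. a) G"
 shows "generated r s X \<Longrightarrow> G r s X = F r s X"
proof (induction rule: generated.induct)
 case (zero r s)
 have "H r s (cls r s 0) = (\<lambda>x\<in>tp r. 0)" if H: "tensor_functor \<B> \<T> (\<lambda>a. a) H" for H
 proof -
  have "cls r s 0 = Smult \<B> r s 0 (cls r s 0)" by (simp add: Smult_class[OF combinations_zero])
  then have "H r s (cls r s 0) = Smult \<T> r s 0 (H r s (cls r s 0))"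
   using functor_laws(5)[OF H brauer_class_hom[OF combinations_zero], where c = 0] by metis
  then show ?thesis by (simp add: tensor_powers_def)
 qed
 then show ?case using F(1) G(1) by metis
next
 case (ident a)
 show ?case using functor_laws(2)[OF F(1)] functor_laws(2)[OF G(1)] by simp
next
 case (comp r s X t Y)
 then show ?case using functor_laws(3)[OF F(1)] functor_laws(3)[OF G(1)] generated_hom by metis
next
 case (tens r s X r' s' Y)
 then show ?case using functor_laws(6)[OF F(1)] functor_laws(6)[OF G(1)] generated_hom by metis
next
 case (plus r s X Y)
 then show ?case using functor_laws(4)[OF F(1)] functor_laws(4)[OF G(1)] generated_hom by metis
next
 case (smult r s X c)
 then show ?case using functor_laws(5)[OF F(1)] functor_laws(5)[OF G(1)] generated_hom by metis
qed (use F(2) G(2) in \<open>simp_all add: realizes_generators_def\<close>)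

lemma functor_unique:
 assumes G: "tensor_functor \<B> \<T> (\<lambda>a. a) G" "realizes_generators scale V b \<epsilon> (m + n) v v' (\<lambda>a. a) G"
  and X: "X \<in> bhom r s"
 shows "G r s X = functor_map r s X"
proof (cases "0 < dm \<or> r = 0 \<and> s = 0")
 case True
 then show ?thesis
  by (rule functors_agree[OF functor_tensor_functor functor_realizes G all_generated[OF _ X]])
next
 case False
 then have "ix r = {} \<or> ix s = {}" using indices_empty by auto
 moreover have "G r s X \<in> lin scale r s" "functor_map r s X \<in> lin scale r s"
  using functor_laws(1)[OF G(1) X] functor_module_hom[OF X] by (auto simp: Defs.module_hom_def)
 ultimately show ?thesis by (intro lin_coord_eqI) auto
qed

end

theorem theorem5p2p1:
  fixes scale :: "'k::field \<Rightarrow> 'v::ab_group_add \<Rightarrow> 'v"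
    and V :: "bit \<Rightarrow> 'v set" and m n :: nat
    and b :: "'v \<Rightarrow> 'v \<Rightarrow> 'k" and d :: bit
    and v v' :: "nat \<Rightarrow> 'v"
    and \<delta> \<epsilon> :: 'k
  assumes "CHAR('k) \<noteq> 2"
    and "superspace scale V m n"
    and "bilinear_form scale b"
    and "homogeneous_form V d b"
    and "supersymmetric_form V b"
    and "nondegenerate_form b"
    and "\<epsilon> = koszul d"
    and "\<delta> = of_nat m - of_nat n"
    and "homogeneous_basis scale V (m + n) v"
    and "homogeneous_basis scale V (m + n) v'"
    and "\<forall>i<m + n. \<forall>j<m + n. b (v i) (v' j) = (if i = j then 1 else 0)"
  shows "\<exists>Fo Fm.
    tensor_functor (marked_brauer \<delta> \<epsilon>) (tensor_powers scale V b) Fo Fm \<and>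
    realizes_generators scale V b \<epsilon> (m + n) v v' Fo Fm \<and>
    preserves_grading (marked_brauer \<delta> \<epsilon>) (tensor_powers scale V b) Fo Fm \<and>
    (\<forall>Go Gm.
      tensor_functor (marked_brauer \<delta> \<epsilon>) (tensor_powers scale V b) Go Gm \<and>
      realizes_generators scale V b \<epsilon> (m + n) v v' Go Gm \<longrightarrow>
      Go = Fo \<and> (\<forall>r s. \<forall>f\<in>Hom (marked_brauer \<delta> \<epsilon>) r s. Gm r s f = Fm r s f))"
proof -
 interpret osp_form scale V m n b d v v' \<delta> \<epsilon>
  by unfold_locales (use assms in blast)+
 have "Go = (\<lambda>a. a) \<and> (\<forall>r s. \<forall>f\<in>Hom (marked_brauer \<delta> \<epsilon>) r s. Gm r s f = functor_map r s f)"
  if G: "tensor_functor (marked_brauer \<delta> \<epsilon>) (tensor_powers scale V b) Go Gm"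
   "realizes_generators scale V b \<epsilon> (m + n) v v' Go Gm" for Go Gm
 proof
  show Go: "Go = (\<lambda>a. a)" using G(2) by (intro ext) (simp add: realizes_generators_def)
  show "\<forall>r s. \<forall>f\<in>Hom (marked_brauer \<delta> \<epsilon>) r s. Gm r s f = functor_map r s f"
   using functor_unique[OF G[unfolded Go]] by (simp add: Hom_marked_brauer)
 qed
 then show ?thesis using functor_tensor_functor functor_realizes functor_grading by blast
qed

end
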